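(* Assume SETH. Then for every $\epsilon,\delta\in(0,1)$, for every sufficiently large integer $k$, and for every computable function $f:\mathbb{N}\to\mathbb{N}$, there is no algorithm running in time $f(k)\cdot N^{k-\epsilon}$ that, given an $N$-vertex set cover instance $I$, distinguishes between (1) $opt(I)\le k$, and (2) $opt(I)>\frac{1}{1+\delta}\left(\frac{\log N}{\log\log N}\right)^{1/k}$.
   Context: A set cover instance is a bipartite graph $I=(S,U,E)$; a subset $C\subseteq S$ covers $U$ if every vertex of $U$ is adjacent to some vertex of $C$, and $opt(I)$ is the minimum size of such a $C$. The number of vertices of $I$ is $|S|+|U|$. Logarithms are base 2. The Strong Exponential Time Hypothesis (SETH): for every $\epsilon\in(0,1)$ there exists $d\ge 3$ such that $d$-SAT on $n$ variables cannot be solved in time $O(2^{(1-\epsilon)n})$. *)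

theory Defs
  imports Complex_Main "HOL-Library.Log_Nat" "HOL-Library.Extended_Real"
begin

section \<open>Random access machines with logarithmic cost\<close>

text \<open>
  The machine model is the RAM of Cook and Reckhow (registers hold natural numbers, subtraction
  is truncated). An instruction is charged the bit length of the register contents and addresses
  it handles, so that running times agree with those on a word RAM with logarithmic word length
  up to polylogarithmic factors. The input is stored in the first registers, all other registers
  are initially zero, and the output is the final content of register 0. A machine halts
  when its program counter leaves the program.
\<close>

datatype instr =
    Const nat nat      \<comment> \<open>\<open>X\<^sub>i := c\<close>\<close>
  | Add nat nat nat    \<comment> \<open>\<open>X\<^sub>i := X\<^sub>j + X\<^sub>k\<close>\<close>
  | Sub nat nat nat    \<comment> \<open>\<open>X\<^sub>i := X\<^sub>j - X\<^sub>k\<close>\<close>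
  | Load nat nat       \<comment> \<open>\<open>X\<^sub>i := X\<close> at address \<open>X\<^sub>j\<close>\<close>
  | Store nat nat      \<comment> \<open>\<open>X\<close> at address \<open>X\<^sub>i\<close> \<open>:= X\<^sub>j\<close>\<close>
  | Jpos nat nat       \<comment> \<open>if \<open>X\<^sub>j > 0\<close> then continue at instruction \<open>l\<close>\<close>

type_synonym program = "instr list"
type_synonym memory = "nat \<Rightarrow> nat"

fun step :: "instr \<Rightarrow> nat \<times> memory \<Rightarrow> nat \<times> memory" where
  "step (Const i c) (pc, M) = (Suc pc, M(i := c))"
| "step (Add i j k) (pc, M) = (Suc pc, M(i := M j + M k))"
| "step (Sub i j k) (pc, M) = (Suc pc, M(i := M j - M k))"
| "step (Load i j) (pc, M) = (Suc pc, M(i := M (M j)))"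
| "step (Store i j) (pc, M) = (Suc pc, M(M i := M j))"
| "step (Jpos j l) (pc, M) = (if M j > 0 then l else Suc pc, M)"

abbreviation blen :: "nat \<Rightarrow> nat" where
  "blen x \<equiv> floorlog 2 x"

fun cost :: "instr \<Rightarrow> memory \<Rightarrow> nat" where
  "cost (Const i c) M = 1 + blen c"
| "cost (Add i j k) M = 1 + blen (M j) + blen (M k)"
| "cost (Sub i j k) M = 1 + blen (M j) + blen (M k)"
| "cost (Load i j) M = 1 + blen (M j) + blen (M (M j))"
| "cost (Store i j) M = 1 + blen (M i) + blen (M j)"
| "cost (Jpos j l) M = 1 + blen (M j)"

text \<open>
  \<open>exec P (pc, M) t M'\<close>: started at instruction \<open>pc\<close> with memory \<open>M\<close>, the program \<open>P\<close> halts
  with memory \<open>M'\<close> after instructions of total cost \<open>t\<close>.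
\<close>

inductive exec :: "program \<Rightarrow> nat \<times> memory \<Rightarrow> nat \<Rightarrow> memory \<Rightarrow> bool" for P where
  exec_halt: "length P \<le> pc \<Longrightarrow> exec P (pc, M) 0 M"
| exec_step: "pc < length P \<Longrightarrow> exec P (step (P ! pc) (pc, M)) t M' \<Longrightarrow>
    exec P (pc, M) (cost (P ! pc) M + t) M'"

definition load_input :: "nat list \<Rightarrow> memory" where
  "load_input xs = (\<lambda>i. if i < length xs then xs ! i else 0)"

definition outputs_in :: "program \<Rightarrow> nat list \<Rightarrow> nat \<Rightarrow> nat \<Rightarrow> bool" where
  "outputs_in P xs t y \<longleftrightarrow> (\<exists>M. exec P (0, load_input xs) t M \<and> M 0 = y)"

lemma exec_deterministic:
  assumes "exec P c t M" and "exec P c t' M'"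
  shows "t = t' \<and> M = M'"
  using assms
proof (induction arbitrary: t' M' rule: exec.induct)
  case (exec_halt pc M)
  from exec_halt(2) show ?case
  proof cases
    case exec_step
    with \<open>length P \<le> pc\<close> show ?thesis by linarith
  qed simp
next
  case (exec_step pc M t M1)
  from exec_step.prems show ?case
  proof cases
    case exec_halt
    with \<open>pc < length P\<close> show ?thesis by linarith
  next
    case step: (exec_step s)
    from exec_step.IH[OF step(3)] step(1) show ?thesis by simp
  qed
qed

definition computable :: "(nat \<Rightarrow> nat) \<Rightarrow> bool" where
  "computable f \<longleftrightarrow> (\<exists>P. \<forall>n. \<exists>t. outputs_in P [n] t (f n))"

section \<open>The Strong Exponential Time Hypothesis\<close>

text \<open>A literal is a variable together with its sign.\<close>

type_synonym literal = "nat \<times> bool"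
type_synonym cnf = "literal list list"

text \<open>
  A CNF formula is a set of clauses and a clause is a set of at most \<open>d\<close> literals, listed in
  arbitrary order without repetition. Without the ban on repetitions the length of the formula
  would not be bounded in terms of \<open>n\<close> and \<open>d\<close>, and a time bound depending only on \<open>n\<close> would
  be meaningless.
\<close>

definition is_dcnf :: "nat \<Rightarrow> nat \<Rightarrow> cnf \<Rightarrow> bool" where
  "is_dcnf d n \<phi> \<longleftrightarrow> distinct (map set \<phi>) \<and>
    (\<forall>C \<in> set \<phi>. distinct C \<and> length C \<le> d \<and> (\<forall>(v, b) \<in> set C. v < n))"

definition satisfiable :: "cnf \<Rightarrow> bool" where
  "satisfiable \<phi> \<longleftrightarrow> (\<exists>a :: nat \<Rightarrow> bool. \<forall>C \<in> set \<phi>. \<exists>(v, b) \<in> set C. a v = b)"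

definition encode_literal :: "literal \<Rightarrow> nat" where
  "encode_literal = (\<lambda>(v, b). 2 * v + of_bool b)"

definition encode_cnf :: "nat \<Rightarrow> cnf \<Rightarrow> nat list" where
  "encode_cnf n \<phi> =
    n # length \<phi> # concat (map (\<lambda>C. length C # map encode_literal C) \<phi>)"

definition solves_SAT_in :: "program \<Rightarrow> nat \<Rightarrow> (nat \<Rightarrow> real) \<Rightarrow> bool" where
  "solves_SAT_in P d T \<longleftrightarrow> (\<forall>n \<phi>. is_dcnf d n \<phi> \<longrightarrow>
    (\<exists>t. real t \<le> T n \<and> outputs_in P (encode_cnf n \<phi>) t (of_bool (satisfiable \<phi>))))"

definition SETH :: bool where
  "SETH \<longleftrightarrow> (\<forall>\<epsilon> :: real. 0 < \<epsilon> \<and> \<epsilon> < 1 \<longrightarrow>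
    (\<exists>d \<ge> 3. \<not> (\<exists>P c. solves_SAT_in P d (\<lambda>n. c * 2 powr ((1 - \<epsilon>) * real n)))))"

section \<open>Set cover\<close>

record ('a, 'b) set_cover =
  set_verts :: "'a set"
  elem_verts :: "'b set"
  edges :: "('a \<times> 'b) set"

definition set_cover_instance :: "('a, 'b) set_cover \<Rightarrow> bool" where
  "set_cover_instance I \<longleftrightarrow>
    finite (set_verts I) \<and> finite (elem_verts I) \<and> edges I \<subseteq> set_verts I \<times> elem_verts I"

definition num_vertices :: "('a, 'b) set_cover \<Rightarrow> nat" where
  "num_vertices I = card (set_verts I) + card (elem_verts I)"

definition covers :: "('a, 'b) set_cover \<Rightarrow> 'a set \<Rightarrow> bool" where
  "covers I C \<longleftrightarrow> C \<subseteq> set_verts I \<and> (\<forall>u \<in> elem_verts I. \<exists>s \<in> C. (s, u) \<in> edges I)"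

text \<open>The optimum is \<open>\<infinity>\<close> if some element has no neighbour at all.\<close>

definition opt :: "('a, 'b) set_cover \<Rightarrow> enat" where
  "opt I = (INF C \<in> {C. covers I C}. enat (card C))"

text \<open>
  Algorithms receive instances whose two vertex classes are numbered from 0, given by the two
  class sizes followed by the adjacency matrix in row-major order.
\<close>

definition numbered_instance :: "(nat, nat) set_cover \<Rightarrow> bool" where
  "numbered_instance I \<longleftrightarrow> set_cover_instance I \<and>
    set_verts I = {..<card (set_verts I)} \<and> elem_verts I = {..<card (elem_verts I)}"

definition encode_instance :: "(nat, nat) set_cover \<Rightarrow> nat list" where
  "encode_instance I = card (set_verts I) # card (elem_verts I) #
    [of_bool ((i, j) \<in> edges I). i \<leftarrow> [0..<card (set_verts I)], j \<leftarrow> [0..<card (elem_verts I)]]"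

text \<open>The empty instance is left out since a bound like \<open>c * N powr a\<close> vanishes for \<open>N = 0\<close>.\<close>

definition runs_in_time :: "program \<Rightarrow> (nat \<Rightarrow> real) \<Rightarrow> bool" where
  "runs_in_time P T \<longleftrightarrow> (\<forall>I. numbered_instance I \<and> num_vertices I > 0 \<longrightarrow>
    (\<exists>t y. outputs_in P (encode_instance I) t y \<and> real t \<le> T (num_vertices I)))"

definition gap_threshold :: "real \<Rightarrow> nat \<Rightarrow> nat \<Rightarrow> real" where
  "gap_threshold \<delta> k N =
    1 / (1 + \<delta>) * (log 2 (real N) / log 2 (log 2 (real N))) powr (1 / real k)"

text \<open>
  The cases \<open>opt I \<le> k\<close> and \<open>opt I > gap_threshold \<delta> k N\<close> exclude each other only if
  \<open>k \<le> gap_threshold \<delta> k N\<close>. For fixed \<open>k\<close> this fails for finitely many \<open>N\<close> only (among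
  them, if \<open>k > 0\<close>, all \<open>N \<le> 2\<close>, where the iterated logarithm is undefined or zero). Nothing is
  demanded of the answer for these \<open>N\<close>: otherwise no algorithm could meet the
  specification, for trivial reasons.
\<close>

definition distinguishes_gap :: "program \<Rightarrow> real \<Rightarrow> nat \<Rightarrow> bool" where
  "distinguishes_gap P \<delta> k \<longleftrightarrow>
    (\<forall>I. numbered_instance I \<and> real k \<le> gap_threshold \<delta> k (num_vertices I) \<longrightarrow>
      (opt I \<le> enat k \<longrightarrow> (\<exists>t. outputs_in P (encode_instance I) t 1)) \<and>
      (ereal_of_enat (opt I) > ereal (gap_threshold \<delta> k (num_vertices I)) \<longrightarrow>
        (\<exists>t. outputs_in P (encode_instance I) t 0)))"

end

theory Submission
  imports Defs "HOL-Real_Asymp.Real_Asymp"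
begin

text \<open>
  A fast gap algorithm yields a fast algorithm for \<open>d\<close>-SAT. Branching on hearts of large flowers
  of clauses writes a formula with \<open>n\<close> variables as a disjunction of \<open>2 ^ r\<close> formulas with few clauses,
  where \<open>r\<close> is a small fraction of \<open>n / k\<close>. Split the variables into \<open>k\<close> blocks. In the base instance,
  a set is given by a block, an assignment to it, and the index of a formula of the disjunction (the advice); the
  elements are the clauses of that formula, together with elements that force equal advice. So \<open>k\<close>
  sets suffice iff the formula is satisfiable, there are about \<open>2 ^ (n / k + r)\<close> sets, and only
  polynomially many elements.

  The gap is created by Lin's composition with perfect hash functions into \<open>h\<close> classes: an element is
  now a hash function together with a base element \<open>u\<^sub>a\<close> for each function \<open>a\<close> from blocks to classes.
  Suppose that \<open>h\<close> sets cover everything but the formula is unsatisfiable, and take a hash function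
  that is injective on these sets. For each \<open>a\<close>, at most one set per block has the class prescribed by
  \<open>a\<close>, so these sets leave some \<open>u\<^sub>a\<close> uncovered, and the tuple of all \<open>u\<^sub>a\<close> is uncovered.
  The number \<open>2 ^ O(h ^ k * log n)\<close> of elements permits \<open>h\<close> of order
  \<open>(log N / log log N) powr (1 / k)\<close>, and the constant factor inside the root is at most \<open>(1 + \<delta>) ^ k\<close> for
  large \<open>k\<close>.

  The instance is computed by a program whose text does not depend on \<open>d\<close> and \<open>k\<close>. Hence it takes time
  \<open>2 ^ (2 * q * n / k)\<close> for an absolute constant \<open>q\<close>, which is negligible for large \<open>k\<close>.
\<close>

section \<open>Sparsification\<close>

text \<open>The order of the choices shapes the proof. SETH is applied with saving
  \<open>\<epsilon> / (2 * k)\<close>, so \<open>d\<close> becomes known only after \<open>k\<close>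
  and may be huge compared with it. Two quantities must therefore be independent of
  \<open>d\<close>. The first is the exponent of the machine that writes the instance:
  \<open>k\<close> must exceed a multiple of it. The second is the constant under the
  \<open>k\<close>-th root, which is weighed against \<open>(1 + \<delta>) ^ k\<close>. If all
  clauses served as elements, a base element would need about \<open>d * log n\<close> bits and
  \<open>h\<close> would lose a factor \<open>d powr (1 / k)\<close>, over which there is no
  control. Sparsification leaves at most about \<open>n ^ 2\<close> elements once \<open>n\<close>
  is large, so that \<open>2 * lam\<close> bits are enough for every \<open>d\<close>.

  The advice makes the sets longer. The constant \<open>c2\<close> keeps \<open>r\<close> below
  \<open>b / c2\<close>, so that half of the saving \<open>\<epsilon>\<close> survives;
  \<open>c3\<close> pays for this by raising the flower thresholds until the petal steps of a branch
  fit into such a short advice. Since the advice is part of the sets, a single instance is written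
  and the gap algorithm runs once.\<close>

definition minimal_sets :: "'a set set \<Rightarrow> 'a set set" where
  "minimal_sets G = {A \<in> G. \<forall>B \<in> G. \<not> B \<subset> A}"

definition petal_sets :: "'a set set \<Rightarrow> nat \<Rightarrow> 'a set \<Rightarrow> 'a set set" where
  "petal_sets G c H = {A \<in> minimal_sets G. card A = c \<and> H \<subseteq> A}"

text \<open>Along a branch at most \<open>card X * \<alpha> ^ (2 * i - 2)\<close> sets of size
  \<open>i\<close> get added (\<open>added_total\<close>). A threshold with one more factor
  \<open>\<alpha>\<close> leaves room for at most \<open>card X / \<alpha>\<close> steps that add
  petals of size \<open>i\<close>.\<close>

definition thr :: "nat \<Rightarrow> nat \<Rightarrow> nat" where
  "thr \<alpha> i = \<alpha> ^ (2 * i - 1)"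

definition flower :: "nat \<Rightarrow> 'a set set \<Rightarrow> nat \<Rightarrow> nat \<Rightarrow> 'a set \<Rightarrow> bool" where
  "flower \<alpha> G c i H \<longleftrightarrow>
    1 \<le> i \<and> H \<noteq> {} \<and> card H + i = c \<and> thr \<alpha> i \<le> card (petal_sets G c H)"

text \<open>Both levels of the order are used: the choice of \<open>c\<close> limits how many older
  sets of a size below \<open>c\<close> share a subset, the choice of \<open>i\<close> limits how
  many of the new petals do.\<close>

definition first_flower :: "nat \<Rightarrow> 'a set set \<Rightarrow> nat \<Rightarrow> nat \<Rightarrow> 'a set \<Rightarrow> bool" where
  "first_flower \<alpha> G c i H \<longleftrightarrow> flower \<alpha> G c i H \<and>
    (\<forall>c' i' H'. flower \<alpha> G c' i' H' \<longrightarrow> c < c' \<or> c = c' \<and> i \<le> i')"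

text \<open>
  A satisfying assignment either makes some literal of the heart \<open>H\<close> true or hits all petals. The
  thresholds \<open>thr \<alpha> i\<close> increase so fast in \<open>i\<close> that most of the petals added at a step stay minimal
  for a long time, which bounds the number of steps of the second kind by roughly \<open>d * card X / \<alpha>\<close>.
\<close>

definition branch :: "bool \<Rightarrow> 'a set set \<Rightarrow> nat \<Rightarrow> 'a set \<Rightarrow> 'a set set" where
  "branch b G c H = (if b then (\<lambda>A. A - H) ` petal_sets G c H else {H})"

locale bounded_family =
  fixes X :: "'a set" and d :: nat and \<alpha> :: nat and G :: "'a set set"
  assumes fin_X: "finite X" and alpha_pos: "\<alpha> \<ge> 1"
    and G_sub: "\<And>A. A \<in> G \<Longrightarrow> A \<subseteq> X" and G_card: "\<And>A. A \<in> G \<Longrightarrow> card A \<le> d"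
begin

lemma fin_G: "finite G"
  using G_sub fin_X by (meson Pow_iff finite_Pow_iff rev_finite_subset subsetI)

lemma fin_mem: "A \<in> G \<Longrightarrow> finite A"
  using G_sub fin_X finite_subset by blast

lemma minimal_sub: "minimal_sets G \<subseteq> G"
  by (auto simp: minimal_sets_def)

lemma fin_petals: "finite (petal_sets G c H)"
  using fin_G minimal_sub by (auto simp: petal_sets_def intro: rev_finite_subset)

lemma thr_pos: "1 \<le> thr \<alpha> i"
  using alpha_pos by (simp add: thr_def)

lemma ex_minimal:
  assumes "A \<in> G" obtains B where "B \<in> minimal_sets G" "B \<subseteq> A"
proof -
  have "finite {B \<in> G. B \<subseteq> A}" "{B \<in> G. B \<subseteq> A} \<noteq> {}" using fin_G assms by auto
  then obtain B where "B \<in> G" "B \<subseteq> A" "\<forall>C \<in> {B \<in> G. B \<subseteq> A}. C \<subseteq> B \<longrightarrow> B = C"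
    using finite_has_minimal[of "{B \<in> G. B \<subseteq> A}"] by auto
  then have "B \<in> minimal_sets G" by (auto simp: minimal_sets_def)
  with \<open>B \<subseteq> A\<close> that show ?thesis by blast
qed

text \<open>From size 2 on a single point can serve as a heart, so without flowers it lies in fewer
  than \<open>thr \<alpha> (c - 1)\<close> minimal sets of size \<open>c\<close>. Sizes 0 and 1 are
  counted directly.\<close>

lemma card_minimal_if_no_flower:
  assumes no: "\<And>c i H. \<not> flower \<alpha> G c i H"
  shows "card (minimal_sets G) \<le> 1 + d * card X * \<alpha> ^ (2 * d)"
proof -
  let ?M = "\<lambda>c. {A \<in> minimal_sets G. card A = c}"
  have finM: "finite (?M c)" for c using fin_G minimal_sub by (auto intro: rev_finite_subset)
  have b0: "card (?M 0) \<le> 1"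
  proof -
    have "?M 0 \<subseteq> {{}}" using minimal_sub fin_mem by fastforce
    then show ?thesis by (metis card_mono card.empty card_insert_disjoint empty_iff finite.emptyI finite_insert One_nat_def)
  qed
  have b: "card (?M c) \<le> card X * \<alpha> ^ (2 * d)" if c: "c \<in> {1..d}" for c
  proof (cases "c = 1")
    case True
    have "?M 1 \<subseteq> (\<lambda>x. {x}) ` X"
      using minimal_sub G_sub by (auto simp: card_1_singleton_iff)
    then have "card (?M 1) \<le> card ((\<lambda>x. {x}) ` X)" using fin_X by (intro card_mono) auto
    also have "\<dots> \<le> card X" by (rule card_image_le[OF fin_X])
    also have "\<dots> \<le> card X * \<alpha> ^ (2 * d)" using alpha_pos by simp
    finally show ?thesis using True by simp
  next
    case False
    have "?M c \<subseteq> (\<Union>x\<in>X. petal_sets G c {x})"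
    proof
      fix A assume A: "A \<in> ?M c"
      then have "A \<noteq> {}" "A \<subseteq> X" using c minimal_sub G_sub by auto
      then show "A \<in> (\<Union>x\<in>X. petal_sets G c {x})" using A by (auto simp: petal_sets_def)
    qed
    then have "card (?M c) \<le> card (\<Union>x\<in>X. petal_sets G c {x})"
      using fin_X fin_petals by (intro card_mono) auto
    also have "\<dots> \<le> (\<Sum>x\<in>X. card (petal_sets G c {x}))" by (rule card_UN_le[OF fin_X])
    also have "\<dots> \<le> (\<Sum>x\<in>X. \<alpha> ^ (2 * d))"
    proof (rule sum_mono)
      fix x
      have "card (petal_sets G c {x}) < thr \<alpha> (c - 1)"
        using no[of c "c - 1" "{x}"] c False by (auto simp: flower_def)
      also have "\<dots> \<le> \<alpha> ^ (2 * d)" unfolding thr_def using alpha_pos c by (intro power_increasing) auto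
      finally show "card (petal_sets G c {x}) \<le> \<alpha> ^ (2 * d)" by simp
    qed
    finally show ?thesis by simp
  qed
  have "minimal_sets G = (\<Union>c\<in>{0..d}. ?M c)" using minimal_sub G_card by auto
  then have "card (minimal_sets G) = card (\<Union>c\<in>{0..d}. ?M c)" by (rule arg_cong)
  also have "\<dots> \<le> (\<Sum>c=0..d. card (?M c))" by (rule card_UN_le) simp
  also have "\<dots> = card (?M 0) + (\<Sum>c=1..d. card (?M c))" by (simp add: sum.atLeast_Suc_atMost)
  also have "\<dots> \<le> 1 + (\<Sum>c=1..d. card X * \<alpha> ^ (2 * d))" using b0 b by (intro add_mono sum_mono) auto
  finally show ?thesis by simp
qed

end

lemma first_flower_exists:
  assumes "flower \<alpha> G c i H" shows "\<exists>c i H. first_flower \<alpha> G c i H"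
proof -
  define c0 where "c0 = (LEAST c. \<exists>i H. flower \<alpha> G c i H)"
  define i0 where "i0 = (LEAST i. \<exists>H. flower \<alpha> G c0 i H)"
  have "\<exists>i H. flower \<alpha> G c0 i H" unfolding c0_def by (rule LeastI_ex) (use assms in blast)
  then have "\<exists>H. flower \<alpha> G c0 i0 H" unfolding i0_def by (rule LeastI_ex)
  moreover have "c0 < c' \<or> c0 = c' \<and> i0 \<le> i'" if f: "flower \<alpha> G c' i' H'" for c' i' H'
  proof -
    have "c0 \<le> c'" unfolding c0_def using f by (blast intro: Least_le)
    moreover have "i0 \<le> i'" if "c0 = c'" unfolding i0_def using f that by (blast intro: Least_le)
    ultimately show ?thesis by linarith
  qed
  ultimately show ?thesis unfolding first_flower_def by blast
qed

section \<open>A single branching step\<close>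

locale family_step = bounded_family X d \<alpha> G for X :: "'a set" and d \<alpha> G +
  fixes c i :: nat and H :: "'a set" and b :: bool
  assumes ff: "first_flower \<alpha> G c i H"
begin

lemma ff1: "1 \<le> i" "H \<noteq> {}" "card H + i = c" "thr \<alpha> i \<le> card (petal_sets G c H)"
  using ff by (auto simp: first_flower_def flower_def)

lemma ex_petal: obtains Q where "Q \<in> petal_sets G c H"
  using ff1(4) thr_pos[of i] by fastforce

lemma petalD: "Q \<in> petal_sets G c H \<Longrightarrow> Q \<in> minimal_sets G \<and> Q \<in> G \<and> H \<subseteq> Q \<and> card Q = c \<and> finite Q"
  using minimal_sub fin_mem by (auto simp: petal_sets_def)

lemma c_le: "c \<le> d" and fin_H: "finite H"
proof -
  obtain Q where "Q \<in> petal_sets G c H" by (rule ex_petal)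
  from petalD[OF this] show "c \<le> d" "finite H" using G_card[of Q] finite_subset[of H Q] by auto
qed

lemma H_pos: "1 \<le> card H" using ff1(2) fin_H by (simp add: Suc_leI card_gt_0_iff)

lemma new_card: "A \<in> branch b G c H \<Longrightarrow> card A = (if b then i else card H)"
proof (cases b)
  case True
  assume "A \<in> branch b G c H"
  then obtain Q where Q: "Q \<in> petal_sets G c H" "A = Q - H" using True by (auto simp: branch_def)
  then have "card A = card Q - card H" using petalD[of Q] fin_H by (simp add: card_Diff_subset)
  also have "card Q = card H + i" using petalD[OF Q(1)] ff1(3) by simp
  finally show ?thesis using True by simp
qed (simp add: branch_def)

lemma new_sub: "A \<in> branch b G c H \<Longrightarrow> A \<subseteq> X"
proof -
  assume A: "A \<in> branch b G c H"
  obtain Q where "Q \<in> petal_sets G c H" "A \<subseteq> Q"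
  proof (cases b)
    case True
    with A that show ?thesis by (auto simp: branch_def)
  next
    case False
    obtain Q where "Q \<in> petal_sets G c H" by (rule ex_petal)
    then show ?thesis using that[of Q] petalD[of Q] A False by (auto simp: branch_def)
  qed
  then show "A \<subseteq> X" using petalD[of Q] G_sub[of Q] by blast
qed

lemma j_bounds: "1 \<le> (if b then i else card H)" "(if b then i else card H) < c" using ff1 H_pos by auto

text \<open>A new set is properly contained in some petal set; an old set inside it would contradict
  the minimality of that petal set.\<close>

lemma new_not_above: assumes "A \<in> branch b G c H" "B \<in> G" shows "\<not> B \<subseteq> A"
proof
  assume BA: "B \<subseteq> A"
  obtain Q where Q: "Q \<in> petal_sets G c H" "A \<subset> Q"
  proof (cases b)
    case True
    with assms(1) obtain Q where "Q \<in> petal_sets G c H" "A = Q - H" by (auto simp: branch_def)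
    then show ?thesis using that petalD[of Q] ff1(2) by blast
  next
    case False
    then have "A = H" using assms by (simp add: branch_def)
    moreover obtain Q where Q: "Q \<in> petal_sets G c H" by (rule ex_petal)
    moreover from Q have "Q \<noteq> H" using petalD[of Q] ff1(1,3) by auto
    ultimately show ?thesis using that petalD[of Q] by blast
  qed
  with BA have "B \<subset> Q" by blast
  then show False using petalD[OF Q(1)] assms(2) by (auto simp: minimal_sets_def)
qed

lemma new_disjoint: "branch b G c H \<inter> G = {}"
  using new_not_above by blast

lemma fin_new: "finite (branch b G c H)" using fin_petals by (simp add: branch_def)

lemma card_new: "(if b then thr \<alpha> i else 1) \<le> card (branch b G c H)"
proof (cases b)
  case True
  have "inj_on (\<lambda>A. A - H) (petal_sets G c H)" using petalD by (intro inj_onI) blast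
  then show ?thesis using True ff1 by (simp add: branch_def card_image)
qed (simp add: branch_def)

lemma new_minimal: "branch b G c H \<subseteq> minimal_sets (G \<union> branch b G c H)"
proof
  fix A assume A: "A \<in> branch b G c H"
  have "\<not> B \<subset> A" if "B \<in> branch b G c H" for B
    using new_card[OF that] new_card[OF A] psubset_card_mono[of A B] finite_subset[OF new_sub[OF A] fin_X] by force
  then show "A \<in> minimal_sets (G \<union> branch b G c H)" using A new_not_above by (auto simp: minimal_sets_def)
qed

lemma minimal_step: "minimal_sets (G \<union> branch b G c H) \<subseteq> minimal_sets G \<union> branch b G c H"
  by (auto simp: minimal_sets_def)

lemma killed:
  "A \<in> minimal_sets G \<Longrightarrow> A \<notin> minimal_sets (G \<union> branch b G c H) \<Longrightarrow> \<exists>B\<in>branch b G c H. B \<subset> A"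
  by (auto simp: minimal_sets_def)

lemma no_small_flower:
  assumes "H' \<noteq> {}" "card H' < s" "s < c"
  shows "card {A \<in> minimal_sets G. card A = s \<and> H' \<subseteq> A} < thr \<alpha> (s - card H')"
proof (rule ccontr)
  assume "\<not> ?thesis"
  then have "flower \<alpha> G s (s - card H') H'" using assms by (auto simp: flower_def petal_sets_def)
  then have "c < s \<or> c = s \<and> i \<le> s - card H'" using ff unfolding first_flower_def by blast
  then show False using assms(3) by linarith
qed

text \<open>If too many new petals contained \<open>H'\<close>, then \<open>H \<union> H'\<close>
  would be the heart of a flower with the same \<open>c\<close> and a smaller petal size, against
  the choice of \<open>i\<close>.\<close>

lemma new_degree:
  assumes "H' \<noteq> {}" "card H' < (if b then i else card H)"
  shows "card {A \<in> branch b G c H. H' \<subseteq> A} \<le> thr \<alpha> ((if b then i else card H) - card H')"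
proof (cases b)
  case False
  then have "{A \<in> branch b G c H. H' \<subseteq> A} \<subseteq> {H}" by (auto simp: branch_def)
  then have "card {A \<in> branch b G c H. H' \<subseteq> A} \<le> 1" by (metis card_mono card.empty card_insert_disjoint empty_iff finite.emptyI finite_insert One_nat_def)
  then show ?thesis using thr_pos order_trans by blast
next
  case True
  show ?thesis
  proof (cases "H' \<inter> H = {} \<and> finite H'")
    case False
    have "{A \<in> branch b G c H. H' \<subseteq> A} = {}" using False True petalD by (auto simp: branch_def dest: finite_subset)
    then show ?thesis by (metis card.empty le0)
  next
    case t: True
    have cu: "card (H \<union> H') = card H + card H'" using t fin_H by (simp add: card_Un_disjoint inf_commute)
    \<comment> \<open>Putting \<open>H\<close> back turns a petal over \<open>H'\<close> into a
      minimal set of size \<open>c\<close> over \<open>H \<union> H'\<close>.\<close>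
    have "{A \<in> branch b G c H. H' \<subseteq> A} \<subseteq> (\<lambda>A. A - H) ` petal_sets G c (H \<union> H')"
    proof
      fix A assume A: "A \<in> {A \<in> branch b G c H. H' \<subseteq> A}"
      then obtain Q where "Q \<in> petal_sets G c H" "A = Q - H" using True by (auto simp: branch_def)
      with A show "A \<in> (\<lambda>A. A - H) ` petal_sets G c (H \<union> H')"
        by (intro rev_image_eqI[of Q]) (auto simp: petal_sets_def)
    qed
    then have "card {A \<in> branch b G c H. H' \<subseteq> A} \<le> card (petal_sets G c (H \<union> H'))"
      by (rule surj_card_le[OF fin_petals])
    also have "\<dots> < thr \<alpha> (i - card H')"
    proof (rule ccontr)
      assume "\<not> ?thesis"
      then have "flower \<alpha> G c (i - card H') (H \<union> H')"
        using assms ff1 True cu by (auto simp: flower_def)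
      then have "i \<le> i - card H'" using ff by (auto simp: first_flower_def)
      then show False using assms(1) ff1(1) t card_gt_0_iff[of H'] by linarith
    qed
    finally show ?thesis using True by simp
  qed
qed

end

section \<open>Counting the sets along one branch of the tree\<close>

locale family_run =
  fixes X :: "'a set" and d \<alpha> :: nat and G :: "nat \<Rightarrow> 'a set set" and D :: "nat \<Rightarrow> bool"
  assumes fin_X: "finite X" and alpha_pos: "\<alpha> \<ge> 1"
    and G0_sub: "\<And>A. A \<in> G 0 \<Longrightarrow> A \<subseteq> X" and G0_card: "\<And>A. A \<in> G 0 \<Longrightarrow> card A \<le> d"
    and step: "\<And>t. (G (Suc t) = G t \<and> (\<forall>c i H. \<not> flower \<alpha> (G t) c i H)) \<or>
      (\<exists>c i H. first_flower \<alpha> (G t) c i H \<and> G (Suc t) = G t \<union> branch (D t) (G t) c H)"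
begin

lemma bounded: "bounded_family X d \<alpha> (G t)"
proof (induction t)
  case 0
  show ?case using fin_X alpha_pos G0_sub G0_card by unfold_locales
next
  case (Suc t)
  interpret bounded_family X d \<alpha> "G t" by (rule Suc)
  from step[of t] show ?case
  proof
    assume "\<exists>c i H. first_flower \<alpha> (G t) c i H \<and> G (Suc t) = G t \<union> branch (D t) (G t) c H"
    then obtain c i H where f: "first_flower \<alpha> (G t) c i H" "G (Suc t) = G t \<union> branch (D t) (G t) c H" by blast
    then interpret family_step X d \<alpha> "G t" c i H "D t" by unfold_locales
    have "A \<subseteq> X \<and> card A \<le> d" if "A \<in> G (Suc t)" for A
    proof (cases "A \<in> G t")
      case False
      then have "A \<in> branch (D t) (G t) c H" using that f(2) by blast
      then show ?thesis using new_sub new_card j_bounds c_le by fastforce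
    qed (use G_sub G_card in blast)
    then show ?thesis using fin_X alpha_pos by unfold_locales auto
  qed (use Suc in simp)
qed

lemmas bf_fin_G = bounded_family.fin_G[OF bounded]
  and bf_minimal_sub = bounded_family.minimal_sub[OF bounded]
  and bf_G_sub = bounded_family.G_sub[OF bounded]

lemma G_mono: "G t \<subseteq> G (Suc t)" using step[of t] by blast

lemma G0_subset: "G 0 \<subseteq> G t" by (induction t) (use G_mono in blast)+

definition added :: "nat \<Rightarrow> nat \<Rightarrow> 'a set set" where
  "added s t = {A \<in> G t - G 0. card A = s}"

text \<open>Sets are never removed from the family; a set drops out of this count when a smaller one
  makes it redundant.\<close>

definition alive :: "nat \<Rightarrow> nat \<Rightarrow> 'a set set" where
  "alive s t = added s t \<inter> minimal_sets (G t)"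

definition petal_steps :: "nat \<Rightarrow> nat \<Rightarrow> nat set" where
  "petal_steps i t = {u. u < t \<and> D u \<and> (\<exists>c H. first_flower \<alpha> (G u) c i H)}"

lemma fin_added: "finite (added s t)" using bf_fin_G by (simp add: added_def)
lemma fin_alive: "finite (alive s t)" using fin_added by (simp add: alive_def)

lemma step_cases [case_names same grow]:
  assumes "G (Suc t) = G t \<Longrightarrow> (\<And>c i H. \<not> flower \<alpha> (G t) c i H) \<Longrightarrow> P"
    and "\<And>c i H. family_step X d \<alpha> (G t) c i H \<Longrightarrow> G (Suc t) = G t \<union> branch (D t) (G t) c H \<Longrightarrow> P"
  shows P
  using step[of t] assms bounded[of t] by (auto simp: family_step_def family_step_axioms_def)

lemma added_step:
  fixes s t c i H
  assumes "family_step X d \<alpha> (G t) c i H" "G (Suc t) = G t \<union> branch (D t) (G t) c H"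
  shows "added s (Suc t) = added s t \<union> (if s = (if D t then i else card H) then branch (D t) (G t) c H else {})"
    "added s t \<inter> branch (D t) (G t) c H = {}"
proof -
  interpret family_step X d \<alpha> "G t" c i H "D t" by (rule assms(1))
  show "added s (Suc t) = added s t \<union> (if s = (if D t then i else card H) then branch (D t) (G t) c H else {})"
  proof (rule set_eqI)
    fix A
    have "A \<in> branch (D t) (G t) c H \<Longrightarrow> card A = (if D t then i else card H)" by (rule new_card)
    moreover have "A \<in> branch (D t) (G t) c H \<Longrightarrow> A \<notin> G t" using new_not_above by blast
    moreover have "A \<in> G 0 \<Longrightarrow> A \<in> G t" using G0_subset[of t] by blast
    ultimately show "A \<in> added s (Suc t) \<longleftrightarrow> A \<in> added s t \<union> (if s = (if D t then i else card H) then branch (D t) (G t) c H else {})"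
      unfolding added_def assms(2) by (cases "A \<in> branch (D t) (G t) c H") auto
  qed
  show "added s t \<inter> branch (D t) (G t) c H = {}" using new_disjoint unfolding added_def by blast
qed

text \<open>Only a step that adds sets of size \<open>s\<close> can raise the count. At such a step
  \<open>s < c\<close>, so the older minimal sets of size \<open>s\<close> over \<open>H'\<close>
  are fewer than the threshold by the choice of \<open>c\<close>, and \<open>new_degree\<close>
  bounds the new ones by the threshold once more.\<close>

lemma alive_degree:
  assumes "H' \<noteq> {}" "card H' < s"
  shows "card {A \<in> alive s t. H' \<subseteq> A} \<le> 2 * thr \<alpha> (s - card H')"
proof (induction t)
  case 0
  have "alive s 0 = {}" by (auto simp: alive_def added_def)
  then show ?case by simp
next
  case (Suc t)
  show ?case
  proof (cases rule: step_cases[of t])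
    case same
    then have "alive s (Suc t) = alive s t" by (simp add: alive_def added_def)
    then show ?thesis using Suc by simp
  next
    case (grow c i H)
    interpret family_step X d \<alpha> "G t" c i H "D t" by (rule grow(1))
    let ?new = "branch (D t) (G t) c H" and ?j = "if D t then i else card H"
    show ?thesis
    proof (cases "s = ?j")
      case False
      have "alive s (Suc t) \<subseteq> alive s t"
        using added_step(1)[OF grow, of s] False minimal_step new_disjoint
        unfolding alive_def grow(2) by (auto simp: added_def)
      then have "card {A \<in> alive s (Suc t). H' \<subseteq> A} \<le> card {A \<in> alive s t. H' \<subseteq> A}"
        using fin_alive by (intro card_mono) auto
      then show ?thesis using Suc by linarith
    next
      case True
      let ?O = "{A \<in> minimal_sets (G t). card A = s \<and> H' \<subseteq> A}"
      have "{A \<in> alive s (Suc t). H' \<subseteq> A} \<subseteq> ?O \<union> {A \<in> ?new. H' \<subseteq> A}"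
        using minimal_step unfolding alive_def added_def grow(2) by auto
      then have "card {A \<in> alive s (Suc t). H' \<subseteq> A} \<le> card (?O \<union> {A \<in> ?new. H' \<subseteq> A})"
      proof (rule card_mono[rotated])
        have "?O \<subseteq> G t" using minimal_sub by blast
        then show "finite (?O \<union> {A \<in> ?new. H' \<subseteq> A})" using fin_G fin_new finite_subset by auto
      qed
      also have "\<dots> \<le> card ?O + card {A \<in> ?new. H' \<subseteq> A}" by (rule card_Un_le)
      also have "\<dots> \<le> thr \<alpha> (s - card H') + thr \<alpha> (s - card H')"
      proof (rule add_mono)
        show "card ?O \<le> thr \<alpha> (s - card H')"
          using no_small_flower[OF assms] True j_bounds(2) by (simp add: less_imp_le)
        show "card {A \<in> ?new. H' \<subseteq> A} \<le> thr \<alpha> (s - card H')"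
          using new_degree[OF assms(1)] assms(2) unfolding True by blast
      qed
      finally show ?thesis by simp
    qed
  qed
qed

text \<open>An added set that is no longer minimal is charged to a smaller added set that destroyed
  its minimality. When a set of size \<open>j\<close> enters, at most
  \<open>2 * thr \<alpha> (s - j)\<close> sets counted by \<open>alive s\<close> contain it, by
  \<open>alive_degree\<close>.\<close>

lemma added_bound:
  "card (added s t) \<le> card (alive s t) + (\<Sum>j=1..<s. 2 * card (added j t) * thr \<alpha> (s - j))"
proof (induction t)
  case 0
  have "added s 0 = {}" by (auto simp: added_def)
  then show ?case by simp
next
  case (Suc t)
  show ?case
  proof (cases rule: step_cases[of t])
    case same
    then have "alive s (Suc t) = alive s t" "\<And>s. added s (Suc t) = added s t" by (simp_all add: alive_def added_def)
    then show ?thesis using Suc by simp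
  next
    case (grow c i H)
    interpret family_step X d \<alpha> "G t" c i H "D t" by (rule grow(1))
    let ?new = "branch (D t) (G t) c H" and ?j = "if D t then i else card H"
    let ?m = "card ?new"
    have ca: "card (added s' (Suc t)) = card (added s' t) + (if s' = ?j then ?m else 0)" for s'
      using added_step[OF grow, of s'] fin_added fin_new by (auto simp: card_Un_disjoint)
    let ?S = "\<lambda>t. \<Sum>j=1..<s. 2 * card (added j t) * thr \<alpha> (s - j)"
    have S: "?S (Suc t) = ?S t + (if ?j < s then 2 * ?m * thr \<alpha> (s - ?j) else 0)"
    proof -
      have "?S (Suc t) = ?S t + (\<Sum>j'=1..<s. if j' = ?j then 2 * ?m * thr \<alpha> (s - ?j) else 0)"
        unfolding ca by (subst sum.distrib[symmetric], rule sum.cong) (auto simp: algebra_simps)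
      then show ?thesis using j_bounds(1) by (subst (asm) sum.delta) auto
    qed
    consider "s < ?j" | "s = ?j" | "s > ?j" by linarith
    then show ?thesis
    proof cases
      case 1
      have "alive s t \<subseteq> alive s (Suc t)"
      proof
        fix A assume A: "A \<in> alive s t"
        then have "A \<in> G t" "card A = s" "A \<in> minimal_sets (G t)" by (auto simp: alive_def added_def)
        then have "\<not> (\<exists>B\<in>?new. B \<subset> A)"
          using new_card psubset_card_mono[OF fin_mem, of A] 1 by (metis order.asym)
        then show "A \<in> alive s (Suc t)"
          using A killed[of A] added_step(1)[OF grow, of s] unfolding alive_def grow(2) by auto
      qed
      then have "card (alive s t) \<le> card (alive s (Suc t))" using fin_alive by (intro card_mono)
      then show ?thesis using Suc S ca[of s] 1 by simp
    next
      case 2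
      have "alive s t \<union> ?new \<subseteq> alive s (Suc t)"
      proof
        fix A assume A: "A \<in> alive s t \<union> ?new"
        show "A \<in> alive s (Suc t)"
        proof (cases "A \<in> ?new")
          case True
          then show ?thesis using new_minimal added_step(1)[OF grow, of s] 2 unfolding alive_def grow(2) by auto
        next
          case False
          with A have A: "A \<in> alive s t" by blast
          then have "A \<in> G t" "card A = s" "A \<in> minimal_sets (G t)" by (auto simp: alive_def added_def)
          then have "\<not> (\<exists>B\<in>?new. B \<subset> A)"
            using new_card psubset_card_mono[OF fin_mem, of A] 2 by (metis order.irrefl)
          then show ?thesis
            using A killed[of A] added_step(1)[OF grow, of s] unfolding alive_def grow(2) by auto
        qed
      qed
      then have "card (alive s t \<union> ?new) \<le> card (alive s (Suc t))" using fin_alive by (intro card_mono)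
      moreover have "card (alive s t \<union> ?new) = card (alive s t) + ?m"
        using fin_alive fin_new added_step(2)[OF grow, of s] by (intro card_Un_disjoint) (auto simp: alive_def)
      ultimately show ?thesis using Suc S ca[of s] 2 by simp
    next
      case 3
      have "alive s t \<subseteq> alive s (Suc t) \<union> (\<Union>B\<in>?new. {A \<in> alive s t. B \<subseteq> A})"
      proof
        fix A assume A: "A \<in> alive s t"
        show "A \<in> alive s (Suc t) \<union> (\<Union>B\<in>?new. {A \<in> alive s t. B \<subseteq> A})"
          using A killed[of A] added_step(1)[OF grow, of s] unfolding alive_def grow(2) by auto
      qed
      then have "card (alive s t) \<le> card (alive s (Suc t) \<union> (\<Union>B\<in>?new. {A \<in> alive s t. B \<subseteq> A}))"
        using fin_alive fin_new by (intro card_mono) auto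
      also have "\<dots> \<le> card (alive s (Suc t)) + card (\<Union>B\<in>?new. {A \<in> alive s t. B \<subseteq> A})" by (rule card_Un_le)
      also have "card (\<Union>B\<in>?new. {A \<in> alive s t. B \<subseteq> A}) \<le> (\<Sum>B\<in>?new. card {A \<in> alive s t. B \<subseteq> A})"
        by (rule card_UN_le[OF fin_new])
      also have "\<dots> \<le> (\<Sum>B\<in>?new. 2 * thr \<alpha> (s - ?j))"
      proof (rule sum_mono)
        fix B assume "B \<in> ?new"
        then have "card B = ?j" by (rule new_card)
        moreover from this j_bounds(1) have "B \<noteq> {}" by auto
        ultimately show "card {A \<in> alive s t. B \<subseteq> A} \<le> 2 * thr \<alpha> (s - ?j)"
          using alive_degree[of B s t] 3 by simp
      qed
      finally have "card (alive s t) \<le> card (alive s (Suc t)) + 2 * ?m * thr \<alpha> (s - ?j)" by simp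
      then show ?thesis using Suc S ca[of s] 3 by simp
    qed
  qed
qed

lemma alive_bound:
  assumes "2 \<le> s" shows "card (alive s t) \<le> 2 * card X * thr \<alpha> (s - 1)"
proof -
  have "alive s t \<subseteq> (\<Union>x\<in>X. {A \<in> alive s t. {x} \<subseteq> A})"
  proof
    fix A assume A: "A \<in> alive s t"
    then have "card A = s" "A \<subseteq> X" using bf_G_sub by (auto simp: alive_def added_def)
    moreover from this have "A \<noteq> {}" using assms by auto
    ultimately obtain x where "x \<in> A" "x \<in> X" by blast
    with A show "A \<in> (\<Union>x\<in>X. {A \<in> alive s t. {x} \<subseteq> A})" by blast
  qed
  then have "card (alive s t) \<le> card (\<Union>x\<in>X. {A \<in> alive s t. {x} \<subseteq> A})"
    using fin_alive fin_X by (intro card_mono) auto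
  also have "\<dots> \<le> (\<Sum>x\<in>X. card {A \<in> alive s t. {x} \<subseteq> A})" by (rule card_UN_le[OF fin_X])
  also have "\<dots> \<le> (\<Sum>x\<in>X. 2 * thr \<alpha> (s - 1))"
    using alive_degree[of "{x}" s t for x] assms by (intro sum_mono) simp
  finally show ?thesis by simp
qed

text \<open>Strong induction on \<open>s\<close>. The exponents \<open>2 * j - 2\<close> and
  \<open>2 * (s - j) - 1\<close> add up to \<open>2 * s - 3\<close> for every \<open>j\<close>, so
  all \<open>s\<close> contributions have the common bound
  \<open>2 * card X * \<alpha> ^ (2 * s - 3)\<close>, and \<open>2 * s \<le> \<alpha>\<close>
  absorbs their number into one more power of \<open>\<alpha>\<close>.\<close>

lemma added_total:
  assumes "2 * d \<le> \<alpha>" "1 \<le> s" "s \<le> d"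
  shows "card (added s t) \<le> card X * \<alpha> ^ (2 * s - 2)"
  using assms(2,3)
proof (induction s rule: less_induct)
  case (less s)
  show ?case
  proof (cases "s = 1")
    case True
    have "alive 1 t \<subseteq> (\<lambda>x. {x}) ` X"
      using bf_G_sub by (auto simp: alive_def added_def card_1_singleton_iff)
    then have "card (alive 1 t) \<le> card ((\<lambda>x. {x}) ` X)" using fin_X by (intro card_mono) auto
    also have "\<dots> \<le> card X" by (rule card_image_le[OF fin_X])
    finally show ?thesis using added_bound[of 1 t] True by simp
  next
    case False
    with less have s: "2 \<le> s" by simp
    let ?p = "card X * \<alpha> ^ (2 * s - 3)"
    have "(\<Sum>j=1..<s. 2 * card (added j t) * thr \<alpha> (s - j)) \<le> (\<Sum>j=1..<s. 2 * ?p)"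
    proof (rule sum_mono)
      fix j assume j: "j \<in> {1..<s}"
      have "2 * card (added j t) * thr \<alpha> (s - j) \<le> 2 * (card X * \<alpha> ^ (2 * j - 2)) * thr \<alpha> (s - j)"
        using less.IH[of j] j less.prems by (intro mult_right_mono mult_left_mono) auto
      also have "\<dots> = 2 * (card X * \<alpha> ^ (2 * j - 2 + (2 * (s - j) - 1)))"
        by (simp add: thr_def power_add)
      also have "2 * j - 2 + (2 * (s - j) - 1) = 2 * s - 3" using j by auto
      finally show "2 * card (added j t) * thr \<alpha> (s - j) \<le> 2 * ?p" .
    qed
    also have "\<dots> = 2 * (s - 1) * ?p" by simp
    finally have "card (added s t) \<le> 2 * card X * thr \<alpha> (s - 1) + 2 * (s - 1) * ?p"
      using added_bound[of s t] alive_bound[OF s, of t] by linarith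
    also have "thr \<alpha> (s - 1) = \<alpha> ^ (2 * s - 3)" by (simp add: thr_def diff_mult_distrib2)
    also have "2 * card X * \<alpha> ^ (2 * s - 3) + 2 * (s - 1) * ?p = 2 * s * ?p"
      using s by (cases s) (simp_all add: algebra_simps)
    also have "\<dots> \<le> \<alpha> * ?p" using assms(1) less.prems by (intro mult_right_mono) auto
    also have "\<dots> = card X * \<alpha> ^ (Suc (2 * s - 3))" by simp
    also have "Suc (2 * s - 3) = 2 * s - 2" using s by simp
    finally show ?thesis .
  qed
qed

lemma petal_steps_added: "card (petal_steps i t) * thr \<alpha> i \<le> card (added i t)"
proof (induction t)
  case 0
  show ?case by (simp add: petal_steps_def)
next
  case (Suc t)
  have sub: "petal_steps i (Suc t) \<subseteq> insert t (petal_steps i t)" and fin: "finite (petal_steps i t)"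
    by (auto simp: petal_steps_def less_Suc_eq)
  show ?case
  proof (cases "t \<in> petal_steps i (Suc t)")
    case False
    with sub have "petal_steps i (Suc t) \<subseteq> petal_steps i t" by auto
    then have "card (petal_steps i (Suc t)) \<le> card (petal_steps i t)" using fin by (intro card_mono)
    then have "card (petal_steps i (Suc t)) * thr \<alpha> i \<le> card (petal_steps i t) * thr \<alpha> i" by (rule mult_le_mono1)
    moreover have "card (added i t) \<le> card (added i (Suc t))"
      using G_mono[of t] fin_added by (intro card_mono) (auto simp: added_def)
    ultimately show ?thesis using Suc by linarith
  next
    case True
    show ?thesis
    proof (cases rule: step_cases[of t])
      case same
      with True show ?thesis by (auto simp: petal_steps_def first_flower_def)
    next
      case (grow c i' H)
      interpret family_step X d \<alpha> "G t" c i' H "D t" by (rule grow(1))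
      from True have Dt: "D t" and "\<exists>c H. first_flower \<alpha> (G t) c i H" by (auto simp: petal_steps_def)
      then have ii: "i' = i" using ff unfolding first_flower_def by (metis less_asym le_antisym)
      have "card (added i (Suc t)) = card (added i t) + card (branch (D t) (G t) c H)"
        using added_step[OF grow, of i] fin_added fin_new Dt ii by (simp add: card_Un_disjoint)
      moreover have "thr \<alpha> i \<le> card (branch (D t) (G t) c H)" using card_new Dt ii by simp
      moreover have "card (petal_steps i (Suc t)) \<le> Suc (card (petal_steps i t))"
        using card_mono[OF _ sub] fin by (simp add: card_insert_if split: if_splits)
      then have "card (petal_steps i (Suc t)) * thr \<alpha> i \<le> card (petal_steps i t) * thr \<alpha> i + thr \<alpha> i"
        using mult_le_mono1[of "card (petal_steps i (Suc t))" "Suc (card (petal_steps i t))" "thr \<alpha> i"] by simp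
      ultimately show ?thesis using Suc by linarith
    qed
  qed
qed

text \<open>Petal steps of type \<open>i\<close> add \<open>\<alpha> ^ (2 * i - 1)\<close> sets
  each, while \<open>added_total\<close> allows only \<open>card X * \<alpha> ^ (2 * i - 2)\<close>
  in total. This gives at most \<open>card X / \<alpha>\<close> steps for each of the
  \<open>d\<close> types.\<close>

lemma card_petal_steps:
  assumes "2 * d \<le> \<alpha>"
  shows "card {u. u < t \<and> D u \<and> (\<exists>c i H. flower \<alpha> (G u) c i H)} * \<alpha> \<le> d * card X"
proof -
  have each: "card (petal_steps i t) * \<alpha> \<le> card X" if i: "i \<in> {1..d}" for i
  proof -
    have "card (petal_steps i t) * \<alpha> * \<alpha> ^ (2 * i - 2) = card (petal_steps i t) * thr \<alpha> i"
    proof -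
      have "Suc (2 * i - 2) = 2 * i - 1" using i by auto
      then show ?thesis by (metis mult.assoc power_Suc thr_def)
    qed
    also have "\<dots> \<le> card X * \<alpha> ^ (2 * i - 2)"
      using petal_steps_added[of i t] added_total[OF assms, of i t] i by auto
    finally show ?thesis using alpha_pos by simp
  qed
  have "{u. u < t \<and> D u \<and> (\<exists>c i H. flower \<alpha> (G u) c i H)} \<subseteq> (\<Union>i\<in>{1..d}. petal_steps i t)"
  proof
    fix u assume u: "u \<in> {u. u < t \<and> D u \<and> (\<exists>c i H. flower \<alpha> (G u) c i H)}"
    then obtain c i H where f: "first_flower \<alpha> (G u) c i H" using first_flower_exists by blast
    interpret family_step X d \<alpha> "G u" c i H True
      using f bounded[of u] by (simp add: family_step_def family_step_axioms_def)
    have "i \<in> {1..d}" using ff1(1,3) c_le by auto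
    moreover have "u \<in> petal_steps i t" using u f unfolding petal_steps_def by blast
    ultimately show "u \<in> (\<Union>i\<in>{1..d}. petal_steps i t)" by blast
  qed
  then have "card {u. u < t \<and> D u \<and> (\<exists>c i H. flower \<alpha> (G u) c i H)} \<le> card (\<Union>i\<in>{1..d}. petal_steps i t)"
    by (intro card_mono) (auto simp: petal_steps_def)
  also have "\<dots> \<le> (\<Sum>i\<in>{1..d}. card (petal_steps i t))" by (rule card_UN_le) simp
  finally have "card {u. u < t \<and> D u \<and> (\<exists>c i H. flower \<alpha> (G u) c i H)} * \<alpha> \<le> (\<Sum>i\<in>{1..d}. card (petal_steps i t) * \<alpha>)"
    unfolding sum_distrib_right[symmetric] by (rule mult_le_mono1)
  also have "\<dots> \<le> (\<Sum>i\<in>{1..d}. card X)" using each by (intro sum_mono)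
  finally show ?thesis by simp
qed

lemma no_flower_eventually:
  assumes "\<And>t. G t \<subseteq> F" "finite F" "card F \<le> t"
  shows "\<not> flower \<alpha> (G t) c i H"
proof -
  \<comment> \<open>Without a flower the family stays constant, so a flower at time \<open>t\<close>
    means that all earlier steps were proper and each added a set.\<close>
  have claim: "(\<exists>c i H. flower \<alpha> (G t) c i H) \<Longrightarrow> t \<le> card (G t)" for t
  proof (induction t)
    case (Suc t)
    show ?case
    proof (cases rule: step_cases[of t])
      case same
      with Suc.prems show ?thesis by simp
    next
      case (grow c i H)
      interpret family_step X d \<alpha> "G t" c i H "D t" by (rule grow(1))
      have "t \<le> card (G t)" using Suc.IH ff by (auto simp: first_flower_def)
      moreover have "card (G (Suc t)) = card (G t) + card (branch (D t) (G t) c H)"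
        unfolding grow(2) using fin_G fin_new new_disjoint by (intro card_Un_disjoint) auto
      moreover have "1 \<le> card (branch (D t) (G t) c H)" using card_new thr_pos[of i] by (auto split: if_splits)
      ultimately show ?thesis by simp
    qed
  qed simp
  show ?thesis
  proof
    assume f: "flower \<alpha> (G t) c i H"
    show False
    proof (cases rule: step_cases[of t])
      case same
      with f show ?thesis by simp
    next
      case (grow c i H)
      interpret family_step X d \<alpha> "G t" c i H "D t" by (rule grow(1))
      have "t \<le> card (G t)" using claim f by blast
      moreover have "card (G (Suc t)) = card (G t) + card (branch (D t) (G t) c H)"
        unfolding grow(2) using fin_G fin_new new_disjoint by (intro card_Un_disjoint) auto
      moreover have "1 \<le> card (branch (D t) (G t) c H)" using card_new thr_pos[of i] by (auto split: if_splits)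
      moreover have "card (G (Suc t)) \<le> card F" using assms by (intro card_mono)
      ultimately show ?thesis using assms(3) by linarith
    qed
  qed
qed

end


section \<open>Branches determined by their decision bits\<close>

definition family_next :: "('a set set \<Rightarrow> (nat \<times> 'a set) option) \<Rightarrow> bool \<Rightarrow> 'a set set \<Rightarrow> 'a set set" where
  "family_next pick b G = (case pick G of None \<Rightarrow> G | Some (c, H) \<Rightarrow> G \<union> branch b G c H)"

text \<open>Since \<open>pick\<close> is a fixed function of the current family, a leaf of the
  branching tree is described by the bits \<open>D\<close> alone, and these are what the advice has
  to encode.\<close>

fun evolve :: "('a set set \<Rightarrow> (nat \<times> 'a set) option) \<Rightarrow> (nat \<Rightarrow> bool) \<Rightarrow> 'a set set \<Rightarrow> nat \<Rightarrow> 'a set set" where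
  "evolve pick D G 0 = G"
| "evolve pick D G (Suc t) = family_next pick (D t) (evolve pick D G t)"

lemma evolve_run:
  assumes "finite X" "\<alpha> \<ge> 1" "\<And>A. A \<in> G \<Longrightarrow> A \<subseteq> X \<and> card A \<le> d"
    and pick: "\<And>G. (\<And>A. A \<in> G \<Longrightarrow> A \<subseteq> X \<and> card A \<le> d) \<Longrightarrow> case pick G of
     None \<Rightarrow> (\<forall>c i H. \<not> flower \<alpha> G c i H) | Some (c, H) \<Rightarrow> (\<exists>i. first_flower \<alpha> G c i H)"
  shows "family_run X d \<alpha> (evolve pick D G) D"
proof -
  have inv: "\<forall>A \<in> evolve pick D G t. A \<subseteq> X \<and> card A \<le> d" for t
  proof (induction t)
    case (Suc t)
    let ?G = "evolve pick D G t"
    show ?case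
    proof (cases "pick ?G")
      case None
      then show ?thesis using Suc by (simp add: family_next_def)
    next
      case (Some p)
      obtain c H where p: "p = (c, H)" by (cases p)
      from pick[of ?G] Suc Some p obtain i where f: "first_flower \<alpha> ?G c i H" by auto
      interpret family_step X d \<alpha> ?G c i H "D t"
        using f Suc assms(1,2) by unfold_locales auto
      have "A \<subseteq> X \<and> card A \<le> d" if "A \<in> branch (D t) ?G c H" for A
        using new_sub[OF that] new_card[OF that] j_bounds c_le by simp
      then show ?thesis using Suc Some p by (auto simp: family_next_def)
    qed
  qed (use assms(3) in simp)
  show ?thesis
  proof (unfold_locales)
    fix t
    let ?G = "evolve pick D G t"
    show "(evolve pick D G (Suc t) = ?G \<and> (\<forall>c i H. \<not> flower \<alpha> ?G c i H)) \<or>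
      (\<exists>c i H. first_flower \<alpha> ?G c i H \<and> evolve pick D G (Suc t) = ?G \<union> branch (D t) ?G c H)"
    proof (cases "pick ?G")
      case None
      then show ?thesis using pick[of ?G] inv[of t] by (simp add: family_next_def)
    next
      case (Some p)
      obtain c H where p: "p = (c, H)" by (cases p)
      from pick[of ?G] inv[of t] Some p obtain i where "first_flower \<alpha> ?G c i H" by auto
      then show ?thesis using Some p by (auto simp: family_next_def)
    qed
  qed (use assms in auto)
qed

text \<open>Bits at steps where \<open>pick\<close> finds nothing have no effect. Hence an advice
  that lists only the petal steps at real flowers reproduces the branch.\<close>

lemma evolve_cong:
  assumes "\<And>u. u < t \<Longrightarrow> pick (evolve pick D G u) \<noteq> None \<Longrightarrow> D u = D' u"
  shows "evolve pick D' G t = evolve pick D G t"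
  using assms
proof (induction t)
  case (Suc t)
  then have "evolve pick D' G t = evolve pick D G t" by simp
  then show ?case using Suc.prems[of t] by (auto simp: family_next_def split: option.split)
qed simp

text \<open>The branches taken by a satisfying assignment, given by the set \<open>Y\<close> of its true literals.\<close>

lemma evolve_hitting:
  assumes "\<And>A. A \<in> G \<Longrightarrow> A \<inter> Y \<noteq> {}"
  shows "\<exists>D. \<forall>t. \<forall>A \<in> evolve pick D G t. A \<inter> Y \<noteq> {}"
proof -
  define dec where "dec K = (case pick K of None \<Rightarrow> False | Some (c, H) \<Rightarrow> H \<inter> Y = {})" for K
  define F where "F = rec_nat G (\<lambda>_ K. family_next pick (dec K) K)"
  have F: "F 0 = G" "F (Suc t) = family_next pick (dec (F t)) (F t)" for t by (simp_all add: F_def)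
  have ev: "evolve pick (\<lambda>t. dec (F t)) G t = F t" for t by (induction t) (simp_all add: F)
  have "\<forall>A \<in> F t. A \<inter> Y \<noteq> {}" for t
  proof (induction t)
    case (Suc t)
    show ?case
    proof (cases "pick (F t)")
      case None
      then show ?thesis using Suc by (simp add: F family_next_def)
    next
      case (Some p)
      obtain c H where p: "p = (c, H)" by (cases p)
      have "A \<inter> Y \<noteq> {}" if A: "A \<in> branch (dec (F t)) (F t) c H" for A
      proof (cases "H \<inter> Y = {}")
        case True
        then have "dec (F t)" using Some p by (simp add: dec_def)
        then obtain Q where Q: "Q \<in> F t" "A = Q - H" using A by (auto simp: branch_def petal_sets_def minimal_sets_def)
        then have "Q \<inter> Y \<noteq> {}" using Suc by blast
        then show ?thesis using True Q by blast
      next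
        case False
        then have "\<not> dec (F t)" using Some p by (simp add: dec_def)
        then show ?thesis using A False by (simp add: branch_def)
      qed
      then show ?thesis using Suc Some p by (auto simp: F family_next_def)
    qed
  qed (use assms F in simp)
  then show ?thesis using ev by (metis (no_types, lifting))
qed

lemma evolve_superset: "G \<subseteq> evolve pick D G t"
  by (induction t) (auto simp: family_next_def split: option.split)

section \<open>Digits and hashing\<close>

lemma ex_digits:
  fixes B :: nat
  assumes "\<And>i. i < m \<Longrightarrow> f i < B"
  shows "\<exists>N < B ^ m. \<forall>i < m. N div B ^ i mod B = f i"
  using assms
proof (induction m)
  case (Suc m)
  then obtain N where N: "N < B ^ m" "\<And>i. i < m \<Longrightarrow> N div B ^ i mod B = f i" by auto
  have fm: "f m < B" using Suc.prems by simp
  let ?N = "N + f m * B ^ m"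
  have "?N < (1 + f m) * B ^ m" using N(1) by simp
  also have "\<dots> \<le> B * B ^ m" using fm by (intro mult_right_mono) auto
  finally have "?N < B ^ Suc m" by simp
  moreover have "?N div B ^ i mod B = f i" if "i < Suc m" for i
  proof (cases "i = m")
    case True
    then show ?thesis using N(1) fm by simp
  next
    case False
    with that have i: "i < m" by simp
    have e: "f m * B ^ m = (f m * B ^ (m - Suc i) * B) * B ^ i"
    proof -
      obtain j where "m = Suc (i + j)" using i less_imp_Suc_add by blast
      then show ?thesis by (simp add: power_add algebra_simps)
    qed
    have "?N div B ^ i = f m * B ^ (m - Suc i) * B + N div B ^ i"
      by (subst e, subst div_mult_self1) (use fm in simp_all)
    then show ?thesis using N(2)[OF i] by simp
  qed
  ultimately show ?case by blast
qed simp

lemma add_high_digit: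
  fixes B :: nat
  assumes "N < B ^ m"
  shows "(y * B ^ m + N) div B ^ m = y" "i < m \<Longrightarrow> (y * B ^ m + N) div B ^ i mod B = N div B ^ i mod B"
proof -
  have B: "B ^ m > 0" using assms by linarith
  show "(y * B ^ m + N) div B ^ m = y" using assms B by simp
  assume i: "i < m"
  then have Bi: "B ^ i > 0" using B by (cases "B = 0") auto
  have e: "y * B ^ m = (y * B ^ (m - Suc i) * B) * B ^ i"
  proof -
    obtain j where "m = Suc (i + j)" using i less_imp_Suc_add by blast
    then show ?thesis by (simp add: power_add algebra_simps)
  qed
  have "(y * B ^ m + N) div B ^ i = y * B ^ (m - Suc i) * B + N div B ^ i"
    by (subst e, subst div_mult_self3) (use Bi in simp_all)
  then show "(y * B ^ m + N) div B ^ i mod B = N div B ^ i mod B" by simp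
qed

lemma eq_if_bits_eq:
  fixes x y :: nat
  assumes "x < 2 ^ m" "y < 2 ^ m" "\<And>p. p < m \<Longrightarrow> x div 2 ^ p mod 2 = y div 2 ^ p mod 2"
  shows "x = y"
  using assms
proof (induction m arbitrary: x y)
  case (Suc m)
  have "x div 2 = y div 2"
  proof (rule Suc.IH)
    show "x div 2 < 2 ^ m" "y div 2 < 2 ^ m" using Suc.prems(1,2) by auto
    show "x div 2 div 2 ^ p mod 2 = y div 2 div 2 ^ p mod 2" if "p < m" for p
      using Suc.prems(3)[of "Suc p"] that by (simp add: div_mult2_eq)
  qed
  moreover have "x mod 2 = y mod 2" using Suc.prems(3)[of 0] by simp
  ultimately show ?case by (metis mult_div_mod_eq)
qed simp

text \<open>
  A set of \<open>h\<close> numbers is separated by \<open>h\<close> steps, each of which splits one class by one bit. So a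
  perfect hash function is described by \<open>h\<close> pairs of a class and a bit position.
\<close>

fun split_class :: "(nat \<Rightarrow> nat) \<Rightarrow> (nat \<Rightarrow> nat \<Rightarrow> bool) \<Rightarrow> nat \<Rightarrow> nat \<Rightarrow> nat" where
  "split_class c bt x 0 = 0"
| "split_class c bt x (Suc t) =
    (if split_class c bt x t = c t \<and> bt t x then t else split_class c bt x t)"

lemma split_class_less: "1 \<le> t \<Longrightarrow> split_class c bt x t < t"
proof (induction t)
  case (Suc t)
  then show ?case by (cases "t = 0") (auto intro: less_SucI)
qed simp

lemma split_class_cong:
  "(\<And>i. i < t \<Longrightarrow> c i = c' i) \<Longrightarrow> (\<And>i. i < t \<Longrightarrow> bt i x = bt' i x) \<Longrightarrow>
    split_class c bt x t = split_class c' bt' x t"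
  by (induction t) auto

text \<open>Induction on the number of steps. As long as two members share a class they differ in
  some bit, and splitting their class by this bit produces one more class.\<close>

lemma perfect_splitting:
  fixes C :: "nat set"
  assumes "finite C" "C \<noteq> {}" "\<And>x. x \<in> C \<Longrightarrow> x < 2 ^ m" "1 \<le> m" "1 \<le> t"
  defines "bitof \<equiv> \<lambda>p i x. x div 2 ^ p i mod 2 = (1::nat)"
  shows "\<exists>c p. (\<forall>i<t. c i < t \<and> p i < m) \<and>
    (inj_on (\<lambda>x. split_class c (bitof p) x t) C \<or> t \<le> card ((\<lambda>x. split_class c (bitof p) x t) ` C))"
  using assms(5)
proof (induction t rule: nat_induct_at_least)
  case base
  have "card ((\<lambda>x. split_class (\<lambda>_. 0) (bitof (\<lambda>_. 0)) x 1) ` C) \<ge> 1"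
  proof -
    have "0 < card (f ` C)" for f :: "nat \<Rightarrow> nat" using assms(1,2) by (simp add: card_gt_0_iff)
    then show ?thesis by (simp only: Suc_leI One_nat_def)
  qed
  then show ?case using assms(4) by (intro exI[of _ "\<lambda>_. 0"]) auto
next
  case (Suc t)
  then obtain c p where cp: "\<forall>i<t. c i < t \<and> p i < m"
    and alt: "inj_on (\<lambda>x. split_class c (bitof p) x t) C \<or> t \<le> card ((\<lambda>x. split_class c (bitof p) x t) ` C)" by blast
  let ?s = "\<lambda>x. split_class c (bitof p) x t"
  show ?case
  proof (cases "inj_on ?s C")
    case True
    \<comment> \<open>An idle step: class \<open>t\<close> is not yet in use, so nothing is
      split.\<close>
    let ?c = "c(t := t)" and ?p = "p(t := 0)"
    have s: "split_class ?c (bitof ?p) x t = ?s x" for x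
      by (rule split_class_cong) (auto simp: bitof_def)
    have "split_class ?c (bitof ?p) x (Suc t) = ?s x" for x
      using split_class_less[OF Suc.hyps, of c "bitof p" x] by (simp add: s)
    then have "inj_on (\<lambda>x. split_class ?c (bitof ?p) x (Suc t)) C" using True by (simp only:)
    moreover have "\<forall>i<Suc t. ?c i < Suc t \<and> ?p i < m" using cp assms(4) by (auto simp: less_Suc_eq)
    ultimately show ?thesis by blast
  next
    case False
    then obtain x y where xy: "x \<in> C" "y \<in> C" "x \<noteq> y" "?s x = ?s y" by (auto simp: inj_on_def)
    obtain pos where pos: "pos < m" "x div 2 ^ pos mod 2 \<noteq> y div 2 ^ pos mod 2"
      using eq_if_bits_eq[of x m y] assms(3) xy by blast
    let ?c = "c(t := ?s x)" and ?p = "p(t := pos)"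
    have s: "split_class ?c (bitof ?p) z t = ?s z" for z
      by (rule split_class_cong) (auto simp: bitof_def)
    have S: "split_class ?c (bitof ?p) z (Suc t) = (if ?s z = ?s x \<and> z div 2 ^ pos mod 2 = 1 then t else ?s z)" for z
      unfolding split_class.simps(2) s by (simp add: bitof_def)
    have "insert t (?s ` C) \<subseteq> (\<lambda>z. split_class ?c (bitof ?p) z (Suc t)) ` C"
    proof -
      \<comment> \<open>Of two members of the split class, \<open>u\<close> receives the new number
        \<open>t\<close> and \<open>v\<close> keeps the old one, so no class disappears.\<close>
      obtain u v where uv: "u \<in> C" "v \<in> C" "?s u = ?s x" "?s v = ?s x" "u div 2 ^ pos mod 2 = 1" "v div 2 ^ pos mod 2 \<noteq> 1"
      proof (cases "x div 2 ^ pos mod 2 = 1")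
        case True
        then show ?thesis using that[OF xy(1,2) refl xy(4)[symmetric] True] pos(2) by argo
      next
        case False
        then have "y div 2 ^ pos mod 2 = 1" using pos(2) by (metis not_mod_2_eq_1_eq_0)
        then show ?thesis using that[OF xy(2,1) xy(4)[symmetric] refl _ False] by blast
      qed
      have "t \<in> (\<lambda>z. split_class ?c (bitof ?p) z (Suc t)) ` C"
        using S[of u] uv by (intro image_eqI[of _ _ u]) auto
      moreover have "?s z \<in> (\<lambda>z. split_class ?c (bitof ?p) z (Suc t)) ` C" if "z \<in> C" for z
      proof (cases "?s z = ?s x")
        case True
        then show ?thesis using S[of v] uv by (intro image_eqI[of _ _ v]) auto
      next
        case False
        then show ?thesis using S[of z] that by (intro image_eqI[of _ _ z]) auto
      qed
      ultimately show ?thesis by blast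
    qed
    then have "card (insert t (?s ` C)) \<le> card ((\<lambda>z. split_class ?c (bitof ?p) z (Suc t)) ` C)"
      using assms(1) by (intro card_mono) auto
    moreover have "t \<notin> ?s ` C" using split_class_less[OF Suc.hyps, of c "bitof p"] by (metis imageE less_irrefl)
    then have "card (insert t (?s ` C)) = Suc (card (?s ` C))" using assms(1) by simp
    moreover have "t \<le> card (?s ` C)" using alt False by blast
    ultimately have "Suc t \<le> card ((\<lambda>z. split_class ?c (bitof ?p) z (Suc t)) ` C)" by linarith
    moreover have "\<forall>i<Suc t. ?c i < Suc t \<and> ?p i < m"
      using cp pos(1) split_class_less[OF Suc.hyps, of c "bitof p" x] by (auto simp: less_Suc_eq)
    ultimately show ?thesis by blast
  qed
qed

text \<open>After \<open>h\<close> steps even the second alternative of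
  \<open>perfect_splitting\<close> gives injectivity, because at most \<open>h\<close> elements
  occupy \<open>h\<close> classes.\<close>

lemma perfect_hashing:
  fixes C :: "nat set"
  assumes "finite C" "\<And>x. x \<in> C \<Longrightarrow> x < 2 ^ m" "1 \<le> m" "1 \<le> h" "card C \<le> h"
  shows "\<exists>c p. (\<forall>i<h. c i < h \<and> p i < m) \<and> inj_on (\<lambda>x. split_class c (\<lambda>i x. x div 2 ^ p i mod 2 = 1) x h) C"
proof (cases "C = {}")
  case True
  then show ?thesis using assms(3,4) by (intro exI[of _ "\<lambda>_. 0"]) auto
next
  case False
  obtain c p where cp: "\<forall>i<h. c i < h \<and> p i < m"
    "inj_on (\<lambda>x. split_class c (\<lambda>i x. x div 2 ^ p i mod 2 = 1) x h) C \<or>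
     h \<le> card ((\<lambda>x. split_class c (\<lambda>i x. x div 2 ^ p i mod 2 = 1) x h) ` C)"
    using perfect_splitting[OF assms(1) False assms(2,3,4)] by blast
  moreover have "card ((\<lambda>x. split_class c (\<lambda>i x. x div 2 ^ p i mod 2 = 1) x h) ` C) \<le> card C"
    using assms(1) by (rule card_image_le)
  ultimately have "inj_on (\<lambda>x. split_class c (\<lambda>i x. x div 2 ^ p i mod 2 = 1) x h) C"
    using assms(1,5) eq_card_imp_inj_on[of C] by (metis (no_types, lifting) le_antisym order_trans)
  with cp(1) show ?thesis by blast
qed

section \<open>The reduction\<close>

text \<open>
  Literals are the numbers below \<open>2 * n\<close>, clauses are sets of literals, \<open>Cl\<close> is the given set of
  clauses. The definitions are written in the form in which the machine evaluates them; \<open>pw\<close>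
  and \<open>pt\<close> are tabulated powers.
\<close>

locale reduction =
  fixes n d k c2 c3 :: nat and Cl :: "nat set set"
begin

definition b :: nat where "b = n div k + 1"
text \<open>A total function that agrees with the machine's finite table, whose cells beyond
  \<open>2 * b\<close> still contain zero.\<close>

definition pw :: "nat \<Rightarrow> nat" where "pw x = (if x \<le> 2 * b then 2 ^ x else 0)"
text \<open>The bit length of \<open>2 * n\<close>, written as a bounded sum because the machine
  evaluates only sums.\<close>

definition lam :: nat where "lam = (\<Sum>x<2 * b + 1. of_bool (pw x \<le> 2 * n))"
text \<open>The width of one entry of the advice. A step number below \<open>T\<close> needs
  \<open>lam * d\<close> bits; the extra bit makes \<open>T\<close> itself available as a filler
  that names no step.\<close>

definition g :: nat where "g = lam * d + 1"
definition q :: nat where "q = b div (c2 * g)"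
definition r :: nat where "r = g * q"
definition alp :: nat where "alp = c3 * lam"
text \<open>Exceeds every exponent for which \<open>pt\<close> is used: up to \<open>k\<close> for
  the functions from blocks to classes, up to \<open>2 * d - 1\<close> for the flower
  thresholds.\<close>

definition E :: nat where "E = k + 2 * d + 1"
definition pt :: "nat \<Rightarrow> nat \<Rightarrow> nat" where "pt z j = (if z \<le> b + alp \<and> j < E then z ^ j else 0)"
text \<open>By monotonicity the count equals the largest \<open>z \<le> b\<close> with
  \<open>8 * lam * z ^ k \<le> b\<close>, about the \<open>k\<close>-th root of
  \<open>b / (8 * lam)\<close>.\<close>

definition h :: nat where "h = (\<Sum>z<b. of_bool (8 * lam * pt (z + 1) k \<le> b))"
definition hk :: nat where "hk = pt h k"
definition T :: nat where "T = pw (lam * d)"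

definition dig :: "nat \<Rightarrow> nat \<Rightarrow> nat \<Rightarrow> nat" where
  "dig x pos l = x div pw pos mod pw l"

definition lits :: "nat \<Rightarrow> nat set" where
  "lits e = {l. l < 2 * n \<and> (\<exists>i<d. dig e (lam * i) lam = l)}"

text \<open>A triple of sizes \<open>c\<close>, \<open>i\<close> and a heart is coded by \<open>(c * (d + 1) + i) * T + e\<close>.\<close>

definition zc :: "nat \<Rightarrow> nat" where "zc z = z div T div (d + 1)"
definition zi :: "nat \<Rightarrow> nat" where "zi z = z div T mod (d + 1)"
definition zh :: "nat \<Rightarrow> nat set" where "zh z = lits (z mod T)"
definition Z :: nat where "Z = (d + 1) * (d + 1) * T"

definition is_fl :: "nat set set \<Rightarrow> nat \<Rightarrow> bool" where
  "is_fl G z \<longleftrightarrow> flower alp G (zc z) (zi z) (zh z)"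

text \<open>Again minimization by counting: the value is the least code of a flower, or
  \<open>Z\<close> if there is none.\<close>

definition first_fl :: "nat set set \<Rightarrow> nat" where
  "first_fl G = (\<Sum>z<Z. of_bool (\<forall>z' < z + 1. \<not> is_fl G z'))"

definition pick :: "nat set set \<Rightarrow> (nat \<times> nat set) option" where
  "pick G = (if first_fl G < Z then Some (zc (first_fl G), zh (first_fl G)) else None)"

text \<open>The advice is read as a list of \<open>q\<close> step numbers; the listed steps are
  those at which the heart is taken to be false.\<close>

definition false_at :: "nat \<Rightarrow> nat \<Rightarrow> bool" where
  "false_at w t \<longleftrightarrow> (\<exists>p<q. dig w (g * p) g = t)"

definition fam :: "nat \<Rightarrow> nat \<Rightarrow> nat set set" where
  "fam w t = evolve pick (false_at w) Cl t"

text \<open>Reordering the literals of a set changes its code, so the least code is singled out to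
  make counting codes the same as counting sets.\<close>

definition canon :: "nat \<Rightarrow> bool" where
  "canon e \<longleftrightarrow> (\<forall>e'<e. lits e' \<noteq> lits e)"

definition cm :: "nat \<Rightarrow> nat \<Rightarrow> bool" where
  "cm w e \<longleftrightarrow> canon e \<and> lits e \<in> minimal_sets (fam w T)"

text \<open>Numbers the clauses of the sparsified formula consecutively. The index of an element
  then depends on how many clauses there are, not on the much larger range \<open>T\<close> of the
  codes.\<close>

definition rk :: "nat \<Rightarrow> nat \<Rightarrow> nat" where
  "rk w e = (\<Sum>e'<e. of_bool (cm w e'))"

definition blk :: "nat \<Rightarrow> nat" where "blk x = x div pw (b + r)"
definition ass :: "nat \<Rightarrow> nat" where "ass x = dig x r b"
definition adv :: "nat \<Rightarrow> nat" where "adv x = dig x 0 r"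
definition nc :: nat where "nc = 2 * r * k"

definition satl :: "nat \<Rightarrow> nat \<Rightarrow> bool" where
  "satl x e \<longleftrightarrow> (\<exists>l<2 * n. l \<in> lits e \<and> l div 2 div b = blk x \<and> dig (ass x) (l div 2 mod b) 1 = l mod 2)"

text \<open>
  The first \<open>nc\<close> elements force all chosen rows to carry the same advice: element
  \<open>(p * k + j) * 2 + \<beta>\<close> compares bit \<open>p\<close> of the advice in the blocks \<open>j\<close> and \<open>j + 1\<close>.
\<close>

definition cov :: "nat \<Rightarrow> nat \<Rightarrow> bool" where
  "cov x u \<longleftrightarrow> (if u < nc
     then u div 2 mod k + 1 = k \<or> blk x = u div 2 mod k \<and> dig (adv x) (u div (2 * k)) 1 = u mod 2 \<or>
       blk x = u div 2 mod k + 1 \<and> dig (adv x) (u div (2 * k)) 1 \<noteq> u mod 2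
     else (\<forall>e<T. cm (adv x) e \<and> rk (adv x) e = u - nc \<longrightarrow> satl x e))"

text \<open>
  A row consists of a block, an assignment to it and an advice. An element of the instance consists
  of a seed of a hash function from the rows to \<open>h\<close> classes and of an element \<open>u\<^sub>a\<close> of the base instance
  for each of the \<open>h ^ k\<close> functions \<open>a\<close> from blocks to classes. A row covers it by covering some \<open>u\<^sub>a\<close>
  such that \<open>a\<close> maps the block of the row to the class of the row.
\<close>

definition NS :: nat where "NS = k * pw (b + r)"
definition NU :: nat where "NU = pw (2 * lam * (h + hk))"

text \<open>The seed \<open>y\<close> consists of \<open>h\<close> pairs of \<open>lam\<close>-bit
  digits: the class to be split sits at even positions, the bit position at odd ones.\<close>

definition hs :: "nat \<Rightarrow> nat \<Rightarrow> nat \<Rightarrow> nat" where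
  "hs y x t = split_class (\<lambda>t. dig y (lam * (2 * t)) lam) (\<lambda>t x. dig x (dig y (lam * (2 * t + 1)) lam) 1 = 1) x t"

definition edge :: "nat \<Rightarrow> nat \<Rightarrow> bool" where
  "edge x c \<longleftrightarrow> (\<exists>a<hk. a div pt h (blk x) mod h = hs (dig c (2 * lam * hk) (2 * lam * h)) x h \<and>
     cov x (dig c (2 * lam * a) (2 * lam)))"

end

text \<open>\<open>few_false\<close> says that the advice can list all petal steps,
  \<open>elements\<close> that \<open>2 * lam\<close> bits address a base element,
  \<open>exps\<close> that the relevant exponents stay inside the table \<open>pw\<close>,
  \<open>rows\<close> that a row number has at most \<open>2 * b\<close> bits, and
  \<open>hash_digits\<close> that classes and bit positions fit into one digit of the seed.\<close>

locale good_reduction = reduction n d k c2 c3 Cl for n d k c2 c3 :: nat and Cl :: "nat set set" +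
  assumes Cl: "\<And>A. A \<in> Cl \<Longrightarrow> A \<subseteq> {..<2 * n} \<and> card A \<le> d"
    and pos: "1 \<le> n" "1 \<le> d" "1 \<le> k" "1 \<le> h" "1 \<le> alp"
    and size_n: "2 * n < 2 ^ (2 * b)"
    and alp_d: "2 * d \<le> alp"
    and few_false: "d * (2 * n) \<le> alp * q"
    and elements: "nc + (1 + d * (2 * n) * alp ^ (2 * d)) \<le> 2 ^ (2 * lam)"
    and exps: "b + r \<le> 2 * b" "lam * d + 1 \<le> 2 * b" "2 * lam * (h + h ^ k) \<le> 2 * b" "2 * lam \<le> 2 * b"
    and rows: "k * 2 ^ (b + r) \<le> 2 ^ (2 * b)"
    and hash_digits: "2 * b \<le> 2 ^ lam" "h \<le> 2 ^ lam"
begin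

section \<open>Codes of literal sets and the search for the first flower\<close>

lemma lam_gt: "2 * n < 2 ^ lam" and lam_le: "lam \<le> 2 * b" and lam_pos: "1 \<le> lam"
proof -
  define S where "S = {x. x < 2 * b + 1 \<and> 2 ^ x \<le> 2 * n}"
  have lamS: "lam = card S"
  proof -
    have "lam = (\<Sum>x<2 * b + 1. of_bool (2 ^ x \<le> 2 * n))"
      unfolding lam_def by (rule sum.cong) (auto simp: pw_def)
    also have "\<dots> = card ({..<2 * b + 1} \<inter> {x. 2 ^ x \<le> 2 * n})" by (subst sum_of_bool_eq) simp_all
    also have "{..<2 * b + 1} \<inter> {x. 2 ^ x \<le> 2 * n} = S" by (auto simp: S_def)
    finally show ?thesis .
  qed
  have finS: "finite S" by (simp add: S_def)
  have "2 * b \<notin> S" using size_n by (simp add: S_def)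
  have down: "y \<in> S" if "x \<in> S" "y \<le> x" for x y
  proof -
    have "(2::nat) ^ y \<le> 2 ^ x" using that(2) by (intro power_increasing) auto
    moreover have "x < 2 * b + 1" "2 ^ x \<le> 2 * n" using that(1) by (simp_all add: S_def)
    ultimately have "y < 2 * b + 1" "2 ^ y \<le> 2 * n" using that(2) by linarith+
    then show ?thesis unfolding S_def by blast
  qed
  have Sb: "S \<subseteq> {..<2 * b}"
  proof
    fix x assume x: "x \<in> S"
    then have "x \<noteq> 2 * b" using \<open>2 * b \<notin> S\<close> by blast
    then show "x \<in> {..<2 * b}" using x by (simp add: S_def)
  qed
  then show "lam \<le> 2 * b" unfolding lamS using card_mono[OF _ Sb] by simp
  \<comment> \<open>A downward closed set of \<open>lam\<close> numbers cannot contain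
    \<open>lam\<close> itself.\<close>
  have "lam \<notin> S"
  proof
    assume "lam \<in> S"
    then have "{..lam} \<subseteq> S" using down by blast
    then have "card {..lam} \<le> card S" using finS by (intro card_mono)
    then show False using lamS by simp
  qed
  then show "2 * n < 2 ^ lam" using \<open>lam \<le> 2 * b\<close> by (simp add: S_def)
  have "0 \<in> S" using pos by (simp add: S_def)
  then show "1 \<le> lam" unfolding lamS using finS by (metis One_nat_def Suc_leI card_gt_0_iff empty_iff)
qed

lemma pw_eq: "x \<le> 2 * b \<Longrightarrow> pw x = 2 ^ x"
  by (simp add: pw_def)

lemma lamd: "lam * d \<le> 2 * b" using exps(2) by simp

lemma T_eq: "T = 2 ^ (lam * d)" unfolding T_def using lamd by (simp add: pw_eq)

lemma b_pos: "1 \<le> b" by (simp add: b_def)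

lemma h_le_b: "h \<le> b"
proof -
  have "h \<le> (\<Sum>z<b. 1)" unfolding h_def by (rule sum_mono) simp
  then show ?thesis by simp
qed

lemma pt_h: "j \<le> k \<Longrightarrow> pt h j = h ^ j"
  using h_le_b by (simp add: pt_def E_def)

lemma hk_eq: "hk = h ^ k" by (simp add: hk_def pt_h)

lemma lits_sub: "lits e \<subseteq> {..<2 * n}" by (auto simp: lits_def)

lemma lits_eq: "i < d \<Longrightarrow> dig e (lam * i) lam = e div (2 ^ lam) ^ i mod 2 ^ lam"
proof -
  assume "i < d"
  then have "lam * i \<le> lam * d" by simp
  then have "lam * i \<le> 2 * b" using lamd by linarith
  then show ?thesis using lam_le by (simp add: dig_def pw_eq power_mult)
qed

text \<open>Unused digits are filled with \<open>2 ^ lam - 1\<close>, which is not a literal.\<close>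

lemma ex_lits:
  assumes "A \<subseteq> {..<2 * n}" "card A \<le> d"
  shows "\<exists>e<T. lits e = A"
proof -
  have fin: "finite A" using assms(1) finite_subset by blast
  obtain xs where xs: "set xs = A" "distinct xs" using finite_distinct_list[OF fin] by blast
  have len: "length xs \<le> d" using assms(2) xs distinct_card by metis
  define f where "f i = (if i < length xs then xs ! i else 2 ^ lam - 1)" for i
  have f: "f i < 2 ^ lam" for i
  proof (cases "i < length xs")
    case True
    then have "xs ! i \<in> A" using xs by auto
    then have "xs ! i < 2 * n" using assms(1) by blast
    then show ?thesis using lam_gt True by (simp add: f_def)
  qed (simp add: f_def)
  obtain e where e: "e < (2 ^ lam) ^ d" "\<forall>i<d. e div (2 ^ lam) ^ i mod 2 ^ lam = f i"
    using ex_digits[of d f "2 ^ lam"] f by blast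
  have dg: "dig e (lam * i) lam = f i" if "i < d" for i using e(2) lits_eq[OF that] that by simp
  have "lits e = A"
  proof
    show "lits e \<subseteq> A"
    proof
      fix l assume "l \<in> lits e"
      then obtain i where i: "i < d" "f i = l" "l < 2 * n" using dg by (auto simp: lits_def)
      have "i < length xs"
      proof (rule ccontr)
        assume "\<not> i < length xs"
        then have "l = 2 ^ lam - 1" using i by (simp add: f_def)
        then show False using i(3) lam_gt by linarith
      qed
      then show "l \<in> A" using i xs by (auto simp: f_def)
    qed
    show "A \<subseteq> lits e"
    proof
      fix l assume l: "l \<in> A"
      then obtain i where i: "i < length xs" "xs ! i = l" using xs by (metis in_set_conv_nth)
      then have "i < d" "dig e (lam * i) lam = l" using len dg[of i] by (auto simp: f_def)
      then show "l \<in> lits e" using l assms(1) by (auto simp: lits_def)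
    qed
  qed
  moreover have "e < T" using e(1) by (simp add: T_eq power_mult)
  ultimately show ?thesis by blast
qed

definition ok_fam :: "nat set set \<Rightarrow> bool" where
  "ok_fam G \<longleftrightarrow> (\<forall>A\<in>G. A \<subseteq> {..<2 * n} \<and> card A \<le> d)"

lemma bounded_ok: "ok_fam G \<Longrightarrow> bounded_family {..<2 * n} d alp G"
  using pos by unfold_locales (auto simp: ok_fam_def)

lemma T_pos: "0 < T" by (simp add: T_eq)

lemma code_parts:
  assumes "c \<le> d" "i \<le> d" "e < T"
  defines "z \<equiv> (c * (d + 1) + i) * T + e"
  shows "zc z = c" "zi z = i" "zh z = lits e" "z < Z"
proof -
  have zT: "z div T = c * (d + 1) + i" "z mod T = e" unfolding z_def using assms(3) by simp_all
  have i: "i < d + 1" using assms(2) by simp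
  have "(c * (d + 1) + i) div (d + 1) = c" "(c * (d + 1) + i) mod (d + 1) = i"
    using i by (metis div_mult_self3 add.commute add_0 div_less zero_neq_one add_eq_0_iff_both_eq_0 mult.commute,
      metis mod_mult_self3 mod_less)
  then show "zc z = c" "zi z = i" "zh z = lits e" by (simp_all add: zc_def zi_def zh_def zT del: add_Suc_right)
  have "z < (c * (d + 1) + i + 1) * T" unfolding z_def using assms(3) by simp
  also have "\<dots> \<le> ((d + 1) * (d + 1)) * T"
  proof (rule mult_right_mono)
    have "c * (d + 1) + i + 1 \<le> c * (d + 1) + (d + 1)" using assms(2) by simp
    also have "\<dots> = (c + 1) * (d + 1)" by simp
    also have "\<dots> \<le> (d + 1) * (d + 1)" using assms(1) by (intro mult_right_mono) auto
    finally show "c * (d + 1) + i + 1 \<le> (d + 1) * (d + 1)" .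
  qed simp
  finally show "z < Z" by (simp add: Z_def)
qed

text \<open>The heart occupies the low digits, so the order of the codes refines the lexicographic
  order of \<open>c\<close> and \<open>i\<close>. This is why the least code of a flower belongs to
  a first flower.\<close>

lemma code_less:
  assumes "z \<le> (c' * (d + 1) + i') * T + e'" "e' < T" "i' \<le> d"
  shows "zc z < c' \<or> zc z = c' \<and> zi z \<le> i'"
proof -
  have "z div T \<le> ((c' * (d + 1) + i') * T + e') div T" using assms(1) by (rule div_le_mono)
  also have "\<dots> = c' * (d + 1) + i'" using assms(2) by simp
  finally have le: "z div T \<le> c' * (d + 1) + i'" .
  have z: "z div T = zc z * (d + 1) + zi z" unfolding zc_def zi_def by (rule div_mult_mod_eq[symmetric])
  have "zc z \<le> c'"
  proof (rule ccontr)
    assume "\<not> zc z \<le> c'"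
    then have "(c' + 1) * (d + 1) \<le> zc z * (d + 1)" by (intro mult_right_mono) auto
    then show False using le z assms(3) by (simp add: algebra_simps)
  qed
  moreover have "zi z \<le> i'" if "zc z = c'" using le z that by simp
  ultimately show ?thesis by linarith
qed

lemma first_fl_least:
  "first_fl G \<le> Z" "first_fl G < Z \<Longrightarrow> is_fl G (first_fl G)" "z < first_fl G \<Longrightarrow> \<not> is_fl G z"
proof -
  define S where "S = {z. z < Z \<and> (\<forall>z'<z + 1. \<not> is_fl G z')}"
  have ff: "first_fl G = card S"
  proof -
    have "first_fl G = card ({..<Z} \<inter> {z. \<forall>z'<z + 1. \<not> is_fl G z'})"
      unfolding first_fl_def by (subst sum_of_bool_eq) auto
    also have "{..<Z} \<inter> {z. \<forall>z'<z + 1. \<not> is_fl G z'} = S" by (auto simp: S_def)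
    finally show ?thesis .
  qed
  have finS: "finite S" by (simp add: S_def)
  have down: "y \<in> S" if "x \<in> S" "y \<le> x" for x y using that by (auto simp: S_def)
  have SE: "S = {..<card S}"
  proof -
    have "\<exists>N. S = {..<N}"
    proof (cases "S = {}")
      case False
      have "S = {..<Suc (Max S)}"
      proof
        show "S \<subseteq> {..<Suc (Max S)}" using finS by (auto simp: less_Suc_eq_le)
        show "{..<Suc (Max S)} \<subseteq> S" using down[OF Max_in[OF finS False]] by (auto simp: less_Suc_eq_le)
      qed
      then show ?thesis by blast
    qed auto
    then obtain N where "S = {..<N}" by blast
    then show ?thesis by simp
  qed
  have "S \<subseteq> {..<Z}" by (auto simp: S_def)
  then have "card S \<le> Z" using card_mono[of "{..<Z}" S] by simp
  then show "first_fl G \<le> Z" using ff by simp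
  show "z < first_fl G \<Longrightarrow> \<not> is_fl G z" for z
  proof -
    assume "z < first_fl G"
    then have "z \<in> S" using SE ff by auto
    then show "\<not> is_fl G z" by (simp add: S_def)
  qed
  then have low: "\<forall>z'<first_fl G. \<not> is_fl G z'" by blast
  assume lt: "first_fl G < Z"
  have "first_fl G \<notin> S" using SE ff by auto
  then obtain z' where "z' < first_fl G + 1" "is_fl G z'" using lt by (auto simp: S_def)
  then show "is_fl G (first_fl G)" using low by (metis Suc_eq_plus1 less_SucE)
qed

lemma pick_spec:
  assumes "ok_fam G"
  shows "case pick G of None \<Rightarrow> (\<forall>c i H. \<not> flower alp G c i H) | Some (c, H) \<Rightarrow> (\<exists>i. first_flower alp G c i H)"
proof -
  interpret bounded_family "{..<2 * n}" d alp G by (rule bounded_ok[OF assms])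
  \<comment> \<open>The heart of a flower lies inside a member of \<open>G\<close>, hence has at
    most \<open>d\<close> literals and possesses a code.\<close>
  have code: "\<exists>z<Z. zc z = c \<and> zi z = i \<and> zh z = H \<and> (\<exists>e<T. z = (c * (d + 1) + i) * T + e) \<and> i \<le> d"
    if f: "flower alp G c i H" for c i H
  proof -
    have "1 \<le> card (petal_sets G c H)" using f thr_pos[of i] unfolding flower_def by linarith
    then obtain Q where "Q \<in> petal_sets G c H" by (metis One_nat_def card.empty equals0I not_one_le_zero)
    then have Q: "Q \<in> G" "card Q = c" "H \<subseteq> Q" using minimal_sub by (auto simp: petal_sets_def)
    have "H \<subseteq> {..<2 * n}" using Q G_sub by blast
    moreover have "card H \<le> d" using Q card_mono[OF fin_mem[OF Q(1)] Q(3)] G_card[OF Q(1)] by linarith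
    ultimately obtain e where e: "e < T" "lits e = H" using ex_lits by blast
    have "c \<le> d" using Q(2) G_card[OF Q(1)] by simp
    moreover have "i \<le> c" using f by (auto simp: flower_def)
    ultimately have ci: "c \<le> d" "i \<le> d" by linarith+
    show ?thesis using code_parts[OF ci e(1)] e ci by (intro exI[of _ "(c * (d + 1) + i) * T + e"]) auto
  qed
  show ?thesis
  proof (cases "first_fl G < Z")
    case True
    let ?z = "first_fl G"
    have f: "flower alp G (zc ?z) (zi ?z) (zh ?z)" using first_fl_least(2)[OF True] by (simp add: is_fl_def)
    have "zc ?z < c' \<or> zc ?z = c' \<and> zi ?z \<le> i'" if f': "flower alp G c' i' H'" for c' i' H'
    proof -
      obtain z e where z: "z < Z" "zc z = c'" "zi z = i'" "zh z = H'" "e < T" "z = (c' * (d + 1) + i') * T + e" "i' \<le> d"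
        using code[OF f'] by blast
      then have "is_fl G z" using f' by (simp add: is_fl_def)
      then have "?z \<le> z" using first_fl_least(3)[of z] by (metis not_le)
      then show ?thesis using code_less[of ?z c' i' e] z by simp
    qed
    then have "first_flower alp G (zc ?z) (zi ?z) (zh ?z)" using f unfolding first_flower_def by blast
    then show ?thesis using True by (auto simp: pick_def)
  next
    case False
    then have eq: "first_fl G = Z" using first_fl_least(1)[of G] by linarith
    have "\<not> flower alp G c i H" for c i H
    proof
      assume f: "flower alp G c i H"
      from code[OF f] obtain z where "z < Z" "is_fl G z" using f by (auto simp: is_fl_def)
      then show False using first_fl_least(3)[of z G] eq by simp
    qed
    then show ?thesis using False by (simp add: pick_def)
  qed
qed

lemma run: "family_run {..<2 * n} d alp (evolve pick D Cl) D"
  by (rule evolve_run) (use pos Cl pick_spec in \<open>auto simp: ok_fam_def\<close>)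

lemma ok_evolve: "ok_fam (evolve pick D Cl t)"
proof -
  interpret family_run "{..<2 * n}" d alp "evolve pick D Cl" D by (rule run)
  show ?thesis using bounded[of t] unfolding bounded_family_def ok_fam_def by blast
qed

lemma ok_fam: "ok_fam (fam w t)" unfolding fam_def by (rule ok_evolve)

text \<open>All families consist of sets with a code below \<open>T\<close>, so there are at most
  \<open>T\<close> proper branching steps.\<close>

lemma no_flower_T: "\<not> flower alp (fam w T) c i H"
proof -
  interpret family_run "{..<2 * n}" d alp "evolve pick (false_at w) Cl" "false_at w" by (rule run)
  have "evolve pick (false_at w) Cl t \<subseteq> lits ` {..<T}" for t
  proof
    fix A assume "A \<in> evolve pick (false_at w) Cl t"
    then have "A \<subseteq> {..<2 * n}" "card A \<le> d" using ok_evolve by (auto simp: ok_fam_def)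
    then obtain e where "e < T" "lits e = A" using ex_lits by blast
    then show "A \<in> lits ` {..<T}" by blast
  qed
  moreover have "card (lits ` {..<T}) \<le> T" using card_image_le[of "{..<T}" lits] by simp
  ultimately show ?thesis unfolding fam_def by (intro no_flower_eventually[of "lits ` {..<T}"]) auto
qed

lemma ex_canon: 
  assumes "ok_fam G" "A \<in> G"
  shows "\<exists>e<T. canon e \<and> lits e = A"
proof -
  obtain e0 where e0: "e0 < T" "lits e0 = A" using ex_lits[of A] assms unfolding ok_fam_def by blast
  define e where "e = (LEAST e. lits e = A)"
  have eA: "lits e = A" unfolding e_def by (rule LeastI, rule e0(2))
  have "lits e' \<noteq> A" if "e' < e" for e' using that unfolding e_def by (rule not_less_Least)
  then have "canon e" using eA by (simp add: canon_def)
  moreover have "e < T" using Least_le[of "\<lambda>e. lits e = A" e0] e0 unfolding e_def by simp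
  ultimately show ?thesis using eA by blast
qed

lemma canon_inj: "inj_on lits {e. canon e}"
proof (rule inj_onI)
  fix x y assume xy: "x \<in> {e. canon e}" "y \<in> {e. canon e}" "lits x = lits y"
  have "lits x' \<noteq> lits y" if "x' < y" for x' using xy(2) that unfolding canon_def by blast
  then have "\<not> x < y" using xy(3) by metis
  moreover have "lits y' \<noteq> lits x" if "y' < x" for y' using xy(1) that unfolding canon_def by blast
  then have "\<not> y < x" using xy(3) by metis
  ultimately show "x = y" by linarith
qed

text \<open>Canonical codes of smaller rank represent different minimal sets of a family without
  flowers, so \<open>card_minimal_if_no_flower\<close> limits their number.\<close>

lemma rk_less:
  assumes "cm w e" shows "nc + rk w e < 2 ^ (2 * lam)"
proof -
  interpret bounded_family "{..<2 * n}" d alp "fam w T" by (rule bounded_ok[OF ok_fam])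
  have "rk w e = card {e'. e' < e \<and> cm w e'}"
    unfolding rk_def by (subst sum_of_bool_eq) (auto intro: arg_cong[where f = card])
  also have "\<dots> = card (lits ` {e'. e' < e \<and> cm w e'})"
    by (rule card_image[symmetric], rule inj_on_subset[OF canon_inj]) (auto simp: cm_def)
  also have "\<dots> < card (minimal_sets (fam w T))"
  proof (rule psubset_card_mono)
    show "finite (minimal_sets (fam w T))" using fin_G minimal_sub finite_subset by blast
    have "lits e \<notin> lits ` {e'. e' < e \<and> cm w e'}" using assms by (auto simp: cm_def canon_def)
    moreover have "lits e \<in> minimal_sets (fam w T)" "lits ` {e'. e' < e \<and> cm w e'} \<subseteq> minimal_sets (fam w T)"
      using assms by (auto simp: cm_def)
    ultimately show "lits ` {e'. e' < e \<and> cm w e'} \<subset> minimal_sets (fam w T)" by blast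
  qed
  also have "\<dots> \<le> 1 + d * (2 * n) * alp ^ (2 * d)"
    using card_minimal_if_no_flower[OF no_flower_T] by simp
  finally show ?thesis using elements by linarith
qed

lemma rk_inj: "cm w e \<Longrightarrow> cm w e' \<Longrightarrow> rk w e = rk w e' \<Longrightarrow> e = e'"
proof (induction e e' rule: linorder_wlog)
  case (le a b)
  show ?case
  proof (rule ccontr)
    assume "a \<noteq> b"
    then have "Suc a \<le> b" using le by simp
    then have "(\<Sum>e'<Suc a. of_bool (cm w e')) \<le> rk w b" unfolding rk_def by (intro sum_mono2) auto
    then show False using le by (simp add: rk_def)
  qed
qed simp

end

section \<open>Completeness and soundness of the composed instance\<close>

context good_reduction
begin

lemma r_le: "r \<le> 2 * b" using exps(1) by simp

lemma NS_eq: "NS = k * 2 ^ (b + r)" using exps(1) by (simp add: NS_def pw_eq)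

lemma blk_eq: "blk x = x div 2 ^ (b + r)" using exps(1) by (simp add: blk_def pw_eq)
lemma ass_eq: "ass x = x div 2 ^ r mod 2 ^ b" using r_le by (simp add: ass_def dig_def pw_eq)
lemma adv_eq: "adv x = x mod 2 ^ r" using r_le by (simp add: adv_def dig_def pw_eq)

lemma bit_eq: "p \<le> 2 * b \<Longrightarrow> dig y p 1 = y div 2 ^ p mod 2"
  using b_pos by (simp add: dig_def pw_eq)

lemma row_parts:
  fixes j s w :: nat
  assumes "s < 2 ^ b" "w < 2 ^ r"
  defines "x \<equiv> (j * 2 ^ b + s) * 2 ^ r + w"
  shows "blk x = j" "ass x = s" "adv x = w" "j < k \<Longrightarrow> x < NS"
proof -
  have d: "x div 2 ^ r = j * 2 ^ b + s" "x mod 2 ^ r = w" unfolding x_def using assms(2) by simp_all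
  have "x div 2 ^ (b + r) = x div 2 ^ r div 2 ^ b" by (simp add: div_mult2_eq[symmetric] power_add mult.commute)
  then show B: "blk x = j" unfolding blk_eq d using assms(1) by simp
  show "ass x = s" unfolding ass_eq d using assms(1) by simp
  show "adv x = w" unfolding adv_eq d ..
  assume "j < k"
  then show "x < NS" using B unfolding NS_eq blk_eq by (metis less_mult_imp_div_less div_less_iff_less_mult zero_less_numeral zero_less_power)
qed

lemma ex_advice:
  assumes "P \<subseteq> {..<T}" "card P \<le> q"
  shows "\<exists>w < 2 ^ r. \<forall>t<T. false_at w t \<longleftrightarrow> t \<in> P"
proof -
  have fin: "finite P" using assms(1) finite_subset by blast
  obtain xs where xs: "set xs = P" "distinct xs" using finite_distinct_list[OF fin] by blast
  have len: "length xs \<le> q" using assms(2) xs distinct_card by metis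
  define f where "f p = (if p < length xs then xs ! p else T)" for p
  have Tg: "T < 2 ^ g" by (simp add: T_eq g_def)
  have f: "f p < 2 ^ g" for p
  proof (cases "p < length xs")
    case True
    then have "xs ! p \<in> P" using xs by auto
    then have "xs ! p < T" using assms(1) by blast
    then show ?thesis using Tg True by (simp add: f_def)
  qed (simp add: f_def Tg)
  obtain w where w: "w < (2 ^ g) ^ q" "\<forall>p<q. w div (2 ^ g) ^ p mod 2 ^ g = f p"
    using ex_digits[of q f "2 ^ g"] f by blast
  have dg: "dig w (g * p) g = f p" if "p < q" for p
  proof -
    have "g * p \<le> r" "g \<le> r" unfolding r_def using that by auto
    then have "g * p \<le> 2 * b" "g \<le> 2 * b" using r_le by linarith+
    then show ?thesis using w(2) that by (simp add: dig_def pw_eq power_mult)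
  qed
  have "false_at w t \<longleftrightarrow> t \<in> P" if t: "t < T" for t
  proof
    assume "false_at w t"
    then obtain p where p: "p < q" "f p = t" using dg by (auto simp: false_at_def)
    have "p < length xs" using p(2) t by (auto simp: f_def split: if_splits)
    then show "t \<in> P" using p(2) xs by (auto simp: f_def)
  next
    assume "t \<in> P"
    then obtain p where p: "p < length xs" "xs ! p = t" using xs by (metis in_set_conv_nth)
    then have "p < q" "dig w (g * p) g = t" using len dg[of p] by (auto simp: f_def)
    then show "false_at w t" by (auto simp: false_at_def)
  qed
  moreover have "w < 2 ^ r" using w(1) by (simp add: r_def power_mult)
  ultimately show ?thesis by blast
qed

lemma var_block: "l < 2 * n \<Longrightarrow> l div 2 div b < k"
proof -
  assume "l < 2 * n"
  then have "l div 2 < n" by simp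
  also have "n < k * b"
  proof -
    have "n = k * (n div k) + n mod k" by simp
    also have "\<dots> < k * (n div k) + k" using mod_less_divisor[of k n] pos(3) by linarith
    finally show ?thesis by (simp add: b_def algebra_simps)
  qed
  finally show ?thesis by (metis less_mult_imp_div_less)
qed

lemma hs_less: "hs y x h < h"
  unfolding hs_def by (rule split_class_less[OF pos(4)])

text \<open>The cover has one row per block: the restriction of the assignment together with the
  common advice that names the petal steps of its branch. For a given seed, the classes of these
  rows define one function \<open>N\<close> from blocks to classes. The base element belonging to
  \<open>N\<close> is covered by one of the rows, and that row has the right class.\<close>

lemma complete:
  assumes sat: "\<forall>A\<in>Cl. \<exists>l\<in>A. a (l div 2) = odd l"
  shows "\<exists>C \<subseteq> {..<NS}. card C \<le> k \<and> (\<forall>c<NU. \<exists>x\<in>C. edge x c)"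
proof -
  define Y where "Y = {l. l < 2 * n \<and> a (l div 2) = odd l}"
  have hit: "A \<inter> Y \<noteq> {}" if "A \<in> Cl" for A
  proof -
    obtain l where "l \<in> A" "a (l div 2) = odd l" using sat \<open>A \<in> Cl\<close> by blast
    moreover have "l < 2 * n" using Cl[OF \<open>A \<in> Cl\<close>] \<open>l \<in> A\<close> by blast
    ultimately show ?thesis by (auto simp: Y_def)
  qed
  obtain D where D: "\<And>t A. A \<in> evolve pick D Cl t \<Longrightarrow> A \<inter> Y \<noteq> {}"
    using evolve_hitting[of Cl Y pick] hit by metis
  \<comment> \<open>Only steps with a flower are listed, since only their number is bounded by
    \<open>q\<close>.\<close>
  define P where "P = {u. u < T \<and> D u \<and> pick (evolve pick D Cl u) \<noteq> None}"
  interpret fr: family_run "{..<2 * n}" d alp "evolve pick D Cl" D by (rule run)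
  have "card P * alp \<le> d * (2 * n)"
  proof -
    have "P \<subseteq> {u. u < T \<and> D u \<and> (\<exists>c i H. flower alp (evolve pick D Cl u) c i H)}"
    proof
      fix u assume u: "u \<in> P"
      then obtain c H where "pick (evolve pick D Cl u) = Some (c, H)" by (auto simp: P_def)
      then obtain i where "first_flower alp (evolve pick D Cl u) c i H"
        using pick_spec[OF ok_evolve[of D u]] by auto
      then show "u \<in> {u. u < T \<and> D u \<and> (\<exists>c i H. flower alp (evolve pick D Cl u) c i H)}"
        using u unfolding P_def first_flower_def by blast
    qed
    then have "card P \<le> card {u. u < T \<and> D u \<and> (\<exists>c i H. flower alp (evolve pick D Cl u) c i H)}"
      by (intro card_mono) auto
    then have "card P * alp \<le> card {u. u < T \<and> D u \<and> (\<exists>c i H. flower alp (evolve pick D Cl u) c i H)} * alp"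
      by (rule mult_le_mono1)
    also have "\<dots> \<le> d * card {..<2 * n}" by (rule fr.card_petal_steps[OF alp_d])
    finally show ?thesis by simp
  qed
  then have "card P * alp \<le> alp * q" using few_false by (rule order_trans)
  then have "card P * alp \<le> q * alp" by (simp only: mult.commute)
  then have "card P \<le> q" using pos(5) by simp
  moreover have "P \<subseteq> {..<T}" by (auto simp: P_def)
  ultimately obtain w where w: "w < 2 ^ r" "\<And>t. t < T \<Longrightarrow> false_at w t \<longleftrightarrow> t \<in> P" using ex_advice by blast
  have famT: "fam w T = evolve pick D Cl T"
    unfolding fam_def by (rule evolve_cong) (use w(2) in \<open>auto simp: P_def\<close>)
  have "\<exists>s :: nat \<Rightarrow> nat. \<forall>j. s j < 2 ^ b \<and> (\<forall>i<b. s j div 2 ^ i mod 2 = of_bool (a (j * b + i)))"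
  proof (rule choice, rule allI)
    fix j
    have "of_bool (a (j * b + i)) < (2::nat)" for i by simp
    then show "\<exists>s::nat. s < 2 ^ b \<and> (\<forall>i<b. s div 2 ^ i mod 2 = of_bool (a (j * b + i)))"
      using ex_digits[of b "\<lambda>i. of_bool (a (j * b + i))" 2] by blast
  qed
  then obtain s where s: "\<And>j. s j < (2::nat) ^ b" "\<And>j i. i < b \<Longrightarrow> s j div 2 ^ i mod 2 = of_bool (a (j * b + i))" by blast
  define x where "x j = (j * 2 ^ b + s j) * 2 ^ r + w" for j
  have x: "blk (x j) = j" "ass (x j) = s j" "adv (x j) = w" "j < k \<Longrightarrow> x j < NS" for j
    unfolding x_def using row_parts[OF s(1) w(1)] by blast+
  have covered: "\<exists>j<k. cov (x j) u" for u
  proof (cases "u < nc")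
    case True
    let ?j = "u div 2 mod k"
    have j: "?j < k" using pos by simp
    show ?thesis
    proof (cases "?j + 1 = k \<or> dig w (u div (2 * k)) 1 = u mod 2")
      case t: True
      then have "cov (x ?j) u" using True x by (auto simp: cov_def)
      then show ?thesis using j by blast
    next
      case False
      then have "cov (x (?j + 1)) u" using True x by (simp add: cov_def)
      moreover have "?j + 1 < k" using j False by linarith
      ultimately show ?thesis by blast
    qed
  next
    case False
    show ?thesis
    proof (cases "\<exists>e<T. cm w e \<and> rk w e = u - nc")
      case True
      then obtain e where e: "e < T" "cm w e" "rk w e = u - nc" by blast
      have "lits e \<in> evolve pick D Cl T" using e(2) unfolding cm_def famT by (simp add: minimal_sets_def)
      then obtain l where l: "l \<in> lits e" "l < 2 * n" "a (l div 2) = odd l" using D unfolding Y_def by blast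
      let ?j = "l div 2 div b" and ?i = "l div 2 mod b"
      have i: "?i < b" using b_pos by simp
      have "?i \<le> 2 * b" using i by simp
      then have "dig (ass (x ?j)) ?i 1 = s ?j div 2 ^ ?i mod 2" unfolding x(2) by (rule bit_eq)
      also have "\<dots> = of_bool (a (?j * b + ?i))" by (rule s(2)[OF i])
      also have "?j * b + ?i = l div 2" by (rule div_mult_mod_eq)
      also have "of_bool (a (l div 2)) = l mod 2" using l(3) by (simp add: odd_iff_mod_2_eq_one)
      finally have "satl (x ?j) e" using l(1,2) x(1)[of ?j] unfolding satl_def by (intro exI[of _ l]) simp
      moreover have "e' = e" if "cm w e'" "rk w e' = u - nc" for e' using rk_inj[of w e' e] that e by simp
      ultimately have "cov (x ?j) u" using False x(3) by (auto simp: cov_def)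
      then show ?thesis using var_block[OF l(2)] by blast
    next
      case f: False
      then have "cov (x 0) u" using False x(3) by (auto simp: cov_def)
      then show ?thesis using pos(3) by (intro exI[of _ 0]) auto
    qed
  qed
  let ?C = "x ` {..<k}"
  have "\<exists>x\<in>?C. edge x c" for c
  proof -
    define y where "y = dig c (2 * lam * hk) (2 * lam * h)"
    obtain N where N: "N < h ^ k" "\<And>j. j < k \<Longrightarrow> N div h ^ j mod h = hs y (x j) h"
      using ex_digits[of k "\<lambda>j. hs y (x j) h" h] hs_less by blast
    obtain j where j: "j < k" "cov (x j) (dig c (2 * lam * N) (2 * lam))" using covered by blast
    have "N div pt h (blk (x j)) mod h = hs y (x j) h" using N(2)[OF j(1)] j(1) x(1) by (simp add: pt_h)
    then have "edge (x j) c" using N(1) j(2) unfolding edge_def y_def hk_eq by blast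
    then show ?thesis using j(1) by blast
  qed
  moreover have "?C \<subseteq> {..<NS}" using x(4) by auto
  moreover have "card ?C \<le> k" using card_image_le[of "{..<k}" x] by simp
  ultimately show ?thesis by blast
qed

text \<open>The first \<open>nc\<close> elements force a common advice \<open>w\<close>. Whichever
  branch \<open>w\<close> describes, its family contains all of \<open>Cl\<close>, so each clause
  includes a minimal set of the family, and covering the element of that set makes one of its
  literals true. Wrong advice is therefore harmless.\<close>

lemma base_sound:
  assumes X: "\<And>j. j < k \<Longrightarrow> blk (X j) = j"
    and cv: "\<And>u. u < 2 ^ (2 * lam) \<Longrightarrow> \<exists>j<k. cov (X j) u"
  shows "\<exists>a. \<forall>A\<in>Cl. \<exists>l\<in>A. a (l div 2) = odd l"
proof -
  define w where "w = adv (X 0)"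
  have step: "adv (X j) = adv (X (j + 1))" if j: "j + 1 < k" for j
  proof (rule eq_if_bits_eq)
    show "adv (X j) < 2 ^ r" "adv (X (j + 1)) < 2 ^ r" by (simp_all add: adv_eq)
    fix p assume p: "p < r"
    have p2: "p \<le> 2 * b" using p r_le by simp
    \<comment> \<open>The value that the row of block \<open>j\<close> does not have, so that this
      row misses the element and the row of block \<open>j + 1\<close> has to cover it.\<close>
    define \<beta> where "\<beta> = 1 - dig (adv (X j)) p 1"
    have d2: "dig z p 1 = 0 \<or> dig z p 1 = 1" for z unfolding bit_eq[OF p2] by auto
    have b2: "\<beta> < 2" unfolding \<beta>_def by simp
    define u where "u = (p * k + j) * 2 + \<beta>"
    have uparts: "u div 2 = p * k + j" "u mod 2 = \<beta>"
    proof -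
      have "(X * 2 + \<beta>) div 2 = X \<and> (X * 2 + \<beta>) mod 2 = \<beta>" for X using b2 by presburger
      then show "u div 2 = p * k + j" "u mod 2 = \<beta>" unfolding u_def by blast+
    qed
    have "u div 2 mod k = j" unfolding uparts using j by simp
    moreover have "u div (2 * k) = p" unfolding div_mult2_eq uparts using j by simp
    moreover have "u < nc"
    proof -
      have "u < (p * k + j + 1) * 2" unfolding u_def using b2 by simp
      also have "\<dots> \<le> ((p + 1) * k) * 2" using j by simp
      also have "\<dots> \<le> (r * k) * 2" using p by (intro mult_right_mono) auto
      finally show ?thesis by (simp add: nc_def algebra_simps)
    qed
    moreover from this have "u < 2 ^ (2 * lam)" using elements by linarith
    then obtain j' where j': "j' < k" "cov (X j') u" using cv by blast
    ultimately have "j' = j \<and> dig (adv (X j')) p 1 = \<beta> \<or> j' = j + 1 \<and> dig (adv (X j')) p 1 \<noteq> \<beta>"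
      using X[OF j'(1)] j uparts(2) unfolding cov_def by auto
    moreover have "dig (adv (X j)) p 1 \<noteq> \<beta>" using d2[of "adv (X j)"] unfolding \<beta>_def by linarith
    ultimately have "dig (adv (X (j + 1))) p 1 \<noteq> \<beta>" by blast
    then have "dig (adv (X j)) p 1 = dig (adv (X (j + 1))) p 1"
      using d2[of "adv (X j)"] d2[of "adv (X (j + 1))"] unfolding \<beta>_def by linarith
    then show "adv (X j) div 2 ^ p mod 2 = adv (X (j + 1)) div 2 ^ p mod 2" unfolding bit_eq[OF p2] .
  qed
  have adv: "adv (X j) = w" if "j < k" for j
    using that by (induction j) (use step w_def in auto)
  define a where "a v \<longleftrightarrow> dig (ass (X (v div b))) (v mod b) 1 = 1" for v
  have "\<exists>l\<in>A. a (l div 2) = odd l" if A: "A \<in> Cl" for A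
  proof -
    interpret bf: bounded_family "{..<2 * n}" d alp "fam w T" by (rule bounded_ok[OF ok_fam])
    have "A \<in> fam w T" using A evolve_superset unfolding fam_def by blast
    then obtain B where B: "B \<in> minimal_sets (fam w T)" "B \<subseteq> A" by (rule bf.ex_minimal)
    then have "B \<in> fam w T" using bf.minimal_sub by blast
    then obtain e where e: "e < T" "canon e" "lits e = B" using ex_canon[OF ok_fam] by blast
    have cme: "cm w e" using e B by (simp add: cm_def)
    obtain j where j: "j < k" "cov (X j) (nc + rk w e)" using cv[OF rk_less[OF cme]] by blast
    then have "satl (X j) e" using e(1) cme adv[OF j(1)] by (simp add: cov_def)
    then obtain l where l: "l \<in> lits e" "l div 2 div b = j" "dig (ass (X j)) (l div 2 mod b) 1 = l mod 2"
      using X[OF j(1)] by (auto simp: satl_def)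
    have "a (l div 2) = odd l" using l by (simp add: a_def odd_iff_mod_2_eq_one)
    then show ?thesis using l(1) e(3) B(2) by blast
  qed
  then show ?thesis by blast
qed

lemma sound:
  assumes C: "C \<subseteq> {..<NS}" "card C \<le> h" and cover: "\<And>c. c < NU \<Longrightarrow> \<exists>x\<in>C. edge x c"
  shows "\<exists>a. \<forall>A\<in>Cl. \<exists>l\<in>A. a (l div 2) = odd l"
proof (rule ccontr)
  assume unsat: "\<not> ?thesis"
  have fin: "finite C" using C(1) finite_subset by blast
  have C2: "x < 2 ^ (2 * b)" if "x \<in> C" for x
  proof -
    have "x < NS" using that C(1) by blast
    then show ?thesis using rows unfolding NS_eq by linarith
  qed
  have "1 \<le> 2 * b" using b_pos by simp
  from perfect_hashing[OF fin C2 this pos(4) C(2)] obtain cl p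
    where cp: "\<And>i. i < h \<Longrightarrow> cl i < h \<and> p i < 2 * b"
      and inj: "inj_on (\<lambda>x. split_class cl (\<lambda>i x. x div 2 ^ p i mod 2 = 1) x h) C" by metis
  define f where "f i = (if even i then cl (i div 2) else p (i div 2))" for i
  have f: "f i < 2 ^ lam" if "i < 2 * h" for i
  proof -
    have "cl (i div 2) < h" "p (i div 2) < 2 * b" using cp[of "i div 2"] that by auto
    then show ?thesis using hash_digits by (auto simp: f_def)
  qed
  obtain y where y: "y < (2 ^ lam) ^ (2 * h)" "\<And>i. i < 2 * h \<Longrightarrow> y div (2 ^ lam) ^ i mod 2 ^ lam = f i"
    using ex_digits[of "2 * h" f "2 ^ lam"] f by blast
  have ydig: "dig y (lam * i) lam = f i" if "i < 2 * h" for i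
  proof -
    have "lam * i \<le> 2 * lam * (h + h ^ k)" using that by (simp add: algebra_simps trans_le_add1)
    then have "lam * i \<le> 2 * b" using exps(3) by linarith
    then show ?thesis using y(2)[OF that] lam_le by (simp add: dig_def pw_eq power_mult)
  qed
  have hsy: "hs y x h = split_class cl (\<lambda>i x. x div 2 ^ p i mod 2 = 1) x h" for x
    unfolding hs_def
  proof (rule split_class_cong)
    fix i assume i: "i < h"
    show "dig y (lam * (2 * i)) lam = cl i" using ydig[of "2 * i"] i by (simp add: f_def)
    have "dig y (lam * (2 * i + 1)) lam = p i" using ydig[of "2 * i + 1"] i by (simp add: f_def)
    moreover have "p i \<le> 2 * b" using cp[OF i] by simp
    ultimately show "(dig x (dig y (lam * (2 * i + 1)) lam) 1 = 1) = (x div 2 ^ p i mod 2 = 1)"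
      by (simp only: bit_eq)
  qed
  have inj': "inj_on (\<lambda>x. hs y x h) C" using inj unfolding hsy .
  \<comment> \<open>The candidate from block \<open>j\<close> is the member of \<open>C\<close>
    whose class is the one that \<open>a\<close> prescribes, unique because the hash function is
    injective on \<open>C\<close>. If there is none, an arbitrary row of the block takes its place,
    so that \<open>base_sound\<close> applies for every \<open>a\<close>.\<close>
  define X where "X a j = (if \<exists>x\<in>C. blk x = j \<and> hs y x h = a div h ^ j mod h
    then (THE x. x \<in> C \<and> blk x = j \<and> hs y x h = a div h ^ j mod h) else (j * 2 ^ b + 0) * 2 ^ r + 0)" for a j
  have XC: "X a (blk x) = x" if "x \<in> C" "hs y x h = a div h ^ blk x mod h" for a x
  proof -
    have "(THE x'. x' \<in> C \<and> blk x' = blk x \<and> hs y x' h = a div h ^ blk x mod h) = x"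
    proof (rule the_equality)
      show "x \<in> C \<and> blk x = blk x \<and> hs y x h = a div h ^ blk x mod h" using that by simp
      fix x' assume x': "x' \<in> C \<and> blk x' = blk x \<and> hs y x' h = a div h ^ blk x mod h"
      then have "hs y x' h = hs y x h" using that by simp
      then show "x' = x" using inj_onD[OF inj'] x' that(1) by blast
    qed
    then show ?thesis using that unfolding X_def by auto
  qed
  have Xb: "blk (X a j) = j" for a j
  proof (cases "\<exists>x\<in>C. blk x = j \<and> hs y x h = a div h ^ j mod h")
    case True
    then obtain x where "x \<in> C" "blk x = j" "hs y x h = a div h ^ j mod h" by blast
    then show ?thesis using XC[of x a] by simp
  next
    case False
    show ?thesis unfolding X_def if_not_P[OF False] by (rule row_parts(1)) simp_all
  qed
  have "\<exists>u. u < 2 ^ (2 * lam) \<and> (\<forall>j<k. \<not> cov (X a j) u)" for a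
  proof (rule ccontr)
    assume "\<not> ?thesis"
    then have "\<exists>a. \<forall>A\<in>Cl. \<exists>l\<in>A. a (l div 2) = odd l" using Xb by (intro base_sound[of "X a"]) blast+
    then show False using unsat by blast
  qed
  then obtain u where u: "\<And>a. u a < 2 ^ (2 * lam)" "\<And>a j. j < k \<Longrightarrow> \<not> cov (X a j) (u a)" by metis
  obtain F where F: "F < (2 ^ (2 * lam)) ^ hk" "\<And>a. a < hk \<Longrightarrow> F div (2 ^ (2 * lam)) ^ a mod 2 ^ (2 * lam) = u a"
    using ex_digits[of hk u "2 ^ (2 * lam)"] u(1) by blast
  \<comment> \<open>The uncovered element: the seed in the high digits, above one uncovered base
    element for each \<open>a\<close>.\<close>
  define c where "c = y * (2 ^ (2 * lam)) ^ hk + F"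
  have ex: "2 * lam * hk + 2 * lam * h \<le> 2 * b" using exps(3) by (simp add: hk_eq algebra_simps)
  have y2: "y < 2 ^ (2 * lam * h)" using y(1) by (simp add: power_mult[symmetric] mult.commute mult.left_commute)
  have p2: "(2 ^ (2 * lam)) ^ hk = (2::nat) ^ (2 * lam * hk)" by (simp add: power_mult)
  have cy: "dig c (2 * lam * hk) (2 * lam * h) = y"
    using add_high_digit(1)[OF F(1), of y] y2 ex unfolding c_def p2 by (simp add: dig_def pw_eq)
  have cu: "dig c (2 * lam * a) (2 * lam) = u a" if a: "a < hk" for a
  proof -
    have "2 * lam * a \<le> 2 * lam * hk" using a by simp
    then have "2 * lam * a \<le> 2 * b" using ex by linarith
    then have "dig c (2 * lam * a) (2 * lam) = c div (2 ^ (2 * lam)) ^ a mod 2 ^ (2 * lam)"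
      using exps(4) by (simp add: dig_def pw_eq power_mult)
    then show ?thesis using add_high_digit(2)[OF F(1) a, of y] F(2)[OF a] unfolding c_def by simp
  qed
  have "c < NU"
  proof -
    have "c < (y + 1) * 2 ^ (2 * lam * hk)" using F(1) unfolding c_def p2 by simp
    also have "\<dots> \<le> 2 ^ (2 * lam * h) * 2 ^ (2 * lam * hk)" using y2 by (intro mult_right_mono) auto
    also have "\<dots> = 2 ^ (2 * lam * (h + hk))" by (simp add: power_add[symmetric] algebra_simps)
    also have "\<dots> = NU" using exps(3) by (simp add: NU_def pw_eq hk_eq)
    finally show ?thesis .
  qed
  then obtain x where x: "x \<in> C" "edge x c" using cover by blast
  then obtain a where a: "a < hk" "a div pt h (blk x) mod h = hs y x h" "cov x (u a)"
    unfolding edge_def cy using cu by auto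
  have "x < k * 2 ^ (b + r)" using x(1) C(1) unfolding NS_eq by blast
  then have bk: "blk x < k" unfolding blk_eq by (rule less_mult_imp_div_less)
  then have "hs y x h = a div h ^ blk x mod h" using a(2) by (simp add: pt_h)
  then have "X a (blk x) = x" using XC x(1) by blast
  then show False using u(2)[OF bk, of a] a(3) by simp
qed

end

section \<open>Structured programs\<close>

datatype com = Block "instr list" | Seq com com (infixr ";;" 60) | While nat com

fun len :: "com \<Rightarrow> nat" where
  "len (Block is) = length is"
| "len (c1 ;; c2) = len c1 + len c2"
| "len (While r c) = len c + 3"

text \<open>Register 1 is reserved for the unconditional jump at the entrance of a loop.\<close>

fun code :: "nat \<Rightarrow> com \<Rightarrow> program" where
  "code p (Block is) = is"
| "code p (c1 ;; c2) = code p c1 @ code (p + len c1) c2"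
| "code p (While r c) = [Const 1 1, Jpos 1 (p + 2 + len c)] @ code (p + 2) c @ [Jpos r (p + 2)]"

lemma length_code [simp]: "length (code p c) = len c"
  by (induction c arbitrary: p) auto

fun straight :: "instr \<Rightarrow> bool" where
  "straight (Jpos j l) = False"
| "straight _ = True"

definition located :: "program \<Rightarrow> nat \<Rightarrow> program \<Rightarrow> bool" where
  "located P p c \<longleftrightarrow> (\<exists>ys zs. P = ys @ c @ zs \<and> length ys = p)"

lemma located_append:
  "located P p (c @ c') \<longleftrightarrow> located P p c \<and> located P (p + length c) c'"
proof
  assume "located P p (c @ c')"
  then obtain ys zs where P: "P = ys @ (c @ c') @ zs" "length ys = p" by (auto simp: located_def)
  have "P = ys @ c @ (c' @ zs)" "P = (ys @ c) @ c' @ zs" "length (ys @ c) = p + length c" using P by auto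
  with P(2) show "located P p c \<and> located P (p + length c) c'" unfolding located_def by blast
next
  assume "located P p c \<and> located P (p + length c) c'"
  then obtain ys zs ys' zs' where P: "P = ys @ c @ zs" "length ys = p"
    and P': "P = ys' @ c' @ zs'" "length ys' = p + length c" unfolding located_def by metis
  have "take (p + length c) P = ys'" "take (p + length c) P = ys @ c"
    using P(2) P'(2) by (simp add: P'(1), simp add: P(1))
  then have "P = ys @ (c @ c') @ zs'" using P'(1) by simp
  then show "located P p (c @ c')" using P(2) unfolding located_def by blast
qed

lemma located_Cons: "located P p (i # c) \<longleftrightarrow> p < length P \<and> P ! p = i \<and> located P (Suc p) c"
proof -
  have "located P p [i] \<longleftrightarrow> p < length P \<and> P ! p = i"
  proof
    assume "located P p [i]"
    then show "p < length P \<and> P ! p = i" by (auto simp: located_def)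
  next
    assume "p < length P \<and> P ! p = i"
    then have "P = take p P @ [i] @ drop (Suc p) P" "length (take p P) = p"
      using id_take_nth_drop[of p P] by auto
    then show "located P p [i]" unfolding located_def by blast
  qed
  then show ?thesis using located_append[of P p "[i]" c] by simp
qed

fun run_block :: "instr list \<Rightarrow> memory \<Rightarrow> memory" where
  "run_block [] M = M"
| "run_block (i # is) M = run_block is (snd (step i (0, M)))"

fun cost_block :: "instr list \<Rightarrow> memory \<Rightarrow> nat" where
  "cost_block [] M = 0"
| "cost_block (i # is) M = cost i M + cost_block is (snd (step i (0, M)))"

text \<open>\<open>exec\<close> describes only runs up to halting, so a fragment is specified by how
  it prolongs any halting run that starts at its end.\<close>

definition runs :: "com \<Rightarrow> memory \<Rightarrow> nat \<Rightarrow> memory \<Rightarrow> bool" where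
  "runs c M t M' \<longleftrightarrow> (\<forall>P p s M''. located P p (code p c) \<longrightarrow>
     exec P (p + len c, M') s M'' \<longrightarrow> exec P (p, M) (t + s) M'')"

definition runs_within :: "com \<Rightarrow> memory \<Rightarrow> nat \<Rightarrow> memory \<Rightarrow> bool" where
  "runs_within c M T M' \<longleftrightarrow> (\<exists>t \<le> T. runs c M t M')"

lemma exec_Cons:
  assumes "P ! p = i" "p < length P" "exec P (step i (p, M)) s M''"
  shows "exec P (p, M) (cost i M + s) M''"
  using exec_step[of p P M s M''] assms by simp

lemma step_straight: "straight i \<Longrightarrow> step i (p, M) = (Suc p, snd (step i (0, M)))"
  by (cases i) auto

lemma runs_Block:
  assumes "list_all straight is"
  shows "runs (Block is) M (cost_block is M) (run_block is M)"
  using assms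
proof (induction "is" arbitrary: M)
  case Nil
  show ?case by (simp add: runs_def)
next
  case (Cons i "is")
  show ?case
    unfolding runs_def
  proof (intro allI impI)
    fix P p s M''
    assume l: "located P p (code p (Block (i # is)))"
      and e: "exec P (p + len (Block (i # is)), run_block (i # is) M) s M''"
    let ?M = "snd (step i (0, M))"
    have "exec P (Suc p, ?M) (cost_block is ?M + s) M''"
      using Cons.IH[of ?M] Cons.prems l e by (simp add: runs_def located_Cons)
    then have "exec P (p, M) (cost i M + (cost_block is ?M + s)) M''"
      using l Cons.prems by (intro exec_Cons) (auto simp: located_Cons step_straight[of i p M])
    then show "exec P (p, M) (cost_block (i # is) M + s) M''" by (simp add: add.assoc)
  qed
qed

lemma runs_Seq:
  assumes "runs c1 M t1 M1" "runs c2 M1 t2 M2"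
  shows "runs (c1 ;; c2) M (t1 + t2) M2"
  unfolding runs_def
proof (intro allI impI)
  fix P p s M''
  assume l: "located P p (code p (c1 ;; c2))" and e: "exec P (p + len (c1 ;; c2), M2) s M''"
  from l have l1: "located P p (code p c1)" and l2: "located P (p + len c1) (code (p + len c1) c2)"
    by (auto simp: located_append)
  have "exec P (p + len c1, M1) (t2 + s) M''"
    using assms(2) l2 e unfolding runs_def by (simp add: add.assoc)
  then show "exec P (p, M) (t1 + t2 + s) M''"
    using assms(1) l1 unfolding runs_def by (simp add: add.assoc)
qed

text \<open>An execution that starts at the test, which the code places behind the body.\<close>

inductive loop :: "nat \<Rightarrow> com \<Rightarrow> memory \<Rightarrow> nat \<Rightarrow> memory \<Rightarrow> bool" for r c where
  loop_stop: "M r = 0 \<Longrightarrow> loop r c M 1 M"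
| loop_go: "M r > 0 \<Longrightarrow> runs c M t M1 \<Longrightarrow> loop r c M1 t' M2 \<Longrightarrow>
    loop r c M (1 + blen (M r) + t + t') M2"

lemma blen_0 [simp]: "blen 0 = 0" and blen_1 [simp]: "blen (Suc 0) = 1" "blen 1 = 1"
  by (simp_all add: floorlog_def)

lemma blen_le: "blen x \<le> x"
proof (cases "x = 0")
  case False
  have "x < 2 ^ x" by (rule less_exp)
  then show ?thesis using floorlog_leI[of x 2 x] by simp
qed simp

lemma blen_double: "blen (x + x) \<le> Suc (blen x)"
proof -
  have "x < 2 ^ blen x" using floorlog_bounds[of x 2] by (cases "x = 0") auto
  then have "x + x < 2 ^ Suc (blen x)" by simp
  then show ?thesis by (intro floorlog_leI) auto
qed

lemma loop_exec:
  assumes "loop r c M t M'" "located P p (code p (While r c))" "exec P (p + len (While r c), M') s M''"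
  shows "exec P (p + 2 + len c, M) (t + s) M''"
  using assms
proof (induction)
  case (loop_stop M)
  have "P ! (p + 2 + len c) = Jpos r (p + 2)" "p + 2 + len c < length P"
    using loop_stop(2) by (auto simp: located_append located_Cons)
  then have "exec P (p + 2 + len c, M) (cost (Jpos r (p + 2)) M + s) M''"
    by (rule exec_Cons) (use loop_stop in \<open>simp add: algebra_simps numeral_eq_Suc\<close>)
  then show ?case using loop_stop by simp
next
  case (loop_go M t M1 t' M2)
  have j: "P ! (p + 2 + len c) = Jpos r (p + 2)" "p + 2 + len c < length P"
    and l: "located P (p + 2) (code (p + 2) c)"
    using loop_go.prems(1) by (auto simp: located_append located_Cons)
  have "exec P (p + 2, M) (t + (t' + s)) M''"
    using loop_go.IH[OF loop_go.prems] loop_go.hyps(2) l unfolding runs_def by blast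
  then have "exec P (p + 2 + len c, M) (cost (Jpos r (p + 2)) M + (t + (t' + s))) M''"
    by (intro exec_Cons[OF j]) (use loop_go.hyps in simp)
  then show ?case by (simp add: add.assoc)
qed

lemma runs_While:
  assumes "loop r c (M(1 := 1)) t M'"
  shows "runs (While r c) M (4 + t) M'"
  unfolding runs_def
proof (intro allI impI)
  fix P p s M''
  assume l: "located P p (code p (While r c))" and e: "exec P (p + len (While r c), M') s M''"
  have i: "P ! p = Const 1 1" "p < length P" "P ! Suc p = Jpos 1 (p + 2 + len c)" "Suc p < length P"
    using l by (auto simp: located_Cons)
  have "exec P (p + 2 + len c, M(1 := 1)) (t + s) M''" by (rule loop_exec[OF assms l e])
  then have "exec P (Suc p, M(1 := 1)) (cost (Jpos 1 (p + 2 + len c)) (M(1 := 1)) + (t + s)) M''"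
    by (intro exec_Cons[OF i(3,4)]) simp
  then have "exec P (p, M) (cost (Const 1 1) M + (cost (Jpos 1 (p + 2 + len c)) (M(1 := 1)) + (t + s))) M''"
    by (intro exec_Cons[OF i(1,2)]) simp
  moreover have "cost (Const 1 1) M + (cost (Jpos 1 (p + 2 + len c)) (M(1 := 1)) + (t + s)) = 4 + t + s" by simp
  ultimately show "exec P (p, M) (4 + t + s) M''" by metis
qed

lemma within_Block:
  assumes "list_all straight is" "cost_block is M \<le> T" "run_block is M = M'"
  shows "runs_within (Block is) M T M'"
  using assms runs_Block[of "is" M] by (auto simp: runs_within_def)

lemma within_Seq:
  assumes "runs_within c1 M T1 M1" "runs_within c2 M1 T2 M2" "T1 + T2 \<le> T"
  shows "runs_within (c1 ;; c2) M T M2"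
proof -
  from assms obtain t1 t2 where "t1 \<le> T1" "t2 \<le> T2" "runs c1 M t1 M1" "runs c2 M1 t2 M2"
    by (auto simp: runs_within_def)
  then show ?thesis using runs_Seq[of c1 M t1 M1 c2 t2 M2] assms(3)
    unfolding runs_within_def by (meson add_mono order_trans)
qed

lemma within_mono: "runs_within c M T M' \<Longrightarrow> T \<le> T' \<Longrightarrow> runs_within c M T' M'"
  unfolding runs_within_def by (meson order_trans)

text \<open>Entering costs 4 and the failing test 1. A succeeding test costs at most
  \<open>n + 1\<close>, as the bit length of the counter is at most its value.\<close>

lemma within_While:
  assumes init: "Q 0 (M(1 := 1))"
    and body: "\<And>i M. i < n \<Longrightarrow> Q i M \<Longrightarrow> \<exists>M'. runs_within c M T M' \<and> Q (Suc i) M'"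
    and reg: "\<And>i M. i \<le> n \<Longrightarrow> Q i M \<Longrightarrow> M r = n - i"
  shows "\<exists>M'. runs_within (While r c) M (5 + n * (T + n + 1)) M' \<and> Q n M'"
proof -
  have "\<exists>t M'. loop r c M t M' \<and> t \<le> 1 + (n - i) * (T + n + 1) \<and> Q n M'" if "Q i M" "i \<le> n" for i M
    using that
  proof (induction "n - i" arbitrary: i M)
    case 0
    then have "M r = 0" "i = n" using reg[of i M] by auto
    then show ?case using loop_stop[of M r c] 0 by auto
  next
    case (Suc m)
    then have i: "i < n" "M r = n - i" using reg[of i M] by auto
    obtain M1 t1 where 1: "runs c M t1 M1" "t1 \<le> T" "Q (Suc i) M1"
      using body[OF i(1) Suc.prems(1)] by (auto simp: runs_within_def)
    obtain t2 M2 where 2: "loop r c M1 t2 M2" "t2 \<le> 1 + (n - Suc i) * (T + n + 1)" "Q n M2"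
      using Suc.hyps(1)[OF _ 1(3)] Suc.hyps(2) i(1) by (metis Suc_leI Suc_diff_Suc Suc_inject)
    have l: "loop r c M (1 + blen (M r) + t1 + t2) M2"
      using loop_go[of M r c t1 M1 t2 M2] 1 2 i by simp
    have "n - i = Suc (n - Suc i)" using i by simp
    then have "(n - i) * (T + n + 1) = (T + n + 1) + (n - Suc i) * (T + n + 1)" by simp
    moreover have "blen (M r) \<le> n" using blen_le[of "M r"] i by simp
    ultimately have "1 + blen (M r) + t1 + t2 \<le> 1 + (n - i) * (T + n + 1)" using 1(2) 2(2) by linarith
    with l 2(3) show ?case by blast
  qed
  from this[of 0, OF init] obtain t M' where "loop r c (M(1 := 1)) t M'" "t \<le> 1 + n * (T + n + 1)" "Q n M'"
    by auto
  then show ?thesis using runs_While[of r c M t M'] unfolding runs_within_def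
    by (intro exI[of _ M']) (auto intro!: exI[of _ "4 + t"])
qed

section \<open>Polynomial bounds\<close>

text \<open>Arguments start at 2 so that constant factors can be absorbed into the exponent and a
  single number measures the growth.\<close>

definition poly_bounded :: "(nat \<Rightarrow> nat) \<Rightarrow> bool" where
  "poly_bounded T \<longleftrightarrow> (\<exists>q. \<forall>V \<ge> 2. T V \<le> V ^ q)"

lemma poly_bounded_const: "poly_bounded (\<lambda>_. c)"
proof -
  have "c \<le> V ^ c" if "V \<ge> 2" for V :: nat
    using less_exp[of c] power_mono[of 2 V c] that by linarith
  then show ?thesis unfolding poly_bounded_def by blast
qed

lemma poly_bounded_id: "poly_bounded (\<lambda>V. V)"
  unfolding poly_bounded_def by (rule exI[of _ 1]) simp

lemma poly_bounded_mult:
  assumes "poly_bounded S" "poly_bounded T" shows "poly_bounded (\<lambda>V. S V * T V)"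
proof -
  from assms obtain p q where "\<forall>V \<ge> 2. S V \<le> V ^ p" "\<forall>V \<ge> 2. T V \<le> V ^ q" by (auto simp: poly_bounded_def)
  then have "\<forall>V \<ge> 2. S V * T V \<le> V ^ (p + q)" by (simp add: power_add mult_mono)
  then show ?thesis unfolding poly_bounded_def by blast
qed

lemma poly_bounded_add:
  assumes "poly_bounded S" "poly_bounded T" shows "poly_bounded (\<lambda>V. S V + T V)"
proof -
  from assms obtain p q where pq: "\<forall>V \<ge> 2. S V \<le> V ^ p" "\<forall>V \<ge> 2. T V \<le> V ^ q" by (auto simp: poly_bounded_def)
  have "S V + T V \<le> V ^ Suc (p + q)" if V: "V \<ge> 2" for V
  proof -
    have "V ^ p \<le> V ^ (p + q)" "V ^ q \<le> V ^ (p + q)" using V by (auto intro!: power_increasing)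
    moreover have "S V \<le> V ^ p" "T V \<le> V ^ q" using pq V by auto
    ultimately have "S V + T V \<le> 2 * V ^ (p + q)" by linarith
    also have "\<dots> \<le> V ^ Suc (p + q)" using V by simp
    finally show ?thesis .
  qed
  then show ?thesis unfolding poly_bounded_def by blast
qed

lemma poly_bounded_power:
  assumes "poly_bounded T" shows "poly_bounded (\<lambda>V. T V ^ n)"
  by (induction n) (use poly_bounded_const[of 1] poly_bounded_mult[OF assms] in auto)

lemmas poly_bounded_intros =
  poly_bounded_const poly_bounded_id poly_bounded_mult poly_bounded_add poly_bounded_power

section \<open>Expressions with bounded sums\<close>

text \<open>Bounded sums express products, quotients, bounded quantifiers and cardinalities, yet
  every expression remains computable in polynomial time with an exponent read off from its
  text.\<close>

datatype exp = N nat | V nat | Rd nat exp | Pl exp exp | Mi exp exp | Sm nat exp exp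

type_synonym arrays = "nat \<Rightarrow> nat \<Rightarrow> nat"

fun eval :: "exp \<Rightarrow> (nat \<Rightarrow> nat) \<Rightarrow> arrays \<Rightarrow> nat" where
  "eval (N c) \<sigma> S = c"
| "eval (V x) \<sigma> S = \<sigma> x"
| "eval (Rd a e) \<sigma> S = S a (eval e \<sigma> S)"
| "eval (Pl e1 e2) \<sigma> S = eval e1 \<sigma> S + eval e2 \<sigma> S"
| "eval (Mi e1 e2) \<sigma> S = eval e1 \<sigma> S - eval e2 \<sigma> S"
| "eval (Sm x e1 e2) \<sigma> S = (\<Sum>z<eval e1 \<sigma> S. eval e2 (\<sigma>(x := z)) S)"

text \<open>
  The memory holds 32 interleaved arrays: entry \<open>x\<close> of array \<open>a\<close> is at address \<open>32 * x + a\<close>.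
  Array 2 holds variables and array 3 intermediate results.
\<close>

definition va :: "nat \<Rightarrow> nat" where "va x = 32 * x + 2"
definition tm :: "nat \<Rightarrow> nat" where "tm k = 32 * k + 3"
definition user :: "nat \<Rightarrow> bool" where "user a \<longleftrightarrow> a < 32 \<and> a \<noteq> 1 \<and> a \<noteq> 2 \<and> a \<noteq> 3"
text \<open>The arrays used for scratch read as zero, so that updates of register 1, of variables
  and of intermediate results leave \<open>arr M\<close> unchanged.\<close>

definition arr :: "memory \<Rightarrow> arrays" where "arr M a x = (if user a then M (32 * x + a) else 0)"
definition vars :: "memory \<Rightarrow> nat \<Rightarrow> nat" where "vars M x = M (va x)"

lemma addr_simps [simp]:
  "va x = va y \<longleftrightarrow> x = y" "tm x = tm y \<longleftrightarrow> x = y" "va x \<noteq> tm y" "tm y \<noteq> va x"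
  "va x \<noteq> Suc 0" "tm x \<noteq> Suc 0" "Suc 0 \<noteq> va x" "Suc 0 \<noteq> tm x"
  unfolding va_def tm_def by presburger+

lemma arr_upd [simp]:
  "arr (M(va x := v)) = arr M" "arr (M(tm x := v)) = arr M" "arr (M(Suc 0 := v)) = arr M"
proof -
  have *: "32 * y + a \<noteq> 32 * x + 2" "32 * y + a \<noteq> 32 * x + 3" "32 * y + a \<noteq> Suc 0" if "user a" for y a x
    using that unfolding user_def by presburger+
  show "arr (M(va x := v)) = arr M" "arr (M(tm x := v)) = arr M" "arr (M(Suc 0 := v)) = arr M"
    using * by (auto simp: arr_def va_def tm_def fun_eq_iff)
qed

lemma arr_upd_user:
  assumes "user a" shows "arr (M(32 * x + a := v)) = (arr M)(a := (arr M a)(x := v))"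
proof -
  have "32 * y + b = 32 * x + a \<longleftrightarrow> y = x \<and> b = a" if "user b" for y b
  proof -
    have "a < 32" "b < 32" using that assms by (auto simp: user_def)
    then have "(32 * y + b) div 32 = y" "(32 * y + b) mod 32 = b"
      "(32 * x + a) div 32 = x" "(32 * x + a) mod 32 = a" by auto
    then show ?thesis by metis
  qed
  then show ?thesis using assms by (auto simp: arr_def fun_eq_iff)
qed

lemma vars_upd [simp]:
  "vars (M(va x := v)) = (vars M)(x := v)" "vars (M(tm x := v)) = vars M" "vars (M(Suc 0 := v)) = vars M"
  by (auto simp: vars_def fun_eq_iff)

lemma upd_user:
  assumes "user a"
  shows "vars (M(32 * x + a := v)) = vars M" "(M(32 * x + a := v)) (tm k) = M (tm k)" "(M(32 * x + a := v)) (va k) = M (va k)"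
proof -
  have "32 * y + 2 \<noteq> 32 * x + a" "32 * y + 3 \<noteq> 32 * x + a" for y
    using assms unfolding user_def by presburger+
  then show "vars (M(32 * x + a := v)) = vars M" "(M(32 * x + a := v)) (tm k) = M (tm k)"
    "(M(32 * x + a := v)) (va k) = M (va k)"
    unfolding vars_def va_def tm_def by (auto simp: fun_eq_iff) 
qed

definition move :: "nat \<Rightarrow> nat \<Rightarrow> instr list" where
  "move i j = [Const i 0, Add i i j]"

definition times32 :: "nat \<Rightarrow> instr list" where
  "times32 i = [Add i i i, Add i i i, Add i i i, Add i i i, Add i i i]"

lemma run_block_append: "run_block (xs @ ys) M = run_block ys (run_block xs M)"
  and cost_block_append: "cost_block (xs @ ys) M = cost_block xs M + cost_block ys (run_block xs M)"
  by (induction xs arbitrary: M) auto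

lemma times32_straight [simp]: "list_all straight (times32 i)"
  by (simp add: times32_def)

lemma run_times32: "run_block (times32 i) M = M(i := 32 * M i)"
proof -
  have "run_block (times32 i) M = M(i := ((((M i + M i) + (M i + M i)) + ((M i + M i) + (M i + M i))) +
    (((M i + M i) + (M i + M i)) + ((M i + M i) + (M i + M i)))) +
    ((((M i + M i) + (M i + M i)) + ((M i + M i) + (M i + M i))) +
    (((M i + M i) + (M i + M i)) + ((M i + M i) + (M i + M i)))))"
    by (simp add: times32_def)
  also have "\<dots> = M(i := 32 * M i)" by (rule arg_cong[where f = "\<lambda>v. M(i := v)"]) linarith
  finally show ?thesis .
qed

lemma cost_times32: "cost_block (times32 i) M \<le> 25 + 10 * blen (M i)"
proof -
  define M1 where "M1 = M(i := M i + M i)"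
  define M2 where "M2 = M1(i := M1 i + M1 i)"
  define M3 where "M3 = M2(i := M2 i + M2 i)"
  define M4 where "M4 = M3(i := M3 i + M3 i)"
  have "cost_block (times32 i) M = 5 + 2 * (blen (M i) + blen (M1 i) + blen (M2 i) + blen (M3 i) + blen (M4 i))"
    by (simp add: times32_def M1_def M2_def M3_def M4_def)
  moreover have "blen (M1 i) \<le> Suc (blen (M i))" "blen (M2 i) \<le> Suc (blen (M1 i))"
    "blen (M3 i) \<le> Suc (blen (M2 i))" "blen (M4 i) \<le> Suc (blen (M3 i))"
    unfolding M4_def M3_def M2_def M1_def by (simp_all only: fun_upd_same blen_double)
  ultimately show ?thesis by (simp add: algebra_simps)
qed

text \<open>The result goes to \<open>tm k\<close>, and intermediate results below \<open>k\<close>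
  survive. In a sum, \<open>tm k\<close> counts the remaining rounds, \<open>tm (k + 1)\<close>
  saves the old value of the bound variable and \<open>tm (k + 2)\<close> accumulates.\<close>

fun compile :: "exp \<Rightarrow> nat \<Rightarrow> com" where
  "compile (N c) k = Block [Const (tm k) c]"
| "compile (V x) k = Block (move (tm k) (va x))"
| "compile (Rd a e) k = compile e k ;; Block (if user a
     then times32 (tm k) @ [Const (tm (k + 1)) a, Add (tm k) (tm k) (tm (k + 1)), Load (tm k) (tm k)]
     else [Const (tm k) 0])"
| "compile (Pl e1 e2) k = compile e1 k ;; compile e2 (k + 1) ;; Block [Add (tm k) (tm k) (tm (k + 1))]"
| "compile (Mi e1 e2) k = compile e1 k ;; compile e2 (k + 1) ;; Block [Sub (tm k) (tm k) (tm (k + 1))]"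
| "compile (Sm x e1 e2) k =
     compile e1 k ;;
     Block (move (tm (k + 1)) (va x) @ [Const (tm (k + 2)) 0, Const (va x) 0]) ;;
     While (tm k) (compile e2 (k + 3) ;;
       Block [Add (tm (k + 2)) (tm (k + 2)) (tm (k + 3)), Const (tm (k + 3)) 1,
         Add (va x) (va x) (tm (k + 3)), Sub (tm k) (tm k) (tm (k + 3))]) ;;
     Block (move (va x) (tm (k + 1)) @ move (tm k) (tm (k + 2)))"

definition bounded_mem :: "nat \<Rightarrow> memory \<Rightarrow> bool" where
  "bounded_mem b M \<longleftrightarrow> (\<forall>x. vars M x \<le> b) \<and> (\<forall>a x. arr M a x \<le> b)"

text \<open>In a sum the bound variable can exceed \<open>b\<close>. The summand is therefore
  estimated with \<open>b ^ Suc p1\<close> in the role of \<open>b\<close>, a number that is at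
  least \<open>b\<close>, \<open>b ^ p1\<close> and 2; the exponents compose to
  \<open>p1 + Suc p1 * p2\<close>.\<close>

lemma eval_bounded:
  "\<exists>p. \<forall>(b::nat) \<sigma> S. 2 \<le> b \<longrightarrow> (\<forall>x. \<sigma> x \<le> b) \<longrightarrow> (\<forall>a x. S a x \<le> b) \<longrightarrow> eval e \<sigma> S \<le> b ^ p"
proof (induction e)
  case (N c)
  have "c \<le> b ^ c" if "2 \<le> b" for b :: nat
    using less_exp[of c] power_mono[of 2 b c] that by linarith
  then show ?case by (intro exI[of _ c]) auto
next
  case (V x)
  show ?case by (rule exI[of _ 1]) simp
next
  case (Rd a e)
  show ?case by (rule exI[of _ 1]) simp
next
  case (Pl e1 e2)
  then obtain p1 p2 where p: "\<And>b \<sigma> S. 2 \<le> b \<Longrightarrow> (\<forall>x. \<sigma> x \<le> b) \<Longrightarrow> (\<forall>a x. S a x \<le> b) \<Longrightarrow>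
    eval e1 \<sigma> S \<le> b ^ p1 \<and> eval e2 \<sigma> S \<le> b ^ p2" by metis
  have "poly_bounded (\<lambda>b. b ^ p1 + b ^ p2 :: nat)" by (intro poly_bounded_intros)
  then obtain q where "\<And>b :: nat. b \<ge> 2 \<Longrightarrow> b ^ p1 + b ^ p2 \<le> b ^ q" unfolding poly_bounded_def by blast
  moreover have "eval (Pl e1 e2) \<sigma> S \<le> b ^ p1 + b ^ p2"
    if "2 \<le> b" "\<forall>x. \<sigma> x \<le> b" "\<forall>a x. S a x \<le> b" for b \<sigma> S
    using p[OF that] by simp
  ultimately show ?case using order_trans by meson
next
  case (Mi e1 e2)
  then obtain p where p: "\<And>(b::nat) \<sigma> S. 2 \<le> b \<Longrightarrow> (\<forall>x. \<sigma> x \<le> b) \<Longrightarrow> (\<forall>a x. S a x \<le> b) \<Longrightarrow> eval e1 \<sigma> S \<le> b ^ p"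
    by metis
  have "eval (Mi e1 e2) \<sigma> S \<le> b ^ p" if "2 \<le> b" "\<forall>x. \<sigma> x \<le> b" "\<forall>a x. S a x \<le> b" for b \<sigma> S
    using p[OF that] by simp
  then show ?case by blast
next
  case (Sm x e1 e2)
  then obtain p1 p2 where p1: "\<And>b \<sigma> S. 2 \<le> b \<Longrightarrow> (\<forall>x. \<sigma> x \<le> b) \<Longrightarrow> (\<forall>a x. S a x \<le> b) \<Longrightarrow> eval e1 \<sigma> S \<le> b ^ p1"
    and p2: "\<And>b \<sigma> S. 2 \<le> b \<Longrightarrow> (\<forall>x. \<sigma> x \<le> b) \<Longrightarrow> (\<forall>a x. S a x \<le> b) \<Longrightarrow> eval e2 \<sigma> S \<le> b ^ p2" by metis
  have "eval (Sm x e1 e2) \<sigma> S \<le> b ^ (p1 + Suc p1 * p2)"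
    if b: "2 \<le> b" "\<forall>x. \<sigma> x \<le> b" "\<forall>a x. S a x \<le> b" for b \<sigma> S
  proof -
    have le: "b ^ p1 \<le> b ^ Suc p1" "b \<le> b ^ Suc p1" "2 \<le> b ^ Suc p1"
      using b(1) self_le_power[of b "Suc p1"] by (auto intro: power_increasing simp del: power_Suc)
    have "eval e2 (\<sigma>(x := z)) S \<le> (b ^ Suc p1) ^ p2" if "z < eval e1 \<sigma> S" for z
    proof (rule p2[OF le(3)])
      have "z \<le> b ^ Suc p1" using that p1[OF b] le(1) by linarith
      then show "\<forall>y. (\<sigma>(x := z)) y \<le> b ^ Suc p1" using b(2) le(2) order_trans by (auto simp del: power_Suc)
      show "\<forall>a x. S a x \<le> b ^ Suc p1" using b(3) le(2) order_trans by blast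
    qed
    then have "eval (Sm x e1 e2) \<sigma> S \<le> (\<Sum>z<eval e1 \<sigma> S. (b ^ Suc p1) ^ p2)"
      unfolding eval.simps by (intro sum_mono) simp
    also have "\<dots> \<le> b ^ p1 * (b ^ Suc p1) ^ p2" using p1[OF b] by (simp del: power_Suc)
    also have "\<dots> = b ^ (p1 + Suc p1 * p2)" by (simp only: power_add power_mult)
    finally show ?thesis .
  qed
  then show ?case by blast
qed


lemma bounded_mem_upd:
  assumes "bounded_mem b M" "b \<le> B" "i \<le> B" "arr M' = arr M" "vars M' = (vars M)(x := i)"
  shows "bounded_mem B M'"
proof -
  have "vars M y \<le> B" "arr M a y \<le> B" for a y
    using assms(1,2) unfolding bounded_mem_def by (meson order_trans)+
  then show ?thesis using assms(3-5) by (simp add: bounded_mem_def)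
qed

definition preserved :: "nat \<Rightarrow> memory \<Rightarrow> memory \<Rightarrow> bool" where
  "preserved k M M' \<longleftrightarrow> arr M' = arr M \<and> vars M' = vars M \<and> (\<forall>j<k. M' (tm j) = M (tm j))"

text \<open>The exponent is fixed before the memory, its bound and the position \<open>k\<close>.
  This uniformity later allows it to be fixed before \<open>d\<close> and \<open>k\<close> of the
  reduction.\<close>

lemma compile_correct:
  "\<exists>q. \<forall>b M k. 2 \<le> b \<longrightarrow> bounded_mem b M \<longrightarrow>
    (\<exists>M'. runs_within (compile e k) M (b ^ q) M' \<and> preserved k M M' \<and> M' (tm k) = eval e (vars M) (arr M))"
proof (induction e)
  case (N c)
  have "poly_bounded (\<lambda>b. 1 + c)" by (intro poly_bounded_intros)
  then obtain q where q: "\<And>b :: nat. b \<ge> 2 \<Longrightarrow> 1 + c \<le> b ^ q" unfolding poly_bounded_def by blast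
  have "runs_within (compile (N c) k) M (b ^ q) (M(tm k := c)) \<and> preserved k M (M(tm k := c))" if "2 \<le> b" for b M k
    using q[OF that] blen_le[of c] by (simp add: within_Block preserved_def)
  then show ?case by (intro exI[of _ q] allI impI) (metis eval.simps(1) fun_upd_same)
next
  case (V x)
  have "poly_bounded (\<lambda>b. 2 + b)" by (intro poly_bounded_intros)
  then obtain q where q: "\<And>b :: nat. b \<ge> 2 \<Longrightarrow> 2 + b \<le> b ^ q" unfolding poly_bounded_def by blast
  have "runs_within (compile (V x) k) M (b ^ q) (M(tm k := vars M x)) \<and> preserved k M (M(tm k := vars M x))"
    if b: "2 \<le> b" "bounded_mem b M" for b M k
  proof -
    have "blen (M (va x)) \<le> b" using b(2) blen_le[of "M (va x)"] order_trans
      unfolding bounded_mem_def vars_def by blast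
    then show ?thesis using q[OF b(1)] by (simp add: within_Block move_def preserved_def vars_def[of M])
  qed
  then show ?case by (intro exI[of _ q] allI impI) (metis eval.simps(2) fun_upd_same)
next
  case (Rd a e)
  then obtain q1 where q1: "\<And>b M k. 2 \<le> b \<Longrightarrow> bounded_mem b M \<Longrightarrow>
    \<exists>M'. runs_within (compile e k) M (b ^ q1) M' \<and> preserved k M M' \<and> M' (tm k) = eval e (vars M) (arr M)" by metis
  obtain p where p: "\<And>(b::nat) \<sigma> S. 2 \<le> b \<Longrightarrow> (\<forall>x. \<sigma> x \<le> b) \<Longrightarrow> (\<forall>a x. S a x \<le> b) \<Longrightarrow> eval e \<sigma> S \<le> b ^ p"
    using eval_bounded[of e] by metis
  have "poly_bounded (\<lambda>b. b ^ q1 + (28 + 3 * a + 130 * b ^ p + b))" by (intro poly_bounded_intros)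
  then obtain q where q: "\<And>b :: nat. b \<ge> 2 \<Longrightarrow> b ^ q1 + (28 + 3 * a + 130 * b ^ p + b) \<le> b ^ q" unfolding poly_bounded_def by blast
  have "\<exists>M'. runs_within (compile (Rd a e) k) M (b ^ q) M' \<and> preserved k M M' \<and> M' (tm k) = eval (Rd a e) (vars M) (arr M)"
    if b: "2 \<le> b" "bounded_mem b M" for b M k
  proof -
    obtain M1 where M1: "runs_within (compile e k) M (b ^ q1) M1" "preserved k M M1" "M1 (tm k) = eval e (vars M) (arr M)"
      using q1[OF b] by blast
    let ?v = "eval e (vars M) (arr M)"
    have v: "?v \<le> b ^ p" using p[OF b(1)] b(2) by (auto simp: bounded_mem_def)
    show ?thesis
    proof (cases "user a")
      case False
      have "runs_within (Block [Const (tm k) 0]) M1 1 (M1(tm k := 0))" by (simp add: within_Block)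
      then have "runs_within (compile (Rd a e) k) M (b ^ q) (M1(tm k := 0))"
        using False M1(1) q[OF b(1)] by (simp add: within_Seq)
      then show ?thesis using M1(2) False by (intro exI[of _ "M1(tm k := 0)"]) (auto simp: preserved_def arr_def)
    next
      case True
      let ?M2 = "M1(tm (k + 1) := a, tm k := arr M a ?v)"
      let ?c = "times32 (tm k) @ [Const (tm (k + 1)) a, Add (tm k) (tm k) (tm (k + 1)), Load (tm k) (tm k)]"
      have rd: "M1 (32 * ?v + a) = arr M a ?v" "32 * ?v + a \<noteq> tm k" "32 * ?v + a \<noteq> tm (k + 1)"
      proof -
        have "arr M1 a ?v = arr M a ?v" using M1(2) by (simp add: preserved_def)
        then show "M1 (32 * ?v + a) = arr M a ?v" using True by (simp add: arr_def[of M1])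
        show "32 * ?v + a \<noteq> tm k" "32 * ?v + a \<noteq> tm (k + 1)"
          using True unfolding user_def tm_def by presburger+
      qed
      have "runs_within (Block ?c) M1 (28 + 3 * a + 130 * b ^ p + b) ?M2"
      proof (rule within_Block)
        show "list_all straight ?c" by (simp add: times32_def)
        show "run_block ?c M1 = ?M2"
          using M1(3) rd by (simp add: run_block_append run_times32 fun_eq_iff)
        have "arr M a ?v \<le> b" using b(2) by (simp add: bounded_mem_def)
        then have bl: "blen (arr M a ?v) \<le> b" using blen_le[of "arr M a ?v"] by linarith
        have "cost_block ?c M1 = cost_block (times32 (tm k)) M1
            + (1 + blen a) + (1 + blen (32 * ?v) + blen a) + (1 + blen (32 * ?v + a) + blen (arr M a ?v))"
          using M1(3) rd by (simp add: cost_block_append run_times32)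
        also have "\<dots> \<le> 28 + 3 * a + 74 * ?v + b"
          using bl cost_times32[of "tm k" M1, unfolded M1(3)] blen_le[of ?v]
            blen_le[of "32 * ?v"] blen_le[of a] blen_le[of "32 * ?v + a"] by linarith
        finally show "cost_block ?c M1 \<le> 28 + 3 * a + 130 * b ^ p + b" using v by linarith
      qed
      then have "runs_within (compile (Rd a e) k) M (b ^ q) ?M2"
        using True M1(1) q[OF b(1)] by (simp add: within_Seq)
      then show ?thesis using M1(2) by (intro exI[of _ ?M2]) (auto simp: preserved_def)
    qed
  qed
  then show ?case by blast
next
  case (Pl e1 e2)
  then obtain q1 q2 where q1: "\<And>b M k. 2 \<le> b \<Longrightarrow> bounded_mem b M \<Longrightarrow>
      \<exists>M'. runs_within (compile e1 k) M (b ^ q1) M' \<and> preserved k M M' \<and> M' (tm k) = eval e1 (vars M) (arr M)"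
    and q2: "\<And>b M k. 2 \<le> b \<Longrightarrow> bounded_mem b M \<Longrightarrow>
      \<exists>M'. runs_within (compile e2 k) M (b ^ q2) M' \<and> preserved k M M' \<and> M' (tm k) = eval e2 (vars M) (arr M)" by metis
  obtain p1 where p1: "\<And>(b::nat) \<sigma> S. 2 \<le> b \<Longrightarrow> (\<forall>x. \<sigma> x \<le> b) \<Longrightarrow> (\<forall>a x. S a x \<le> b) \<Longrightarrow> eval e1 \<sigma> S \<le> b ^ p1"
    using eval_bounded[of e1] by metis
  obtain p2 where p2: "\<And>(b::nat) \<sigma> S. 2 \<le> b \<Longrightarrow> (\<forall>x. \<sigma> x \<le> b) \<Longrightarrow> (\<forall>a x. S a x \<le> b) \<Longrightarrow> eval e2 \<sigma> S \<le> b ^ p2"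
    using eval_bounded[of e2] by metis
  have "poly_bounded (\<lambda>b. b ^ q1 + (b ^ q2 + (1 + b ^ p1 + b ^ p2)))" by (intro poly_bounded_intros)
  then obtain q where q: "\<And>b :: nat. b \<ge> 2 \<Longrightarrow> b ^ q1 + (b ^ q2 + (1 + b ^ p1 + b ^ p2)) \<le> b ^ q" unfolding poly_bounded_def by blast
  have "\<exists>M'. runs_within (compile (Pl e1 e2) k) M (b ^ q) M' \<and> preserved k M M' \<and> M' (tm k) = eval (Pl e1 e2) (vars M) (arr M)"
    if b: "2 \<le> b" "bounded_mem b M" for b M k
  proof -
    obtain M1 where M1: "runs_within (compile e1 k) M (b ^ q1) M1" "preserved k M M1" "M1 (tm k) = eval e1 (vars M) (arr M)"
      using q1[OF b] by blast
    have b1: "bounded_mem b M1" using b(2) M1(2) by (simp add: bounded_mem_def preserved_def)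
    obtain M2 where M2: "runs_within (compile e2 (k + 1)) M1 (b ^ q2) M2" "preserved (k + 1) M1 M2"
      "M2 (tm (k + 1)) = eval e2 (vars M1) (arr M1)"
      using q2[OF b(1) b1] by blast
    let ?v = "eval e1 (vars M) (arr M)" and ?w = "eval e2 (vars M) (arr M)"
    have v: "?v \<le> b ^ p1" "?w \<le> b ^ p2" using p1[OF b(1)] p2[OF b(1)] b(2) by (auto simp: bounded_mem_def)
    have m: "M2 (tm k) = ?v" "M2 (tm (k + 1)) = ?w" using M1 M2 by (auto simp: preserved_def)
    have "runs_within (Block [Add (tm k) (tm k) (tm (k + 1))]) M2 (1 + b ^ p1 + b ^ p2) (M2(tm k := ?v + ?w))"
      using m v blen_le[of ?v] blen_le[of ?w] by (intro within_Block) auto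
    with M2(1) have "runs_within (compile e2 (k + 1) ;; Block [Add (tm k) (tm k) (tm (k + 1))]) M1
        (b ^ q2 + (1 + b ^ p1 + b ^ p2)) (M2(tm k := ?v + ?w))" by (rule within_Seq) simp
    with M1(1) have "runs_within (compile (Pl e1 e2) k) M (b ^ q) (M2(tm k := ?v + ?w))"
      unfolding compile.simps by (rule within_Seq) (rule q[OF b(1)])
    then show ?thesis using M1(2) M2(2) by (intro exI[of _ "M2(tm k := ?v + ?w)"]) (auto simp: preserved_def)
  qed
  then show ?case by blast
next
  case (Mi e1 e2)
  then obtain q1 q2 where q1: "\<And>b M k. 2 \<le> b \<Longrightarrow> bounded_mem b M \<Longrightarrow>
      \<exists>M'. runs_within (compile e1 k) M (b ^ q1) M' \<and> preserved k M M' \<and> M' (tm k) = eval e1 (vars M) (arr M)"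
    and q2: "\<And>b M k. 2 \<le> b \<Longrightarrow> bounded_mem b M \<Longrightarrow>
      \<exists>M'. runs_within (compile e2 k) M (b ^ q2) M' \<and> preserved k M M' \<and> M' (tm k) = eval e2 (vars M) (arr M)" by metis
  obtain p1 where p1: "\<And>(b::nat) \<sigma> S. 2 \<le> b \<Longrightarrow> (\<forall>x. \<sigma> x \<le> b) \<Longrightarrow> (\<forall>a x. S a x \<le> b) \<Longrightarrow> eval e1 \<sigma> S \<le> b ^ p1"
    using eval_bounded[of e1] by metis
  obtain p2 where p2: "\<And>(b::nat) \<sigma> S. 2 \<le> b \<Longrightarrow> (\<forall>x. \<sigma> x \<le> b) \<Longrightarrow> (\<forall>a x. S a x \<le> b) \<Longrightarrow> eval e2 \<sigma> S \<le> b ^ p2"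
    using eval_bounded[of e2] by metis
  have "poly_bounded (\<lambda>b. b ^ q1 + (b ^ q2 + (1 + b ^ p1 + b ^ p2)))" by (intro poly_bounded_intros)
  then obtain q where q: "\<And>b :: nat. b \<ge> 2 \<Longrightarrow> b ^ q1 + (b ^ q2 + (1 + b ^ p1 + b ^ p2)) \<le> b ^ q" unfolding poly_bounded_def by blast
  have "\<exists>M'. runs_within (compile (Mi e1 e2) k) M (b ^ q) M' \<and> preserved k M M' \<and> M' (tm k) = eval (Mi e1 e2) (vars M) (arr M)"
    if b: "2 \<le> b" "bounded_mem b M" for b M k
  proof -
    obtain M1 where M1: "runs_within (compile e1 k) M (b ^ q1) M1" "preserved k M M1" "M1 (tm k) = eval e1 (vars M) (arr M)"
      using q1[OF b] by blast
    have b1: "bounded_mem b M1" using b(2) M1(2) by (simp add: bounded_mem_def preserved_def)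
    obtain M2 where M2: "runs_within (compile e2 (k + 1)) M1 (b ^ q2) M2" "preserved (k + 1) M1 M2"
      "M2 (tm (k + 1)) = eval e2 (vars M1) (arr M1)"
      using q2[OF b(1) b1] by blast
    let ?v = "eval e1 (vars M) (arr M)" and ?w = "eval e2 (vars M) (arr M)"
    have v: "?v \<le> b ^ p1" "?w \<le> b ^ p2" using p1[OF b(1)] p2[OF b(1)] b(2) by (auto simp: bounded_mem_def)
    have m: "M2 (tm k) = ?v" "M2 (tm (k + 1)) = ?w" using M1 M2 by (auto simp: preserved_def)
    have "runs_within (Block [Sub (tm k) (tm k) (tm (k + 1))]) M2 (1 + b ^ p1 + b ^ p2) (M2(tm k := ?v - ?w))"
      using m v blen_le[of ?v] blen_le[of ?w] by (intro within_Block) auto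
    with M2(1) have "runs_within (compile e2 (k + 1) ;; Block [Sub (tm k) (tm k) (tm (k + 1))]) M1
        (b ^ q2 + (1 + b ^ p1 + b ^ p2)) (M2(tm k := ?v - ?w))" by (rule within_Seq) simp
    with M1(1) have "runs_within (compile (Mi e1 e2) k) M (b ^ q) (M2(tm k := ?v - ?w))"
      unfolding compile.simps by (rule within_Seq) (rule q[OF b(1)])
    then show ?thesis using M1(2) M2(2) by (intro exI[of _ "M2(tm k := ?v - ?w)"]) (auto simp: preserved_def)
  qed
  then show ?case by blast
next
  case (Sm x e1 e2)
  then obtain q1 q2 where q1: "\<And>b M k. 2 \<le> b \<Longrightarrow> bounded_mem b M \<Longrightarrow>
      \<exists>M'. runs_within (compile e1 k) M (b ^ q1) M' \<and> preserved k M M' \<and> M' (tm k) = eval e1 (vars M) (arr M)"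
    and q2: "\<And>b M k. 2 \<le> b \<Longrightarrow> bounded_mem b M \<Longrightarrow>
      \<exists>M'. runs_within (compile e2 k) M (b ^ q2) M' \<and> preserved k M M' \<and> M' (tm k) = eval e2 (vars M) (arr M)" by metis
  obtain p1 where p1: "\<And>(b::nat) \<sigma> S. 2 \<le> b \<Longrightarrow> (\<forall>x. \<sigma> x \<le> b) \<Longrightarrow> (\<forall>a x. S a x \<le> b) \<Longrightarrow> eval e1 \<sigma> S \<le> b ^ p1"
    using eval_bounded[of e1] by metis
  obtain p2 where p2: "\<And>(b::nat) \<sigma> S. 2 \<le> b \<Longrightarrow> (\<forall>x. \<sigma> x \<le> b) \<Longrightarrow> (\<forall>a x. S a x \<le> b) \<Longrightarrow> eval e2 \<sigma> S \<le> b ^ p2"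
    using eval_bounded[of e2] by metis
  \<comment> \<open>One round: the summand, run on a memory bounded by \<open>b ^ Suc p1\<close>,
    followed by four instructions on the partial sum, the summand, the variable and the
    counter.\<close>
  define T where "T b = (b ^ Suc p1) ^ q2 + (7 + b ^ p1 * (b ^ Suc p1) ^ p2 + (b ^ Suc p1) ^ p2 + 2 * b ^ p1)" for b :: nat
  have "poly_bounded (\<lambda>b. b ^ q1 + ((4 + b) + ((5 + b ^ p1 * (T b + b ^ p1 + 1)) + (4 + b + b ^ p1 * (b ^ Suc p1) ^ p2))))"
    unfolding T_def by (intro poly_bounded_intros)
  then obtain q where q: "\<And>b :: nat. b \<ge> 2 \<Longrightarrow> b ^ q1 + ((4 + b) + ((5 + b ^ p1 * (T b + b ^ p1 + 1)) + (4 + b + b ^ p1 * (b ^ Suc p1) ^ p2))) \<le> b ^ q"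
    unfolding poly_bounded_def by blast
  have "\<exists>M'. runs_within (compile (Sm x e1 e2) k) M (b ^ q) M' \<and> preserved k M M' \<and> M' (tm k) = eval (Sm x e1 e2) (vars M) (arr M)"
    if b: "2 \<le> b" "bounded_mem b M" for b M k
  proof -
    let ?B = "b ^ Suc p1"
    define n where "n = eval e1 (vars M) (arr M)"
    define g where "g z = eval e2 ((vars M)(x := z)) (arr M)" for z
    have B: "b ^ p1 \<le> ?B" "b \<le> ?B" "2 \<le> ?B"
      using b(1) self_le_power[of b "Suc p1"] by (auto intro: power_increasing simp del: power_Suc)
    have n: "n \<le> b ^ p1" unfolding n_def using p1[OF b(1)] b(2) by (auto simp: bounded_mem_def)
    have bM: "bounded_mem ?B M'" if "arr M' = arr M" "vars M' = (vars M)(x := i)" "i < n" for M' i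
    proof -
      have "i \<le> ?B" using that(3) n B(1) by linarith
      then show ?thesis using bounded_mem_upd[OF b(2) B(2)] that(1,2) by blast
    qed
    have g: "g i \<le> ?B ^ p2" if "i < n" for i
    proof -
      have "i \<le> ?B" using that n B(1) by linarith
      then have "\<forall>y. ((vars M)(x := i)) y \<le> ?B" "\<forall>a y. arr M a y \<le> ?B"
        using bounded_mem_upd[OF b(2) B(2), of i "M(va x := i)" x] by (simp_all add: bounded_mem_def)
      then show ?thesis unfolding g_def by (rule p2[OF B(3)])
    qed
    have acc: "(\<Sum>z<i. g z) \<le> b ^ p1 * ?B ^ p2" if "i \<le> n" for i
    proof -
      have "(\<Sum>z<i. g z) \<le> (\<Sum>z<i. ?B ^ p2)" using g that by (intro sum_mono) auto
      also have "\<dots> = i * ?B ^ p2" by simp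
      also have "\<dots> \<le> b ^ p1 * ?B ^ p2" using that n by (intro mult_right_mono) auto
      finally show ?thesis .
    qed
    obtain M1 where M1: "runs_within (compile e1 k) M (b ^ q1) M1" "preserved k M M1" "M1 (tm k) = n"
      using q1[OF b] unfolding n_def by blast
    have old: "M1 (va x) = vars M x" using M1(2) by (auto simp: preserved_def vars_def fun_eq_iff)
    have oldb: "vars M x \<le> b" using b(2) by (simp add: bounded_mem_def)
    let ?M2 = "M1(tm (k + 1) := vars M x, tm (k + 2) := 0, va x := 0)"
    have M2: "runs_within (Block (move (tm (k + 1)) (va x) @ [Const (tm (k + 2)) 0, Const (va x) 0])) M1 (4 + b) ?M2"
      using old oldb blen_le[of "vars M x"] by (intro within_Block) (auto simp: move_def)
    define Q where "Q i M' \<longleftrightarrow> arr M' = arr M \<and> vars M' = (vars M)(x := i) \<and> (\<forall>j<k. M' (tm j) = M (tm j)) \<and>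
      M' (tm k) = n - i \<and> M' (tm (k + 1)) = vars M x \<and> M' (tm (k + 2)) = (\<Sum>z<i. g z)" for i M'
    let ?body = "[Add (tm (k + 2)) (tm (k + 2)) (tm (k + 3)), Const (tm (k + 3)) 1,
         Add (va x) (va x) (tm (k + 3)), Sub (tm k) (tm k) (tm (k + 3))]"
    have "\<exists>M'. runs_within (While (tm k) (compile e2 (k + 3) ;; Block ?body)) ?M2 (5 + n * (T b + n + 1)) M' \<and> Q n M'"
    proof (rule within_While)
      show "Q 0 (?M2(1 := 1))" using M1 by (auto simp: Q_def preserved_def)
      show "M' (tm k) = n - i" if "Q i M'" for i M' using that by (simp add: Q_def)
      fix i M' assume i: "i < n" and Qi: "Q i M'"
      obtain M3 where M3: "runs_within (compile e2 (k + 3)) M' (?B ^ q2) M3" "preserved (k + 3) M' M3"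
        "M3 (tm (k + 3)) = eval e2 (vars M') (arr M')"
        using q2[OF B(3) bM[of M' i]] Qi i by (auto simp: Q_def)
      have m: "M3 (tm (k + 3)) = g i" "M3 (tm (k + 2)) = (\<Sum>z<i. g z)" "M3 (tm k) = n - i" "M3 (va x) = i"
        "M3 (tm (k + 1)) = vars M x" "arr M3 = arr M" "vars M3 = (vars M)(x := i)" "\<forall>j<k. M3 (tm j) = M (tm j)"
      proof -
        have e: "arr M' = arr M" "vars M' = (vars M)(x := i)" using Qi by (simp_all add: Q_def)
        then show "M3 (tm (k + 3)) = g i" "arr M3 = arr M" "vars M3 = (vars M)(x := i)"
          using M3(2,3) by (simp_all add: preserved_def g_def)
        then show "M3 (va x) = i" by (simp add: vars_def fun_eq_iff)
        show "M3 (tm (k + 2)) = (\<Sum>z<i. g z)" "M3 (tm k) = n - i" "M3 (tm (k + 1)) = vars M x"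
          "\<forall>j<k. M3 (tm j) = M (tm j)"
          using M3(2) Qi by (auto simp: preserved_def Q_def)
      qed
      let ?M4 = "M3(tm (k + 2) := (\<Sum>z<Suc i. g z), tm (k + 3) := 1, va x := Suc i, tm k := n - Suc i)"
      have "runs_within (Block ?body) M3 (7 + b ^ p1 * ?B ^ p2 + ?B ^ p2 + 2 * b ^ p1) ?M4"
      proof (rule within_Block)
        show "run_block ?body M3 = ?M4" using m by (simp add: fun_eq_iff)
        have "cost_block ?body M3 = (1 + blen (\<Sum>z<i. g z) + blen (g i)) + 2 + (2 + blen i) + (2 + blen (n - i))"
          using m by simp
        also have "\<dots> \<le> 7 + (\<Sum>z<i. g z) + g i + i + (n - i)"
          using blen_le[of "\<Sum>z<i. g z"] blen_le[of "g i"] blen_le[of i] blen_le[of "n - i"] by linarith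
        also have "\<dots> \<le> 7 + b ^ p1 * ?B ^ p2 + ?B ^ p2 + 2 * b ^ p1"
          using acc[of i] g[OF i] i n by linarith
        finally show "cost_block ?body M3 \<le> 7 + b ^ p1 * ?B ^ p2 + ?B ^ p2 + 2 * b ^ p1" .
      qed simp
      with M3(1) have "runs_within (compile e2 (k + 3) ;; Block ?body) M' (T b) ?M4"
        by (rule within_Seq) (simp add: T_def)
      moreover have "Q (Suc i) ?M4" using m by (auto simp: Q_def)
      ultimately show "\<exists>M''. runs_within (compile e2 (k + 3) ;; Block ?body) M' (T b) M'' \<and> Q (Suc i) M''" by blast
    qed
    then obtain M5 where M5: "runs_within (While (tm k) (compile e2 (k + 3) ;; Block ?body)) ?M2 (5 + n * (T b + n + 1)) M5"
      "Q n M5" by blast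
    have "5 + n * (T b + n + 1) \<le> 5 + b ^ p1 * (T b + b ^ p1 + 1)" using n by (intro add_left_mono mult_mono) auto
    with M5(1) have W: "runs_within (While (tm k) (compile e2 (k + 3) ;; Block ?body)) ?M2 (5 + b ^ p1 * (T b + b ^ p1 + 1)) M5"
      by (rule within_mono)
    let ?M6 = "M5(va x := vars M x, tm k := (\<Sum>z<n. g z))"
    have "runs_within (Block (move (va x) (tm (k + 1)) @ move (tm k) (tm (k + 2)))) M5
       (4 + b + b ^ p1 * ?B ^ p2) ?M6"
    proof (rule within_Block)
      have m: "M5 (tm (k + 1)) = vars M x" "M5 (tm (k + 2)) = (\<Sum>z<n. g z)" using M5(2) by (auto simp: Q_def)
      show "run_block (move (va x) (tm (k + 1)) @ move (tm k) (tm (k + 2))) M5 = ?M6"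
        using m by (simp add: move_def fun_eq_iff)
      have "cost_block (move (va x) (tm (k + 1)) @ move (tm k) (tm (k + 2))) M5 = 4 + blen (vars M x) + blen (\<Sum>z<n. g z)"
        using m by (simp add: move_def)
      then show "cost_block (move (va x) (tm (k + 1)) @ move (tm k) (tm (k + 2))) M5 \<le> 4 + b + b ^ p1 * ?B ^ p2"
        using blen_le[of "vars M x"] blen_le[of "\<Sum>z<n. g z"] acc[of n] oldb by linarith
    qed (simp add: move_def)
    with W have "runs_within (While (tm k) (compile e2 (k + 3) ;; Block ?body) ;;
        Block (move (va x) (tm (k + 1)) @ move (tm k) (tm (k + 2)))) ?M2
        ((5 + b ^ p1 * (T b + b ^ p1 + 1)) + (4 + b + b ^ p1 * ?B ^ p2)) ?M6"
      by (rule within_Seq) simp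
    with M2 have "runs_within (Block (move (tm (k + 1)) (va x) @ [Const (tm (k + 2)) 0, Const (va x) 0]) ;;
        While (tm k) (compile e2 (k + 3) ;; Block ?body) ;;
        Block (move (va x) (tm (k + 1)) @ move (tm k) (tm (k + 2)))) M1
        ((4 + b) + ((5 + b ^ p1 * (T b + b ^ p1 + 1)) + (4 + b + b ^ p1 * ?B ^ p2))) ?M6"
      by (rule within_Seq) simp
    with M1(1) have "runs_within (compile (Sm x e1 e2) k) M (b ^ q) ?M6"
      unfolding compile.simps by (rule within_Seq) (rule q[OF b(1)])
    moreover have "preserved k M ?M6" using M5(2) by (auto simp: Q_def preserved_def)
    moreover have "?M6 (tm k) = eval (Sm x e1 e2) (vars M) (arr M)" by (simp add: n_def g_def)
    ultimately show ?thesis by blast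
  qed
  then show ?case by blast
qed


section \<open>Filling arrays\<close>

text \<open>\<open>Fill a x e1 e2\<close> stores the value of \<open>e2\<close> at entry \<open>x\<close> of array \<open>a\<close>, for each \<open>x\<close> below \<open>e1\<close>.\<close>

datatype fill = Fill nat nat exp exp

primrec fill_upto :: "nat \<Rightarrow> nat \<Rightarrow> exp \<Rightarrow> arrays \<Rightarrow> nat \<Rightarrow> arrays" where
  "fill_upto a x e S 0 = S"
| "fill_upto a x e S (Suc i) = (let S' = fill_upto a x e S i in
     S'(a := (S' a)(i := eval e ((\<lambda>_. 0)(x := i)) S')))"

fun run_fill :: "fill \<Rightarrow> arrays \<Rightarrow> arrays" where
  "run_fill (Fill a x e1 e2) S = fill_upto a x e2 S (eval e1 (\<lambda>_. 0) S)"

fun fill_array :: "fill \<Rightarrow> nat" where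
  "fill_array (Fill a x e1 e2) = a"

fun compile_fill :: "fill \<Rightarrow> com" where
  "compile_fill (Fill a x e1 e2) =
     compile e1 0 ;;
     While (tm 0) (compile e2 1 ;;
       Block (move (tm 2) (va x) @ times32 (tm 2) @ [Const (tm 3) a, Add (tm 2) (tm 2) (tm 3), Store (tm 2) (tm 1),
         Const (tm 3) 1, Add (va x) (va x) (tm 3), Sub (tm 0) (tm 0) (tm 3)])) ;;
     Block [Const (va x) 0]"

lemma fill_upto_other: "b \<noteq> a \<Longrightarrow> fill_upto a x e S i b = S b"
  by (induction i) (auto simp: Let_def)

lemma fill_upto_ge: "i \<le> y \<Longrightarrow> fill_upto a x e S i a y = S a y"
  by (induction i) (auto simp: Let_def)

lemma fill_upto_stable: "y < i \<Longrightarrow> i \<le> j \<Longrightarrow> fill_upto a x e S j a y = fill_upto a x e S i a y"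
  by (induction j) (auto simp: Let_def le_Suc_eq)

text \<open>While entry \<open>i\<close> is computed, the entries below \<open>i\<close> of the same
  array are already final. Hence a table may refer to itself recursively.\<close>

lemma fill_upto_eq:
  assumes "\<And>i. i < n \<Longrightarrow> eval e ((\<lambda>_. 0)(x := i)) (S(a := (\<lambda>y. if y < i then g y else S a y))) = g i"
  shows "fill_upto a x e S n = S(a := (\<lambda>y. if y < n then g y else S a y))"
  using assms
proof (induction n)
  case (Suc n)
  have IH: "fill_upto a x e S n = S(a := (\<lambda>y. if y < n then g y else S a y))"
    by (rule Suc.IH) (rule Suc.prems, simp)
  have e: "eval e ((\<lambda>_. 0)(x := n)) (S(a := (\<lambda>y. if y < n then g y else S a y))) = g n"
    by (rule Suc.prems) simp
  have g: "(\<lambda>y. if y < n then g y else S a y)(n := g n) = (\<lambda>y. if y < Suc n then g y else S a y)"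
    by (auto simp: fun_eq_iff)
  show ?case by (simp only: fill_upto.simps IH Let_def e fun_upd_same fun_upd_upd g)
qed simp

lemma compile_fill_correct:
  assumes "user a"
  shows "\<exists>q. \<forall>b M. 2 \<le> b \<longrightarrow> vars M = (\<lambda>_. 0) \<longrightarrow> (\<forall>a x. arr M a x \<le> b) \<longrightarrow>
    (\<forall>a' y. run_fill (Fill a x e1 e2) (arr M) a' y \<le> b) \<longrightarrow>
    (\<exists>M'. runs_within (compile_fill (Fill a x e1 e2)) M (b ^ q) M' \<and> vars M' = (\<lambda>_. 0) \<and>
      arr M' = run_fill (Fill a x e1 e2) (arr M))"
proof -
  obtain q1 where q1: "\<And>b M k. 2 \<le> b \<Longrightarrow> bounded_mem b M \<Longrightarrow>
      \<exists>M'. runs_within (compile e1 k) M (b ^ q1) M' \<and> preserved k M M' \<and> M' (tm k) = eval e1 (vars M) (arr M)"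
    using compile_correct[of e1] by metis
  obtain q2 where q2: "\<And>b M k. 2 \<le> b \<Longrightarrow> bounded_mem b M \<Longrightarrow>
      \<exists>M'. runs_within (compile e2 k) M (b ^ q2) M' \<and> preserved k M M' \<and> M' (tm k) = eval e2 (vars M) (arr M)"
    using compile_correct[of e2] by metis
  obtain p1 where p1: "\<And>(b::nat) \<sigma> S. 2 \<le> b \<Longrightarrow> (\<forall>x. \<sigma> x \<le> b) \<Longrightarrow> (\<forall>a x. S a x \<le> b) \<Longrightarrow> eval e1 \<sigma> S \<le> b ^ p1"
    using eval_bounded[of e1] by metis
  define T where "T b = (b ^ Suc p1) ^ q2 + (36 + 3 * a + 200 * b ^ p1 + b)" for b :: nat
  have "poly_bounded (\<lambda>b. b ^ q1 + ((5 + b ^ p1 * (T b + b ^ p1 + 1)) + 1))"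
    unfolding T_def by (intro poly_bounded_intros)
  then obtain q where q: "\<And>b :: nat. b \<ge> 2 \<Longrightarrow> b ^ q1 + ((5 + b ^ p1 * (T b + b ^ p1 + 1)) + 1) \<le> b ^ q"
    unfolding poly_bounded_def by blast
  have "\<exists>M'. runs_within (compile_fill (Fill a x e1 e2)) M (b ^ q) M' \<and> vars M' = (\<lambda>_. 0) \<and>
      arr M' = run_fill (Fill a x e1 e2) (arr M)"
    if b: "2 \<le> b" and v0: "vars M = (\<lambda>_. 0)" and bd: "\<forall>a x. arr M a x \<le> b"
      and bd': "\<forall>a' y. run_fill (Fill a x e1 e2) (arr M) a' y \<le> b" for b M
  proof -
    let ?B = "b ^ Suc p1"
    define n where "n = eval e1 (\<lambda>_. 0) (arr M)"
    define F where "F i = fill_upto a x e2 (arr M) i" for i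
    have B: "b ^ p1 \<le> ?B" "b \<le> ?B" "2 \<le> ?B"
      using b self_le_power[of b "Suc p1"] by (auto intro: power_increasing simp del: power_Suc)
    have bM: "bounded_mem b M" using v0 bd by (simp add: bounded_mem_def)
    have n: "n \<le> b ^ p1" unfolding n_def using p1[OF b] bd by simp
    \<comment> \<open>Each cell is either still old or already final, so bounds for the first and
      last state cover all states in between.\<close>
    have Fb: "F i a' y \<le> b" if "i \<le> n" for i a' y
    proof (cases "a' = a")
      case False
      then show ?thesis using bd by (simp add: F_def fill_upto_other)
    next
      case True
      show ?thesis
      proof (cases "y < i")
        case True
        have "F i a y = F n a y" unfolding F_def using fill_upto_stable[OF True that] by simp
        then show ?thesis using bd' \<open>a' = a\<close> by (simp add: F_def n_def)
      next
        case False
        then show ?thesis using bd True by (simp add: F_def fill_upto_ge)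
      qed
    qed
    obtain M1 where M1: "runs_within (compile e1 0) M (b ^ q1) M1" "preserved 0 M M1" "M1 (tm 0) = n"
      using q1[OF b bM, of 0] v0 unfolding n_def by auto
    define Q where "Q i M' \<longleftrightarrow> arr M' = F i \<and> vars M' = (\<lambda>_. 0)(x := i) \<and> M' (tm 0) = n - i" for i M'
    let ?body = "move (tm 2) (va x) @ times32 (tm 2) @ [Const (tm 3) a, Add (tm 2) (tm 2) (tm 3), Store (tm 2) (tm 1),
         Const (tm 3) 1, Add (va x) (va x) (tm 3), Sub (tm 0) (tm 0) (tm 3)]"
    have "\<exists>M'. runs_within (While (tm 0) (compile e2 1 ;; Block ?body)) M1 (5 + n * (T b + n + 1)) M' \<and> Q n M'"
    proof (rule within_While)
      show "Q 0 (M1(1 := 1))" using M1 v0 by (auto simp: Q_def preserved_def F_def)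
      show "M' (tm 0) = n - i" if "Q i M'" for i M' using that by (simp add: Q_def)
      fix i M' assume i: "i < n" and Qi: "Q i M'"
      have "bounded_mem ?B M'"
        unfolding bounded_mem_def
      proof (intro conjI allI)
        have "i \<le> ?B" using i n B(1) by linarith
        then show "vars M' y \<le> ?B" for y using Qi by (simp add: Q_def)
        have "F i a' y \<le> ?B" for a' y using Fb[of i a' y] i B(2) by linarith
        then show "arr M' a' y \<le> ?B" for a' y using Qi by (simp add: Q_def)
      qed
      from q2[OF B(3) this, of 1] obtain M3 where M3: "runs_within (compile e2 1) M' (?B ^ q2) M3" "preserved 1 M' M3"
        "M3 (tm 1) = eval e2 (vars M') (arr M')" by blast
      define v where "v = eval e2 ((\<lambda>_. 0)(x := i)) (F i)"
      have m: "M3 (tm 1) = v" "M3 (tm 0) = n - i" "M3 (va x) = i" "arr M3 = F i" "vars M3 = (\<lambda>_. 0)(x := i)"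
      proof -
        have "arr M' = F i" "vars M' = (\<lambda>_. 0)(x := i)" using Qi by (simp_all add: Q_def)
        then show "M3 (tm 1) = v" "arr M3 = F i" "vars M3 = (\<lambda>_. 0)(x := i)"
          using M3(2,3) by (simp_all add: preserved_def v_def)
        then show "M3 (va x) = i" by (simp add: vars_def fun_eq_iff)
        show "M3 (tm 0) = n - i" using M3(2) Qi by (simp add: preserved_def Q_def)
      qed
      have FS: "F (Suc i) = (F i)(a := (F i a)(i := v))" by (simp add: F_def Let_def v_def)
      then have v: "v \<le> b" using Fb[of "Suc i" a i] i by simp
      let ?M4 = "(M3(tm 2 := 32 * i + a, 32 * i + a := v))(tm 3 := 1, va x := Suc i, tm 0 := n - Suc i)"
      note u = upd_user[OF assms]
      have "runs_within (Block ?body) M3 (36 + 3 * a + 200 * b ^ p1 + b) ?M4"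
      proof (rule within_Block)
        have ne: "tm 1 \<noteq> tm 2" "tm 1 \<noteq> tm 3" "tm 2 \<noteq> tm 3" "tm 0 \<noteq> tm 2" "tm 0 \<noteq> tm 3" "tm 0 \<noteq> tm 1"
          by (simp_all add: tm_def)
        have na: "32 * i + a \<noteq> tm j" "32 * i + a \<noteq> va j" for j
          using assms unfolding user_def tm_def va_def by presburger+
        show "run_block ?body M3 = ?M4"
          using m ne na na[symmetric] by (simp add: move_def run_block_append run_times32 fun_eq_iff)
        have "cost_block ?body M3 = (2 + blen i) + cost_block (times32 (tm 2)) (M3(tm 2 := i))
            + (1 + blen a) + (1 + blen (32 * i) + blen a) + (1 + blen (32 * i + a) + blen v) + 2 + (2 + blen i) + (2 + blen (n - i))"
          using m ne na na[symmetric] by (simp add: move_def cost_block_append run_times32)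
        also have "\<dots> \<le> 36 + 12 * i + 3 * a + 64 * i + v + n"
          using cost_times32[of "tm 2" "M3(tm 2 := i)"] blen_le[of i]
            blen_le[of "32 * i"] blen_le[of a] blen_le[of "32 * i + a"] blen_le[of v] blen_le[of "n - i"] by simp
        also have "\<dots> \<le> 36 + 3 * a + 200 * b ^ p1 + b" using v i n by linarith
        finally show "cost_block ?body M3 \<le> 36 + 3 * a + 200 * b ^ p1 + b" .
      qed (simp add: move_def)
      with M3(1) have "runs_within (compile e2 1 ;; Block ?body) M' (T b) ?M4"
        by (rule within_Seq) (simp add: T_def)
      moreover have "Q (Suc i) ?M4"
        unfolding Q_def
      proof (intro conjI)
        show "arr ?M4 = F (Suc i)" using m FS by (simp add: arr_upd_user[OF assms] del: fun_upd_apply)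
        show "vars ?M4 = (\<lambda>_. 0)(x := Suc i)" using m u(1) by (simp del: fun_upd_apply)
      qed simp
      ultimately show "\<exists>M''. runs_within (compile e2 1 ;; Block ?body) M' (T b) M'' \<and> Q (Suc i) M''" by blast
    qed
    then obtain M5 where M5: "runs_within (While (tm 0) (compile e2 1 ;; Block ?body)) M1 (5 + n * (T b + n + 1)) M5"
      "Q n M5" by blast
    have "5 + n * (T b + n + 1) \<le> 5 + b ^ p1 * (T b + b ^ p1 + 1)" using n by (intro add_left_mono mult_mono) auto
    with M5(1) have W: "runs_within (While (tm 0) (compile e2 1 ;; Block ?body)) M1 (5 + b ^ p1 * (T b + b ^ p1 + 1)) M5"
      by (rule within_mono)
    have "runs_within (Block [Const (va x) 0]) M5 1 (M5(va x := 0))" by (simp add: within_Block)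
    with W have "runs_within (While (tm 0) (compile e2 1 ;; Block ?body) ;; Block [Const (va x) 0]) M1
        ((5 + b ^ p1 * (T b + b ^ p1 + 1)) + 1) (M5(va x := 0))"
      by (rule within_Seq) simp
    with M1(1) have "runs_within (compile_fill (Fill a x e1 e2)) M (b ^ q) (M5(va x := 0))"
      unfolding compile_fill.simps by (rule within_Seq) (rule q[OF b])
    moreover have "vars (M5(va x := 0)) = (\<lambda>_. 0)" using M5(2) by (auto simp: Q_def)
    moreover have "arr (M5(va x := 0)) = run_fill (Fill a x e1 e2) (arr M)"
      using M5(2) by (simp add: Q_def F_def n_def)
    ultimately show ?thesis by blast
  qed
  then show ?thesis by blast
qed

fun run_fills :: "fill list \<Rightarrow> arrays \<Rightarrow> arrays" where
  "run_fills [] S = S"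
| "run_fills (f # fs) S = run_fills fs (run_fill f S)"

fun compile_fills :: "fill list \<Rightarrow> com" where
  "compile_fills [] = Block []"
| "compile_fills (f # fs) = compile_fill f ;; compile_fills fs"

lemma compile_fills_correct:
  assumes "\<forall>f \<in> set fs. user (fill_array f)"
  shows "\<exists>q. \<forall>b M. 2 \<le> b \<longrightarrow> vars M = (\<lambda>_. 0) \<longrightarrow>
    (\<forall>i \<le> length fs. \<forall>a x. run_fills (take i fs) (arr M) a x \<le> b) \<longrightarrow>
    (\<exists>M'. runs_within (compile_fills fs) M (b ^ q) M' \<and> vars M' = (\<lambda>_. 0) \<and> arr M' = run_fills fs (arr M))"
  using assms
proof (induction fs)
  case Nil
  have "runs_within (compile_fills []) M (b ^ 0) M" for b M by (simp add: within_Block)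
  then show ?case by (metis run_fills.simps(1))
next
  case (Cons f fs)
  obtain a x e1 e2 where f: "f = Fill a x e1 e2" by (cases f)
  obtain q1 where q1: "\<And>b M. 2 \<le> b \<Longrightarrow> vars M = (\<lambda>_. 0) \<Longrightarrow> \<forall>a x. arr M a x \<le> b \<Longrightarrow>
    \<forall>a' y. run_fill f (arr M) a' y \<le> b \<Longrightarrow>
    \<exists>M'. runs_within (compile_fill f) M (b ^ q1) M' \<and> vars M' = (\<lambda>_. 0) \<and> arr M' = run_fill f (arr M)"
    using compile_fill_correct[of a x e1 e2] Cons.prems unfolding f by (metis fill_array.simps list.set_intros(1))
  obtain q2 where q2: "\<And>b M. 2 \<le> b \<Longrightarrow> vars M = (\<lambda>_. 0) \<Longrightarrow>
    \<forall>i \<le> length fs. \<forall>a x. run_fills (take i fs) (arr M) a x \<le> b \<Longrightarrow>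
    \<exists>M'. runs_within (compile_fills fs) M (b ^ q2) M' \<and> vars M' = (\<lambda>_. 0) \<and> arr M' = run_fills fs (arr M)"
    using Cons by (metis list.set_intros(2))
  have "poly_bounded (\<lambda>b. b ^ q1 + b ^ q2)" by (intro poly_bounded_intros)
  then obtain q where q: "\<And>b :: nat. b \<ge> 2 \<Longrightarrow> b ^ q1 + b ^ q2 \<le> b ^ q"
    unfolding poly_bounded_def by blast
  have "\<exists>M'. runs_within (compile_fills (f # fs)) M (b ^ q) M' \<and> vars M' = (\<lambda>_. 0) \<and> arr M' = run_fills (f # fs) (arr M)"
    if b: "2 \<le> b" and v0: "vars M = (\<lambda>_. 0)"
      and bd: "\<forall>i \<le> length (f # fs). \<forall>a x. run_fills (take i (f # fs)) (arr M) a x \<le> b" for b M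
  proof -
    have "\<forall>a x. arr M a x \<le> b" using bd[rule_format, of 0] by simp
    moreover have s: "\<forall>i \<le> length fs. \<forall>a x. run_fills (take i fs) (run_fill f (arr M)) a x \<le> b"
    proof (intro allI impI)
      fix i a x assume "i \<le> length fs"
      then show "run_fills (take i fs) (run_fill f (arr M)) a x \<le> b" using bd[rule_format, of "Suc i" a x] by simp
    qed
    moreover from this[rule_format, of 0] have "\<forall>a' y. run_fill f (arr M) a' y \<le> b" by simp
    ultimately obtain M1 where M1: "runs_within (compile_fill f) M (b ^ q1) M1" "vars M1 = (\<lambda>_. 0)"
      "arr M1 = run_fill f (arr M)" using q1[OF b v0] by blast
    obtain M2 where M2: "runs_within (compile_fills fs) M1 (b ^ q2) M2" "vars M2 = (\<lambda>_. 0)"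
      "arr M2 = run_fills fs (arr M1)" using q2[OF b M1(2)] s M1(3) by auto
    have "runs_within (compile_fills (f # fs)) M (b ^ q) M2"
      unfolding compile_fills.simps by (rule within_Seq[OF M1(1) M2(1) q[OF b]])
    then show ?thesis using M1 M2 by auto
  qed
  then show ?case by blast
qed

section \<open>Running a program on an array\<close>

text \<open>All instructions are padded to length 8, so target \<open>m\<close> moves to
  \<open>p + 8 * m\<close>, and \<open>min m l\<close> sends every exit to the end of the copy.
  Indirect addresses are scaled in register 1, which is not a multiple of 32 and thus outside array
  0.\<close>

fun embed_instr :: "nat \<Rightarrow> nat \<Rightarrow> instr \<Rightarrow> program" where
  "embed_instr p l (Const i c) = Const (32 * i) c # replicate 7 (Const 1 0)"
| "embed_instr p l (Add i j k) = Add (32 * i) (32 * j) (32 * k) # replicate 7 (Const 1 0)"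
| "embed_instr p l (Sub i j k) = Sub (32 * i) (32 * j) (32 * k) # replicate 7 (Const 1 0)"
| "embed_instr p l (Load i j) = move 1 (32 * j) @ times32 1 @ [Load (32 * i) 1]"
| "embed_instr p l (Store i j) = move 1 (32 * i) @ times32 1 @ [Store 1 (32 * j)]"
| "embed_instr p l (Jpos j m) = Jpos (32 * j) (p + 8 * min m l) # replicate 7 (Const 1 0)"

text \<open>The program \<open>P\<close>, moved to position \<open>p\<close>, with array 0 in the role of the memory.\<close>

definition embed :: "nat \<Rightarrow> program \<Rightarrow> program" where
  "embed p P = concat (map (embed_instr p (length P)) P)"

lemma length_embed_instr: "length (embed_instr p l i) = 8"
  by (cases i) (auto simp: move_def times32_def)

lemma length_concat_8: "(\<And>x. x \<in> set xs \<Longrightarrow> length (f x) = 8) \<Longrightarrow> length (concat (map f xs)) = 8 * length xs"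
  by (induction xs) auto

lemma length_embed: "length (embed p P) = 8 * length P"
  unfolding embed_def by (rule length_concat_8) (rule length_embed_instr)

lemma located_embed:
  assumes "located Q p (embed p P)" "i < length P"
  shows "located Q (p + 8 * i) (embed_instr p (length P) (P ! i))"
proof -
  have "P = take i P @ P ! i # drop (Suc i) P" using assms(2) by (simp add: id_take_nth_drop)
  then have "embed p P = concat (map (embed_instr p (length P)) (take i P)) @ embed_instr p (length P) (P ! i) @
    concat (map (embed_instr p (length P)) (drop (Suc i) P))"
    unfolding embed_def by (metis concat.simps(2) concat_append list.simps(9) map_append)
  moreover have "length (concat (map (embed_instr p (length P)) (take i P))) = 8 * i"
    using assms(2) by (subst length_concat_8) (auto simp: length_embed_instr)
  ultimately show ?thesis using assms(1) by (simp add: located_append)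
qed

definition embeds :: "memory \<Rightarrow> memory \<Rightarrow> bool" where
  "embeds M0 M \<longleftrightarrow> (\<forall>x. M (32 * x) = M0 x)"

lemma run_pad: "run_block (replicate n (Const r 0)) M = (if n = 0 then M else M(r := 0))"
  by (induction n arbitrary: M) auto

lemma cost_pad: "cost_block (replicate n (Const r 0)) M = n"
  by (induction n arbitrary: M) auto

lemma embeds_upd: "embeds M0 M \<Longrightarrow> embeds (M0(i := v)) ((M(Suc 0 := w))(32 * i := v))"
  "embeds M0 M \<Longrightarrow> embeds (M0(i := v)) ((M(32 * i := v))(Suc 0 := w))"
  "embeds M0 M \<Longrightarrow> embeds M0 (M(Suc 0 := w))"
proof -
  have "32 * x \<noteq> Suc 0" for x :: nat by presburger
  then show "embeds M0 M \<Longrightarrow> embeds (M0(i := v)) ((M(Suc 0 := w))(32 * i := v))"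
    "embeds M0 M \<Longrightarrow> embeds (M0(i := v)) ((M(32 * i := v))(Suc 0 := w))"
    "embeds M0 M \<Longrightarrow> embeds M0 (M(Suc 0 := w))"
    by (auto simp: embeds_def)
qed

lemma blen_times32: "blen (32 * x) \<le> blen x + 5"
proof -
  have "x < 2 ^ blen x" using floorlog_bounds[of x 2] by (cases "x = 0") auto
  then have "32 * x < 2 ^ (blen x + 5)" by (simp add: power_add)
  then show ?thesis by (intro floorlog_leI) auto
qed

text \<open>Indirect access is the most expensive case: scaling the address costs up to
  \<open>25 + 10 * blen\<close> of it. The factor 60 is a crude bound for everything.\<close>

lemma embed_straight:
  assumes "straight i" "embeds M0 M"
  shows "\<exists>M'. runs_within (Block (embed_instr p l i)) M (60 * cost i M0) M' \<and> embeds (snd (step i (0, M0))) M'"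
proof -
  have ne: "32 * x \<noteq> Suc 0" "Suc 0 \<noteq> 32 * x" for x :: nat by presburger+
  have eq: "M (32 * x) = M0 x" for x using assms(2) by (simp add: embeds_def)
  show ?thesis
  proof (cases i)
    case (Const a c)
    show ?thesis unfolding Const
      by (rule exI[of _ "(M(32 * a := c))(Suc 0 := 0)"], rule conjI, rule within_Block)
        (use assms(2) in \<open>simp_all add: cost_pad run_pad embeds_upd list_all_iff\<close>)
  next
    case (Add a j k)
    show ?thesis unfolding Add
      by (rule exI[of _ "(M(32 * a := M0 j + M0 k))(Suc 0 := 0)"], rule conjI, rule within_Block)
        (use assms(2) eq in \<open>simp_all add: cost_pad run_pad embeds_upd list_all_iff\<close>)
  next
    case (Sub a j k)
    show ?thesis unfolding Sub
      by (rule exI[of _ "(M(32 * a := M0 j - M0 k))(Suc 0 := 0)"], rule conjI, rule within_Block)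
        (use assms(2) eq in \<open>simp_all add: cost_pad run_pad embeds_upd list_all_iff\<close>)
  next
    case (Load a j)
    have b32: "blen (32 * M0 j) \<le> blen (M0 j) + 5" by (rule blen_times32)
    have "cost_block (embed_instr p l i) M = 2 + blen (M0 j) + cost_block (times32 1) (M(1 := M0 j)) + (1 + blen (32 * M0 j) + blen (M0 (M0 j)))"
      using eq ne by (simp add: Load move_def cost_block_append run_times32)
    also have "\<dots> \<le> 2 + blen (M0 j) + (25 + 10 * blen (M0 j)) + (1 + (blen (M0 j) + 5) + blen (M0 (M0 j)))"
      using b32 cost_times32[of 1 "M(1 := M0 j)"] by simp
    finally have c: "cost_block (embed_instr p l i) M \<le> 60 * cost i M0" by (simp add: Load)
    show ?thesis
      by (rule exI[of _ "(M(Suc 0 := 32 * M0 j))(32 * a := M0 (M0 j))"], rule conjI, rule within_Block)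
        (use c assms(2) eq ne in \<open>simp_all add: Load move_def run_block_append run_times32 embeds_upd\<close>)
  next
    case (Store a j)
    have b32: "blen (32 * M0 a) \<le> blen (M0 a) + 5" by (rule blen_times32)
    have "cost_block (embed_instr p l i) M = 2 + blen (M0 a) + cost_block (times32 1) (M(1 := M0 a)) + (1 + blen (32 * M0 a) + blen (M0 j))"
      using eq ne by (simp add: Store move_def cost_block_append run_times32)
    also have "\<dots> \<le> 2 + blen (M0 a) + (25 + 10 * blen (M0 a)) + (1 + (blen (M0 a) + 5) + blen (M0 j))"
      using b32 cost_times32[of 1 "M(1 := M0 a)"] by simp
    finally have c: "cost_block (embed_instr p l i) M \<le> 60 * cost i M0" by (simp add: Store)
    show ?thesis
      by (rule exI[of _ "(M(Suc 0 := 32 * M0 a))(32 * M0 a := M0 j)"], rule conjI, rule within_Block)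
        (use c assms(2) eq ne in \<open>simp_all add: Store move_def run_block_append run_times32 embeds_upd\<close>)
  qed (use assms in simp)
qed

lemma embed_exec:
  assumes "exec P c t M1" "c = (pc, M0)" "embeds M0 M" "located Q p (embed p P)" "length Q = p + 8 * length P"
  shows "\<exists>t' M'. t' \<le> 60 * t \<and> exec Q (p + 8 * min pc (length P), M) t' M' \<and> embeds M1 M'"
  using assms(1-3)
proof (induction arbitrary: pc M0 M rule: exec.induct)
  case (exec_halt pc' M0')
  then have "exec Q (p + 8 * min pc (length P), M) 0 M" using assms(5) by (intro exec.exec_halt) simp
  then show ?case using exec_halt by auto
next
  case (exec_step pc' M0' t M1)
  then have pc: "pc' = pc" "M0' = M0" "pc < length P" by auto
  let ?i = "P ! pc"
  have l: "located Q (p + 8 * pc) (embed_instr p (length P) ?i)" by (rule located_embed[OF assms(4) pc(3)])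
  show ?case
  proof (cases "straight ?i")
    case True
    obtain M2 where M2: "runs_within (Block (embed_instr p (length P) ?i)) M (60 * cost ?i M0) M2" "embeds (snd (step ?i (0, M0))) M2"
      using embed_straight[OF True exec_step.prems(2)] by blast
    then obtain t1 where t1: "t1 \<le> 60 * cost ?i M0" "runs (Block (embed_instr p (length P) ?i)) M t1 M2"
      by (auto simp: runs_within_def)
    obtain t2 M3 where 2: "t2 \<le> 60 * t" "exec Q (p + 8 * min (Suc pc) (length P), M2) t2 M3" "embeds M1 M3"
      using exec_step.IH[of "Suc pc" "snd (step ?i (0, M0))" M2] step_straight[OF True, of pc M0] M2(2) pc by auto
    have "p + 8 * pc + len (Block (embed_instr p (length P) ?i)) = p + 8 * min (Suc pc) (length P)"
      using pc(3) by (simp add: length_embed_instr)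
    then have "exec Q (p + 8 * pc, M) (t1 + t2) M3"
      using t1(2) l 2(2) unfolding runs_def code.simps by metis
    then show ?thesis using t1(1) 2 pc
      by (intro exI[of _ "t1 + t2"] exI[of _ M3]) (simp add: min_def add_mult_distrib2)
  next
    case False
    then obtain j m where J: "?i = Jpos j m" by (cases ?i) auto
    let ?q = "p + 8 * pc"
    have lq: "?q < length Q" "Q ! ?q = Jpos (32 * j) (p + 8 * min m (length P))"
      "located Q (Suc ?q) (code (Suc ?q) (Block (replicate 7 (Const 1 0))))"
      using l unfolding J embed_instr.simps located_Cons by auto
    have eq: "M (32 * j) = M0 j" using exec_step.prems(2) by (simp add: embeds_def)
    show ?thesis
    proof (cases "M0 j > 0")
      case True
      obtain t2 M3 where 2: "t2 \<le> 60 * t" "exec Q (p + 8 * min m (length P), M) t2 M3" "embeds M1 M3"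
        using exec_step.IH[of m M0 M] exec_step.prems(2) True J pc by auto
      have "exec Q (?q, M) (cost (Jpos (32 * j) (p + 8 * min m (length P))) M + t2) M3"
        by (rule exec_Cons[OF lq(2,1)]) (use 2 True eq in simp)
      then show ?thesis using 2 pc J eq
        by (intro exI[of _ "1 + blen (M0 j) + t2"] exI[of _ M3]) simp
    next
      case False
      have st: "step (P ! pc') (pc', M0') = (Suc pc, M0)" using False J pc by simp
      have e1: "embeds M0 (M(1 := 0))" using embeds_upd(3)[OF exec_step.prems(2)] by simp
      obtain t2 M3 where 2: "t2 \<le> 60 * t" "exec Q (p + 8 * min (Suc pc) (length P), M(1 := 0)) t2 M3" "embeds M1 M3"
        using exec_step.IH[OF st e1] by blast
      have r: "runs (Block (replicate 7 (Const 1 0))) M 7 (M(1 := 0))"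
        using runs_Block[of "replicate 7 (Const 1 0)" M] unfolding run_pad cost_pad by (simp add: list_all_iff)
      have "Suc ?q + len (Block (replicate 7 (Const 1 0))) = p + 8 * min (Suc pc) (length P)" using pc(3) by simp
      then have "exec Q (Suc ?q, M) (7 + t2) M3"
        using r lq(3) 2(2) unfolding runs_def by metis
      then have "exec Q (?q, M) (cost (Jpos (32 * j) (p + 8 * min m (length P))) M + (7 + t2)) M3"
        by (intro exec_Cons[OF lq(2,1)]) (use 2 False eq in simp)
      then show ?thesis using 2 pc J eq False
        by (intro exI[of _ "1 + blen (M0 j) + (7 + t2)"] exI[of _ M3]) simp
    qed
  qed
qed

section \<open>Moving the input\<close>

text \<open>
  The input of length at most \<open>e * m\<close>, where \<open>m\<close> is its entry 1, occupies all registers that could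
  serve as work space. The first nine of its entries other than \<open>n\<close> are saved at address
  \<open>p = n + D * m\<close> for a large constant \<open>D\<close>, computed in register 0 without losing \<open>n\<close>. Then the input
  is spread over array 31, in descending order since entry \<open>x\<close> goes to address \<open>32 * x + 31\<close>.
\<close>

definition save_block :: "nat \<Rightarrow> program" where
  "save_block k = concat (map (\<lambda>i. [Add 0 0 1, Store 0 i]) [2..<2 + k])"

definition restore_block :: "nat \<Rightarrow> program" where
  "restore_block k = concat (map (\<lambda>i. [Const 7 1, Add 0 0 7, Load 8 0, Const 5 (32 * i + 31), Store 5 8, Const 8 0, Store 0 8]) [2..<2 + k])"

text \<open>Register 4 contains the current index minus 9, so the loop stops after entry 10, the
  lowest one that has not been saved.\<close>

definition spread_body :: program where
  "spread_body = [Const 5 9, Add 5 5 4, Const 6 0, Add 6 6 5] @ times32 6 @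
     [Const 7 31, Add 6 6 7, Load 8 5, Store 6 8, Const 8 0, Store 5 8, Const 7 1, Sub 4 4 7]"

text \<open>At the start no register is free for a loop counter, so \<open>p\<close> is computed by
  \<open>D\<close> unrolled additions. Subtracting \<open>D * m\<close> from a copy of
  \<open>p\<close> gives \<open>n\<close> back.\<close>

definition prepare_block :: "nat \<Rightarrow> nat \<Rightarrow> program" where
  "prepare_block e D = replicate D (Add 0 0 1) @ [Store 0 1, Const 1 1] @ save_block 8 @
     [Const 1 8, Sub 0 0 1, Load 9 0, Const 2 0, Add 2 2 0] @ replicate D (Sub 2 2 9) @
     [Const 3 0] @ replicate e (Add 3 3 9) @ [Const 5 10, Const 4 0, Add 4 4 3, Sub 4 4 5]"

text \<open>Addresses 31 and 63 are entries 0 and 1 of array 31. The save area and the low registers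
  are cleared because the later tables start from zero arrays.\<close>

definition finish_block :: program where
  "finish_block = [Const 8 0, Store 0 8, Const 5 31, Store 5 2, Const 5 63, Store 5 9] @ restore_block 8 @
     map (\<lambda>i. Const i 0) [0..<10]"

definition spread_input :: "nat \<Rightarrow> nat \<Rightarrow> com" where
  "spread_input e D = Block (prepare_block e D) ;; While 4 (Block spread_body) ;; Block finish_block"

fun const_bound :: "nat \<Rightarrow> instr \<Rightarrow> bool" where
  "const_bound B (Const i c) = (c \<le> B)"
| "const_bound B _ = True"

text \<open>An instruction without jump at most doubles the largest content, apart from constants,
  which are bounded separately.\<close>

lemma cost_block_crude:
  assumes "\<And>a. M a \<le> B" "list_all (const_bound B) is" "list_all straight is"
  shows "cost_block is M \<le> length is * (1 + 2 * (2 ^ length is * B))"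
  using assms
proof (induction "is" arbitrary: M B)
  case (Cons i "is")
  let ?M = "snd (step i (0, M))"
  note M = Cons.prems(1)
  have c: "cost i M \<le> 1 + 2 * B"
  proof (cases i)
    case (Const x c)
    then show ?thesis using Cons.prems(2) blen_le[of c] by simp
  next
    case (Add x j k)
    then show ?thesis using M[of j] M[of k] blen_le[of "M j"] blen_le[of "M k"] by simp
  next
    case (Sub x j k)
    then show ?thesis using M[of j] M[of k] blen_le[of "M j"] blen_le[of "M k"] by simp
  next
    case (Load x j)
    then show ?thesis using blen_le[of "M j"] blen_le[of "M (M j)"] M[of j] M[of "M j"] by simp
  next
    case (Store x j)
    then show ?thesis using M[of x] M[of j] blen_le[of "M x"] blen_le[of "M j"] by simp
  next
    case (Jpos j l)
    then show ?thesis using M[of j] blen_le[of "M j"] by simp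
  qed
  have "?M a \<le> 2 * B" for a
  proof (cases i)
    case (Const x c)
    then show ?thesis using Cons.prems(2) M[of a] by simp
  next
    case (Add x j k)
    then show ?thesis using M[of a] M[of j] M[of k] by simp
  next
    case (Sub x j k)
    have "M j - M k \<le> 2 * B" using M[of j] by simp
    then show ?thesis using M[of a] Sub by simp
  next
    case (Load x j)
    then show ?thesis using M[of a] M[of "M j"] by simp
  next
    case (Store x j)
    then show ?thesis using M[of a] M[of j] by simp
  next
    case (Jpos j l)
    then show ?thesis using Cons.prems(3) by simp
  qed
  moreover have "list_all (const_bound (2 * B)) is"
    unfolding list_all_iff
  proof
    fix x assume "x \<in> set is"
    then have "const_bound B x" using Cons.prems(2) by (simp add: list_all_iff)
    then show "const_bound (2 * B) x" by (cases x) auto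
  qed
  ultimately have "cost_block is ?M \<le> length is * (1 + 2 * (2 ^ length is * (2 * B)))"
    using Cons.prems(3) by (intro Cons.IH) auto
  moreover have "2 ^ length is * (2 * B) = 2 ^ length (i # is) * B" by simp
  ultimately have "cost_block is ?M \<le> length is * (1 + 2 * (2 ^ length (i # is) * B))" by (simp only:)
  moreover have "1 * B \<le> 2 ^ length (i # is) * B" by (rule mult_right_mono) auto
  then have "cost i M \<le> 1 + 2 * (2 ^ length (i # is) * B)" using c by linarith
  ultimately show ?case by (simp add: add_mult_distrib del: power_Suc)
qed simp

lemma run_add_repeat: "i \<noteq> j \<Longrightarrow> run_block (replicate k (Add i i j)) M = M(i := M i + k * M j)"
  by (induction k arbitrary: M) (auto simp: fun_eq_iff)

lemma run_sub_repeat: "i \<noteq> j \<Longrightarrow> run_block (replicate k (Sub i i j)) M = M(i := M i - k * M j)"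
  by (induction k arbitrary: M) (auto simp: fun_eq_iff)

lemma run_save:
  assumes "M 1 = 1" "M 0 = p" "p \<ge> 10" "k \<le> 8"
  shows "run_block (save_block k) M = (\<lambda>a. if a = 0 then p + k else if p < a \<and> a \<le> p + k then M (a - p + 1) else M a)"
  using assms(4)
proof (induction k)
  case 0
  show ?case using assms by (auto simp: save_block_def fun_eq_iff)
next
  case (Suc k)
  have "save_block (Suc k) = save_block k @ [Add 0 0 1, Store 0 (2 + k)]" by (simp add: save_block_def)
  then show ?case using Suc assms by (auto simp: run_block_append fun_eq_iff le_Suc_eq)
qed

lemma run_restore:
  assumes "M 0 = p" "p > 600" "k \<le> 8"
  shows "\<exists>N. run_block (restore_block k) M = N \<and> N 0 = p + k \<and>
    (\<forall>a \<ge> 10. N a = (if p < a \<and> a \<le> p + k then 0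
       else if \<exists>i. 2 \<le> i \<and> i < 2 + k \<and> a = 32 * i + 31 then M (p + a div 32 - 1) else M a))"
  using assms(3)
proof (induction k)
  case 0
  show ?case using assms by (auto simp: restore_block_def)
next
  case (Suc k)
  then obtain N where N: "run_block (restore_block k) M = N" "N 0 = p + k"
    "\<And>a. a \<ge> 10 \<Longrightarrow> N a = (if p < a \<and> a \<le> p + k then 0
       else if \<exists>i. 2 \<le> i \<and> i < 2 + k \<and> a = 32 * i + 31 then M (p + a div 32 - 1) else M a)" by auto
  let ?t = "[Const 7 1, Add 0 0 7, Load 8 0, Const 5 (32 * (2 + k) + 31), Store 5 8, Const 8 0, Store 0 8]"
  have rb: "restore_block (Suc k) = restore_block k @ ?t" by (simp add: restore_block_def)
  have q: "N (p + k + 1) = M (p + k + 1)" using N(3)[of "p + k + 1"] assms Suc.prems by auto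
  let ?N = "N(7 := 1, 0 := p + k + 1, 8 := 0, 5 := 32 * (2 + k) + 31, 32 * (2 + k) + 31 := M (p + k + 1), p + k + 1 := 0)"
  have run: "run_block (restore_block (Suc k)) M = ?N"
    unfolding rb run_block_append N(1) using N(2) q assms(2) Suc.prems by (simp add: fun_eq_iff)
  have "?N a = (if p < a \<and> a \<le> p + Suc k then 0
       else if \<exists>i. 2 \<le> i \<and> i < 2 + Suc k \<and> a = 32 * i + 31 then M (p + a div 32 - 1) else M a)" if a: "a \<ge> 10" for a
  proof -
    consider "a = p + k + 1" | "a = 32 * (2 + k) + 31" | "a \<noteq> p + k + 1" "a \<noteq> 32 * (2 + k) + 31" by blast
    then show ?thesis
    proof cases
      case 3
      have "(\<exists>i. 2 \<le> i \<and> i < 2 + Suc k \<and> a = 32 * i + 31) \<longleftrightarrow> (\<exists>i. 2 \<le> i \<and> i < 2 + k \<and> a = 32 * i + 31)"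
        using 3 by (metis add_Suc_right less_Suc_eq)
      moreover have "p < a \<and> a \<le> p + Suc k \<longleftrightarrow> p < a \<and> a \<le> p + k" using 3 by auto
      moreover have "?N a = N a" using 3 a by auto
      ultimately show ?thesis using N(3)[OF a] by presburger
    next
      case 2
      have h1: "\<not> (p < a \<and> a \<le> p + Suc k)" and h: "p + a div 32 - 1 = p + k + 1" "a \<noteq> p + k + 1"
        using 2 assms(2) Suc.prems by auto
      have h2: "\<exists>i. 2 \<le> i \<and> i < 2 + Suc k \<and> a = 32 * i + 31" using 2 by (intro exI[of _ "2 + k"]) auto
      have "?N a = M (p + k + 1)" using h(2) unfolding 2 by (simp only: fun_upd_apply if_False if_True simp_thms)
      then show ?thesis unfolding if_not_P[OF h1] if_P[OF h2] h(1) .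
    qed simp
  qed
  then show ?case using run assms(2) by (intro exI[of _ ?N]) auto
qed

text \<open>All contents remain linear in \<open>n + m\<close>, and there are at most
  \<open>e * m\<close> rounds; this makes the time quadratic.\<close>

lemma spread_input_correct:
  assumes "e \<ge> 1" "D = 32 * e + 700"
  shows "\<exists>C. \<forall>xs n m. length xs \<ge> 2 \<longrightarrow> xs ! 0 = n \<longrightarrow> xs ! 1 = m \<longrightarrow> m \<ge> 1 \<longrightarrow> length xs \<le> e * m \<longrightarrow>
    (\<forall>x \<in> set xs. x \<le> 2 * n + m + e) \<longrightarrow>
    runs_within (spread_input e D) (load_input xs) (C * (n + m) ^ 2)
      (\<lambda>a. if a mod 32 = 31 then load_input xs (a div 32) else 0)"
proof -
  define lp where "lp = length (prepare_block e D)"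
  define lb where "lb = length spread_body"
  define lf where "lf = length finish_block"
  define K where "K = 2 * D + 1000"
  define c where "c l = l * (1 + 2 * (2 ^ l * K))" for l :: nat
  define C where "C = c lp + (5 + e * (c lb + e + 1)) + c lf"
  have cb: "cost_block is M \<le> c (length is) * s"
    if "\<And>a. M a \<le> K * s" "list_all (const_bound K) is" "list_all straight is" "s \<ge> 1" for "is" M s
  proof -
    have "list_all (const_bound (K * s)) is"
      using that(2,4) unfolding list_all_iff
    proof (intro ballI)
      fix i assume "\<forall>x\<in>set is. const_bound K x" "i \<in> set is" "1 \<le> s"
      moreover from this have "K \<le> K * s" by simp
      ultimately show "const_bound (K * s) i" by (cases i) (auto dest!: bspec intro: order_trans[of _ K])
    qed
    then have "cost_block is M \<le> length is * (1 + 2 * (2 ^ length is * (K * s)))"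
      using that by (intro cost_block_crude) auto
    also have "\<dots> \<le> length is * (s + 2 * (2 ^ length is * (K * s)))"
      using that(4) by (intro mult_left_mono add_right_mono) simp_all
    also have "\<dots> = c (length is) * s" by (simp add: c_def algebra_simps)
    finally show ?thesis .
  qed
  have "runs_within (spread_input e D) (load_input xs) (C * (n + m) ^ 2)
      (\<lambda>a. if a mod 32 = 31 then load_input xs (a div 32) else 0)"
    if xs: "length xs \<ge> 2" "xs ! 0 = n" "xs ! 1 = m" and m: "m \<ge> 1" and lx: "length xs \<le> e * m"
      and bd: "\<forall>x \<in> set xs. x \<le> 2 * n + m + e" for xs n m
  proof -
    define inp where "inp = load_input xs"
    define p where "p = n + D * m"
    define L where "L = e * m"
    define s where "s = n + m"
    define sv where "sv j = (if j = 0 then m else inp (j + 1))" for j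
    have i01: "inp 0 = n" "inp 1 = m" "inp (Suc 0) = m" using xs by (auto simp: inp_def load_input_def)
    have i0: "inp a = 0" if "a \<ge> L" for a using that lx by (simp add: inp_def load_input_def L_def)
    have s1: "s \<ge> 1" using m by (simp add: s_def)
    have ib: "inp a \<le> (3 + e) * s" for a
    proof -
      have "inp a \<le> 2 * n + m + e" using bd by (auto simp: inp_def load_input_def)
      also have "\<dots> \<le> 3 * s + e * s" using mult_left_mono[OF s1, of e] s_def by linarith
      also have "\<dots> = (3 + e) * s" by (simp add: algebra_simps)
      finally show ?thesis .
    qed
    \<comment> \<open>All targets \<open>32 * x + 31\<close> with \<open>x < L\<close> lie below
      \<open>p\<close>, and so do the targets of the ten low entries, which end at 319. Hence
      nothing is written over the saved entries.\<close>
    have pL: "p \<ge> 32 * L + 700"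
    proof -
      have "p = n + 32 * L + 700 * m" by (simp add: p_def L_def assms(2) algebra_simps)
      then show ?thesis using m by linarith
    qed
    have ps: "p \<le> D * s" using assms mult_right_mono[of 1 D n] by (simp add: p_def s_def add_mult_distrib2)
    have Ks: "K * s = 2 * (D * s) + 1000 * s" by (simp add: K_def algebra_simps)
    have e3: "(3 + e) * s \<le> D * s" using assms by (intro mult_right_mono) auto
    have Ls: "L \<le> e * s" by (simp add: L_def s_def)
    define M1 where "M1 = run_block (prepare_block e D) inp"
    have M1: "M1 0 = p" "M1 2 = n" "M1 9 = m" "M1 4 = L - 10" "M1 3 = L" "M1 5 = 10"
      "\<And>a. a \<ge> 10 \<Longrightarrow> M1 a = (if p \<le> a \<and> a < p + 9 then sv (a - p) else inp a)"
      "\<And>a. a < 10 \<Longrightarrow> a \<notin> {0, 2, 9, 4, 3, 5} \<Longrightarrow> M1 a = (if a = 1 then 8 else inp a)"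
    proof -
      let ?A = "inp(0 := p)" let ?B = "?A(p := m, 1 := 1)"
      have A: "run_block (replicate D (Add 0 0 1)) inp = ?A" by (simp add: run_add_repeat i01 p_def)
      have B: "run_block [Store 0 1, Const 1 1] ?A = ?B" by (simp add: i01)
      define S where "S = run_block (save_block 8) ?B"
      have S: "S = (\<lambda>a. if a = 0 then p + 8 else if p < a \<and> a \<le> p + 8 then ?B (a - p + 1) else ?B a)"
        unfolding S_def by (rule run_save) (use pL in auto)
      have S': "S 0 = p + 8" "S p = m" "\<And>a. a < 10 \<Longrightarrow> a > 1 \<Longrightarrow> S a = inp a"
        "\<And>a. a \<ge> 10 \<Longrightarrow> S a = (if p \<le> a \<and> a < p + 9 then sv (a - p) else inp a)"
        using pL by (auto simp: S sv_def)
      let ?C = "S(1 := 8, 0 := p, 9 := m, 2 := p)"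
      have C: "run_block ([Const 1 8, Sub 0 0 1, Load 9 0, Const 2 0, Add 2 2 0]) S = ?C"
        using S' pL by (simp add: fun_eq_iff)
      let ?D = "?C(2 := n, 3 := L, 5 := 10, 4 := L - 10)"
      have "M1 = run_block [Const 5 10, Const 4 0, Add 4 4 3, Sub 4 4 5] (run_block (replicate e (Add 3 3 9))
          (run_block [Const 3 0] (run_block (replicate D (Sub 2 2 9)) ?C)))"
        by (simp only: M1_def prepare_block_def run_block_append A B S_def[symmetric] C)
      also have "\<dots> = ?D"
        by (simp add: run_sub_repeat run_add_repeat fun_eq_iff p_def L_def)
      finally have D: "M1 = ?D" .
      show "M1 0 = p" "M1 2 = n" "M1 9 = m" "M1 4 = L - 10" "M1 3 = L" "M1 5 = 10"
        "\<And>a. a \<ge> 10 \<Longrightarrow> M1 a = (if p \<le> a \<and> a < p + 9 then sv (a - p) else inp a)"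
        "\<And>a. a < 10 \<Longrightarrow> a \<notin> {0, 2, 9, 4, 3, 5} \<Longrightarrow> M1 a = (if a = 1 then 8 else inp a)"
        unfolding D using S' by auto
    qed
    have st1: "list_all straight (prepare_block e D)" "list_all (const_bound K) (prepare_block e D)"
      by (auto simp: prepare_block_def save_block_def list_all_iff K_def)
    have inpK: "inp a \<le> K * s" for a using ib[of a] e3 Ks by linarith
    have R1: "runs_within (Block (prepare_block e D)) inp (c lp * s) M1"
      by (rule within_Block[OF st1(1)]) (use cb[OF inpK st1(2,1) s1] in \<open>simp_all add: lp_def M1_def\<close>)
    \<comment> \<open>The memory when entries 10 to \<open>R + 9\<close> are still to be moved: the
      save area, the untouched prefix of the input, and the part of array 31 that is
      complete.\<close>
    define E where "E R a = (if p \<le> a \<and> a < p + 9 then sv (a - p) else if a < R + 10 then inp a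
       else if a mod 32 = 31 \<and> R + 10 \<le> a div 32 then inp (a div 32) else 0)" for R a
    define Q where "Q i M \<longleftrightarrow> (\<forall>a \<ge> 10. M a = E (L - 10 - i) a) \<and> M 0 = p \<and> M 2 = n \<and> M 9 = m \<and>
       M 4 = L - 10 - i \<and> (\<forall>a. M a \<le> K * s)" for i M
    have small: "p \<le> K * s" "n \<le> K * s" "m \<le> K * s" "L \<le> K * s" "1000 \<le> K * s"
    proof -
      show "p \<le> K * s" using ps Ks by linarith
      have "s \<le> D * s" using assms by simp
      then show "n \<le> K * s" "m \<le> K * s" using Ks s_def by linarith+
      show "L \<le> K * s" using pL \<open>p \<le> K * s\<close> by linarith
      show "1000 \<le> K * s" using Ks s1 by linarith
    qed
    have svK: "sv j \<le> K * s" for j using inpK small by (simp add: sv_def)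
    have EK: "E R a \<le> K * s" for R a using svK inpK by (simp add: E_def)
    have "\<exists>M'. runs_within (While 4 (Block spread_body)) M1 (5 + (L - 10) * (c lb * s + (L - 10) + 1)) M' \<and> Q (L - 10) M'"
    proof (rule within_While)
      show "Q 0 (M1(1 := 1))"
      proof -
        have "M1 a = E (L - 10) a" if "a \<ge> 10" for a
        proof -
          have "inp a = 0" if "a \<ge> L - 10 + 10" using i0 that by simp
          moreover have "inp (a div 32) = 0" if "L - 10 + 10 \<le> a div 32" using i0 that by simp
          ultimately show ?thesis using M1(7)[OF that] by (auto simp: E_def)
        qed
        moreover have "M1 a \<le> K * s" for a
        proof (cases "a \<ge> 10")
          case True
          then show ?thesis using M1(7)[of a] svK inpK by simp
        next
          case False
          show ?thesis
          proof (cases "a \<in> {0, 2, 9, 4, 3, 5}")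
            case True
            then show ?thesis using M1(1-6) small by auto
          next
            case f: False
            then show ?thesis using M1(8)[of a] False inpK[of a] small(5) by auto
          qed
        qed
        moreover have "1 \<le> K * s" using small(5) by linarith
        ultimately show ?thesis using M1(1-4) unfolding Q_def by simp
      qed
      show "M' 4 = L - 10 - i" if "Q i M'" for i M' using that by (simp add: Q_def)
      fix i M' assume i: "i < L - 10" and Qi: "Q i M'"
      define x where "x = L - 10 - i + 9"
      have x: "10 \<le> x" "x < L" "M' 4 = x - 9" "L - 10 - Suc i = x - 10" "L - 10 - i = x - 9"
        using i Qi by (auto simp: x_def Q_def)
      have xp: "32 * x + 31 < p" using x(2) pL by linarith
      have "M' x = E (x - 9) x" using Qi x(1) unfolding Q_def x(5) by blast
      also have "\<dots> = inp x" using x(1) xp by (simp add: E_def)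
      finally have M'x: "M' x = inp x" .
      let ?N = "M'(5 := x, 6 := 32 * x + 31, 8 := 0, 32 * x + 31 := inp x, x := 0, 7 := 1, 4 := x - 10)"
      have run: "run_block spread_body M' = ?N"
        using x M'x by (simp add: spread_body_def run_block_append run_times32 fun_eq_iff)
      have "list_all straight spread_body" "list_all (const_bound K) spread_body"
        by (auto simp: spread_body_def times32_def K_def)
      then have r: "runs_within (Block spread_body) M' (c lb * s) ?N"
        using cb[of M' s spread_body] Qi s1 run by (intro within_Block) (auto simp: lb_def Q_def)
      have "?N a = E (x - 10) a" if a: "a \<ge> 10" for a
      proof -
        consider "a = x" | "a = 32 * x + 31" | "a \<noteq> x" "a \<noteq> 32 * x + 31" by blast
        then show ?thesis
        proof cases
          case 1
          have "\<not> x \<le> x div 32" using x(1) by simp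
          then show ?thesis using 1 x xp by (simp add: E_def)
        next
          case 2
          then show ?thesis using x xp by (simp add: E_def)
        next
          case 3
          have "?N a = M' a" using 3 a by auto
          also have "\<dots> = E (x - 9) a" using Qi a x(5) by (simp add: Q_def)
          also have "\<dots> = E (x - 10) a"
          proof -
            have e1: "a < x - 9 + 10 \<longleftrightarrow> a < x - 10 + 10" using 3 x(1) by auto
            have e2: "a mod 32 = 31 \<and> x - 9 + 10 \<le> a div 32 \<longleftrightarrow> a mod 32 = 31 \<and> x - 10 + 10 \<le> a div 32"
            proof -
              have "a = 32 * x + 31" if "a mod 32 = 31" "a div 32 = x"
                using that by (metis mult_div_mod_eq)
              then have "\<not> (a mod 32 = 31 \<and> a div 32 = x)" using 3 by blast
              then show ?thesis using x(1) by auto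
            qed
            show ?thesis by (simp only: E_def e1 e2)
          qed
          finally show ?thesis .
        qed
      qed
      moreover have "?N a \<le> K * s" for a
      proof -
        have "x \<le> K * s" "32 * x + 31 \<le> K * s" "x - 10 \<le> K * s" "1 \<le> K * s" using x(2) xp small by linarith+
        moreover have "M' a \<le> K * s" using Qi by (simp add: Q_def)
        ultimately show ?thesis using inpK[of x] by auto
      qed
      ultimately have "Q (Suc i) ?N" using Qi x by (auto simp: Q_def)
      with r show "\<exists>M''. runs_within (Block spread_body) M' (c lb * s) M'' \<and> Q (Suc i) M''" by blast
    qed
    then obtain M2 where M2: "runs_within (While 4 (Block spread_body)) M1 (5 + (L - 10) * (c lb * s + (L - 10) + 1)) M2"
      "Q (L - 10) M2" by blast
    have M2': "M2 0 = p" "M2 2 = n" "M2 9 = m" "\<And>a. a \<ge> 10 \<Longrightarrow> M2 a = E 0 a" "\<And>a. M2 a \<le> K * s"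
      using M2(2) by (auto simp: Q_def)
    let ?F = "\<lambda>a. if a mod 32 = 31 then inp (a div 32) else 0"
    have fin: "run_block finish_block M2 = ?F"
    proof -
      let ?G = "M2(8 := 0, p := 0, 31 := n, 5 := 63, 63 := m)"
      have G: "run_block [Const 8 0, Store 0 8, Const 5 31, Store 5 2, Const 5 63, Store 5 9] M2 = ?G"
        using M2' pL by (simp add: fun_eq_iff)
      obtain N where N: "run_block (restore_block 8) ?G = N" "\<forall>a \<ge> 10. N a = (if p < a \<and> a \<le> p + 8 then 0
         else if \<exists>i. 2 \<le> i \<and> i < 2 + 8 \<and> a = 32 * i + 31 then ?G (p + a div 32 - 1) else ?G a)"
        using run_restore[of ?G p 8] M2'(1) pL by auto
      have clr: "run_block (map (\<lambda>i. Const i 0) [0..<10]) N = (\<lambda>a. if a < 10 then 0 else N a)"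
        by (simp add: upt_rec numeral_eq_Suc) (auto simp: fun_eq_iff less_Suc_eq numeral_eq_Suc)
      have "(\<lambda>a. if a < 10 then 0 else N a) = ?F"
      proof
        fix a
        show "(if a < 10 then 0 else N a) = ?F a"
        proof (cases "a < 10")
          case False
          then have a: "a \<ge> 10" by simp
          have Na: "N a = (if p < a \<and> a \<le> p + 8 then 0
            else if \<exists>i. 2 \<le> i \<and> i < 2 + 8 \<and> a = 32 * i + 31 then ?G (p + a div 32 - 1) else ?G a)"
            using N(2) a by blast
          have big: "inp (y div 32) = 0" if "y \<ge> p" for y
          proof (rule i0)
            have "32 * L \<le> y" using that pL by linarith
            then show "L \<le> y div 32" by (metis div_le_mono nonzero_mult_div_cancel_left zero_neq_numeral)
          qed
          consider "p \<le> a \<and> a \<le> p + 8" | i where "2 \<le> i" "i < 10" "a = 32 * i + 31"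
            | "\<not> (p \<le> a \<and> a \<le> p + 8)" "\<not> (\<exists>i. 2 \<le> i \<and> i < 2 + 8 \<and> a = 32 * i + 31)" by force
          then show ?thesis
          proof cases
            case 1
            have "\<not> (\<exists>i. 2 \<le> i \<and> i < 2 + 8 \<and> a = 32 * i + 31)" using 1 pL by auto
            then have "N a = 0" using Na 1 pL by auto
            then show ?thesis using big[of a] 1 False by simp
          next
            case (2 i)
            have "\<not> (p < a \<and> a \<le> p + 8)" using 2 pL by auto
            moreover have "\<exists>i. 2 \<le> i \<and> i < 2 + 8 \<and> a = 32 * i + 31" using 2 by auto
            moreover have ad: "a div 32 = i" "a mod 32 = 31" using 2 by auto
            ultimately have "N a = ?G (p + i - 1)" using Na by auto
            also have "\<dots> = M2 (p + i - 1)" using 2 pL by auto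
            also have "\<dots> = E 0 (p + i - 1)" by (rule M2'(4)) (use 2 pL in linarith)
            also have "\<dots> = sv (p + i - 1 - p)" unfolding E_def using 2 by (subst if_P) auto
            also have "p + i - 1 - p = i - 1" by simp
            also have "sv (i - 1) = inp i" using 2 by (auto simp: sv_def)
            finally show ?thesis using False ad by simp
          next
            case 3
            have np: "\<not> (p < a \<and> a \<le> p + 8)" using 3(1) by linarith
            have NG: "N a = ?G a" using Na unfolding if_not_P[OF np] if_not_P[OF 3(2)] .
            show ?thesis
            proof (cases "a = 31 \<or> a = 63")
              case True
              then show ?thesis using NG pL i01 by auto
            next
              case f: False
              have "N a = E 0 a" using NG f False 3(1) M2'(4)[OF a] by auto
              also have "\<dots> = ?F a"
              proof -
                have "10 \<le> a div 32" if am: "a mod 32 = 31"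
                proof (rule ccontr)
                  assume "\<not> 10 \<le> a div 32"
                  have a32: "a = 32 * (a div 32) + 31" using am by (metis mult_div_mod_eq)
                  then have "a div 32 \<noteq> 0" "a div 32 \<noteq> 1" using f by auto
                  then have "2 \<le> a div 32" by linarith
                  moreover have "a div 32 < 2 + 8" using \<open>\<not> 10 \<le> a div 32\<close> by simp
                  ultimately show False using 3(2) a32 by blast
                qed
                then show ?thesis using 3(1) a by (auto simp: E_def)
              qed
              finally show ?thesis using False by simp
            qed
          qed
        qed auto
      qed
      then show ?thesis unfolding finish_block_def run_block_append G N(1) clr .
    qed
    have st3: "list_all straight finish_block" "list_all (const_bound K) finish_block"
      by (auto simp: finish_block_def restore_block_def list_all_iff K_def)
    have R3: "runs_within (Block finish_block) M2 (c lf * s) ?F"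
      by (rule within_Block[OF st3(1)]) (use cb[OF M2'(5) st3(2,1) s1] fin in \<open>simp_all add: lf_def\<close>)
    have "5 + (L - 10) * (c lb * s + (L - 10) + 1) \<le> 5 * s * s + (e * s) * (c lb * s + e * s + s)"
    proof (intro add_mono mult_mono)
      have "1 \<le> s * s" using s1 by simp
      then show "5 \<le> 5 * s * s" by simp
    qed (use Ls s1 in auto)
    also have "\<dots> = (5 + e * (c lb + e + 1)) * s ^ 2" by (simp add: algebra_simps power2_eq_square)
    finally have R2: "runs_within (While 4 (Block spread_body)) M1 ((5 + e * (c lb + e + 1)) * s ^ 2) M2"
      using M2(1) within_mono by blast
    have "s \<le> s ^ 2" using s1 by (simp add: power2_eq_square)
    then have "c lp * s + ((5 + e * (c lb + e + 1)) * s ^ 2 + c lf * s) \<le> c lp * s ^ 2 + ((5 + e * (c lb + e + 1)) * s ^ 2 + c lf * s ^ 2)"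
      by (intro add_mono mult_left_mono order_refl) auto
    also have "\<dots> = C * s ^ 2" by (simp add: C_def algebra_simps)
    finally have "c lp * s + ((5 + e * (c lb + e + 1)) * s ^ 2 + c lf * s) \<le> C * s ^ 2" .
    then have "runs_within (spread_input e D) inp (C * s ^ 2) ?F"
      unfolding spread_input_def by (intro within_Seq[OF R1 within_Seq[OF R2 R3 order_refl]])
    then show ?thesis unfolding inp_def s_def .
  qed
  then show ?thesis by blast
qed

section \<open>The reduction as a program\<close>

fun mv :: "exp \<Rightarrow> nat" where
  "mv (N c) = 0"
| "mv (V x) = Suc x"
| "mv (Rd a e) = mv e"
| "mv (Pl e1 e2) = max (mv e1) (mv e2)"
| "mv (Mi e1 e2) = max (mv e1) (mv e2)"
| "mv (Sm x e1 e2) = max (Suc x) (max (mv e1) (mv e2))"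

lemma eval_fresh [simp]: "mv e \<le> y \<Longrightarrow> eval e (\<sigma>(y := z)) S = eval e \<sigma> S"
proof (induction e arbitrary: \<sigma>)
  case (Sm x e1 e2)
  have m: "mv e1 \<le> y" "mv e2 \<le> y" "y \<noteq> x" using Sm.prems by auto
  have "eval e2 (\<sigma>(y := z, x := v)) S = eval e2 (\<sigma>(x := v)) S" for v
    unfolding fun_upd_twist[OF m(3)] by (rule Sm.IH(2)[OF m(2)])
  then show ?case unfolding eval.simps Sm.IH(1)[OF m(1)] by (rule sum.cong[OF refl])
qed auto

text \<open>
  Array 31 holds the input, array 30 the parameters \<open>d\<close>, \<open>k\<close>, \<open>c2\<close>, \<open>c3\<close> and a lower bound for \<open>n\<close>.
  They are data so that the text of the program, and with it the exponent of its polynomial running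
  time, does not depend on them. Arrays 4 to 9 are tables for \<open>pw\<close>, \<open>pt\<close>, \<open>posn\<close>, \<open>fam\<close>, \<open>cm\<close> and \<open>hs\<close>;
  the instance is written to array 0.
\<close>

definition tr :: "exp \<Rightarrow> (nat \<Rightarrow> nat) \<Rightarrow> arrays \<Rightarrow> bool" where
  "tr e \<sigma> S \<longleftrightarrow> 0 < eval e \<sigma> S"

text \<open>A sum of \<open>a\<close> copies of \<open>c\<close> over a variable that is fresh for
  \<open>c\<close>.\<close>

definition "eMul a c = Sm (mv c) a c"
definition "eNot e = Mi (N 1) e"
definition "eBo e = eNot (eNot e)"
definition "eAnd a c = eMul a c"
definition "eOr a c = Pl a c"
definition "eImp a c = eOr (eNot a) c"
definition "eLe a c = eNot (Mi a c)"
definition "eLt a c = eNot (Mi (Pl a (N 1)) c)"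
definition "eEq a c = eNot (Pl (Mi a c) (Mi c a))"
definition "eIff a c = eEq (eBo a) (eBo c)"
definition "eIte p a c = Pl (eMul (eBo p) a) (eMul (eNot p) c)"

fun fr :: "exp list \<Rightarrow> nat" where
  "fr [] = 0"
| "fr (e # es) = max (mv e) (fr es)"

text \<open>In the binders, \<open>es\<close> lists the expressions in which the bound variable must not occur.\<close>

definition "eSum es B f = Sm (fr es) B (f (V (fr es)))"
definition "eEx es B f = eSum es B f"
definition "eAll es B f = eNot (eSum es B (\<lambda>x. eNot (f x)))"
definition "eCount es B f = eSum es B (\<lambda>x. eBo (f x))"
text \<open>Counts the positive multiples of \<open>c\<close> up to \<open>a\<close>; the guard
  reproduces the convention that division by zero gives zero.\<close>

definition "eDiv a c = eCount [a, c] a (\<lambda>x. eAnd (eLt (N 0) c) (eLe (eMul (Pl x (N 1)) c) a))"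
definition "eMod a c = Mi a (eMul (eDiv a c) c)"

lemma eval_basic [simp]:
  "eval (eMul a c) \<sigma> S = eval a \<sigma> S * eval c \<sigma> S"
  "eval (eNot e) \<sigma> S = of_bool (\<not> tr e \<sigma> S)"
  "eval (eBo e) \<sigma> S = of_bool (tr e \<sigma> S)"
  "eval (eIte p a c) \<sigma> S = (if tr p \<sigma> S then eval a \<sigma> S else eval c \<sigma> S)"
proof -
  show m: "eval (eMul a c) \<sigma> S = eval a \<sigma> S * eval c \<sigma> S" for a c by (simp add: eMul_def)
  show "eval (eNot e) \<sigma> S = of_bool (\<not> tr e \<sigma> S)" for e by (simp add: eNot_def tr_def)
  then show b: "eval (eBo e) \<sigma> S = of_bool (tr e \<sigma> S)" for e by (simp add: eBo_def tr_def)
  show "eval (eIte p a c) \<sigma> S = (if tr p \<sigma> S then eval a \<sigma> S else eval c \<sigma> S)"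
    by (simp add: eIte_def m b) (simp add: eNot_def tr_def)
qed

lemma tr_basic [simp]:
  "tr (eNot e) \<sigma> S \<longleftrightarrow> \<not> tr e \<sigma> S"
  "tr (eBo e) \<sigma> S \<longleftrightarrow> tr e \<sigma> S"
  "tr (eAnd a c) \<sigma> S \<longleftrightarrow> tr a \<sigma> S \<and> tr c \<sigma> S"
  "tr (eOr a c) \<sigma> S \<longleftrightarrow> tr a \<sigma> S \<or> tr c \<sigma> S"
  "tr (eImp a c) \<sigma> S \<longleftrightarrow> (tr a \<sigma> S \<longrightarrow> tr c \<sigma> S)"
  "tr (eLe a c) \<sigma> S \<longleftrightarrow> eval a \<sigma> S \<le> eval c \<sigma> S"
  "tr (eLt a c) \<sigma> S \<longleftrightarrow> eval a \<sigma> S < eval c \<sigma> S"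
  "tr (eEq a c) \<sigma> S \<longleftrightarrow> eval a \<sigma> S = eval c \<sigma> S"
proof -
  show n: "tr (eNot e) \<sigma> S \<longleftrightarrow> \<not> tr e \<sigma> S" for e by (simp add: tr_def[of "eNot e"])
  show "tr (eBo e) \<sigma> S \<longleftrightarrow> tr e \<sigma> S" by (simp add: tr_def[of "eBo e"])
  show "tr (eAnd a c) \<sigma> S \<longleftrightarrow> tr a \<sigma> S \<and> tr c \<sigma> S" by (simp add: tr_def eAnd_def)
  show o: "tr (eOr a c) \<sigma> S \<longleftrightarrow> tr a \<sigma> S \<or> tr c \<sigma> S" for a c by (auto simp: tr_def eOr_def)
  show "tr (eImp a c) \<sigma> S \<longleftrightarrow> (tr a \<sigma> S \<longrightarrow> tr c \<sigma> S)" by (simp add: eImp_def n o)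
  show "tr (eLe a c) \<sigma> S \<longleftrightarrow> eval a \<sigma> S \<le> eval c \<sigma> S" unfolding eLe_def n by (auto simp add: tr_def)
  show "tr (eLt a c) \<sigma> S \<longleftrightarrow> eval a \<sigma> S < eval c \<sigma> S" unfolding eLt_def n by (auto simp add: tr_def)
  show "tr (eEq a c) \<sigma> S \<longleftrightarrow> eval a \<sigma> S = eval c \<sigma> S" unfolding eEq_def n by (auto simp add: tr_def)
qed

lemma tr_eIff [simp]: "tr (eIff a c) \<sigma> S \<longleftrightarrow> (tr a \<sigma> S \<longleftrightarrow> tr c \<sigma> S)"
  by (simp add: eIff_def of_bool_def)

lemma eval_eSum: "eval (eSum es B f) \<sigma> S = (\<Sum>v<eval B \<sigma> S. eval (f (V (fr es))) (\<sigma>(fr es := v)) S)"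
  by (simp add: eSum_def)

lemma eval_eCount: "eval (eCount es B f) \<sigma> S = (\<Sum>v<eval B \<sigma> S. of_bool (tr (f (V (fr es))) (\<sigma>(fr es := v)) S))"
  by (simp add: eCount_def eval_eSum)

lemma tr_eEx: "tr (eEx es B f) \<sigma> S \<longleftrightarrow> (\<exists>v<eval B \<sigma> S. tr (f (V (fr es))) (\<sigma>(fr es := v)) S)"
proof -
  have "tr (eEx es B f) \<sigma> S \<longleftrightarrow> eval (eSum es B f) \<sigma> S \<noteq> 0" by (simp add: tr_def eEx_def)
  then show ?thesis by (auto simp: eval_eSum tr_def)
qed

lemma tr_eAll: "tr (eAll es B f) \<sigma> S \<longleftrightarrow> (\<forall>v<eval B \<sigma> S. tr (f (V (fr es))) (\<sigma>(fr es := v)) S)"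
proof -
  have "tr (eAll es B f) \<sigma> S \<longleftrightarrow> \<not> tr (eSum es B (\<lambda>x. eNot (f x))) \<sigma> S" by (simp add: eAll_def)
  also have "\<dots> \<longleftrightarrow> eval (eSum es B (\<lambda>x. eNot (f x))) \<sigma> S = 0" by (simp add: tr_def)
  finally show ?thesis by (auto simp: eval_eSum)
qed

lemma div_as_sum: "(\<Sum>z<a. of_bool (0 < c \<and> (z + 1) * c \<le> a)) = a div (c::nat)"
proof (cases "c = 0")
  case False
  have "(\<Sum>z<a. of_bool (0 < c \<and> (z + 1) * c \<le> a)) = card ({..<a} \<inter> {z. 0 < c \<and> (z + 1) * c \<le> a})"
    by (subst sum_of_bool_eq) simp_all
  also have "{..<a} \<inter> {z. 0 < c \<and> (z + 1) * c \<le> a} = {..<a div c}"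
  proof (rule set_eqI)
    fix z
    have "z + 1 \<le> a div c \<longleftrightarrow> (z + 1) * c \<le> a" using False by (intro less_eq_div_iff_mult_less_eq) simp
    moreover have "a div c \<le> a" by simp
    ultimately show "z \<in> {..<a} \<inter> {z. 0 < c \<and> (z + 1) * c \<le> a} \<longleftrightarrow> z \<in> {..<a div c}"
      using False unfolding Int_iff lessThan_iff mem_Collect_eq by linarith
  qed
  finally show ?thesis by simp
qed simp

lemma eval_div_mod [simp]:
  "eval (eDiv a c) \<sigma> S = eval a \<sigma> S div eval c \<sigma> S"
  "eval (eMod a c) \<sigma> S = eval a \<sigma> S mod eval c \<sigma> S"
proof -
  show d: "eval (eDiv a c) \<sigma> S = eval a \<sigma> S div eval c \<sigma> S"
    unfolding eDiv_def eval_eCount using div_as_sum[of "eval c \<sigma> S" "eval a \<sigma> S"] by simp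
  show "eval (eMod a c) \<sigma> S = eval a \<sigma> S mod eval c \<sigma> S"
    unfolding eMod_def by (simp add: d minus_div_mult_eq_mod)
qed

subsection \<open>Parameters\<close>

definition "xd = Rd 30 (N 0)"
definition "xk = Rd 30 (N 1)"
text \<open>Raising \<open>n\<close> to a constant lower bound adds variables that occur in no
  clause. Satisfiability is unaffected, and the asymptotic inequalities become available for every
  input.\<close>

definition "xn = eIte (eLe (Rd 31 (N 0)) (Rd 30 (N 4))) (Rd 30 (N 4)) (Rd 31 (N 0))"
definition "x2n = eMul (N 2) xn"
definition "xb = Pl (eDiv xn xk) (N 1)"
definition "x2b = eMul (N 2) xb"
definition "xpw e = Rd 4 e"
definition "xlam = eCount [] (Pl x2b (N 1)) (\<lambda>x. eLe (xpw x) x2n)"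
definition "xg = Pl (eMul xlam xd) (N 1)"
definition "xq = eDiv xb (eMul (Rd 30 (N 2)) xg)"
definition "xr = eMul xg xq"
definition "xalp = eMul (Rd 30 (N 3)) xlam"
definition "xE = Pl (Pl xk (eMul (N 2) xd)) (N 1)"
definition "xpt z j = eIte (eAnd (eLe z (Pl xb xalp)) (eLt j xE)) (Rd 5 (Pl (eMul z xE) j)) (N 0)"
definition "xh = eCount [] xb (\<lambda>z. eLe (eMul (eMul (N 8) xlam) (xpt (Pl z (N 1)) xk)) xb)"
definition "xhk = xpt xh xk"
definition "xT = xpw (eMul xlam xd)"
definition "xdig x p l = eMod (eDiv x (xpw p)) (xpw l)"
definition "xZ = eMul (eMul (Pl xd (N 1)) (Pl xd (N 1))) xT"
definition "xnc = eMul (eMul (N 2) xr) xk"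
definition "xNS = eMul xk (xpw (Pl xb xr))"
definition "xNU = xpw (eMul (eMul (N 2) xlam) (Pl xh xhk))"

subsection \<open>Clauses and flowers\<close>

definition "xin l e = eEx [l, e] xd (\<lambda>i. eEq (xdig e (eMul xlam i) xlam) l)"
definition "xsub e e' = eAll [e, e'] x2n (\<lambda>l. eImp (xin l e) (xin l e'))"
definition "xeql e e' = eAnd (xsub e e') (xsub e' e)"
definition "xcard e = eCount [e] x2n (\<lambda>l. xin l e)"
text \<open>A row for advice \<open>w\<close> and step \<open>t\<close> has \<open>T + 1\<close>
  columns: membership of the coded sets and, in the last column, the cached code of the first
  flower.\<close>

definition "xG w t e = Rd 7 (Pl (eMul (Pl (eMul w (Pl xT (N 1))) t) (Pl xT (N 1))) e)"
definition "xmin w t e = eAnd (xG w t e)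
  (eAll [w, t, e] xT (\<lambda>e'. eImp (eAnd (xG w t e') (xsub e' e)) (xsub e e')))"
definition "xcanon e = eAll [e] e (\<lambda>e'. eNot (xeql e' e))"
definition "xzc z = eDiv (eDiv z xT) (Pl xd (N 1))"
definition "xzi z = eMod (eDiv z xT) (Pl xd (N 1))"
definition "xzh z = eMod z xT"
definition "xfl w t z = eAnd (eLe (N 1) (xzi z)) (eAnd (eLt (N 0) (xcard (xzh z)))
  (eAnd (eEq (Pl (xcard (xzh z)) (xzi z)) (xzc z))
   (eLe (xpt xalp (Mi (eMul (N 2) (xzi z)) (N 1)))
     (eCount [w, t, z] xT (\<lambda>e. eAnd (xcanon e) (eAnd (xmin w t e) (eAnd (eEq (xcard e) (xzc z)) (xsub (xzh z) e))))))))"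
definition "xfirst w t = eCount [w, t] xZ (\<lambda>z. eAll [w, t, z] (Pl z (N 1)) (\<lambda>z'. eNot (xfl w t z')))"
definition "xfalse w t = eEx [w, t] xq (\<lambda>p. eEq (xdig w (eMul xg p) xg) t)"
definition "xinit e = eEx [e] (Rd 31 (N 1)) (\<lambda>c. eAll [e, c] x2n (\<lambda>l.
  eIff (xin l e) (eEx [c, l] (Rd 31 (Rd 6 c)) (\<lambda>i. eEq (Rd 31 (Pl (Pl (Rd 6 c) (N 1)) i)) l))))"
definition "xpetal w t z e = eEx [w, t, z, e] xT (\<lambda>e'. eAnd (xmin w t e') (eAnd (eEq (xcard e') (xzc z)) (eAnd (xsub (xzh z) e')
  (eAll [e, e', z] x2n (\<lambda>l. eIff (xin l e) (eAnd (xin l e') (eNot (xin l (xzh z)))))))))"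
definition "xgrow w t z e = eOr (xG w t e) (eAnd (eLt z xZ)
  (eOr (eAnd (xfalse w t) (xpetal w t z e)) (eAnd (eNot (xfalse w t)) (xeql e (xzh z)))))"
definition "xfam w t e = eIte (eEq e xT) (xfirst w t) (eIte (eEq t (N 0)) (eBo (xinit e))
  (eBo (xgrow w (Mi t (N 1)) (xG w (Mi t (N 1)) xT) e)))"

subsection \<open>The edges\<close>

definition "xcm w e = Rd 8 (Pl (eMul w xT) e)"
definition "xrk w e = eCount [w, e] e (\<lambda>e'. xcm w e')"
definition "xblk x = eDiv x (xpw (Pl xb xr))"
definition "xass x = xdig x xr xb"
definition "xadv x = xdig x (N 0) xr"
definition "xsatl x e = eEx [x, e] x2n (\<lambda>l. eAnd (xin l e) (eAnd (eEq (eDiv (eDiv l (N 2)) xb) (xblk x))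
  (eEq (xdig (xass x) (eMod (eDiv l (N 2)) xb) (N 1)) (eMod l (N 2)))))"
definition "xcov x u = eOr
  (eAnd (eLt u xnc) (eOr (eEq (Pl (eMod (eDiv u (N 2)) xk) (N 1)) xk) (eOr
    (eAnd (eEq (xblk x) (eMod (eDiv u (N 2)) xk)) (eEq (xdig (xadv x) (eDiv u (eMul (N 2) xk)) (N 1)) (eMod u (N 2))))
    (eAnd (eEq (xblk x) (Pl (eMod (eDiv u (N 2)) xk) (N 1))) (eNot (eEq (xdig (xadv x) (eDiv u (eMul (N 2) xk)) (N 1)) (eMod u (N 2))))))))
  (eAnd (eNot (eLt u xnc)) (eAll [x, u] xT (\<lambda>e. eImp (eAnd (xcm (xadv x) e) (eEq (xrk (xadv x) e) (Mi u xnc))) (xsatl x e))))"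
definition "xhs y x t = Rd 9 (Pl (eMul (Pl (eMul y xNS) x) (Pl xh (N 1))) t)"
definition "xedge x c = eEx [x, c] xhk (\<lambda>a. eAnd
  (eEq (eMod (eDiv a (xpt xh (xblk x))) xh) (xhs (xdig c (eMul (eMul (N 2) xlam) xhk) (eMul (eMul (N 2) xlam) xh)) x xh))
  (xcov x (xdig c (eMul (eMul (N 2) xlam) a) (eMul (N 2) xlam))))"

section \<open>Agreement of the expressions with the notions of the reduction\<close>

context reduction
begin

definition tab_par :: "arrays \<Rightarrow> bool" where
  "tab_par S \<longleftrightarrow> S 30 0 = d \<and> S 30 1 = k \<and> S 30 2 = c2 \<and> S 30 3 = c3 \<and> max (S 31 0) (S 30 4) = n"

definition tab_pw :: "arrays \<Rightarrow> bool" where "tab_pw S \<longleftrightarrow> S 4 = pw"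

definition tab_pt :: "arrays \<Rightarrow> bool" where
  "tab_pt S \<longleftrightarrow> (\<forall>z j. z \<le> b + alp \<longrightarrow> j < E \<longrightarrow> S 5 (z * E + j) = z ^ j)"

lemma tab_upd [simp]:
  "a \<noteq> 30 \<Longrightarrow> a \<noteq> 31 \<Longrightarrow> tab_par (S(a := f)) = tab_par S"
  "a \<noteq> 4 \<Longrightarrow> tab_pw (S(a := f)) = tab_pw S"
  "a \<noteq> 5 \<Longrightarrow> tab_pt (S(a := f)) = tab_pt S"
  by (simp_all add: tab_par_def tab_pw_def tab_pt_def)

lemma eval_par [simp]:
  assumes "tab_par S"
  shows "eval xd \<sigma> S = d" "eval xk \<sigma> S = k" "eval xn \<sigma> S = n" "eval x2n \<sigma> S = 2 * n"
    "eval xb \<sigma> S = b" "eval x2b \<sigma> S = 2 * b" "eval xE \<sigma> S = E"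
proof -
  show p: "eval xd \<sigma> S = d" "eval xk \<sigma> S = k" "eval xn \<sigma> S = n"
    using assms by (auto simp: xd_def xk_def xn_def tab_par_def max_def)
  then show "eval x2n \<sigma> S = 2 * n" "eval xb \<sigma> S = b" "eval xE \<sigma> S = E"
    by (simp_all add: x2n_def xb_def b_def E_def xE_def)
  then show "eval x2b \<sigma> S = 2 * b" by (simp add: x2b_def)
qed

lemma eval_pw [simp]: "tab_pw S \<Longrightarrow> eval (xpw e) \<sigma> S = pw (eval e \<sigma> S)"
  by (simp add: xpw_def tab_pw_def)

lemma eval_lam [simp]:
  assumes "tab_par S" "tab_pw S"
  shows "eval xlam \<sigma> S = lam" "eval xg \<sigma> S = g" "eval xq \<sigma> S = q" "eval xr \<sigma> S = r" "eval xalp \<sigma> S = alp"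
    "eval xT \<sigma> S = T" "eval xZ \<sigma> S = Z" "eval xnc \<sigma> S = nc" "eval xNS \<sigma> S = NS"
    "eval (xdig x p l) \<sigma> S = dig (eval x \<sigma> S) (eval p \<sigma> S) (eval l \<sigma> S)"
proof -
  show l: "eval xlam \<sigma> S = lam" for \<sigma> using assms by (simp add: xlam_def eval_eCount lam_def)
  then show g: "eval xg \<sigma> S = g" using assms by (simp add: xg_def g_def)
  then show q: "eval xq \<sigma> S = q" using assms by (simp add: xq_def q_def tab_par_def)
  then show r: "eval xr \<sigma> S = r" using assms g by (simp add: xr_def r_def)
  show "eval xalp \<sigma> S = alp" using assms l by (simp add: xalp_def alp_def tab_par_def)
  show T: "eval xT \<sigma> S = T" using assms l by (simp add: xT_def T_def)
  then show "eval xZ \<sigma> S = Z" using assms by (simp add: xZ_def Z_def)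
  show "eval xnc \<sigma> S = nc" "eval xNS \<sigma> S = NS" using assms r by (simp_all add: xnc_def nc_def xNS_def NS_def)
  show "eval (xdig x p l) \<sigma> S = dig (eval x \<sigma> S) (eval p \<sigma> S) (eval l \<sigma> S)" using assms by (simp add: xdig_def dig_def)
qed

lemma eval_pt [simp]:
  assumes "tab_par S" "tab_pw S" "tab_pt S"
  shows "eval (xpt z j) \<sigma> S = pt (eval z \<sigma> S) (eval j \<sigma> S)" "eval xh \<sigma> S = h" "eval xhk \<sigma> S = hk" "eval xNU \<sigma> S = NU"
proof -
  show p: "eval (xpt z j) \<sigma> S = pt (eval z \<sigma> S) (eval j \<sigma> S)" for z j \<sigma>
    using assms by (simp add: xpt_def pt_def tab_pt_def)
  show h: "eval xh \<sigma> S = h" for \<sigma> using assms p by (simp add: xh_def eval_eCount h_def)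
  then show hk: "eval xhk \<sigma> S = hk" using assms p by (simp add: xhk_def hk_def)
  then show "eval xNU \<sigma> S = NU" using assms h by (simp add: xNU_def NU_def)
qed

lemma tr_clause [simp]:
  assumes "tab_par S" "tab_pw S"
  shows "tr (xin l e) \<sigma> S \<longleftrightarrow> (\<exists>i<d. dig (eval e \<sigma> S) (lam * i) lam = eval l \<sigma> S)"
    "tr (xsub e e') \<sigma> S \<longleftrightarrow> lits (eval e \<sigma> S) \<subseteq> lits (eval e' \<sigma> S)"
    "tr (xeql e e') \<sigma> S \<longleftrightarrow> lits (eval e \<sigma> S) = lits (eval e' \<sigma> S)"
    "eval (xcard e) \<sigma> S = card (lits (eval e \<sigma> S))"
    "tr (xcanon e) \<sigma> S \<longleftrightarrow> canon (eval e \<sigma> S)"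
    "tr (xfalse w t) \<sigma> S \<longleftrightarrow> false_at (eval w \<sigma> S) (eval t \<sigma> S)"
proof -
  show i: "tr (xin l e) \<sigma> S \<longleftrightarrow> (\<exists>i<d. dig (eval e \<sigma> S) (lam * i) lam = eval l \<sigma> S)" for l e \<sigma>
    using assms by (simp add: xin_def tr_eEx)
  show s: "tr (xsub e e') \<sigma> S \<longleftrightarrow> lits (eval e \<sigma> S) \<subseteq> lits (eval e' \<sigma> S)" for e e' \<sigma>
    using assms by (auto simp: xsub_def tr_eAll i lits_def)
  then show q: "tr (xeql e e') \<sigma> S \<longleftrightarrow> lits (eval e \<sigma> S) = lits (eval e' \<sigma> S)" for e e' \<sigma>
    by (auto simp: xeql_def)
  show "eval (xcard e) \<sigma> S = card (lits (eval e \<sigma> S))"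
  proof -
    have "eval (xcard e) \<sigma> S = (\<Sum>v<2 * n. of_bool (\<exists>i<d. dig (eval e \<sigma> S) (lam * i) lam = v))"
      using assms by (simp add: xcard_def eval_eCount i)
    also have "\<dots> = card ({..<2 * n} \<inter> {v. \<exists>i<d. dig (eval e \<sigma> S) (lam * i) lam = v})"
      by (subst sum_of_bool_eq) simp_all
    also have "{..<2 * n} \<inter> {v. \<exists>i<d. dig (eval e \<sigma> S) (lam * i) lam = v} = lits (eval e \<sigma> S)"
      by (auto simp: lits_def)
    finally show ?thesis .
  qed
  show "tr (xcanon e) \<sigma> S \<longleftrightarrow> canon (eval e \<sigma> S)" by (simp add: xcanon_def tr_eAll q canon_def)
  show "tr (xfalse w t) \<sigma> S \<longleftrightarrow> false_at (eval w \<sigma> S) (eval t \<sigma> S)"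
    using assms by (simp add: xfalse_def tr_eEx false_at_def)
qed

end

text \<open>The address at which clause \<open>c\<close> starts. Clauses differ in length, so it has
  to be accumulated.\<close>

primrec posn :: "(nat \<Rightarrow> nat) \<Rightarrow> nat \<Rightarrow> nat" where
  "posn inp 0 = 2"
| "posn inp (Suc c) = posn inp c + (inp (posn inp c) + 1)"

context good_reduction
begin

text \<open>Every set of an admissible family has exactly one canonical code below
  \<open>T\<close>.\<close>

lemma card_eq_sum_canon:
  assumes "ok_fam G" "K \<subseteq> G"
  shows "(\<Sum>e<T. of_bool (canon e \<and> lits e \<in> K)) = card K"
proof -
  let ?A = "{e. e < T \<and> canon e \<and> lits e \<in> K}"
  have "(\<Sum>e<T. of_bool (canon e \<and> lits e \<in> K)) = card ({..<T} \<inter> {e. canon e \<and> lits e \<in> K})"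
    by (subst sum_of_bool_eq) simp_all
  also have "{..<T} \<inter> {e. canon e \<and> lits e \<in> K} = ?A" by auto
  also have "card ?A = card (lits ` ?A)"
    by (rule card_image[symmetric], rule inj_on_subset[OF canon_inj]) auto
  also have "lits ` ?A = K"
  proof
    show "lits ` ?A \<subseteq> K" by auto
    show "K \<subseteq> lits ` ?A"
    proof
      fix A assume A: "A \<in> K"
      then obtain e where "e < T" "canon e" "lits e = A" using ex_canon[OF assms(1)] assms(2) by blast
      then show "A \<in> lits ` ?A" using A by blast
    qed
  qed
  finally show ?thesis .
qed

definition row :: "arrays \<Rightarrow> nat \<Rightarrow> nat \<Rightarrow> bool" where
  "row S w t \<longleftrightarrow> (\<forall>e<T. S 7 ((w * (T + 1) + t) * (T + 1) + e) = of_bool (lits e \<in> fam w t))"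

lemma tr_min:
  assumes "tab_par S" "tab_pw S" "row S (eval w \<sigma> S) (eval t \<sigma> S)" "eval e \<sigma> S < T"
  shows "tr (xmin w t e) \<sigma> S \<longleftrightarrow> lits (eval e \<sigma> S) \<in> minimal_sets (fam (eval w \<sigma> S) (eval t \<sigma> S))"
proof -
  let ?F = "fam (eval w \<sigma> S) (eval t \<sigma> S)" and ?A = "lits (eval e \<sigma> S)"
  have G: "tr (xG w t e') \<sigma>' S \<longleftrightarrow> lits (eval e' \<sigma>' S) \<in> ?F"
    if "eval e' \<sigma>' S < T" "eval w \<sigma>' S = eval w \<sigma> S" "eval t \<sigma>' S = eval t \<sigma> S" for e' \<sigma>'
    using assms that by (simp add: tr_def xG_def row_def)
  have "tr (xmin w t e) \<sigma> S \<longleftrightarrow> ?A \<in> ?F \<and> (\<forall>v<T. lits v \<in> ?F \<and> lits v \<subseteq> ?A \<longrightarrow> ?A \<subseteq> lits v)"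
    using assms by (simp add: xmin_def tr_eAll G)
  also have "\<dots> \<longleftrightarrow> ?A \<in> minimal_sets ?F"
  proof -
    have "(\<forall>v<T. lits v \<in> ?F \<and> lits v \<subseteq> ?A \<longrightarrow> ?A \<subseteq> lits v) \<longleftrightarrow> (\<forall>B\<in>?F. \<not> B \<subset> ?A)"
    proof
      assume H: "\<forall>v<T. lits v \<in> ?F \<and> lits v \<subseteq> ?A \<longrightarrow> ?A \<subseteq> lits v"
      show "\<forall>B\<in>?F. \<not> B \<subset> ?A"
      proof
        fix B assume B: "B \<in> ?F"
        then obtain v where "v < T" "lits v = B" using ex_canon[OF ok_fam] by blast
        then show "\<not> B \<subset> ?A" using H B by blast
      qed
    qed blast
    then show ?thesis by (simp add: minimal_sets_def)
  qed
  finally show ?thesis .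
qed

lemma zi_le: "zi z \<le> d" 
  using mod_less_divisor[of "d + 1" "z div T"] by (simp add: zi_def)

lemma tr_fl:
  assumes "tab_par S" "tab_pw S" "tab_pt S" "row S (eval w \<sigma> S) (eval t \<sigma> S)"
  shows "tr (xfl w t z) \<sigma> S \<longleftrightarrow> is_fl (fam (eval w \<sigma> S) (eval t \<sigma> S)) (eval z \<sigma> S)"
proof -
  let ?F = "fam (eval w \<sigma> S) (eval t \<sigma> S)" and ?z = "eval z \<sigma> S"
  let ?P = "petal_sets ?F (zc ?z) (zh ?z)"
  have zz: "eval (xzc z) \<sigma>' S = zc (eval z \<sigma>' S)" "eval (xzi z) \<sigma>' S = zi (eval z \<sigma>' S)"
    "lits (eval (xzh z) \<sigma>' S) = zh (eval z \<sigma>' S)" for \<sigma>'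
    using assms by (simp_all add: xzc_def zc_def xzi_def zi_def xzh_def zh_def)
  define x where "x = fr [w, t, z]"
  have fresh: "eval w (\<sigma>(x := v)) S = eval w \<sigma> S" "eval t (\<sigma>(x := v)) S = eval t \<sigma> S" "eval z (\<sigma>(x := v)) S = eval z \<sigma> S" for v
    unfolding x_def by simp_all
  have "eval (eCount [w, t, z] xT (\<lambda>e. eAnd (xcanon e) (eAnd (xmin w t e) (eAnd (eEq (xcard e) (xzc z)) (xsub (xzh z) e))))) \<sigma> S
    = (\<Sum>e<T. of_bool (canon e \<and> lits e \<in> minimal_sets ?F \<and> card (lits e) = zc ?z \<and> zh ?z \<subseteq> lits e))"
    unfolding eval_eCount x_def[symmetric] eval_lam(6)[OF assms(1,2)]
  proof (rule sum.cong[OF refl])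
    fix e assume e: "e \<in> {..<T}"
    have m: "tr (xmin w t (V x)) (\<sigma>(x := e)) S \<longleftrightarrow> lits e \<in> minimal_sets ?F"
      using tr_min[of S w "\<sigma>(x := e)" t "V x"] assms e fresh by simp
    show "of_bool (tr (eAnd (xcanon (V x)) (eAnd (xmin w t (V x)) (eAnd (eEq (xcard (V x)) (xzc z)) (xsub (xzh z) (V x))))) (\<sigma>(x := e)) S) =
      of_bool (canon e \<and> lits e \<in> minimal_sets ?F \<and> card (lits e) = zc ?z \<and> zh ?z \<subseteq> lits e)"
      using assms by (simp add: m zz fresh)
  qed
  also have "\<dots> = (\<Sum>e<T. of_bool (canon e \<and> lits e \<in> ?P))"
    by (rule sum.cong) (auto simp: petal_sets_def)
  also have "\<dots> = card ?P"
    by (rule card_eq_sum_canon[OF ok_fam]) (auto simp: petal_sets_def minimal_sets_def)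
  finally have count: "eval (eCount [w, t, z] xT (\<lambda>e. eAnd (xcanon e) (eAnd (xmin w t e) (eAnd (eEq (xcard e) (xzc z)) (xsub (xzh z) e))))) \<sigma> S = card ?P" .
  have "finite (zh ?z)" unfolding zh_def using lits_sub finite_subset by blast
  then have ne: "0 < card (zh ?z) \<longleftrightarrow> zh ?z \<noteq> {}" by (simp add: card_gt_0_iff)
  have th: "pt alp (2 * zi ?z - 1) = thr alp (zi ?z)"
    using zi_le[of ?z] pos(2) by (simp add: pt_def thr_def E_def)
  show ?thesis
    unfolding xfl_def is_fl_def flower_def using assms
    by (simp only: tr_basic eval_pt eval_basic eval.simps zz eval_lam count tr_clause th ne) 
qed

lemma eval_first:
  assumes "tab_par S" "tab_pw S" "tab_pt S" "row S (eval w \<sigma> S) (eval t \<sigma> S)"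
  shows "eval (xfirst w t) \<sigma> S = first_fl (fam (eval w \<sigma> S) (eval t \<sigma> S))"
proof -
  let ?F = "fam (eval w \<sigma> S) (eval t \<sigma> S)"
  define x where "x = fr [w, t]"
  define y where "y = fr [w, t, V x]"
  have fx: "eval w (\<sigma>(x := v, y := u)) S = eval w \<sigma> S" "eval t (\<sigma>(x := v, y := u)) S = eval t \<sigma> S" for v u
    unfolding x_def y_def by simp_all
  have fl: "tr (xfl w t (V y)) (\<sigma>(x := v, y := u)) S \<longleftrightarrow> is_fl ?F u" for v u
    using tr_fl[of S w "\<sigma>(x := v, y := u)" t "V y"] assms fx by simp
  have "tr (eAll [w, t, V x] (Pl (V x) (N 1)) (\<lambda>z'. eNot (xfl w t z'))) (\<sigma>(x := v)) S \<longleftrightarrow> (\<forall>u<v + 1. \<not> is_fl ?F u)" for v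
    unfolding tr_eAll y_def[symmetric] by (simp add: fl)
  then show ?thesis
    unfolding xfirst_def eval_eCount x_def[symmetric] eval_lam(7)[OF assms(1,2)] first_fl_def by (simp only:)
qed

lemma tr_grow:
  assumes "tab_par S" "tab_pw S" "row S (eval w \<sigma> S) (eval t \<sigma> S)"
    and z: "eval z \<sigma> S = first_fl (fam (eval w \<sigma> S) (eval t \<sigma> S))" and e: "eval e \<sigma> S < T"
  shows "tr (xgrow w t z e) \<sigma> S \<longleftrightarrow> lits (eval e \<sigma> S) \<in> fam (eval w \<sigma> S) (Suc (eval t \<sigma> S))"
proof -
  let ?F = "fam (eval w \<sigma> S) (eval t \<sigma> S)" and ?z = "eval z \<sigma> S" and ?A = "lits (eval e \<sigma> S)"
  let ?b = "false_at (eval w \<sigma> S) (eval t \<sigma> S)"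
  have zz: "eval (xzc z) \<sigma>' S = zc (eval z \<sigma>' S)" "lits (eval (xzh z) \<sigma>' S) = zh (eval z \<sigma>' S)" for \<sigma>'
    using assms by (simp_all add: xzc_def zc_def xzh_def zh_def)
  define x where "x = fr [w, t, z, e]"
  have fresh: "eval w (\<sigma>(x := v)) S = eval w \<sigma> S" "eval t (\<sigma>(x := v)) S = eval t \<sigma> S"
     "eval z (\<sigma>(x := v)) S = ?z" "eval e (\<sigma>(x := v)) S = eval e \<sigma> S" for v
    unfolding x_def by simp_all
  have diff: "tr (eAll [e, V x, z] x2n (\<lambda>l. eIff (xin l e) (eAnd (xin l (V x)) (eNot (xin l (xzh z)))))) (\<sigma>(x := v)) S
      \<longleftrightarrow> ?A = lits v - zh ?z" for v
  proof -
    define y where "y = fr [e, V x, z]"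
    have f2: "eval e (\<sigma>(x := v, y := u)) S = eval e \<sigma> S" "eval z (\<sigma>(x := v, y := u)) S = ?z" "x \<noteq> y" for u
      unfolding y_def using fresh by simp_all
    have hz: "(\<exists>i<d. dig (eval (xzh z) (\<sigma>(x := v, y := u)) S) (lam * i) lam = u) \<longleftrightarrow> u \<in> zh ?z" if "u < 2 * n" for u
      using zz(2)[of "\<sigma>(x := v, y := u)"] that f2 unfolding lits_def by auto
    have "tr (eAll [e, V x, z] x2n (\<lambda>l. eIff (xin l e) (eAnd (xin l (V x)) (eNot (xin l (xzh z)))))) (\<sigma>(x := v)) S
      \<longleftrightarrow> (\<forall>u<2 * n. (\<exists>i<d. dig (eval e \<sigma> S) (lam * i) lam = u) \<longleftrightarrow> (\<exists>i<d. dig v (lam * i) lam = u) \<and> \<not> u \<in> zh ?z)"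
      unfolding tr_eAll y_def[symmetric] eval_par(4)[OF assms(1)]
      by (intro all_cong) (use assms f2 hz in \<open>simp add: tr_clause\<close>)
    also have "\<dots> \<longleftrightarrow> ?A = lits v - zh ?z" by (auto simp: lits_def)
    finally show ?thesis .
  qed
  have petal: "tr (xpetal w t z e) \<sigma> S \<longleftrightarrow> (\<exists>v<T. lits v \<in> petal_sets ?F (zc ?z) (zh ?z) \<and> ?A = lits v - zh ?z)"
    unfolding xpetal_def tr_eEx x_def[symmetric] eval_lam(6)[OF assms(1,2)]
  proof (intro ex_cong conj_cong refl)
    fix v assume v: "v < T"
    have m: "tr (xmin w t (V x)) (\<sigma>(x := v)) S \<longleftrightarrow> lits v \<in> minimal_sets ?F"
      using tr_min[of S w "\<sigma>(x := v)" t "V x"] assms v fresh by simp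
    show "tr (eAnd (xmin w t (V x)) (eAnd (eEq (xcard (V x)) (xzc z)) (eAnd (xsub (xzh z) (V x))
      (eAll [e, V x, z] x2n (\<lambda>l. eIff (xin l e) (eAnd (xin l (V x)) (eNot (xin l (xzh z))))))))) (\<sigma>(x := v)) S
      \<longleftrightarrow> lits v \<in> petal_sets ?F (zc ?z) (zh ?z) \<and> ?A = lits v - zh ?z"
      using assms by (simp add: m diff zz fresh petal_sets_def)
  qed
  have G: "tr (xG w t e) \<sigma> S \<longleftrightarrow> ?A \<in> ?F" using assms by (simp add: tr_def xG_def row_def)
  have grow: "tr (xgrow w t z e) \<sigma> S \<longleftrightarrow> ?A \<in> ?F \<or> ?z < Z \<and>
    (if ?b then \<exists>v<T. lits v \<in> petal_sets ?F (zc ?z) (zh ?z) \<and> ?A = lits v - zh ?z else ?A = zh ?z)"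
    using assms(1,2) by (simp add: xgrow_def G petal zz)
  have F: "fam (eval w \<sigma> S) (Suc (eval t \<sigma> S)) = family_next pick ?b ?F" by (simp add: fam_def)
  show ?thesis
  proof (cases "?z < Z")
    case False
    then show ?thesis unfolding grow F family_next_def pick_def z by simp
  next
    case True
    have N: "family_next pick ?b ?F = ?F \<union> branch ?b ?F (zc ?z) (zh ?z)"
      using True unfolding family_next_def pick_def z by simp
    have "?A \<in> branch ?b ?F (zc ?z) (zh ?z) \<longleftrightarrow>
      (if ?b then \<exists>v<T. lits v \<in> petal_sets ?F (zc ?z) (zh ?z) \<and> ?A = lits v - zh ?z else ?A = zh ?z)"
    proof (cases ?b)
      case b: True
      have "?A \<in> (\<lambda>A. A - zh ?z) ` petal_sets ?F (zc ?z) (zh ?z) \<longleftrightarrow>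
        (\<exists>v<T. lits v \<in> petal_sets ?F (zc ?z) (zh ?z) \<and> ?A = lits v - zh ?z)"
      proof
        assume "?A \<in> (\<lambda>A. A - zh ?z) ` petal_sets ?F (zc ?z) (zh ?z)"
        then obtain B where B: "B \<in> petal_sets ?F (zc ?z) (zh ?z)" "?A = B - zh ?z" by blast
        then have "B \<in> ?F" by (auto simp: petal_sets_def minimal_sets_def)
        then obtain v where "v < T" "lits v = B" using ex_canon[OF ok_fam] by blast
        then show "\<exists>v<T. lits v \<in> petal_sets ?F (zc ?z) (zh ?z) \<and> ?A = lits v - zh ?z" using B by blast
      qed blast
      then show ?thesis using b by (simp add: branch_def)
    qed (simp add: branch_def)
    then show ?thesis unfolding grow F N using True by blast
  qed
qed

definition gG :: "nat \<Rightarrow> nat" where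
  "gG x = (if x mod (T + 1) = T then first_fl (fam (x div (T + 1) div (T + 1)) (x div (T + 1) mod (T + 1)))
     else of_bool (lits (x mod (T + 1)) \<in> fam (x div (T + 1) div (T + 1)) (x div (T + 1) mod (T + 1))))"

lemma gG_at: "e \<le> T \<Longrightarrow> t \<le> T \<Longrightarrow> gG ((w * (T + 1) + t) * (T + 1) + e) =
  (if e = T then first_fl (fam w t) else of_bool (lits e \<in> fam w t))"
proof -
  assume "e \<le> T" "t \<le> T"
  then have "((w * (T + 1) + t) * (T + 1) + e) div (T + 1) = w * (T + 1) + t"
    "((w * (T + 1) + t) * (T + 1) + e) mod (T + 1) = e" "(w * (T + 1) + t) div (T + 1) = w" "(w * (T + 1) + t) mod (T + 1) = t"
    by (simp_all only: div_mult_self3 mod_mult_self3 div_less mod_less less_Suc_eq_le Suc_eq_plus1[symmetric]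
        add_0_right nat.simps(3) not_False_eq_True)
  then show ?thesis unfolding gG_def by (simp only:)
qed

definition init_ok :: "arrays \<Rightarrow> bool" where
  "init_ok S \<longleftrightarrow> (\<forall>e<T. (\<exists>c<S 31 1. \<forall>l<2 * n. l \<in> lits e \<longleftrightarrow> (\<exists>i<S 31 (S 6 c). S 31 (S 6 c + 1 + i) = l)) \<longleftrightarrow> lits e \<in> Cl)"

lemma tr_init:
  assumes "tab_par S" "tab_pw S" "init_ok S" "eval e \<sigma> S < T"
  shows "tr (xinit e) \<sigma> S \<longleftrightarrow> lits (eval e \<sigma> S) \<in> Cl"
proof -
  have "tr (xinit e) \<sigma> S \<longleftrightarrow> (\<exists>c<S 31 1. \<forall>l<2 * n. l \<in> lits (eval e \<sigma> S) \<longleftrightarrow> (\<exists>i<S 31 (S 6 c). S 31 (S 6 c + 1 + i) = l))"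
    using assms by (simp add: xinit_def tr_eEx tr_eAll lits_def)
  then show ?thesis using assms(3,4) by (simp add: init_ok_def)
qed

text \<open>An entry depends only on smaller indices: an ordinary entry on the previous row and its
  cached flower, the cache column on the ordinary entries of its own row.\<close>

lemma eval_fam:
  assumes "tab_par S" "tab_pw S" "tab_pt S" "init_ok S"
    and S7: "\<And>y. y < x \<Longrightarrow> S 7 y = gG y"
    and x: "x = (eval w \<sigma> S * (T + 1) + eval t \<sigma> S) * (T + 1) + eval e \<sigma> S" "eval t \<sigma> S \<le> T" "eval e \<sigma> S \<le> T"
  shows "eval (xfam w t e) \<sigma> S = gG x"
proof -
  let ?w = "eval w \<sigma> S" and ?t = "eval t \<sigma> S" and ?e = "eval e \<sigma> S"
  have row: "row S ?w t'" if "t' < ?t \<or> t' = ?t \<and> ?e = T" for t'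
    unfolding row_def
  proof (intro allI impI)
    fix e' assume e': "e' < T"
    have "(?w * (T + 1) + t') * (T + 1) + e' < x"
    proof (cases "t' < ?t")
      case True
      have "(?w * (T + 1) + t') * (T + 1) + e' < (?w * (T + 1) + t') * (T + 1) + (T + 1)" using e' by simp
      also have "\<dots> = (?w * (T + 1) + (t' + 1)) * (T + 1)" by (simp add: algebra_simps)
      also have "\<dots> \<le> (?w * (T + 1) + ?t) * (T + 1)" using True by (intro mult_right_mono) auto
      finally show ?thesis unfolding x(1) by linarith
    next
      case False
      then show ?thesis using that e' unfolding x(1) by simp
    qed
    then show "S 7 ((?w * (T + 1) + t') * (T + 1) + e') = of_bool (lits e' \<in> fam ?w t')"
      using S7 gG_at[of e' t' ?w] e' that x(2) by auto
  qed
  have g: "gG x = (if ?e = T then first_fl (fam ?w ?t) else of_bool (lits ?e \<in> fam ?w ?t))"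
    using gG_at[OF x(3,2)] x(1) by simp
  consider "?e = T" | "?e < T" "?t = 0" | t' where "?e < T" "?t = Suc t'" using x(3) by (metis le_neq_implies_less not0_implies_Suc)
  then show ?thesis
  proof cases
    case 1
    then show ?thesis using eval_first[of S w \<sigma> t] row[of ?t] assms g by (simp add: xfam_def)
  next
    case 2
    then show ?thesis using tr_init[of S e \<sigma>] assms g by (simp add: xfam_def fam_def)
  next
    case (3 t')
    let ?te = "Mi t (N 1)"
    have te: "eval ?te \<sigma> S = t'" using 3 by simp
    have "(?w * (T + 1) + t') * (T + 1) + T < x"
    proof -
      have "(?w * (T + 1) + t') * (T + 1) + T < (?w * (T + 1) + (t' + 1)) * (T + 1)" by (simp add: algebra_simps)
      also have "\<dots> \<le> x" unfolding x(1) using 3 by simp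
      finally show ?thesis .
    qed
    then have z: "eval (xG w ?te xT) \<sigma> S = first_fl (fam ?w t')"
      using S7 gG_at[of T t' ?w] te x(2) 3 assms by (simp add: xG_def)
    have "row S (eval w \<sigma> S) (eval ?te \<sigma> S)" unfolding te using row[of t'] 3 by simp
    then have "tr (xgrow w ?te (xG w ?te xT) e) \<sigma> S \<longleftrightarrow> lits ?e \<in> fam ?w ?t"
      using tr_grow[of S w \<sigma> ?te "xG w ?te xT" e] assms(1,2) z 3 te by simp
    then show ?thesis using 3 assms g by (simp add: xfam_def)
  qed
qed

end

definition "xcmf w e = eBo (eAnd (xcanon e) (xmin w xT e))"
definition "xT1 = Pl xT (N 1)"
definition "xh1 = Pl xh (N 1)"
definition "prev = Mi (V 0) (N 1)"
text \<open>The recursion of \<open>split_class\<close>: the step number is the lowest digit of the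
  index, so cell \<open>i - 1\<close> describes the same seed and row one step earlier.\<close>

definition "xhsf i t x y = eIte (eEq t (N 0)) (N 0) (eIte (eAnd
   (eEq (Rd 9 (Mi i (N 1))) (xdig y (eMul xlam (eMul (N 2) (Mi t (N 1)))) xlam))
   (eEq (xdig x (xdig y (eMul xlam (Pl (eMul (N 2) (Mi t (N 1))) (N 1))) xlam) (N 1)) (N 1)))
  (Mi t (N 1)) (Rd 9 (Mi i (N 1))))"

text \<open>Each table uses only the parameters, the input, tables further up and its own earlier
  entries. The last one has the format of \<open>encode_instance\<close>, with the matrix shifted by
  the two size entries.\<close>

definition reduction_fills :: "fill list" where
  "reduction_fills =
    [Fill 4 0 (Pl x2b (N 1)) (eIte (eEq (V 0) (N 0)) (N 1) (Pl (Rd 4 prev) (Rd 4 prev))),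
     Fill 5 0 (eMul (Pl (Pl xb xalp) (N 1)) xE) (eIte (eEq (eMod (V 0) xE) (N 0)) (N 1) (eMul (Rd 5 prev) (eDiv (V 0) xE))),
     Fill 6 0 (Rd 31 (N 1)) (eIte (eEq (V 0) (N 0)) (N 2) (Pl (Rd 6 prev) (Pl (Rd 31 (Rd 6 prev)) (N 1)))),
     Fill 7 0 (eMul (eMul (xpw xr) xT1) xT1) (xfam (eDiv (eDiv (V 0) xT1) xT1) (eMod (eDiv (V 0) xT1) xT1) (eMod (V 0) xT1)),
     Fill 8 0 (eMul (xpw xr) xT) (xcmf (eDiv (V 0) xT) (eMod (V 0) xT)),
     Fill 9 0 (eMul (eMul (xpw (eMul (eMul (N 2) xlam) xh)) xNS) xh1)
       (xhsf (V 0) (eMod (V 0) xh1) (eMod (eDiv (V 0) xh1) xNS) (eDiv (eDiv (V 0) xh1) xNS)),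
     Fill 0 0 (Pl (N 2) (eMul xNS xNU)) (eIte (eEq (V 0) (N 0)) xNS (eIte (eEq (V 0) (N 1)) xNU
       (eBo (xedge (eDiv (Mi (V 0) (N 2)) xNU) (eMod (Mi (V 0) (N 2)) xNU)))))]"

definition put :: "nat \<Rightarrow> nat \<Rightarrow> (nat \<Rightarrow> nat) \<Rightarrow> arrays \<Rightarrow> arrays" where
  "put a n g S = S(a := (\<lambda>y. if y < n then g y else S a y))"

lemma put_simps [simp]:
  "put a n g S a = (\<lambda>y. if y < n then g y else S a y)" "a' \<noteq> a \<Longrightarrow> put a n g S a' = S a'"
  by (simp_all add: put_def)

lemma run_fill_put:
  assumes "eval e1 (\<lambda>_. 0) S = n" "\<And>i. i < n \<Longrightarrow> eval e2 ((\<lambda>_. 0)(x := i)) (put a i g S) = g i"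
  shows "run_fill (Fill a x e1 e2) S = put a n g S"
  using fill_upto_eq[of n e2 x S a g] assms by (simp add: put_def)

lemma put_bounded:
  "\<forall>a x. S a x \<le> v \<Longrightarrow> (\<And>y. y < n \<Longrightarrow> g y \<le> v) \<Longrightarrow> \<forall>a' x. put a n g S a' x \<le> v"
  by (auto simp: put_def)

section \<open>Contents and bounds of the tables\<close>

context good_reduction
begin

lemma tab_put [simp]:
  "a \<noteq> 30 \<Longrightarrow> a \<noteq> 31 \<Longrightarrow> tab_par (put a n' f S) = tab_par S"
  "a \<noteq> 4 \<Longrightarrow> tab_pw (put a n' f S) = tab_pw S"
  "a \<noteq> 5 \<Longrightarrow> tab_pt (put a n' f S) = tab_pt S"
  "a \<noteq> 31 \<Longrightarrow> a \<noteq> 6 \<Longrightarrow> init_ok (put a n' f S) = init_ok S"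
  "a \<noteq> 7 \<Longrightarrow> row (put a n' f S) w t = row S w t"
  by (simp_all add: put_def init_ok_def row_def)

definition tab_cm :: "arrays \<Rightarrow> bool" where
  "tab_cm S \<longleftrightarrow> (\<forall>w<2 ^ r. \<forall>e<T. S 8 (w * T + e) = of_bool (cm w e))"

lemma eval_cmf:
  assumes "tab_par S" "tab_pw S" "row S (eval w \<sigma> S) T" "eval e \<sigma> S < T"
  shows "eval (xcmf w e) \<sigma> S = of_bool (cm (eval w \<sigma> S) (eval e \<sigma> S))"
  using tr_min[of S w \<sigma> xT e] assms by (simp add: xcmf_def cm_def)

lemma tr_cm:
  assumes "tab_par S" "tab_pw S" "tab_cm S" "eval w \<sigma> S < 2 ^ r" "eval e \<sigma> S < T"
  shows "tr (xcm w e) \<sigma> S \<longleftrightarrow> cm (eval w \<sigma> S) (eval e \<sigma> S)"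
  using assms by (simp add: xcm_def tr_def tab_cm_def)

lemma eval_rk:
  assumes "tab_par S" "tab_pw S" "tab_cm S" "eval w \<sigma> S < 2 ^ r" "eval e \<sigma> S < T"
  shows "eval (xrk w e) \<sigma> S = rk (eval w \<sigma> S) (eval e \<sigma> S)"
  unfolding xrk_def eval_eCount rk_def
proof (rule sum.cong[OF refl])
  let ?x = "fr [w, e]"
  fix v assume v: "v \<in> {..<eval e \<sigma> S}"
  have "eval w (\<sigma>(?x := v)) S = eval w \<sigma> S" by simp
  then have "tr (xcm w (V ?x)) (\<sigma>(?x := v)) S \<longleftrightarrow> cm (eval w \<sigma> S) v"
    using tr_cm[of S w "\<sigma>(?x := v)" "V ?x"] assms v by simp
  then show "of_bool (tr (xcm w (V ?x)) (\<sigma>(?x := v)) S) = of_bool (cm (eval w \<sigma> S) v)" by simp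
qed

lemma eval_row:
  assumes "tab_par S" "tab_pw S"
  shows "eval (xblk x) \<sigma> S = blk (eval x \<sigma> S)" "eval (xass x) \<sigma> S = ass (eval x \<sigma> S)" "eval (xadv x) \<sigma> S = adv (eval x \<sigma> S)"
    "tr (xsatl x e) \<sigma> S \<longleftrightarrow> satl (eval x \<sigma> S) (eval e \<sigma> S)"
proof -
  show 1: "eval (xblk x) \<sigma> S = blk (eval x \<sigma> S)" "eval (xass x) \<sigma> S = ass (eval x \<sigma> S)"
    "eval (xadv x) \<sigma> S = adv (eval x \<sigma> S)" for \<sigma>
    using assms by (simp_all add: xblk_def blk_def xass_def ass_def xadv_def adv_def)
  show "tr (xsatl x e) \<sigma> S \<longleftrightarrow> satl (eval x \<sigma> S) (eval e \<sigma> S)"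
    using assms by (simp add: xsatl_def tr_eEx 1 satl_def lits_def)
qed

lemma tr_cov:
  assumes "tab_par S" "tab_pw S" "tab_cm S"
  shows "tr (xcov x u) \<sigma> S \<longleftrightarrow> cov (eval x \<sigma> S) (eval u \<sigma> S)"
proof -
  note ev = eval_row[OF assms(1,2)]
  define y where "y = fr [x, u]"
  have fresh: "eval x (\<sigma>(y := v)) S = eval x \<sigma> S" "eval u (\<sigma>(y := v)) S = eval u \<sigma> S" for v
    unfolding y_def by simp_all
  have ad: "adv z < 2 ^ r" for z by (simp add: adv_eq)
  have "tr (eAll [x, u] xT (\<lambda>e. eImp (eAnd (xcm (xadv x) e) (eEq (xrk (xadv x) e) (Mi u xnc))) (xsatl x e))) \<sigma> S
    \<longleftrightarrow> (\<forall>e<T. cm (adv (eval x \<sigma> S)) e \<and> rk (adv (eval x \<sigma> S)) e = eval u \<sigma> S - nc \<longrightarrow> satl (eval x \<sigma> S) e)"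
    unfolding tr_eAll y_def[symmetric] eval_lam(6)[OF assms(1,2)]
  proof (intro all_cong)
    fix v assume v: "v < T"
    have "tr (xcm (xadv x) (V y)) (\<sigma>(y := v)) S \<longleftrightarrow> cm (adv (eval x \<sigma> S)) v"
      "eval (xrk (xadv x) (V y)) (\<sigma>(y := v)) S = rk (adv (eval x \<sigma> S)) v"
      using tr_cm[of S "xadv x" "\<sigma>(y := v)" "V y"] eval_rk[of S "xadv x" "\<sigma>(y := v)" "V y"] assms v fresh ev ad by simp_all
    then show "tr (eImp (eAnd (xcm (xadv x) (V y)) (eEq (xrk (xadv x) (V y)) (Mi u xnc))) (xsatl x (V y))) (\<sigma>(y := v)) S \<longleftrightarrow>
      (cm (adv (eval x \<sigma> S)) v \<and> rk (adv (eval x \<sigma> S)) v = eval u \<sigma> S - nc \<longrightarrow> satl (eval x \<sigma> S) v)"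
      using assms fresh ev by simp
  qed
  then show ?thesis using assms unfolding xcov_def cov_def by (simp add: ev)
qed

lemma NU_pos: "0 < NU"
  using exps(3) by (simp add: NU_def pw_eq hk_eq)

definition gH :: "nat \<Rightarrow> nat" where
  "gH i = hs (i div (h + 1) div NS) (i div (h + 1) mod NS) (i mod (h + 1))"

lemma eval_hsf:
  assumes "tab_par S" "tab_pw S" "0 < i \<Longrightarrow> S 9 (i - 1) = gH (i - 1)"
    and "eval ei \<sigma> S = i" "eval t \<sigma> S = i mod (h + 1)" "eval x \<sigma> S = i div (h + 1) mod NS" "eval y \<sigma> S = i div (h + 1) div NS"
  shows "eval (xhsf ei t x y) \<sigma> S = gH i"
proof (cases "i mod (h + 1)")
  case 0
  then show ?thesis using assms by (simp add: xhsf_def gH_def hs_def)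
next
  case (Suc t')
  then have i: "0 < i" by (cases i) auto
  have "i = i div (h + 1) * (h + 1) + Suc t'" using Suc by (metis div_mult_mod_eq)
  then have i1: "i - 1 = i div (h + 1) * (h + 1) + t'" by linarith
  have "t' < h + 1" using Suc mod_less_divisor[of "h + 1" i] by linarith
  moreover have "(A * B + s) div B = A" "(A * B + s) mod B = s" if "s < B" for A B s :: nat using that by simp_all
  ultimately have "(i - 1) div (h + 1) = i div (h + 1)" "(i - 1) mod (h + 1) = t'" unfolding i1 by blast+
  then have "S 9 (i - 1) = hs (i div (h + 1) div NS) (i div (h + 1) mod NS) t'" using assms(3)[OF i] by (simp add: gH_def)
  then show ?thesis using assms Suc by (simp add: xhsf_def gH_def hs_def)
qed

definition tab_hs :: "arrays \<Rightarrow> bool" where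
  "tab_hs S \<longleftrightarrow> (\<forall>y<pw (2 * lam * h). \<forall>x<NS. S 9 ((y * NS + x) * (h + 1) + h) = hs y x h)"

lemma tr_edge:
  assumes "tab_par S" "tab_pw S" "tab_pt S" "tab_cm S" "tab_hs S" "eval x \<sigma> S < NS"
  shows "tr (xedge x c) \<sigma> S \<longleftrightarrow> edge (eval x \<sigma> S) (eval c \<sigma> S)"
proof -
  note t = assms(1-4)
  have "2 * lam * h \<le> 2 * lam * (h + h ^ k)" by simp
  then have "2 * lam * h \<le> 2 * b" using exps(3) by linarith
  then have yl: "dig z p (2 * lam * h) < pw (2 * lam * h)" for z p by (simp add: dig_def pw_eq)
  define y where "y = fr [x, c]"
  have fresh: "eval x (\<sigma>(y := v)) S = eval x \<sigma> S" "eval c (\<sigma>(y := v)) S = eval c \<sigma> S" for v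
    unfolding y_def by simp_all
  have hsv: "S 9 ((dig z p (2 * lam * h) * NS + eval x \<sigma> S) * (h + 1) + h) = hs (dig z p (2 * lam * h)) (eval x \<sigma> S) h" for z p
    using assms(5,6) yl[of z p] unfolding tab_hs_def by blast
  show ?thesis
    unfolding xedge_def tr_eEx y_def[symmetric] edge_def eval_pt(3)[OF t(1-3)]
  proof (intro ex_cong conj_cong refl)
    fix v assume "v < hk"
    have "eval (xhs (xdig c (eMul (eMul (N 2) xlam) xhk) (eMul (eMul (N 2) xlam) xh)) x xh) (\<sigma>(y := v)) S
      = hs (dig (eval c \<sigma> S) (2 * lam * hk) (2 * lam * h)) (eval x \<sigma> S) h"
      unfolding xhs_def using t fresh hsv[of "eval c \<sigma> S" "2 * lam * hk"] by simp
    then show "tr (eAnd (eEq (eMod (eDiv (V y) (xpt xh (xblk x))) xh)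
         (xhs (xdig c (eMul (eMul (N 2) xlam) xhk) (eMul (eMul (N 2) xlam) xh)) x xh))
       (xcov x (xdig c (eMul (eMul (N 2) xlam) (V y)) (eMul (N 2) xlam)))) (\<sigma>(y := v)) S \<longleftrightarrow>
      v div pt h (blk (eval x \<sigma> S)) mod h = hs (dig (eval c \<sigma> S) (2 * lam * hk) (2 * lam * h)) (eval x \<sigma> S) h \<and>
      cov (eval x \<sigma> S) (dig (eval c \<sigma> S) (2 * lam * v) (2 * lam))"
      using t fresh by (simp add: tr_cov eval_row)
  qed
qed

definition gP :: "nat \<Rightarrow> nat" where "gP x = (x div E) ^ (x mod E)"
definition gC :: "nat \<Rightarrow> nat" where "gC x = of_bool (cm (x div T) (x mod T))"
definition gO :: "nat \<Rightarrow> nat" where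
  "gO i = (if i = 0 then NS else if i = 1 then NU else of_bool (edge ((i - 2) div NU) ((i - 2) mod NU)))"

definition S1 where "S1 S = put 4 (2 * b + 1) (\<lambda>x. 2 ^ x) S"
definition S2 where "S2 S = put 5 ((b + alp + 1) * E) gP (S1 S)"
definition S3 where "S3 S = put 6 (S 31 1) (posn (S 31)) (S2 S)"
definition S4 where "S4 S = put 7 (pw r * (T + 1) * (T + 1)) gG (S3 S)"
definition S5 where "S5 S = put 8 (pw r * T) gC (S4 S)"
definition S6 where "S6 S = put 9 (pw (2 * lam * h) * NS * (h + 1)) gH (S5 S)"
definition S7 where "S7 S = put 0 (2 + NS * NU) gO (S6 S)"

context
  fixes S :: arrays
  assumes par: "tab_par S"
    and zero: "S 0 = (\<lambda>_. 0)" "S 4 = (\<lambda>_. 0)" "S 5 = (\<lambda>_. 0)" "S 6 = (\<lambda>_. 0)" "S 7 = (\<lambda>_. 0)" "S 8 = (\<lambda>_. 0)" "S 9 = (\<lambda>_. 0)"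
    and init: "\<And>e. e < T \<Longrightarrow> (\<exists>c<S 31 1. \<forall>l<2 * n. l \<in> lits e \<longleftrightarrow>
      (\<exists>i<S 31 (posn (S 31) c). S 31 (posn (S 31) c + 1 + i) = l)) \<longleftrightarrow> lits e \<in> Cl"
begin

lemma par_S: "tab_par (S1 S)" "tab_par (S2 S)" "tab_par (S3 S)" "tab_par (S4 S)" "tab_par (S5 S)" "tab_par (S6 S)"
  using par by (simp_all add: S6_def S5_def S4_def S3_def S2_def S1_def)

lemma pw_S: "tab_pw (S1 S)" "tab_pw (S2 S)" "tab_pw (S3 S)" "tab_pw (S4 S)" "tab_pw (S5 S)" "tab_pw (S6 S)"
proof -
  have "S1 S 4 = pw" by (auto simp: S1_def zero pw_def fun_eq_iff)
  then show "tab_pw (S1 S)" by (simp add: tab_pw_def)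
  then show "tab_pw (S2 S)" "tab_pw (S3 S)" "tab_pw (S4 S)" "tab_pw (S5 S)" "tab_pw (S6 S)"
    by (simp_all add: S6_def S5_def S4_def S3_def S2_def)
qed

lemma E_pos: "0 < E" by (simp add: E_def)

lemma pt_S: "tab_pt (S2 S)" "tab_pt (S3 S)" "tab_pt (S4 S)" "tab_pt (S5 S)" "tab_pt (S6 S)"
proof -
  have "S2 S 5 (z * E + j) = z ^ j" if "z \<le> b + alp" "j < E" for z j
  proof -
    have "z * E + j < (z + 1) * E" using that by simp
    also have "\<dots> \<le> (b + alp + 1) * E" using that by (intro mult_right_mono) auto
    finally show ?thesis using that by (simp add: S2_def gP_def)
  qed
  then show "tab_pt (S2 S)" by (simp add: tab_pt_def)
  then show "tab_pt (S3 S)" "tab_pt (S4 S)" "tab_pt (S5 S)" "tab_pt (S6 S)"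
    by (simp_all add: S6_def S5_def S4_def S3_def)
qed

lemma init_S: "init_ok (S3 S)"
proof -
  have S31: "S3 S 31 = S 31" by (simp add: S3_def S2_def S1_def)
  have S6: "S3 S 6 c = posn (S 31) c" if "c < S 31 1" for c using that by (simp add: S3_def)
  show ?thesis unfolding init_ok_def S31
  proof (intro allI impI)
    fix e assume e: "e < T"
    show "(\<exists>c<S 31 1. \<forall>l<2 * n. l \<in> lits e \<longleftrightarrow> (\<exists>i<S 31 (S3 S 6 c). S 31 (S3 S 6 c + 1 + i) = l)) \<longleftrightarrow> lits e \<in> Cl"
      unfolding init[OF e, symmetric] by (intro ex_cong conj_cong refl) (simp only: S6)
  qed
qed

lemma row_S4:
  assumes "w < 2 ^ r" "t \<le> T" shows "row (S4 S) w t"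
  unfolding row_def
proof (intro allI impI)
  fix e assume e: "e < T"
  have "(w * (T + 1) + t) * (T + 1) + e < (w * (T + 1) + (t + 1)) * (T + 1)" using e by (simp add: algebra_simps)
  also have "\<dots> \<le> ((w + 1) * (T + 1)) * (T + 1)" using assms(2) by (intro mult_right_mono) auto
  also have "\<dots> \<le> (2 ^ r * (T + 1)) * (T + 1)" using assms(1) by (intro mult_right_mono) auto
  also have "\<dots> = pw r * (T + 1) * (T + 1)" using r_le by (simp add: pw_eq)
  finally have "S4 S 7 ((w * (T + 1) + t) * (T + 1) + e) = gG ((w * (T + 1) + t) * (T + 1) + e)" by (simp add: S4_def)
  then show "S4 S 7 ((w * (T + 1) + t) * (T + 1) + e) = of_bool (lits e \<in> fam w t)"
    using gG_at[of e t w] e assms(2) by simp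
qed

lemma cm_S: "tab_cm (S5 S)" "tab_cm (S6 S)"
proof -
  have "S5 S 8 (w * T + e) = of_bool (cm w e)" if "w < 2 ^ r" "e < T" for w e
  proof -
    have "w * T + e < (w + 1) * T" using that by simp
    also have "\<dots> \<le> pw r * T" using that r_le by (intro mult_right_mono) (auto simp: pw_eq)
    finally show ?thesis using that by (simp add: S5_def gC_def)
  qed
  then show "tab_cm (S5 S)" by (simp add: tab_cm_def)
  then show "tab_cm (S6 S)" by (simp add: tab_cm_def S6_def)
qed

lemma hs_S: "tab_hs (S6 S)"
  unfolding tab_hs_def
proof (intro allI impI)
  fix y x assume yx: "y < pw (2 * lam * h)" "x < NS"
  have "(y * NS + x) * (h + 1) + h < (y * NS + (x + 1)) * (h + 1)" by (simp add: algebra_simps)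
  also have "\<dots> \<le> ((y + 1) * NS) * (h + 1)" using yx(2) by (intro mult_right_mono) auto
  also have "\<dots> \<le> (pw (2 * lam * h) * NS) * (h + 1)" using yx(1) by (intro mult_right_mono) auto
  finally have "S6 S 9 ((y * NS + x) * (h + 1) + h) = gH ((y * NS + x) * (h + 1) + h)" by (simp add: S6_def)
  also have "\<dots> = hs y x h"
  proof -
    have "((y * NS + x) * (h + 1) + h) div (h + 1) = y * NS + x" "((y * NS + x) * (h + 1) + h) mod (h + 1) = h"
      by (simp_all only: div_mult_self3 mod_mult_self3 div_less mod_less less_add_one add_0_right add_is_0 one_neq_zero simp_thms not_False_eq_True)
    moreover have "(y * NS + x) div NS = y" "(y * NS + x) mod NS = x" using yx(2) by simp_all
    ultimately show ?thesis unfolding gH_def by (simp only:)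
  qed
  finally show "S6 S 9 ((y * NS + x) * (h + 1) + h) = hs y x h" .
qed

lemma fill1: "run_fill (reduction_fills ! 0) S = S1 S"
proof -
  have "eval (eIte (eEq (V 0) (N 0)) (N 1) (Pl (Rd 4 prev) (Rd 4 prev))) ((\<lambda>_. 0)(0 := i)) (put 4 i (\<lambda>x. 2 ^ x) S) = 2 ^ i" for i
    by (cases i) (simp_all add: prev_def)
  then show ?thesis unfolding reduction_fills_def S1_def using par by (simp add: run_fill_put del: run_fill.simps)
qed

lemma fill2: "run_fill (reduction_fills ! 1) (S1 S) = S2 S"
proof -
  have "eval (eIte (eEq (eMod (V 0) xE) (N 0)) (N 1) (eMul (Rd 5 prev) (eDiv (V 0) xE))) ((\<lambda>_. 0)(0 := i)) (put 5 i gP (S1 S)) = gP i" for i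
  proof (cases "i mod E")
    case 0
    then show ?thesis using par_S by (simp add: gP_def)
  next
    case (Suc j)
    then have i: "0 < i" by (cases i) auto
    have "i = i div E * E + Suc j" using Suc by (metis div_mult_mod_eq)
    then have i1: "i - 1 = i div E * E + j" by linarith
    have "j < E" using Suc mod_less_divisor[OF E_pos, of i] by linarith
    then have "(i - 1) div E = i div E" "(i - 1) mod E = j" unfolding i1 by simp_all
    then have "gP (i - 1) * (i div E) = gP i" using Suc by (simp add: gP_def)
    then show ?thesis using par_S Suc i by (simp add: prev_def)
  qed
  then show ?thesis unfolding reduction_fills_def S2_def using par_S pw_S by (simp add: run_fill_put del: run_fill.simps)
qed

lemma fill3: "run_fill (reduction_fills ! 2) (S2 S) = S3 S"
proof -
  have S31: "S2 S 31 = S 31" by (simp add: S2_def S1_def)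
  have "eval (eIte (eEq (V 0) (N 0)) (N 2) (Pl (Rd 6 prev) (Pl (Rd 31 (Rd 6 prev)) (N 1)))) ((\<lambda>_. 0)(0 := i))
    (put 6 i (posn (S 31)) (S2 S)) = posn (S 31) i" for i
    by (cases i) (simp_all add: prev_def S31)
  then show ?thesis unfolding reduction_fills_def S3_def by (simp add: run_fill_put S31 del: run_fill.simps)
qed

lemma fill4: "run_fill (reduction_fills ! 3) (S3 S) = S4 S"
proof -
  let ?e = "xfam (eDiv (eDiv (V 0) xT1) xT1) (eMod (eDiv (V 0) xT1) xT1) (eMod (V 0) xT1)"
  have "eval ?e ((\<lambda>_. 0)(0 := i)) (put 7 i gG (S3 S)) = gG i" for i
  proof (rule eval_fam)
    let ?S = "put 7 i gG (S3 S)"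
    show t: "tab_par ?S" "tab_pw ?S" "tab_pt ?S" "init_ok ?S" using par_S pw_S pt_S init_S by simp_all
    show "?S 7 y = gG y" if "y < i" for y using that by simp
    have T1: "eval xT1 \<sigma> ?S = T + 1" for \<sigma> using t by (simp add: xT1_def)
    show "i = (eval (eDiv (eDiv (V 0) xT1) xT1) ((\<lambda>_. 0)(0 := i)) ?S * (T + 1) + eval (eMod (eDiv (V 0) xT1) xT1) ((\<lambda>_. 0)(0 := i)) ?S) * (T + 1) +
      eval (eMod (V 0) xT1) ((\<lambda>_. 0)(0 := i)) ?S"
      by (simp only: eval_div_mod T1 eval.simps fun_upd_same div_mult_mod_eq)
    have "x mod (T + 1) \<le> T" for x using mod_less_divisor[of "T + 1" x] by linarith
    then show "eval (eMod (eDiv (V 0) xT1) xT1) ((\<lambda>_. 0)(0 := i)) ?S \<le> T" "eval (eMod (V 0) xT1) ((\<lambda>_. 0)(0 := i)) ?S \<le> T"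
      by (simp_all only: eval_div_mod T1)
  qed
  then show ?thesis unfolding reduction_fills_def S4_def using par_S pw_S
    by (simp add: run_fill_put xT1_def del: run_fill.simps)
qed

lemma fill5: "run_fill (reduction_fills ! 4) (S4 S) = S5 S"
proof -
  have "eval (xcmf (eDiv (V 0) xT) (eMod (V 0) xT)) ((\<lambda>_. 0)(0 := i)) (put 8 i gC (S4 S)) = gC i" if i: "i < pw r * T" for i
  proof -
    have "i div T < pw r" using i by (simp add: less_mult_imp_div_less)
    then have "row (put 8 i gC (S4 S)) (i div T) T" using row_S4[of "i div T" T] r_le by (simp add: pw_eq)
    then show ?thesis
      using eval_cmf[of "put 8 i gC (S4 S)" "eDiv (V 0) xT" "(\<lambda>_. 0)(0 := i)" "eMod (V 0) xT"] par_S pw_S T_pos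
      by (simp add: gC_def)
  qed
  then show ?thesis unfolding reduction_fills_def S5_def using par_S pw_S by (simp add: run_fill_put del: run_fill.simps)
qed

lemma fill6: "run_fill (reduction_fills ! 5) (S5 S) = S6 S"
proof -
  have "eval (xhsf (V 0) (eMod (V 0) xh1) (eMod (eDiv (V 0) xh1) xNS) (eDiv (eDiv (V 0) xh1) xNS)) ((\<lambda>_. 0)(0 := i))
    (put 9 i gH (S5 S)) = gH i" for i
    by (rule eval_hsf) (use par_S pw_S pt_S in \<open>simp_all add: xh1_def\<close>)
  then show ?thesis unfolding reduction_fills_def S6_def using par_S pw_S pt_S
    by (simp add: run_fill_put xh1_def del: run_fill.simps)
qed

lemma fill7: "run_fill (reduction_fills ! 6) (S6 S) = S7 S"
proof -
  have "eval (eIte (eEq (V 0) (N 0)) xNS (eIte (eEq (V 0) (N 1)) xNU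
       (eBo (xedge (eDiv (Mi (V 0) (N 2)) xNU) (eMod (Mi (V 0) (N 2)) xNU))))) ((\<lambda>_. 0)(0 := i)) (put 0 i gO (S6 S)) = gO i"
    if i: "i < 2 + NS * NU" for i
  proof (cases "i < 2")
    case True
    then have "i = 0 \<or> i = 1" by linarith
    then show ?thesis using par_S pw_S pt_S by (auto simp: gO_def)
  next
    case False
    let ?S = "put 0 i gO (S6 S)"
    have t: "tab_par ?S" "tab_pw ?S" "tab_pt ?S" "tab_cm ?S" "tab_hs ?S"
      using par_S pw_S pt_S cm_S hs_S by (simp_all add: tab_cm_def tab_hs_def)
    have "(i - 2) div NU < NS" using i False by (simp add: less_mult_imp_div_less)
    then show ?thesis
      using tr_edge[OF t, of "eDiv (Mi (V 0) (N 2)) xNU" "(\<lambda>_. 0)(0 := i)" "eMod (Mi (V 0) (N 2)) xNU"] t False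
      by (simp add: gO_def)
  qed
  then show ?thesis unfolding reduction_fills_def S7_def using par_S pw_S pt_S by (simp add: run_fill_put del: run_fill.simps)
qed

lemma run_prefix:
  assumes "i \<le> 7"
  shows "run_fills (take i reduction_fills) S = [S, S1 S, S2 S, S3 S, S4 S, S5 S, S6 S, S7 S] ! i"
proof -
  have len: "length reduction_fills = 7" by (simp add: reduction_fills_def)
  have app: "run_fills (fs @ [f]) S = run_fill f (run_fills fs S)" for fs f
    by (induction fs arbitrary: S) auto
  have st: "run_fills (take (Suc j) reduction_fills) S = run_fill (reduction_fills ! j) (run_fills (take j reduction_fills) S)"
    if "j < 7" for j using that len app by (simp add: take_Suc_conv_app_nth)
  have r0: "run_fills (take 0 reduction_fills) S = S" by simp
  have r1: "run_fills (take 1 reduction_fills) S = S1 S" using st[of 0] r0 fill1 by simp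
  have r2: "run_fills (take 2 reduction_fills) S = S2 S" using st[of 1] r1 fill2 by (simp add: numeral_2_eq_2)
  have r3: "run_fills (take 3 reduction_fills) S = S3 S" using st[of 2] r2 fill3 by (simp add: numeral_3_eq_3)
  have r4: "run_fills (take 4 reduction_fills) S = S4 S" using st[of 3] r3 fill4 by simp
  have r5: "run_fills (take 5 reduction_fills) S = S5 S" using st[of 4] r4 fill5 by simp
  have r6: "run_fills (take 6 reduction_fills) S = S6 S" using st[of 5] r5 fill6 by simp
  have r7: "run_fills (take 7 reduction_fills) S = S7 S" using st[of 6] r6 fill7 by simp
  consider "i = 0" | "i = 1" | "i = 2" | "i = 3" | "i = 4" | "i = 5" | "i = 6" | "i = 7" using assms by linarith
  then show ?thesis by cases (simp_all only: r0 r1 r2 r3 r4 r5 r6 r7, simp_all)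
qed

lemma run_reduction: "run_fills reduction_fills S = S7 S"
proof -
  have "length reduction_fills = 7" by (simp add: reduction_fills_def)
  then show ?thesis using run_prefix[of 7] by simp
qed

lemma output_array: "S7 S 0 = (\<lambda>y. if y < 2 + NS * NU then gO y else 0)"
  unfolding S7_def by (auto simp: S6_def S5_def S4_def S3_def S2_def S1_def zero)

text \<open>With all contents at most \<open>2 ^ (2 * b)\<close>, the time for all tables is a fixed
  power of this number, hence about \<open>2 powr (2 * q * n / k)\<close> with \<open>q\<close>
  independent of \<open>k\<close> and \<open>d\<close>.\<close>

lemma bounded_prefix:
  assumes S: "\<forall>a x. S a x \<le> 2 ^ (2 * b)" and Zb: "Z \<le> 2 ^ (2 * b)" and pb: "(b + alp) ^ E \<le> 2 ^ (2 * b)"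
    and posb: "\<And>c. c < S 31 1 \<Longrightarrow> posn (S 31) c \<le> 2 ^ (2 * b)"
    and i: "i \<le> length reduction_fills"
  shows "run_fills (take i reduction_fills) S a x \<le> 2 ^ (2 * b)"
proof -
  have one: "(1::nat) \<le> 2 ^ (2 * b)" by simp
  have 1: "\<forall>a x. S1 S a x \<le> 2 ^ (2 * b)" unfolding S1_def
    by (rule put_bounded[OF S]) (auto intro: power_increasing)
  have 2: "\<forall>a x. S2 S a x \<le> 2 ^ (2 * b)" unfolding S2_def
  proof (rule put_bounded[OF 1])
    fix y assume y: "y < (b + alp + 1) * E"
    have "y div E < b + alp + 1" using y by (rule less_mult_imp_div_less)
    then have "gP y \<le> (b + alp) ^ (y mod E)" unfolding gP_def by (intro power_mono) auto
    also have "\<dots> \<le> (b + alp) ^ E" using mod_less_divisor[OF E_pos, of y] b_pos by (intro power_increasing) auto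
    finally show "gP y \<le> 2 ^ (2 * b)" using pb by linarith
  qed
  have 3: "\<forall>a x. S3 S a x \<le> 2 ^ (2 * b)" unfolding S3_def by (rule put_bounded[OF 2]) (use posb in auto)
  have 4: "\<forall>a x. S4 S a x \<le> 2 ^ (2 * b)" unfolding S4_def
  proof (rule put_bounded[OF 3])
    show "gG y \<le> 2 ^ (2 * b)" for y
      unfolding gG_def using le_trans[OF first_fl_least(1) Zb] one by (simp add: of_bool_def del: one_le_power)
  qed
  have 5: "\<forall>a x. S5 S a x \<le> 2 ^ (2 * b)" unfolding S5_def
    by (rule put_bounded[OF 4]) (simp add: gC_def)
  have 6: "\<forall>a x. S6 S a x \<le> 2 ^ (2 * b)" unfolding S6_def
  proof (rule put_bounded[OF 5])
    fix y
    have "gH y \<le> h"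
    proof (cases "y mod (h + 1)")
      case 0
      then show ?thesis by (simp add: gH_def hs_def)
    next
      case (Suc t)
      have "gH y < y mod (h + 1)" unfolding gH_def hs_def by (rule split_class_less) (use Suc in simp)
      then show ?thesis using mod_less_divisor[of "h + 1" y] by linarith
    qed
    also have "h \<le> 2 * b" using h_le_b by simp
    also have "\<dots> \<le> 2 ^ (2 * b)" using less_exp[of "2 * b"] by simp
    finally show "gH y \<le> 2 ^ (2 * b)" .
  qed
  have 7: "\<forall>a x. S7 S a x \<le> 2 ^ (2 * b)" unfolding S7_def
  proof (rule put_bounded[OF 6])
    have "NS \<le> 2 ^ (2 * b)" using rows by (simp add: NS_eq)
    moreover have "NU \<le> 2 ^ (2 * b)" by (simp add: NU_def pw_def power_increasing)
    ultimately show "gO y \<le> 2 ^ (2 * b)" for y using one by (simp add: gO_def of_bool_def)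
  qed
  have "i \<le> 7" using i by (simp add: reduction_fills_def)
  define L where "L = [S, S1 S, S2 S, S3 S, S4 S, S5 S, S6 S, S7 S]"
  have "list_all (\<lambda>s. \<forall>a x. s a x \<le> 2 ^ (2 * b)) L"
    unfolding L_def list.pred_inject(2) by (intro conjI S 1 2 3 4 5 6 7) simp
  moreover have "i < length L" using \<open>i \<le> 7\<close> by (simp add: L_def)
  ultimately have "(L ! i) a x \<le> 2 ^ (2 * b)" unfolding list_all_length by blast
  then show ?thesis unfolding run_prefix[OF \<open>i \<le> 7\<close>] L_def .
qed

end

end

lemma reduction_fills_user: "\<forall>f \<in> set reduction_fills. user (fill_array f)"
proof -
  have "map fill_array reduction_fills = [4, 5, 6, 7, 8, 9, 0]"
    unfolding reduction_fills_def list.map fill_array.simps ..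
  moreover have "list_all user [4, 5, 6, 7, 8, 9, 0]" by (simp add: user_def)
  ultimately have "list_all user (map fill_array reduction_fills)" by (rule ssubst)
  then show ?thesis by (simp add: list_all_iff)
qed

section \<open>Choice of the parameters\<close>

text \<open>A downward closed predicate holds on an initial segment, and counting finds its length.
  This turns the sum defining \<open>h\<close> into a maximum.\<close>

lemma count_down_closed:
  fixes P :: "nat \<Rightarrow> bool"
  assumes "\<And>x y. P y \<Longrightarrow> x \<le> y \<Longrightarrow> P x"
  shows "(\<Sum>z<M. of_bool (P z)) \<le> M \<and> (\<forall>z<(\<Sum>z<M. of_bool (P z)). P z) \<and>
    ((\<Sum>z<M. of_bool (P z)) < M \<longrightarrow> \<not> P (\<Sum>z<M. of_bool (P z)))"
proof (induction M)
  case 0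
  show ?case by simp
next
  case (Suc M)
  define s where "s = (\<Sum>z<M. of_bool (P z) :: nat)"
  have IH: "s \<le> M" "\<forall>z<s. P z" "s < M \<longrightarrow> \<not> P s" using Suc unfolding s_def by blast+
  have sum: "(\<Sum>z<Suc M. of_bool (P z)) = s + of_bool (P M)" by (simp add: s_def)
  show ?case
  proof (cases "P M")
    case True
    then have "s = M" using IH assms[of M s] by (cases "s < M") auto
    then show ?thesis unfolding sum using True IH by (auto simp: less_Suc_eq)
  next
    case False
    then show ?thesis unfolding sum using IH by (cases "s = M") auto
  qed
qed

lemma power_le_exp: "\<exists>X. \<forall>x \<ge> X. C * x ^ p \<le> (2::nat) ^ x"
proof -
  have "eventually (\<lambda>x::nat. real C * real x ^ p \<le> 2 ^ x) at_top" by real_asymp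
  then obtain X where X: "\<And>x. x \<ge> X \<Longrightarrow> real C * real x ^ p \<le> 2 ^ x" unfolding eventually_at_top_linorder by blast
  have "C * x ^ p \<le> 2 ^ x" if "x \<ge> X" for x
  proof -
    have "real (C * x ^ p) \<le> real (2 ^ x)" using X[OF that] by simp
    then show ?thesis by (simp only: of_nat_le_iff)
  qed
  then show ?thesis by blast
qed

lemma log_power_small: "\<forall>\<^sub>F n in sequentially. \<forall>l. 2 ^ l \<le> 4 * n \<longrightarrow> C * l ^ p \<le> n"
proof -
  obtain X where X: "\<And>x. x \<ge> X \<Longrightarrow> (4 * C) * x ^ p \<le> (2::nat) ^ x" using power_le_exp[of "4 * C" p] by blast
  have "C * l ^ p \<le> n" if n: "C * X ^ p \<le> n" "2 ^ l \<le> 4 * n" for n l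
  proof (cases "X \<le> l")
    case True
    then show ?thesis using X[of l] n by linarith
  next
    case False
    then have "C * l ^ p \<le> C * X ^ p" by (intro mult_left_mono power_mono) auto
    then show ?thesis using n by linarith
  qed
  then show ?thesis unfolding eventually_sequentially by blast
qed

text \<open>The variable \<open>l\<close> stands for \<open>lam\<close>, about which
  \<open>2 ^ lam \<le> 4 * n\<close> is known. For fixed parameters the conditions only say that
  constants and polylogarithmic terms are at most \<open>n\<close>.\<close>

definition large :: "nat \<Rightarrow> nat \<Rightarrow> nat \<Rightarrow> nat \<Rightarrow> nat \<Rightarrow> bool" where
  "large d k c2 c3 n \<longleftrightarrow> 4 * k ^ 2 + (d + 1) ^ 2 + (d + 3) + k + c2 + c3 + 2 \<le> n \<and>
    (\<forall>l. 2 ^ l \<le> 4 * n \<longrightarrow> k * (9 + k + 2 * d) * l \<le> n \<and> 2 * k * c2 * (d + 1) * l \<le> n \<and>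
      2 * d * c3 ^ (2 * d) * l ^ (2 * d) \<le> n \<and> c3 * l \<le> n \<and> k * (2 * k) ^ k * l \<le> n)"

lemma eventually_large: "\<forall>\<^sub>F n in sequentially. large d k c2 c3 n"
proof -
  have "\<forall>\<^sub>F n in sequentially. C \<le> n" for C :: nat by (rule eventually_ge_at_top)
  moreover have "\<forall>\<^sub>F n in sequentially. \<forall>l. 2 ^ l \<le> 4 * n \<longrightarrow> C * l \<le> n" for C :: nat
    using log_power_small[of C 1] by simp
  ultimately show ?thesis unfolding large_def
    using log_power_small[of "2 * d * c3 ^ (2 * d)" "2 * d"]
    by (simp only: all_conj_distrib imp_conjR eventually_conj_iff simp_thms)
qed

context reduction
begin

text \<open>Besides the locale, the facts serve the size estimates: \<open>b_square\<close> and
  \<open>b_le\<close> enclose \<open>log log N\<close> between \<open>lam / 2\<close> and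
  \<open>lam\<close>, \<open>b_large\<close> lifts the gap threshold above \<open>k\<close>,
  \<open>c2_r\<close> limits the cost of the advice, and \<open>NU_exp\<close> keeps the elements
  from dominating \<open>N\<close>.\<close>

lemma large_params:
  assumes large: "large d k c2 c3 n" and d: "1 \<le> d" and k: "4 \<le> k" and c: "2 \<le> c2" "c3 = 4 * d * (d + 1) * k * c2"
    and Cl: "\<And>A. A \<in> Cl \<Longrightarrow> A \<subseteq> {..<2 * n} \<and> card A \<le> d"
  shows good_if_large: "good_reduction n d k c2 c3 Cl"
    and lam_bounds: "2 * n < 2 ^ lam" "2 ^ lam \<le> 4 * n" "lam * (9 + k + 2 * d) \<le> b"
    and c2_r: "c2 * r \<le> b"
    and NU_exp: "2 * lam * (h + h ^ k) \<le> b"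
    and h_maximal: "b < 8 * lam * (h + 1) ^ k"
    and b_square: "4 * n \<le> b ^ 2"
    and b_large: "(2 * k) ^ k * lam \<le> b"
    and b_le: "2 * b \<le> 2 ^ lam"
proof -
  have n: "4 * k ^ 2 \<le> n" "(d + 1) ^ 2 \<le> n" "d + 3 \<le> n" "k \<le> n" "c2 \<le> n" "c3 \<le> n" "2 \<le> n"
    using large unfolding large_def by linarith+
  have small: "k * (9 + k + 2 * d) * l \<le> n" "2 * k * c2 * (d + 1) * l \<le> n"
      "2 * d * c3 ^ (2 * d) * l ^ (2 * d) \<le> n" "c3 * l \<le> n" "k * (2 * k) ^ k * l \<le> n" if "2 ^ l \<le> 4 * n" for l
    using large that unfolding large_def by blast+
  have kb: "n \<le> k * b"
  proof -
    have "n = k * (n div k) + n mod k" "n mod k < k" using k by simp_all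
    moreover have "k * b = k * (n div k) + k" by (simp add: b_def)
    ultimately show ?thesis by linarith
  qed
  have bk: "k * b \<le> n + k" using mult_div_mod_eq[of k n] by (simp add: b_def)
  have le_b: "x \<le> b" if "k * x \<le> n" for x using kb that k by (metis le_trans mult_le_cancel1 not_numeral_le_zero neq0_conv)
  obtain l where l: "2 ^ l \<le> 2 * n" "2 * n < 2 ^ (l + 1)" using ex_power_ivl1[of 2 "2 * n"] n by auto
  have l4: "2 ^ (l + 1) \<le> 4 * n" using l by simp
  have lb: "(l + 1) * (9 + k + 2 * d) \<le> b" by (rule le_b) (use small(1)[OF l4] in \<open>simp add: algebra_simps\<close>)
  then have l2b: "l + 1 \<le> b" by (metis le_trans le_add1 mult_le_mono2 mult.right_neutral add.assoc one_le_numeral add_leE)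
  have lam: "lam = l + 1"
  proof -
    have P: "pw x \<le> 2 * n \<longleftrightarrow> x \<le> l" if "x \<in> {..<2 * b + 1}" for x
    proof
      show "x \<le> l" if a: "pw x \<le> 2 * n"
      proof (rule ccontr)
        assume "\<not> x \<le> l"
        then have "(2::nat) ^ (l + 1) \<le> 2 ^ x" by (intro power_increasing) auto
        then show False using a \<open>x \<in> _\<close> l by (simp add: pw_def)
      qed
      show "pw x \<le> 2 * n" if a: "x \<le> l"
      proof -
        have "(2::nat) ^ x \<le> 2 ^ l" using a by (intro power_increasing) auto
        then have "2 ^ x \<le> 2 * n" using l(1) by linarith
        then show ?thesis by (simp add: pw_def)
      qed
    qed
    have "lam = (\<Sum>x<2 * b + 1. of_bool (x \<le> l))" unfolding lam_def by (rule sum.cong[OF refl]) (simp only: P)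
    also have "\<dots> = card ({..<2 * b + 1} \<inter> {x. x \<le> l})" by (subst sum_of_bool_eq) simp_all
    also have "{..<2 * b + 1} \<inter> {x. x \<le> l} = {..l}" using l2b by auto
    finally show ?thesis by simp
  qed
  show L: "2 * n < 2 ^ lam" "2 ^ lam \<le> 4 * n" "lam * (9 + k + 2 * d) \<le> b" using l l4 lb unfolding lam by simp_all
  have lam1: "1 \<le> lam" by (simp add: lam)
  note sm = small[OF L(2)]
  have "lam * (9 + k + 2 * d) = 9 * lam + k * lam + 2 * (d * lam)" by (simp add: algebra_simps)
  then have lamb: "9 * lam + k * lam + 2 * (d * lam) \<le> b" using L(3) by linarith
  have "2 ^ lam \<le> (2::nat) ^ (2 * b)" using lamb by (intro power_increasing) auto
  then have n2b: "2 * n < 2 ^ (2 * b)" using L(1) by linarith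
  show c2r: "c2 * r \<le> b"
    unfolding r_def q_def using div_times_less_eq_dividend[of b "c2 * g"] by (simp add: algebra_simps)
  have r2: "2 * r \<le> b" using c2r mult_le_mono1[OF c(1), of r] by linarith
  define P where "P z \<longleftrightarrow> 8 * lam * (z + 1) ^ k \<le> b" for z
  have h: "h = (\<Sum>z<b. of_bool (P z))"
    unfolding h_def P_def by (rule sum.cong) (auto simp: pt_def E_def)
  have mono: "P x" if "P y" "x \<le> y" for x y
  proof -
    have "8 * lam * (x + 1) ^ k \<le> 8 * lam * (y + 1) ^ k" using that(2) by (intro mult_left_mono power_mono) auto
    then show ?thesis using that(1) unfolding P_def by linarith
  qed
  have cnt: "h \<le> b \<and> (\<forall>z<h. P z) \<and> (h < b \<longrightarrow> \<not> P h)"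
    unfolding h by (rule count_down_closed) (rule mono)
  have hb: "h \<le> b" using cnt by blast
  have b1: "1 \<le> b" by (simp add: b_def)
  have "P 0" unfolding P_def using lamb by simp
  then have h1: "1 \<le> h" using cnt b1 by (cases h) auto
  have "P (h - 1)" using cnt h1 by simp
  then have hk: "8 * lam * h ^ k \<le> b" using h1 by (simp add: P_def)
  have "h \<le> h ^ k" using h1 k self_le_power[of h k] by simp
  then have "2 * lam * (h + h ^ k) \<le> 2 * lam * (2 * h ^ k)" by (intro mult_left_mono) auto
  also have "\<dots> \<le> 8 * lam * h ^ k" by simp
  finally show NUe: "2 * lam * (h + h ^ k) \<le> b" using hk by linarith
  show "b < 8 * lam * (h + 1) ^ k"
  proof (cases "h < b")
    case True
    then show ?thesis using cnt by (simp add: P_def)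
  next
    case False
    then have "b < h + 1" by simp
    also have "h + 1 \<le> (h + 1) ^ k" using k self_le_power[of "h + 1" k] by simp
    also have "\<dots> \<le> 8 * lam * (h + 1) ^ k" using lam1 by simp
    finally show ?thesis .
  qed
  show "4 * n \<le> b ^ 2"
  proof -
    have "k ^ 2 * (4 * n) = (4 * k ^ 2) * n" by simp
    also have "\<dots> \<le> n * n" using n(1) by (rule mult_right_mono) simp
    also have "\<dots> \<le> (k * b) * (k * b)" by (intro mult_mono kb) simp_all
    also have "\<dots> = k ^ 2 * b ^ 2" by (simp add: power2_eq_square)
    finally show ?thesis using k by simp
  qed
  show "(2 * k) ^ k * lam \<le> b" by (rule le_b) (use sm(5) in \<open>simp add: mult.assoc\<close>)
  show b2: "2 * b \<le> 2 ^ lam"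
  proof -
    have "4 * b \<le> k * b" using k by simp
    then have "4 * b \<le> n + k" using bk by linarith
    then show ?thesis using L(1) n(4) by linarith
  qed
  show "good_reduction n d k c2 c3 Cl"
  proof
    show "\<And>A. A \<in> Cl \<Longrightarrow> A \<subseteq> {..<2 * n} \<and> card A \<le> d" by (rule Cl)
    show "1 \<le> n" "1 \<le> d" "1 \<le> k" "1 \<le> h" using n d k h1 by simp_all
    have "4 * d * 1 \<le> 4 * d * ((d + 1) * k * c2)" using c k by (intro mult_left_mono) auto
    then have c3: "4 * d \<le> c3" unfolding c(2) by (simp only: mult.assoc mult_1_right)
    have alp: "alp = 4 * d * (d + 1) * k * c2 * lam" 
      using alp_def arg_cong[OF c(2), of "\<lambda>x. x * lam"] by (rule trans)
    have al: "c3 \<le> alp" using lam1 by (simp add: alp_def)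
    show "1 \<le> alp" "2 * d \<le> alp" using c3 al d by linarith+
    show "2 * n < 2 ^ (2 * b)" by (rule n2b)
    \<comment> \<open>The origin of \<open>c3\<close>: without rounding, \<open>alp * q\<close>
      would be at least \<open>c3 * lam * b / (c2 * (d + 1) * lam) = 4 * d * k * b\<close>, which is
      at least \<open>4 * d * n\<close>. Rounding \<open>q\<close> down costs at most
      \<open>alp \<le> 2 * d * n\<close>.\<close>
    show "d * (2 * n) \<le> alp * q"
    proof -
      have g: "g \<le> (d + 1) * lam" using lam1 by (simp add: g_def algebra_simps)
      have "b \<le> c2 * g * q + c2 * g"
      proof -
        have "0 < c2 * g" using c(1) by (simp add: g_def)
        then have "b mod (c2 * g) < c2 * g" "b = c2 * g * q + b mod (c2 * g)" by (simp_all add: q_def)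
        then show ?thesis by linarith
      qed
      then have "4 * d * k * b \<le> 4 * d * k * (c2 * g * q + c2 * g)" by (rule mult_left_mono) simp
      also have "\<dots> = (4 * d * k * c2 * q) * g + (4 * d * k * c2) * g" by (simp add: algebra_simps)
      also have "\<dots> \<le> (4 * d * k * c2 * q) * ((d + 1) * lam) + (4 * d * k * c2) * ((d + 1) * lam)"
        using g by (intro add_mono mult_left_mono) auto
      also have "\<dots> = alp * q + 2 * d * (2 * k * c2 * (d + 1) * lam)" by (simp add: alp algebra_simps)
      also have "\<dots> \<le> alp * q + 2 * d * n" using sm(2) by (intro add_mono mult_left_mono) auto
      finally have "4 * d * k * b \<le> alp * q + 2 * d * n" .
      moreover have "4 * d * n \<le> 4 * d * (k * b)" using kb by (intro mult_left_mono) auto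
      moreover have "4 * d * (k * b) = 4 * d * k * b" "d * (2 * n) = 2 * d * n" "4 * d * n = 2 * (2 * d * n)" by simp_all
      ultimately show ?thesis by linarith
    qed
    \<comment> \<open>At most \<open>2 * n\<close> elements compare advice bits. The polylogarithmic
      factor in the number of clauses is at most \<open>n\<close>, which leaves \<open>n ^ 2\<close>
      clauses.\<close>
    show "nc + (1 + d * (2 * n) * alp ^ (2 * d)) \<le> 2 ^ (2 * lam)"
    proof -
      have "nc \<le> k * b" using mult_left_mono[OF r2, of k] by (simp add: nc_def algebra_simps)
      then have 1: "nc \<le> 2 * n" using bk n(4) by linarith
      have "d * (2 * n) * alp ^ (2 * d) = (2 * d * c3 ^ (2 * d) * lam ^ (2 * d)) * n"
        by (simp add: alp_def power_mult_distrib)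
      also have "\<dots> \<le> n * n" using sm(3) by (rule mult_right_mono) simp
      finally have 2: "d * (2 * n) * alp ^ (2 * d) \<le> n * n" .
      have "2 * n + 1 \<le> 3 * (n * n)"
      proof -
        have "n * 2 \<le> n * n" using n(7) by (rule mult_left_mono) simp
        then show ?thesis using n(7) by linarith
      qed
      moreover have "(2 * n) * (2 * n) \<le> 2 ^ lam * 2 ^ lam" using L(1) by (intro mult_mono) auto
      moreover have "(2 * n) * (2 * n) = 4 * (n * n)" by simp
      moreover have "(2::nat) ^ (2 * lam) = 2 ^ lam * 2 ^ lam"
        by (simp add: power_add mult_2)
      ultimately show ?thesis using 1 2 by linarith
    qed
    show "b + r \<le> 2 * b" using r2 by simp
    show "lam * d + 1 \<le> 2 * b" "2 * lam \<le> 2 * b" using lamb b1 mult.commute[of d lam] by linarith+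
    show "2 * lam * (h + h ^ k) \<le> 2 * b" using NUe by linarith
    show "k * 2 ^ (b + r) \<le> 2 ^ (2 * b)"
    proof -
      have "k \<le> 2 ^ lam" using n(4) L(1) by linarith
      then have "k * 2 ^ (b + r) \<le> 2 ^ lam * 2 ^ (b + r)" by (rule mult_right_mono) simp
      also have "\<dots> = 2 ^ (lam + (b + r))" by (simp add: power_add)
      also have "\<dots> \<le> 2 ^ (2 * b)" using lamb r2 by (intro power_increasing) auto
      finally show ?thesis .
    qed
    show "2 * b \<le> 2 ^ lam" by (rule b2)
    show "h \<le> 2 ^ lam" using b2 hb by linarith
  qed
qed

end

context good_reduction
begin

text \<open>\<open>T\<close> is a power of \<open>n\<close> whose exponent grows with
  \<open>d\<close>, but \<open>b\<close> is linear in \<open>n\<close>, so \<open>2 ^ b\<close>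
  exceeds it for large \<open>n\<close>.\<close>

lemma machine_bounds:
  assumes large: "large d k c2 c3 n" and k: "4 \<le> k" and c: "2 \<le> c2" "c3 = 4 * d * (d + 1) * k * c2"
  shows "Z \<le> 2 ^ (2 * b)" "(b + alp) ^ E \<le> 2 ^ (2 * b)" "(d + 3) * T \<le> 2 ^ (2 * b)"
    "2 * n + T + (d + 3) \<le> 2 ^ (2 * b)" "d + k + c2 + c3 + n \<le> 2 ^ (2 * b)"
proof -
  note lb = lam_bounds[OF large pos(2) k c Cl]
  have n: "(d + 1) ^ 2 \<le> n" "d + 3 \<le> n" "d + k + c2 + c3 \<le> n" "c3 * lam \<le> n"
    using large lb(2) unfolding large_def by (auto intro: le_trans[rotated] simp del: power2_sum)
  have pl: "n \<le> 2 ^ lam" "2 * n \<le> 2 ^ lam" using lb(1) by linarith+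
  have "lam * (9 + k + 2 * d) = 9 * lam + k * lam + 2 * (lam * d)" by (simp add: algebra_simps)
  then have lamb: "9 * lam + k * lam + 2 * (lam * d) \<le> b" using lb(3) by linarith
  have T1: "c * T \<le> 2 ^ b" if "c \<le> n" for c
  proof -
    have "c * T \<le> 2 ^ lam * 2 ^ (lam * d)" unfolding T_eq using that pl by (intro mult_right_mono) auto
    also have "\<dots> = 2 ^ (lam + lam * d)" by (simp add: power_add)
    also have "\<dots> \<le> 2 ^ b" using lamb by (intro power_increasing) auto
    finally show ?thesis .
  qed
  have b2b: "2 ^ b \<le> (2::nat) ^ (2 * b)" by (intro power_increasing) auto
  show "Z \<le> 2 ^ (2 * b)" using T1[of "(d + 1) ^ 2"] n(1) b2b unfolding Z_def power2_eq_square by (metis le_trans)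
  show "(d + 3) * T \<le> 2 ^ (2 * b)" using T1[of "d + 3"] n(2) b2b by linarith
  have "(b + alp) ^ E \<le> (2 ^ lam) ^ E"
  proof (rule power_mono)
    show "b + alp \<le> 2 ^ lam" using b_le[OF large pos(2) k c Cl] n(4) pl by (simp add: alp_def)
  qed simp
  also have "\<dots> = 2 ^ (lam * E)" by (simp add: power_mult)
  also have "\<dots> \<le> 2 ^ (2 * b)"
  proof (intro power_increasing)
    have "lam * E = lam * k + 2 * (lam * d) + lam" by (simp add: E_def algebra_simps)
    then show "lam * E \<le> 2 * b" using lamb mult.commute[of k lam] by linarith
  qed simp
  finally show "(b + alp) ^ E \<le> 2 ^ (2 * b)" .
  have lb: "2 ^ lam \<le> (2::nat) ^ b" using lamb by (intro power_increasing) auto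
  have b2: "2 \<le> b" using lamb lam_pos by linarith
  have "(4::nat) * 2 ^ b = 2 ^ (2 + b)" by (simp add: power_add)
  also have "\<dots> \<le> 2 ^ (2 * b)" using b2 by (intro power_increasing) auto
  finally have four: "4 * 2 ^ b \<le> (2::nat) ^ (2 * b)" .
  have "1 * T \<le> 2 ^ b" using T1[of 1] pos by simp
  then show "2 * n + T + (d + 3) \<le> 2 ^ (2 * b)" using four lb pl n(2) by linarith
  show "d + k + c2 + c3 + n \<le> 2 ^ (2 * b)" using four lb pl n(3) by linarith
qed

end

section \<open>Encoded formulas\<close>

definition clause_set :: "literal list \<Rightarrow> nat set" where
  "clause_set C = encode_literal ` set C"

lemma inj_encode_literal: "inj encode_literal"
proof
  fix x y :: literal assume eq: "encode_literal x = encode_literal y"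
  obtain v b v' b' where xy: "x = (v, b)" "y = (v', b')" by fastforce
  from eq have e: "2 * v + of_bool b = 2 * v' + (of_bool b' :: nat)" by (simp add: xy encode_literal_def)
  from arg_cong[OF e, of "\<lambda>x. x mod 2"] have "b = b'" by (cases b; cases b') simp_all
  with e show "x = y" by (simp add: xy)
qed

lemma clause_set_bounds:
  assumes "is_dcnf d n \<phi>" "C \<in> set \<phi>"
  shows "clause_set C \<subseteq> {..<2 * n}" "card (clause_set C) \<le> d" "length C \<le> d"
proof -
  have C: "length C \<le> d" "\<And>v b. (v, b) \<in> set C \<Longrightarrow> v < n" using assms unfolding is_dcnf_def by blast+
  show "length C \<le> d" by (rule C)
  show "clause_set C \<subseteq> {..<2 * n}"
  proof
    fix l assume "l \<in> clause_set C"
    then obtain v b where vb: "(v, b) \<in> set C" "l = 2 * v + of_bool b" by (auto simp: clause_set_def encode_literal_def)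
    have "of_bool b \<le> (1::nat)" by simp
    then show "l \<in> {..<2 * n}" using vb C(2)[OF vb(1)] by simp
  qed
  have "card (clause_set C) \<le> card (set C)" unfolding clause_set_def by (rule card_image_le) simp
  also have "\<dots> \<le> length C" by (rule card_length)
  finally show "card (clause_set C) \<le> d" using C(1) by linarith
qed

text \<open>Clauses that differ as sets keep different codes. Together with \<open>card_Cl\<close>
  this bounds the length of the input by a polynomial in \<open>n\<close>.\<close>

lemma card_clause_sets:
  assumes "is_dcnf d n \<phi>"
  shows "card (clause_set ` set \<phi>) = length \<phi>"
proof -
  have "clause_set ` set \<phi> = (image encode_literal) ` set (map set \<phi>)" by (auto simp: clause_set_def)
  moreover have "inj (image encode_literal)" using inj_encode_literal by (simp add: inj_image_eq_iff inj_def)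
  ultimately have "card (clause_set ` set \<phi>) = card (set (map set \<phi>))"
    using card_image[OF inj_on_subset, of "image encode_literal" UNIV "set (map set \<phi>)"] by simp
  also have "\<dots> = length \<phi>" using assms distinct_card[of "map set \<phi>"] by (simp add: is_dcnf_def)
  finally show ?thesis .
qed

lemma satisfiable_iff:
  "satisfiable \<phi> \<longleftrightarrow> (\<exists>a. \<forall>A \<in> clause_set ` set \<phi>. \<exists>l\<in>A. a (l div 2) = odd l)"
proof -
  have "(\<exists>l\<in>clause_set C. a (l div 2) = odd l) \<longleftrightarrow> (\<exists>(v, b)\<in>set C. a v = b)" for a C
  proof -
    have "a (encode_literal x div 2) = odd (encode_literal x) \<longleftrightarrow> a (fst x) = snd x" for x
      by (cases x) (simp add: encode_literal_def)
    then show ?thesis by (auto simp: clause_set_def split_beta)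
  qed
  then show ?thesis by (simp add: satisfiable_def)
qed

definition clause_code :: "literal list \<Rightarrow> nat list" where
  "clause_code C = length C # map encode_literal C"

lemma posn_encode:
  assumes "c \<le> length \<phi>"
  shows "posn (load_input (encode_cnf n \<phi>)) c = length (n # length \<phi> # concat (map clause_code (take c \<phi>)))"
    and "c < length \<phi> \<Longrightarrow> i < length (clause_code (\<phi> ! c)) \<Longrightarrow>
      load_input (encode_cnf n \<phi>) (posn (load_input (encode_cnf n \<phi>)) c + i) = clause_code (\<phi> ! c) ! i"
proof -
  let ?pre = "\<lambda>c. n # length \<phi> # concat (map clause_code (take c \<phi>))"
  have xs: "encode_cnf n \<phi> = n # length \<phi> # concat (map clause_code \<phi>)"
    unfolding encode_cnf_def clause_code_def by simp
  have at: "load_input (encode_cnf n \<phi>) (length (?pre c) + i) = clause_code (\<phi> ! c) ! i"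
    if "c < length \<phi>" "i < length (clause_code (\<phi> ! c))" for c i
  proof -
    have "concat (map clause_code \<phi>) = concat (map clause_code (take c \<phi> @ \<phi> ! c # drop (Suc c) \<phi>))"
      using id_take_nth_drop[OF that(1)] by simp
    then have "encode_cnf n \<phi> = ?pre c @ clause_code (\<phi> ! c) @ concat (map clause_code (drop (Suc c) \<phi>))"
      unfolding xs by simp
    then show ?thesis using that(2) by (simp add: load_input_def nth_append)
  qed
  have pos: "posn (load_input (encode_cnf n \<phi>)) c = length (?pre c)" if "c \<le> length \<phi>" for c
    using that
  proof (induction c)
    case 0
    then show ?case by simp
  next
    case (Suc c)
    then have c: "c < length \<phi>" by simp
    have "load_input (encode_cnf n \<phi>) (length (?pre c)) = length (\<phi> ! c)"
      using at[OF c, of 0] by (simp add: clause_code_def)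
    moreover have "length (?pre (Suc c)) = length (?pre c) + length (clause_code (\<phi> ! c))"
      using c by (simp add: take_Suc_conv_app_nth)
    moreover have "length (clause_code (\<phi> ! c)) = length (\<phi> ! c) + 1" by (simp add: clause_code_def)
    moreover have "posn (load_input (encode_cnf n \<phi>)) c = length (?pre c)" using Suc by simp
    ultimately show ?case by (simp only: posn.simps)
  qed
  show "posn (load_input (encode_cnf n \<phi>)) c = length (?pre c)" by (rule pos[OF assms])
  show "load_input (encode_cnf n \<phi>) (posn (load_input (encode_cnf n \<phi>)) c + i) = clause_code (\<phi> ! c) ! i"
    if "c < length \<phi>" "i < length (clause_code (\<phi> ! c))"
    unfolding pos[OF assms] by (rule at[OF that])
qed

lemma encode_bounds:
  assumes "is_dcnf d n \<phi>" "\<phi> \<noteq> []"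
  shows "length (encode_cnf n \<phi>) \<le> (d + 3) * length \<phi>"
    and "\<forall>x \<in> set (encode_cnf n \<phi>). x \<le> 2 * n + length \<phi> + (d + 3)"
proof -
  have "length (concat (map clause_code \<phi>')) \<le> (d + 1) * length \<phi>'" if "set \<phi>' \<subseteq> set \<phi>" for \<phi>'
    using that
  proof (induction \<phi>')
    case (Cons C \<phi>')
    then have "length C \<le> d" using clause_set_bounds(3)[OF assms(1)] by simp
    then show ?case using Cons by (simp add: clause_code_def)
  qed simp
  from this[of \<phi>] have "length (encode_cnf n \<phi>) \<le> 2 + (d + 1) * length \<phi>"
    by (simp add: encode_cnf_def clause_code_def[abs_def])
  also have "\<dots> \<le> (d + 3) * length \<phi>" using assms(2) by (cases \<phi>) (simp_all add: algebra_simps)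
  finally show "length (encode_cnf n \<phi>) \<le> (d + 3) * length \<phi>" .
  show "\<forall>x \<in> set (encode_cnf n \<phi>). x \<le> 2 * n + length \<phi> + (d + 3)"
  proof
    fix x assume "x \<in> set (encode_cnf n \<phi>)"
    then consider "x = n" | "x = length \<phi>" | C where "C \<in> set \<phi>" "x \<in> set (clause_code C)"
      by (auto simp: encode_cnf_def clause_code_def)
    then show "x \<le> 2 * n + length \<phi> + (d + 3)"
    proof cases
      case 3
      then have "x = length C \<or> x \<in> clause_set C" by (auto simp: clause_code_def clause_set_def)
      then show ?thesis using clause_set_bounds[OF assms(1) 3(1)] by auto
    qed simp_all
  qed
qed

lemma (in reduction) encoded_clauses:
  fixes S :: arrays
  assumes dcnf: "is_dcnf d n \<phi>" and xs: "S 31 = load_input (encode_cnf n0 \<phi>)" and Cl: "Cl = clause_set ` set \<phi>"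
  shows "(\<exists>c<S 31 1. \<forall>l<2 * n. l \<in> lits e \<longleftrightarrow>
      (\<exists>i<S 31 (posn (S 31) c). S 31 (posn (S 31) c + 1 + i) = l)) \<longleftrightarrow> lits e \<in> Cl"
proof -
  have m: "S 31 1 = length \<phi>" unfolding xs by (simp add: load_input_def encode_cnf_def)
  have cl: "(\<exists>i<S 31 (posn (S 31) c). S 31 (posn (S 31) c + 1 + i) = l) \<longleftrightarrow> l \<in> clause_set (\<phi> ! c)"
    if c: "c < length \<phi>" for c l
  proof -
    note at = posn_encode(2)[of c \<phi> _ n0, folded xs]
    have "S 31 (posn (S 31) c) = length (\<phi> ! c)" using at[of 0] c by (simp add: clause_code_def)
    moreover have "S 31 (posn (S 31) c + 1 + i) = encode_literal (\<phi> ! c ! i)" if "i < length (\<phi> ! c)" for i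
      using at[of "1 + i"] c that by (simp add: clause_code_def)
    ultimately have "(\<exists>i<S 31 (posn (S 31) c). S 31 (posn (S 31) c + 1 + i) = l) \<longleftrightarrow>
      (\<exists>i<length (\<phi> ! c). encode_literal (\<phi> ! c ! i) = l)" by (metis (no_types, lifting))
    also have "\<dots> \<longleftrightarrow> l \<in> clause_set (\<phi> ! c)" unfolding clause_set_def set_conv_nth by auto
    finally show ?thesis .
  qed
  have sub: "lits e \<subseteq> {..<2 * n}" by (auto simp: lits_def)
  have "(\<forall>l<2 * n. l \<in> lits e \<longleftrightarrow> l \<in> clause_set (\<phi> ! c)) \<longleftrightarrow> lits e = clause_set (\<phi> ! c)" if "c < length \<phi>" for c
    using sub clause_set_bounds(1)[OF dcnf nth_mem[OF that]] by blast
  then have "(\<exists>c<S 31 1. \<forall>l<2 * n. l \<in> lits e \<longleftrightarrow>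
      (\<exists>i<S 31 (posn (S 31) c). S 31 (posn (S 31) c + 1 + i) = l)) \<longleftrightarrow> (\<exists>c<length \<phi>. lits e = clause_set (\<phi> ! c))"
    unfolding m using cl by (intro ex_cong conj_cong refl) simp
  also have "\<dots> \<longleftrightarrow> lits e \<in> Cl" unfolding Cl set_conv_nth by auto
  finally show ?thesis .
qed

lemma (in good_reduction) card_Cl: "card Cl \<le> T"
proof -
  have "Cl \<subseteq> lits ` {..<T}"
  proof
    fix A assume "A \<in> Cl"
    then obtain e where "e < T" "lits e = A" using Cl[of A] ex_lits[of A] by blast
    then show "A \<in> lits ` {..<T}" by blast
  qed
  then have "card Cl \<le> card (lits ` {..<T})" by (intro card_mono) auto
  also have "\<dots> \<le> T" using card_image_le[of "{..<T}" lits] by simp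
  finally show ?thesis .
qed

section \<open>The instance produced by the reduction\<close>

lemma length_rows: "length (concat (map (\<lambda>i. map (f i) [0..<m]) [0..<n])) = n * m"
  by (induction n) auto

lemma nth_rows:
  assumes "p < n * m"
  shows "concat (map (\<lambda>i. map (f i) [0..<m]) [0..<n]) ! p = f (p div m) (p mod m)"
  using assms
proof (induction n)
  case (Suc n)
  let ?c = "concat (map (\<lambda>i. map (f i) [0..<m]) [0..<n])"
  have c: "concat (map (\<lambda>i. map (f i) [0..<m]) [0..<Suc n]) = ?c @ map (f n) [0..<m]" by simp
  show ?case
  proof (cases "p < n * m")
    case True
    then show ?thesis unfolding c using Suc.IH by (simp add: nth_append length_rows)
  next
    case False
    then obtain s where s: "p = n * m + s" using le_Suc_ex[of "n * m" p] by auto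
    then have "s < m" using Suc.prems by simp
    then show ?thesis unfolding c using s by (simp add: nth_append length_rows)
  qed
qed simp

context good_reduction
begin

definition inst :: "(nat, nat) set_cover" where
  "inst = \<lparr>set_verts = {..<NS}, elem_verts = {..<NU}, edges = {(x, c). x < NS \<and> c < NU \<and> edge x c}\<rparr>"

lemma inst_sel [simp]: "set_verts inst = {..<NS}" "elem_verts inst = {..<NU}" "num_vertices inst = NS + NU"
  by (simp_all add: inst_def num_vertices_def)

lemma inst_edge: "x < NS \<Longrightarrow> c < NU \<Longrightarrow> (x, c) \<in> edges inst \<longleftrightarrow> edge x c"
  by (simp add: inst_def)

lemma numbered_inst: "numbered_instance inst"
  unfolding numbered_instance_def set_cover_instance_def by (auto simp: inst_def)

lemma load_inst: "load_input (encode_instance inst) = (\<lambda>y. if y < 2 + NS * NU then gO y else 0)"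
proof
  fix y
  let ?f = "\<lambda>i j. of_bool ((i, j) \<in> edges inst) :: nat"
  have code: "encode_instance inst = NS # NU # concat (map (\<lambda>i. map (?f i) [0..<NU]) [0..<NS])"
    unfolding encode_instance_def by simp
  have len: "length (encode_instance inst) = 2 + NS * NU" unfolding code by (simp add: length_rows)
  have at: "encode_instance inst ! y = gO y" if y: "y < 2 + NS * NU"
  proof -
    consider "y = 0" | "y = 1" | "2 \<le> y" by linarith
    then show ?thesis
    proof cases
      case 3
      then obtain p where p: "y = Suc (Suc p)" "p < NS * NU" using y by (metis add_2_eq_Suc le_Suc_ex nat_add_left_cancel_less)
      have "p div NU < NS" using p by (simp add: less_mult_imp_div_less)
      moreover have "p mod NU < NU" using NU_pos by simp
      ultimately have "?f (p div NU) (p mod NU) = of_bool (edge (p div NU) (p mod NU))" by (simp only: inst_edge)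
      then show ?thesis unfolding code p(1) nth_Cons_Suc nth_rows[OF p(2)] gO_def by simp
    qed (simp_all only: code gO_def nth_Cons_0 nth_Cons_Suc One_nat_def, simp_all)
  qed
  show "load_input (encode_instance inst) y = (if y < 2 + NS * NU then gO y else 0)"
    using at by (cases "y < 2 + NS * NU") (simp_all only: load_input_def len if_True if_False)
qed

lemma opt_inst_le:
  assumes "\<exists>a. \<forall>A\<in>Cl. \<exists>l\<in>A. a (l div 2) = odd l"
  shows "opt inst \<le> enat k"
proof -
  obtain a where a: "\<forall>A\<in>Cl. \<exists>l\<in>A. a (l div 2) = odd l" using assms by (elim exE)
  obtain C where C: "C \<subseteq> {..<NS}" "card C \<le> k" "\<forall>c<NU. \<exists>x\<in>C. edge x c" using complete[OF a] by (elim exE conjE)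
  have "covers inst C" unfolding covers_def
  proof (intro conjI ballI)
    fix u assume "u \<in> elem_verts inst"
    then have u: "u < NU" by simp
    then obtain x where x: "x \<in> C" "edge x u" using C(3) by (elim allE impE bexE)
    then have "(x, u) \<in> edges inst" using C(1) u by (subst inst_edge) auto
    then show "\<exists>s\<in>C. (s, u) \<in> edges inst" by (rule bexI) (rule x(1))
  qed (use C(1) in simp)
  then have "opt inst \<le> enat (card C)" unfolding opt_def by (intro INF_lower) simp
  also have "\<dots> \<le> enat k" using C(2) by simp
  finally show ?thesis .
qed

lemma opt_inst_gt:
  assumes "\<not> (\<exists>a. \<forall>A\<in>Cl. \<exists>l\<in>A. a (l div 2) = odd l)"
  shows "enat (h + 1) \<le> opt inst"
  unfolding opt_def
proof (rule INF_greatest)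
  fix C assume "C \<in> {C. covers inst C}"
  then have C: "C \<subseteq> {..<NS}" "\<And>c. c < NU \<Longrightarrow> \<exists>x\<in>C. (x, c) \<in> edges inst" by (simp_all add: covers_def)
  have "\<not> card C \<le> h"
  proof
    assume "card C \<le> h"
    moreover have "\<exists>x\<in>C. edge x c" if c: "c < NU" for c
    proof -
      obtain x where x: "x \<in> C" "(x, c) \<in> edges inst" using C(2)[OF c] by (elim bexE)
      moreover have "x < NS" using x(1) C(1) by auto
      ultimately show ?thesis using inst_edge c by (intro bexI[of _ x]) simp_all
    qed
    ultimately have "\<exists>a. \<forall>A\<in>Cl. \<exists>l\<in>A. a (l div 2) = odd l" using C(1) by (intro sound)
    with assms show False by (rule notE)
  qed
  then show "enat (h + 1) \<le> enat (card C)" by simp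
qed

section \<open>Size and gap\<close>

context
  assumes large: "large d k c2 c3 n" and k4: "4 \<le> k" and c: "2 \<le> c2" "c3 = 4 * d * (d + 1) * k * c2"
begin

lemmas bounds = lam_bounds[OF large pos(2) k4 c Cl] c2_r[OF large pos(2) k4 c Cl] NU_exp[OF large pos(2) k4 c Cl]
  h_maximal[OF large pos(2) k4 c Cl] b_square[OF large pos(2) k4 c Cl] b_large[OF large pos(2) k4 c Cl] b_le[OF large pos(2) k4 c Cl]

lemma size_bounds: "2 ^ b \<le> NS + NU" "NS + NU \<le> (k + 1) * 2 ^ (b + r)" "NS + NU \<le> 2 ^ (2 * b)"
proof -
  have "2 ^ b \<le> (2::nat) ^ (b + r)" by (intro power_increasing) auto
  moreover have "1 * 2 ^ (b + r) \<le> NS" unfolding NS_eq using k4 by (intro mult_right_mono) auto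
  moreover have NU: "NU \<le> 2 ^ b"
  proof -
    have "NU = 2 ^ (2 * lam * (h + h ^ k))" unfolding NU_def hk_eq using exps(3) by (rule pw_eq)
    also have "\<dots> \<le> 2 ^ b" using bounds(5) by (intro power_increasing) auto
    finally show ?thesis .
  qed
  ultimately show "2 ^ b \<le> NS + NU" and le: "NS + NU \<le> (k + 1) * 2 ^ (b + r)"
    unfolding NS_eq add_mult_distrib mult_1 by linarith+
  have "k + 1 \<le> n" using large unfolding large_def by linarith
  then have "k + 1 \<le> 2 ^ lam" using bounds(1) by linarith
  then have "(k + 1) * 2 ^ (b + r) \<le> 2 ^ lam * 2 ^ (b + r)" by (rule mult_right_mono) simp
  also have "\<dots> = 2 ^ (lam + (b + r))" by (simp add: power_add)
  also have "\<dots> \<le> 2 ^ (2 * b)"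
  proof (intro power_increasing)
    have "2 * r \<le> c2 * r" using c(1) by (rule mult_right_mono) simp
    moreover have "lam * 9 \<le> lam * (9 + k + 2 * d)" by (rule mult_left_mono) simp_all
    ultimately show "lam + (b + r) \<le> 2 * b" using bounds(3,4) by linarith
  qed simp
  finally show "NS + NU \<le> 2 ^ (2 * b)" using le by linarith
qed

text \<open>\<open>log N\<close> lies between \<open>b\<close> and \<open>2 * b\<close>, and
  \<open>log log N\<close> between \<open>lam / 2\<close> and \<open>lam\<close>.\<close>

lemma log_ratio:
  defines "L \<equiv> log 2 (real (NS + NU))"
  shows "real b / real lam \<le> L / log 2 L" "L / log 2 L \<le> 4 * real b / real lam"
proof -
  have b1: "1 \<le> real b" using b_pos by simp
  have lam1: "1 \<le> real lam" using lam_pos by simp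
  have "real (2 ^ b) \<le> real (NS + NU)" "real (NS + NU) \<le> real (2 ^ (2 * b))"
    using size_bounds(1,3) by (simp_all only: of_nat_le_iff)
  then have N: "2 powr real b \<le> real (NS + NU)" "real (NS + NU) \<le> 2 powr real (2 * b)"
    by (simp_all add: powr_realpow del: of_nat_mult)
  have N0: "0 < real (NS + NU)" using NU_pos by simp
  have L: "real b \<le> L" "L \<le> 2 * real b" unfolding L_def using N N0 by (simp_all add: le_log_iff log_le_iff)
  have "real (2 * b) \<le> real (2 ^ lam)" using bounds(9) by (simp only: of_nat_le_iff)
  then have "L \<le> 2 powr real lam" using L(2) by (simp add: powr_realpow)
  then have LL1: "log 2 L \<le> real lam" using L(1) b1 by (simp add: log_le_iff)
  have "2 ^ lam \<le> b ^ 2" using bounds(2,7) by linarith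
  then have "real (2 ^ lam) \<le> real (b ^ 2)" by (simp only: of_nat_le_iff)
  then have "2 powr real lam \<le> real b ^ 2" by (simp add: powr_realpow)
  then have "real lam \<le> log 2 (real b ^ 2)" using b1 by (simp add: le_log_iff)
  also have "\<dots> = 2 * log 2 (real b)" using b1 by (simp add: log_nat_power)
  also have "\<dots> \<le> 2 * log 2 L" using L(1) b1 by simp
  finally have LL2: "real lam / 2 \<le> log 2 L" by simp
  then have LL0: "0 < log 2 L * real lam" "0 < log 2 L * (real lam / 2)" using lam1 by (simp_all add: mult_pos_pos)
  have "real b / real lam \<le> L / real lam" using L(1) lam1 by (simp add: divide_right_mono)
  also have "\<dots> \<le> L / log 2 L" using L(1) b1 LL1 LL0 by (intro divide_left_mono) (auto simp: mult.commute)
  finally show "real b / real lam \<le> L / log 2 L" .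
  have "L / log 2 L \<le> L / (real lam / 2)" using L(1) b1 LL2 LL0 by (intro divide_left_mono) auto
  also have "\<dots> \<le> 2 * real b / (real lam / 2)" using L(2) lam1 by (intro divide_right_mono) auto
  finally show "L / log 2 L \<le> 4 * real b / real lam" by simp
qed

text \<open>Maximality of \<open>h\<close> loses a factor 8 and \<open>log_ratio\<close> a factor 4.
  Their product 32 is at most \<open>(1 + \<delta>) ^ k\<close> by Bernoulli's inequality, so it
  disappears under the root.\<close>

lemma gap_bounds:
  assumes "0 < \<delta>" "\<delta> < 1" "32 \<le> real k * \<delta>"
  shows "real k \<le> gap_threshold \<delta> k (NS + NU)" "gap_threshold \<delta> k (NS + NU) < real (h + 1)"
proof -
  define \<rho> where "\<rho> = log 2 (real (NS + NU)) / log 2 (log 2 (real (NS + NU)))"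
  note \<rho> = log_ratio[folded \<rho>_def]
  have k: "0 < real k" using k4 by simp
  have lam1: "1 \<le> real lam" using lam_pos by simp
  have root: "(x ^ k) powr (1 / real k) = x" if "0 < x" for x :: real
    using that k by (simp add: powr_powr flip: powr_realpow)
  have "real ((2 * k) ^ k * lam) \<le> real b" using bounds(8) by (simp only: of_nat_le_iff)
  then have "(2 * real k) ^ k \<le> real b / real lam" using lam1 by (simp add: pos_le_divide_eq)
  then have "(2 * real k) ^ k \<le> \<rho>" using \<rho>(1) by linarith
  then have "((2 * real k) ^ k) powr (1 / real k) \<le> \<rho> powr (1 / real k)" using k by (intro powr_mono2) auto
  then have 1: "2 * real k \<le> \<rho> powr (1 / real k)" using root[of "2 * real k"] k by simp
  have "real k = 1 / 2 * (2 * real k)" by simp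
  also have "\<dots> \<le> 1 / (1 + \<delta>) * \<rho> powr (1 / real k)" using 1 assms by (intro mult_mono) (auto simp: field_simps)
  finally show "real k \<le> gap_threshold \<delta> k (NS + NU)" by (simp add: gap_threshold_def \<rho>_def)
  have \<rho>0: "0 \<le> \<rho>" using \<rho>(1) lam1 by (meson divide_nonneg_nonneg of_nat_0_le_iff order_trans)
  have "real b < real (8 * lam * (h + 1) ^ k)" using bounds(6) by (simp only: of_nat_less_iff)
  then have "4 * real b / real lam < 32 * real (h + 1) ^ k" using lam1 by (simp add: pos_divide_less_eq algebra_simps)
  then have "\<rho> < 32 * real (h + 1) ^ k" using \<rho>(2) by linarith
  also have "\<dots> \<le> (1 + \<delta>) ^ k * real (h + 1) ^ k"
  proof (rule mult_right_mono)
    show "32 \<le> (1 + \<delta>) ^ k" using Bernoulli_inequality[of \<delta> k] assms by linarith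
  qed simp
  also have "\<dots> = ((1 + \<delta>) * real (h + 1)) ^ k" by (rule power_mult_distrib[symmetric])
  finally have "\<rho> powr (1 / real k) < (((1 + \<delta>) * real (h + 1)) ^ k) powr (1 / real k)"
    using k \<rho>0 by (intro powr_less_mono2) auto
  also have "\<dots> = (1 + \<delta>) * real (h + 1)" using assms by (intro root) simp
  finally show "gap_threshold \<delta> k (NS + NU) < real (h + 1)"
    unfolding gap_threshold_def \<rho>_def[symmetric] using assms by (simp add: pos_divide_less_eq mult.commute)
qed

text \<open>The advice lengthens the exponent by \<open>r\<close>, and
  \<open>k * r \<le> \<epsilon> * b / 2\<close> by the choice of \<open>c2\<close>, so
  \<open>b * (k - \<epsilon> / 2)\<close> remains. As \<open>k * b\<close> exceeds \<open>n\<close>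
  by at most \<open>k\<close>, this is a saving of \<open>\<epsilon> / (2 * k)\<close> per
  variable.\<close>

lemma size_power:
  assumes e: "0 < \<epsilon>" "\<epsilon> < 1" and c2: "2 * real k \<le> \<epsilon> * real c2"
  shows "real (NS + NU) powr (real k - \<epsilon>) \<le> (real k + 1) ^ k * 2 ^ k * 2 powr ((1 - \<epsilon> / (2 * real k)) * real n)"
proof -
  have k: "4 \<le> real k" using k4 by simp
  have "real (c2 * r) \<le> real b" using bounds(4) by (simp only: of_nat_le_iff)
  then have cr: "real c2 * real r \<le> real b" by simp
  have "2 * real k * real r \<le> \<epsilon> * real c2 * real r" using c2 by (rule mult_right_mono) simp
  also have "\<dots> \<le> \<epsilon> * real b" using cr e by (simp add: mult.assoc)
  finally have kr: "2 * real k * real r \<le> \<epsilon> * real b" .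
  have bn: "real k * real b \<le> real n + real k"
  proof -
    have "k * b \<le> n + k" using mult_div_mod_eq[of k n] by (simp add: b_def)
    then have "real (k * b) \<le> real (n + k)" by (simp only: of_nat_le_iff)
    then show ?thesis by simp
  qed
  have "(real b + real r) * (real k - \<epsilon>) = real b * (real k - \<epsilon>) + real r * (real k - \<epsilon>)" by (simp add: algebra_simps)
  also have "\<dots> \<le> real b * (real k - \<epsilon>) + real r * real k" using e by (intro add_left_mono mult_left_mono) auto
  also have "\<dots> \<le> real b * (real k - \<epsilon> / 2)" using kr by (simp add: algebra_simps)
  also have "\<dots> = (real k * real b) * (1 - \<epsilon> / (2 * real k))" using k by (simp add: field_simps)
  also have "\<dots> \<le> (real n + real k) * (1 - \<epsilon> / (2 * real k))" using bn e k by (intro mult_right_mono) (auto simp: field_simps)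
  also have "\<dots> = real n * (1 - \<epsilon> / (2 * real k)) + (real k - \<epsilon> / 2)" using k by (simp add: field_simps)
  also have "\<dots> \<le> (1 - \<epsilon> / (2 * real k)) * real n + real k" using e by (simp add: mult.commute)
  finally have ex: "(real b + real r) * (real k - \<epsilon>) \<le> (1 - \<epsilon> / (2 * real k)) * real n + real k" .
  have "real (NS + NU) \<le> real ((k + 1) * 2 ^ (b + r))" using size_bounds(2) by (simp only: of_nat_le_iff)
  also have "\<dots> = (real k + 1) * 2 powr (real b + real r)" by (simp add: powr_add powr_realpow power_add algebra_simps)
  finally have "real (NS + NU) powr (real k - \<epsilon>) \<le> ((real k + 1) * 2 powr (real b + real r)) powr (real k - \<epsilon>)"
    using e k by (intro powr_mono2) auto
  also have "\<dots> = (real k + 1) powr (real k - \<epsilon>) * 2 powr ((real b + real r) * (real k - \<epsilon>))"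
    by (simp add: powr_mult powr_powr)
  also have "\<dots> \<le> (real k + 1) powr real k * 2 powr ((1 - \<epsilon> / (2 * real k)) * real n + real k)"
    using ex e k by (intro mult_mono powr_mono) auto
  also have "\<dots> = (real k + 1) ^ k * 2 ^ k * 2 powr ((1 - \<epsilon> / (2 * real k)) * real n)"
    by (simp add: powr_add powr_realpow)
  finally show ?thesis .
qed

end

end

section \<open>A SAT solver from a gap algorithm\<close>

text \<open>No parameter of the reduction occurs here, so the exponent can be fixed before
  \<open>k\<close> and \<open>d\<close>.\<close>

definition fills_exponent :: "nat \<Rightarrow> bool" where
  "fills_exponent q \<longleftrightarrow> (\<forall>v M. 2 \<le> v \<longrightarrow> vars M = (\<lambda>_. 0) \<longrightarrow>
    (\<forall>i \<le> length reduction_fills. \<forall>a x. run_fills (take i reduction_fills) (arr M) a x \<le> v) \<longrightarrow>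
    (\<exists>M'. runs_within (compile_fills reduction_fills) M (v ^ q) M' \<and> vars M' = (\<lambda>_. 0) \<and>
      arr M' = run_fills reduction_fills (arr M)))"

text \<open>Here \<open>C\<close> may depend on \<open>e\<close>, hence on \<open>d\<close>: it
  enters the running time only as a factor.\<close>

definition spread_const :: "nat \<Rightarrow> nat \<Rightarrow> bool" where
  "spread_const e C \<longleftrightarrow> (\<forall>xs n m. length xs \<ge> 2 \<longrightarrow> xs ! 0 = n \<longrightarrow> xs ! 1 = m \<longrightarrow> m \<ge> 1 \<longrightarrow> length xs \<le> e * m \<longrightarrow>
    (\<forall>x \<in> set xs. x \<le> 2 * n + m + e) \<longrightarrow>
    runs_within (spread_input e (32 * e + 700)) (load_input xs) (C * (n + m) ^ 2)
      (\<lambda>a. if a mod 32 = 31 then load_input xs (a div 32) else 0))"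

lemma ex_fills_exponent: "\<exists>q. fills_exponent q"
  unfolding fills_exponent_def by (rule compile_fills_correct[OF reduction_fills_user])

lemma ex_spread_const: "1 \<le> e \<Longrightarrow> \<exists>C. spread_const e C"
  unfolding spread_const_def by (rule spread_input_correct) simp_all

definition parameters :: "nat \<Rightarrow> nat \<Rightarrow> nat \<Rightarrow> nat \<Rightarrow> nat \<Rightarrow> instr list" where
  "parameters d k c2 c3 n0 = [Const 30 d, Const 62 k, Const 94 c2, Const 126 c3, Const 158 n0]"

definition prelude :: "nat \<Rightarrow> nat \<Rightarrow> nat \<Rightarrow> nat \<Rightarrow> nat \<Rightarrow> com" where
  "prelude d k c2 c3 n0 = spread_input (d + 3) (32 * (d + 3) + 700) ;; Block (parameters d k c2 c3 n0) ;;
     compile_fills reduction_fills"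

text \<open>The four leading instructions answer 1 if there are no clauses.\<close>

definition solver :: "com \<Rightarrow> program \<Rightarrow> program" where
  "solver c P = [Jpos 1 4, Const 0 1, Const 1 1, Jpos 1 (4 + len c + 8 * length P)] @ code 4 c @ embed (4 + len c) P"

lemma length_solver: "length (solver c P) = 4 + len c + 8 * length P"
  by (simp add: solver_def length_embed)

text \<open>With \<open>m = 0\<close> the save address \<open>n + D * m\<close> would be
  \<open>n\<close>, possibly inside the input, so this case is kept away from
  \<open>spread_input\<close>.\<close>

lemma solver_no_clauses: "\<exists>t \<le> 7. outputs_in (solver c P) (encode_cnf n []) t 1"
proof -
  let ?Q = "solver c P"
  let ?M = "load_input (encode_cnf n [])"
  let ?M' = "?M(0 := 1, 1 := 1)"
  have Q: "?Q ! 0 = Jpos 1 4" "?Q ! 1 = Const 0 1" "?Q ! 2 = Const 1 1" "?Q ! 3 = Jpos 1 (length ?Q)"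
    unfolding length_solver by (simp_all add: solver_def)
  have len: "3 < length ?Q" by (simp add: length_solver)
  then have len0: "0 < length ?Q" by linarith
  have M1: "?M 1 = 0" by (simp add: load_input_def encode_cnf_def)
  have "exec ?Q (length ?Q, ?M') 0 ?M'" by (rule exec_halt) simp
  then have "exec ?Q (3, ?M') (cost (Jpos 1 (length ?Q)) ?M' + 0) ?M'" using Q(4) len by (intro exec_Cons) simp_all
  then have "exec ?Q (2, ?M(0 := 1)) (cost (Const 1 1) (?M(0 := 1)) + (cost (Jpos 1 (length ?Q)) ?M' + 0)) ?M'"
    using Q(3) len by (intro exec_Cons) (simp_all add: numeral_3_eq_3 numeral_2_eq_2)
  then have "exec ?Q (1, ?M) (cost (Const 0 1) ?M + (cost (Const 1 1) (?M(0 := 1)) + (cost (Jpos 1 (length ?Q)) ?M' + 0))) ?M'"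
    using Q(2) len by (intro exec_Cons) (simp_all add: numeral_2_eq_2)
  then have ex: "exec ?Q (0, ?M) (cost (Jpos 1 4) ?M + (cost (Const 0 1) ?M + (cost (Const 1 1) (?M(0 := 1)) + (cost (Jpos 1 (length ?Q)) ?M' + 0)))) ?M'"
    using Q(1) len0 M1 by (intro exec_Cons) simp_all
  have "cost (Jpos 1 4) ?M + (cost (Const 0 1) ?M + (cost (Const 1 1) (?M(0 := 1)) + (cost (Jpos 1 (length ?Q)) ?M' + 0))) \<le> 7"
    using M1 blen_le[of 1] by (simp add: floorlog_def)
  then show ?thesis unfolding outputs_in_def using ex by (intro exI conjI) (assumption, assumption, simp)
qed

lemma solver_exec:
  assumes c: "runs_within c M0 T M1" "0 < M0 1" and P: "exec P (0, Y) t Y'" and Y: "embeds Y M1"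
  shows "\<exists>t' M'. t' \<le> 1 + M0 1 + T + 60 * t \<and> exec (solver c P) (0, M0) t' M' \<and> M' 0 = Y' 0"
proof -
  let ?Q = "solver c P"
  have l1: "located ?Q 4 (code 4 c)" unfolding located_def solver_def
    by (rule exI[of _ "[Jpos 1 4, Const 0 1, Const 1 1, Jpos 1 (4 + len c + 8 * length P)]"]) simp
  have l2: "located ?Q (4 + len c) (embed (4 + len c) P)" unfolding located_def solver_def
    by (rule exI[of _ "[Jpos 1 4, Const 0 1, Const 1 1, Jpos 1 (4 + len c + 8 * length P)] @ code 4 c"], rule exI[of _ "[]"]) simp
  obtain t2 M2 where 2: "t2 \<le> 60 * t" "exec ?Q (4 + len c + 8 * min 0 (length P), M1) t2 M2" "embeds Y' M2"
    using embed_exec[OF P refl Y l2 length_solver] by (elim exE conjE)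
  obtain t1 where 1: "t1 \<le> T" "runs c M0 t1 M1" using c(1) unfolding runs_within_def by (elim exE conjE)
  have "exec ?Q (4, M0) (t1 + t2) M2" using 1(2) l1 2(2) unfolding runs_def by simp
  then have "exec ?Q (0, M0) (cost (Jpos 1 4) M0 + (t1 + t2)) M2"
    using c(2) by (intro exec_Cons) (simp_all add: solver_def)
  moreover have "cost (Jpos 1 4) M0 + (t1 + t2) \<le> 1 + M0 1 + T + 60 * t"
    using 1(1) 2(1) blen_le[of "M0 1"] by simp
  moreover have "M2 0 = Y' 0" using 2(3) unfolding embeds_def by (metis mult_0_right)
  ultimately show ?thesis by (intro exI conjI)
qed

context good_reduction
begin

context
  fixes n0 nf :: nat and \<phi> :: cnf and C qe :: nat
  assumes large: "large d k c2 c3 n" and k4: "4 \<le> k" and c: "2 \<le> c2" "c3 = 4 * d * (d + 1) * k * c2"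
    and \<phi>: "is_dcnf d nf \<phi>" "\<phi> \<noteq> []" and Clf: "Cl = clause_set ` set \<phi>" and nf: "n = max nf n0"
    and qe: "fills_exponent qe" and C: "spread_const (d + 3) C"
begin

lemma dcnf_n: "is_dcnf d n \<phi>"
  using \<phi>(1) nf unfolding is_dcnf_def by fastforce

lemma clauses_le: "length \<phi> \<le> T"
  using card_Cl card_clause_sets[OF \<phi>(1)] by (simp add: Clf)

lemmas mb = machine_bounds[OF large k4 c]

definition input :: memory where "input = load_input (encode_cnf nf \<phi>)"

lemma input_le: "input x \<le> 2 ^ (2 * b)"
proof (cases "x < length (encode_cnf nf \<phi>)")
  case True
  then have "input x \<le> 2 * nf + length \<phi> + (d + 3)" using encode_bounds(2)[OF \<phi>] nth_mem[OF True] by (simp add: input_def load_input_def)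
  then show ?thesis using clauses_le nf mb(4) by linarith
next
  case False
  then show ?thesis by (simp add: input_def load_input_def)
qed

definition start :: memory where
  "start = run_block (parameters d k c2 c3 n0) (\<lambda>a. if a mod 32 = 31 then input (a div 32) else 0)"

lemma start_at:
  "start x = (if x mod 32 = 31 then input (x div 32) else if x = 30 then d else if x = 62 then k
    else if x = 94 then c2 else if x = 126 then c3 else if x = 158 then n0 else 0)"
proof -
  have "y mod 32 \<noteq> (31::nat)" if "y \<in> {30, 62, 94, 126, 158}" for y using that by auto
  then show ?thesis by (simp add: start_def parameters_def)
qed

lemma start_0: "x mod 32 \<noteq> 30 \<Longrightarrow> x mod 32 \<noteq> 31 \<Longrightarrow> start x = 0"
  by (auto simp: start_at)

lemma vars_start: "vars start = (\<lambda>_. 0)"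
proof
  fix x
  have "(32 * x + 2) mod 32 = (2::nat)" by presburger
  then show "vars start x = 0" unfolding vars_def va_def by (intro start_0) linarith+
qed

lemma arr_start:
  "arr start 31 = input" "a \<noteq> 30 \<Longrightarrow> a \<noteq> 31 \<Longrightarrow> arr start a = (\<lambda>_. 0)"
  "arr start 30 0 = d" "arr start 30 1 = k" "arr start 30 2 = c2" "arr start 30 3 = c3" "arr start 30 4 = n0"
proof -
  have "(32 * x + 31) mod 32 = (31::nat)" "(32 * x + 31) div 32 = x" for x by simp_all
  then show "arr start 31 = input" unfolding arr_def by (simp add: user_def start_at)
  show "arr start a = (\<lambda>_. 0)" if a: "a \<noteq> 30" "a \<noteq> 31"
  proof
    fix x
    show "arr start a x = 0"
    proof (cases "user a")
      case True
      then have "(32 * x + a) mod 32 = a" by (simp add: user_def)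
      then have "start (32 * x + a) = 0" using a by (intro start_0) linarith+
      then show ?thesis by (simp add: arr_def)
    qed (simp add: arr_def)
  qed
  show "arr start 30 0 = d" "arr start 30 1 = k" "arr start 30 2 = c2" "arr start 30 3 = c3" "arr start 30 4 = n0"
    by (simp_all add: arr_def user_def start_at)
qed

lemma start_le: "start x \<le> 2 ^ (2 * b)"
  using input_le mb(5) nf by (auto simp: start_at)

lemma prelude_correct:
  "\<exists>M'. runs_within (prelude d k c2 c3 n0) input ((C + 6) * 2 ^ (2 * b * (qe + 2))) M' \<and>
    embeds (load_input (encode_instance inst)) M'"
proof -
  let ?V = "2 ^ (2 * b) :: nat"
  let ?M1 = "\<lambda>a. if a mod 32 = 31 then input (a div 32) else 0"
  let ?xs = "encode_cnf nf \<phi>"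
  have m1: "1 \<le> length \<phi>" using \<phi>(2) by (cases \<phi>) simp_all
  have V1: "1 \<le> ?V" by simp
  have V2: "2 \<le> ?V" using self_le_power[of 2 "2 * b"] b_pos by simp
  have "runs_within (spread_input (d + 3) (32 * (d + 3) + 700)) (load_input ?xs) (C * (nf + length \<phi>) ^ 2) (\<lambda>a. if a mod 32 = 31 then load_input ?xs (a div 32) else 0)"
    using C[unfolded spread_const_def, rule_format, of ?xs nf "length \<phi>"] encode_bounds[OF \<phi>] m1
    by (simp add: encode_cnf_def)
  then have r1: "runs_within (spread_input (d + 3) (32 * (d + 3) + 700)) input (C * ?V ^ 2) ?M1"
  proof (fold input_def, elim within_mono)
    have "nf + length \<phi> \<le> ?V" using clauses_le mb(4) nf by linarith
    then show "C * (nf + length \<phi>) ^ 2 \<le> C * ?V ^ 2" by (intro mult_left_mono power_mono) simp_all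
  qed
  have r2: "runs_within (Block (parameters d k c2 c3 n0)) ?M1 (5 + ?V) start"
  proof (rule within_Block)
    show "list_all straight (parameters d k c2 c3 n0)" by (simp add: parameters_def)
    have "cost_block (parameters d k c2 c3 n0) ?M1 = 5 + blen d + blen k + blen c2 + blen c3 + blen n0"
      by (simp add: parameters_def)
    moreover have "n0 \<le> n" using nf by simp
    ultimately show "cost_block (parameters d k c2 c3 n0) ?M1 \<le> 5 + ?V"
      using blen_le[of d] blen_le[of k] blen_le[of c2] blen_le[of c3] blen_le[of n0] mb(5) by linarith
  qed (simp add: start_def)
  have par: "tab_par (arr start)" unfolding tab_par_def arr_start using nf by (simp add: input_def load_input_def encode_cnf_def)
  have zero: "arr start 0 = (\<lambda>_. 0)" "arr start 4 = (\<lambda>_. 0)" "arr start 5 = (\<lambda>_. 0)" "arr start 6 = (\<lambda>_. 0)"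
    "arr start 7 = (\<lambda>_. 0)" "arr start 8 = (\<lambda>_. 0)" "arr start 9 = (\<lambda>_. 0)"
    by (intro arr_start; simp)+
  note init = encoded_clauses[where S = "arr start", OF dcnf_n arr_start(1)[unfolded input_def] Clf]
  have pos: "posn (arr start 31) c \<le> ?V" if "c < arr start 31 1" for c
  proof -
    have c: "c \<le> length \<phi>" using that by (simp add: arr_start input_def load_input_def encode_cnf_def)
    have "length (concat (map clause_code \<phi>)) = length (concat (map clause_code (take c \<phi>))) + length (concat (map clause_code (drop c \<phi>)))"
      by (metis append_take_drop_id concat_append length_append map_append)
    then have "posn (arr start 31) c \<le> length ?xs"
      unfolding arr_start input_def posn_encode(1)[OF c] by (simp add: encode_cnf_def clause_code_def[abs_def])
    also have "\<dots> \<le> (d + 3) * T" by (rule le_trans[OF encode_bounds(1)[OF \<phi>] mult_left_mono[OF clauses_le]]) simp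
    finally show ?thesis using mb(3) by linarith
  qed
  have le: "\<forall>a x. arr start a x \<le> ?V" using start_le by (simp add: arr_def)
  have "\<forall>i \<le> length reduction_fills. \<forall>a x. run_fills (take i reduction_fills) (arr start) a x \<le> ?V"
    using bounded_prefix[OF par zero init le mb(1,2) pos] by blast
  then obtain M3 where r3: "runs_within (compile_fills reduction_fills) start (?V ^ qe) M3"
      and M3: "arr M3 = run_fills reduction_fills (arr start)"
    using qe[unfolded fills_exponent_def, rule_format, OF V2 vars_start] by blast
  have "embeds (load_input (encode_instance inst)) M3" unfolding embeds_def
  proof
    fix x
    have "M3 (32 * x) = arr M3 0 x" by (simp add: arr_def user_def)
    then show "M3 (32 * x) = load_input (encode_instance inst) x"
      unfolding M3 run_reduction[OF par zero init] output_array[OF par zero init] load_inst .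
  qed
  moreover have "runs_within (prelude d k c2 c3 n0) input ((C + 6) * 2 ^ (2 * b * (qe + 2))) M3"
    unfolding prelude_def
  proof (rule within_Seq[OF r1 within_Seq[OF r2 r3 order_refl]])
    have W: "(2::nat) ^ (2 * b * (qe + 2)) = ?V ^ (qe + 2)" by (rule power_mult)
    have "?V ^ 2 \<le> ?V ^ (qe + 2)" "?V ^ qe \<le> ?V ^ (qe + 2)" using V1 by (intro power_increasing; simp)+
    moreover have "?V ^ 1 \<le> ?V ^ (qe + 2)" using V1 by (intro power_increasing) simp_all
    moreover have "4 \<le> ?V ^ 2" using power_mono[OF V2, of 2] by simp
    ultimately have "5 + ?V + ?V ^ qe \<le> 6 * ?V ^ (qe + 2)" unfolding power_one_right by linarith
    moreover have "C * ?V ^ 2 \<le> C * ?V ^ (qe + 2)" using V1 by (intro mult_left_mono power_increasing) simp_all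
    ultimately show "C * ?V ^ 2 + (5 + ?V + ?V ^ qe) \<le> (C + 6) * 2 ^ (2 * b * (qe + 2))"
      unfolding W add_mult_distrib by linarith
  qed
  ultimately show ?thesis by blast
qed

lemma solver_correct:
  assumes time: "runs_in_time P F" and gap: "distinguishes_gap P \<delta> k" and \<delta>: "0 < \<delta>" "\<delta> < 1" "32 \<le> real k * \<delta>"
  shows "\<exists>t. real t \<le> real ((C + 8) * 2 ^ (2 * b * (qe + 2))) + 60 * F (NS + NU) \<and>
    outputs_in (solver (prelude d k c2 c3 n0) P) (encode_cnf nf \<phi>) t (of_bool (satisfiable \<phi>))"
proof -
  have N0: "0 < num_vertices inst" using NU_pos by simp
  obtain t y where t: "outputs_in P (encode_instance inst) t y" "real t \<le> F (NS + NU)"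
    using time[unfolded runs_in_time_def, rule_format, OF conjI[OF numbered_inst N0]] unfolding inst_sel(3) by blast
  obtain Y where Y: "exec P (0, load_input (encode_instance inst)) t Y" "Y 0 = y" using t(1) unfolding outputs_in_def by blast
  \<comment> \<open>Determinism identifies the output of the timed run with the answer promised in
    either case of the gap.\<close>
  have uniq: "y = y'" if "outputs_in P (encode_instance inst) t' y'" for t' y'
    using that Y exec_deterministic unfolding outputs_in_def by metis
  have ok: "numbered_instance inst \<and> real k \<le> gap_threshold \<delta> k (num_vertices inst)"
    using numbered_inst gap_bounds(1)[OF large k4 c \<delta>] by simp
  note g = gap[unfolded distinguishes_gap_def, rule_format, OF ok]
  have y: "y = of_bool (satisfiable \<phi>)"
  proof (cases "satisfiable \<phi>")
    case True
    then have "opt inst \<le> enat k" by (intro opt_inst_le) (simp only: satisfiable_iff Clf)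
    then show ?thesis using g uniq True by auto
  next
    case False
    then have "enat (h + 1) \<le> opt inst" by (intro opt_inst_gt) (simp only: satisfiable_iff Clf not_False_eq_True)
    then have "ereal_of_enat (enat (h + 1)) \<le> ereal_of_enat (opt inst)" by (simp only: ereal_of_enat_le_iff)
    moreover have "ereal (gap_threshold \<delta> k (num_vertices inst)) < ereal_of_enat (enat (h + 1))"
      using gap_bounds(2)[OF large k4 c \<delta>] by simp
    ultimately have "ereal (gap_threshold \<delta> k (num_vertices inst)) < ereal_of_enat (opt inst)" by (rule less_le_trans[rotated])
    then show ?thesis using g uniq False by auto
  qed
  obtain M1 where M1: "runs_within (prelude d k c2 c3 n0) input ((C + 6) * 2 ^ (2 * b * (qe + 2))) M1"
    "embeds (load_input (encode_instance inst)) M1" using prelude_correct by blast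
  have in1: "input 1 = length \<phi>" by (simp add: input_def load_input_def encode_cnf_def)
  have "0 < input 1" using \<phi>(2) in1 by simp
  from solver_exec[OF M1(1) this Y(1) M1(2)] obtain t' M' where
    t': "t' \<le> 1 + input 1 + (C + 6) * 2 ^ (2 * b * (qe + 2)) + 60 * t"
      "exec (solver (prelude d k c2 c3 n0) P) (0, input) t' M'" "M' 0 = Y 0" by blast
  have "outputs_in (solver (prelude d k c2 c3 n0) P) (encode_cnf nf \<phi>) t' (of_bool (satisfiable \<phi>))"
    unfolding outputs_in_def using t'(2,3) Y(2) y unfolding input_def by (intro exI[of _ M'] conjI) simp_all
  moreover have "t' \<le> (C + 8) * 2 ^ (2 * b * (qe + 2)) + 60 * t"
  proof -
    have "2 ^ (2 * b * 1) \<le> (2::nat) ^ (2 * b * (qe + 2))" by (intro power_increasing mult_left_mono) simp_all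
    then have "input 1 \<le> 2 ^ (2 * b * (qe + 2))" using input_le[of 1] unfolding mult_1_right by linarith
    moreover have "1 \<le> (2::nat) ^ (2 * b * (qe + 2))" by simp
    ultimately
    show ?thesis using t'(1) unfolding add_mult_distrib by linarith
  qed
  then have "real t' \<le> real ((C + 8) * 2 ^ (2 * b * (qe + 2)) + 60 * t)" by (simp only: of_nat_le_iff)
  then have "real t' \<le> real ((C + 8) * 2 ^ (2 * b * (qe + 2))) + 60 * F (NS + NU)" using t(2) by simp
  ultimately show ?thesis by blast
qed

end

end


text \<open>With \<open>k \<ge> 4 * (q + 2)\<close> the exponent of the reduction's time is at most
  \<open>n / 2\<close> plus a constant, and \<open>e \<le> 1 / 2\<close> leaves at least
  \<open>n / 2\<close> available. Raising \<open>n\<close> to \<open>n0\<close> costs a factor of at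
  most \<open>2 ^ n0\<close>.\<close>

lemma solver_time:
  fixes n n0 k q :: nat and e :: real
  assumes e: "0 < e" "e \<le> 1 / 2" and k: "4 * (q + 2) \<le> k"
  shows "2 ^ (2 * (max n n0 div k + 1) * (q + 2)) \<le> 2 ^ (2 * (q + 2)) * 2 ^ n0 * 2 powr ((1 - e) * real n)"
    and "2 powr ((1 - e) * real (max n n0)) \<le> 2 ^ n0 * 2 powr ((1 - e) * real n)"
proof -
  let ?n = "max n n0"
  have "?n \<le> n + n0" by simp
  then have "real ?n \<le> real (n + n0)" by (simp only: of_nat_le_iff)
  then have "(1 - e) * real ?n \<le> (1 - e) * real (n + n0)" using e by (intro mult_left_mono) linarith+
  also have "\<dots> \<le> real n0 + (1 - e) * real n" using e mult_right_mono[of "1 - e" 1 "real n0"] by (simp add: distrib_left)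
  finally have "2 powr ((1 - e) * real ?n) \<le> 2 powr (real n0 + (1 - e) * real n)" by (intro powr_mono) simp_all
  also have "\<dots> = 2 ^ n0 * 2 powr ((1 - e) * real n)" by (simp add: powr_add powr_realpow)
  finally show le: "2 powr ((1 - e) * real ?n) \<le> 2 ^ n0 * 2 powr ((1 - e) * real n)" .
  have "4 * (q + 2) * (?n div k) \<le> k * (?n div k)" using k by (rule mult_right_mono) simp
  also have "\<dots> \<le> ?n" by simp
  finally have "real (4 * (q + 2) * (?n div k)) \<le> real ?n" by (simp only: of_nat_le_iff)
  then have "real (2 * (q + 2) * (?n div k)) \<le> 1 / 2 * real ?n" by (simp add: algebra_simps)
  also have "\<dots> \<le> (1 - e) * real ?n" using e by (intro mult_right_mono) auto
  finally have "2 powr real (2 * (q + 2) * (?n div k)) \<le> 2 powr ((1 - e) * real ?n)" by (intro powr_mono) simp_all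
  then have p: "2 ^ (2 * (q + 2) * (?n div k)) \<le> 2 powr ((1 - e) * real ?n)" by (simp only: powr_realpow zero_less_numeral)
  have "2 * (?n div k + 1) * (q + 2) = 2 * (q + 2) + 2 * (q + 2) * (?n div k)" by (simp add: algebra_simps)
  then have "(2::real) ^ (2 * (?n div k + 1) * (q + 2)) = 2 ^ (2 * (q + 2)) * 2 ^ (2 * (q + 2) * (?n div k))"
    by (simp only: power_add)
  also have "\<dots> \<le> 2 ^ (2 * (q + 2)) * (2 ^ n0 * 2 powr ((1 - e) * real n))"
    using p le by (intro mult_left_mono) (linarith, simp)
  finally show "2 ^ (2 * (?n div k + 1) * (q + 2)) \<le> 2 ^ (2 * (q + 2)) * 2 ^ n0 * 2 powr ((1 - e) * real n)"
    by (simp only: mult.assoc)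
qed

lemma SAT_from_gap:
  assumes q: "fills_exponent q" and k: "4 * (q + 2) \<le> k" "32 \<le> real k * \<delta>"
    and \<epsilon>: "0 < \<epsilon>" "\<epsilon> < 1" and \<delta>: "0 < \<delta>" "\<delta> < 1" and d: "1 \<le> d"
    and time: "runs_in_time P (\<lambda>N. F * real N powr (real k - \<epsilon>))" and F: "0 \<le> F"
    and gap: "distinguishes_gap P \<delta> k"
  shows "\<exists>Q K. solves_SAT_in Q d (\<lambda>n. K * 2 powr ((1 - \<epsilon> / (2 * real k)) * real n))"
proof -
  define e where "e = \<epsilon> / (2 * real k)"
  have k4: "4 \<le> k" using k(1) by simp
  have e: "0 < e" "e \<le> 1 / 2" using \<epsilon> k4 by (simp_all add: e_def field_simps)
  \<comment> \<open>Large enough for \<open>size_power\<close>; the lower bound 2 guarantees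
    \<open>2 * r \<le> b\<close>.\<close>
  define c2 where "c2 = max 2 (nat \<lceil>2 * real k / \<epsilon>\<rceil>)"
  define c3 where "c3 = 4 * d * (d + 1) * k * c2"
  have c2: "2 \<le> c2" by (simp add: c2_def)
  have "2 * real k / \<epsilon> \<le> real c2" using real_nat_ceiling_ge[of "2 * real k / \<epsilon>"] unfolding c2_def by linarith
  then have kc: "2 * real k \<le> \<epsilon> * real c2" using \<epsilon> by (simp add: pos_divide_le_eq mult.commute)
  obtain n0 where n0: "\<And>n. n0 \<le> n \<Longrightarrow> large d k c2 c3 n" using eventually_large unfolding eventually_sequentially by blast
  obtain C where C: "spread_const (d + 3) C" using ex_spread_const[of "d + 3"] by auto
  define Q where "Q = solver (prelude d k c2 c3 n0) P"
  define A where "A = real (C + 8) * 2 ^ (2 * (q + 2)) * 2 ^ n0"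
  define B where "B = 60 * (F * ((real k + 1) ^ k * 2 ^ k * 2 ^ n0))"
  have AB: "0 \<le> A" "0 \<le> B" using F by (simp_all add: A_def B_def)
  have "\<exists>t. real t \<le> (A + B + 7) * 2 powr ((1 - e) * real n) \<and> outputs_in Q (encode_cnf n \<phi>) t (of_bool (satisfiable \<phi>))"
    if \<phi>: "is_dcnf d n \<phi>" for n \<phi>
  proof (cases "\<phi> = []")
    case True
    obtain t where t: "t \<le> 7" "outputs_in Q (encode_cnf n []) t 1" using solver_no_clauses unfolding Q_def by blast
    have "2 powr 0 \<le> 2 powr ((1 - e) * real n)" using e by (intro powr_mono) simp_all
    then have "7 * 1 \<le> (A + B + 7) * 2 powr ((1 - e) * real n)" using AB by (intro mult_mono) simp_all
    then have "real t \<le> (A + B + 7) * 2 powr ((1 - e) * real n)" using t(1) by linarith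
    moreover have "satisfiable []" by (simp add: satisfiable_def)
    ultimately show ?thesis using t(2) True by (intro exI[of _ t]) simp
  next
    case False
    let ?n = "max n n0"
    define Cl where "Cl = clause_set ` set \<phi>"
    have large: "large d k c2 c3 ?n" by (rule n0) simp
    have dn: "is_dcnf d ?n \<phi>" using \<phi> unfolding is_dcnf_def by fastforce
    have "good_reduction ?n d k c2 c3 Cl"
      by (rule reduction.good_if_large[OF large d k4 c2 c3_def]) (auto simp: Cl_def dest: clause_set_bounds[OF dn])
    then interpret good_reduction ?n d k c2 c3 Cl .
    obtain t where t: "real t \<le> real ((C + 8) * 2 ^ (2 * b * (q + 2))) + 60 * (F * real (NS + NU) powr (real k - \<epsilon>))"
      "outputs_in Q (encode_cnf n \<phi>) t (of_bool (satisfiable \<phi>))"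
      using solver_correct[OF large k4 c2 c3_def \<phi> False Cl_def refl q C time gap \<delta> k(2)] unfolding Q_def by blast
    have "real ((C + 8) * 2 ^ (2 * b * (q + 2))) = real (C + 8) * 2 ^ (2 * (?n div k + 1) * (q + 2))" by (simp add: b_def)
    also have "\<dots> \<le> real (C + 8) * (2 ^ (2 * (q + 2)) * 2 ^ n0 * 2 powr ((1 - e) * real n))"
      by (rule mult_left_mono[OF solver_time(1)[OF e k(1)]]) simp
    also have "\<dots> = A * 2 powr ((1 - e) * real n)" by (simp add: A_def)
    finally have 1: "real ((C + 8) * 2 ^ (2 * b * (q + 2))) \<le> A * 2 powr ((1 - e) * real n)" .
    have "real (NS + NU) powr (real k - \<epsilon>) \<le> (real k + 1) ^ k * 2 ^ k * 2 powr ((1 - e) * real ?n)"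
      unfolding e_def by (rule size_power[OF large k4 c2 c3_def \<epsilon> kc])
    also have "\<dots> \<le> (real k + 1) ^ k * 2 ^ k * (2 ^ n0 * 2 powr ((1 - e) * real n))"
      by (rule mult_left_mono[OF solver_time(2)[OF e k(1)]]) simp
    finally have "60 * (F * real (NS + NU) powr (real k - \<epsilon>)) \<le> 60 * (F * ((real k + 1) ^ k * 2 ^ k * (2 ^ n0 * 2 powr ((1 - e) * real n))))"
      using F by (intro mult_left_mono) simp_all
    also have "\<dots> = B * 2 powr ((1 - e) * real n)" by (simp add: B_def)
    finally have "real t \<le> A * 2 powr ((1 - e) * real n) + B * 2 powr ((1 - e) * real n)" using t(1) 1 by linarith
    also have "\<dots> \<le> (A + B + 7) * 2 powr ((1 - e) * real n)" by (simp add: algebra_simps)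
    finally show ?thesis using t(2) by blast
  qed
  then have "solves_SAT_in Q d (\<lambda>n. (A + B + 7) * 2 powr ((1 - e) * real n))" unfolding solves_SAT_in_def by blast
  then show ?thesis unfolding e_def by blast
qed

theorem theorem1:
  assumes "SETH"
  shows "\<forall>\<epsilon> \<delta> :: real. 0 < \<epsilon> \<and> \<epsilon> < 1 \<and> 0 < \<delta> \<and> \<delta> < 1 \<longrightarrow>
    (\<exists>k\<^sub>0 :: nat. \<forall>k \<ge> k\<^sub>0. \<forall>f :: nat \<Rightarrow> nat. computable f \<longrightarrow>
      \<not> (\<exists>P. runs_in_time P (\<lambda>N. real (f k) * real N powr (real k - \<epsilon>)) \<and>
             distinguishes_gap P \<delta> k))"
proof (intro allI impI)
  fix \<epsilon> \<delta> :: real assume \<epsilon>\<delta>: "0 < \<epsilon> \<and> \<epsilon> < 1 \<and> 0 < \<delta> \<and> \<delta> < 1"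
  obtain q where q: "fills_exponent q" using ex_fills_exponent by blast
  \<comment> \<open>The first bound on \<open>k\<close> makes writing the instance cheap, the second
    yields \<open>32 \<le> (1 + \<delta>) ^ k\<close>.\<close>
  have False if k: "max (4 * (q + 2)) (nat \<lceil>32 / \<delta>\<rceil>) \<le> k"
    and P: "runs_in_time P (\<lambda>N. real (f k) * real N powr (real k - \<epsilon>))" "distinguishes_gap P \<delta> k" for k P and f :: "nat \<Rightarrow> nat"
  proof -
    have k1: "4 * (q + 2) \<le> k" using k by simp
    have "32 / \<delta> \<le> real k" using k real_nat_ceiling_ge[of "32 / \<delta>"] by linarith
    then have k2: "32 \<le> real k * \<delta>" using \<epsilon>\<delta> by (simp add: pos_divide_le_eq)
    have "0 < \<epsilon> / (2 * real k)" "\<epsilon> / (2 * real k) < 1" using \<epsilon>\<delta> k1 by (simp_all add: field_simps)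
    then obtain d where d: "d \<ge> 3" "\<not> (\<exists>P c. solves_SAT_in P d (\<lambda>n. c * 2 powr ((1 - \<epsilon> / (2 * real k)) * real n)))"
      using assms unfolding SETH_def by blast
    have "\<exists>Q K. solves_SAT_in Q d (\<lambda>n. K * 2 powr ((1 - \<epsilon> / (2 * real k)) * real n))"
      by (rule SAT_from_gap[OF q k1 k2 _ _ _ _ _ P(1) _ P(2)]) (use \<epsilon>\<delta> d(1) in simp_all)
    then show False using d(2) by (rule notE[rotated])
  qed
  then show "\<exists>k\<^sub>0 :: nat. \<forall>k \<ge> k\<^sub>0. \<forall>f :: nat \<Rightarrow> nat. computable f \<longrightarrow>
      \<not> (\<exists>P. runs_in_time P (\<lambda>N. real (f k) * real N powr (real k - \<epsilon>)) \<and> distinguishes_gap P \<delta> k)"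
    by blast
qed

end
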